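(* Let $s\in(0,1)$, $\alpha\in(s,1)$, $n\ge 2$, and let $E\subset\mathbb R^n$ satisfy assumption (h1) below. Suppose there is $\sigma\in(-1,1)$ such that $$\nu_E(q)\cdot\nu_H(q)=\sigma\qquad\text{for all } q\in M\cap\partial H.$$ Then for every unit vector $e\in S^{n-1}\cap\partial H$ there is a hyperplane $\pi_e$ orthogonal to $e$ such that, denoting by $\rho$ the reflection across $\pi_e$, $$|E\,\Delta\,\rho(E)|\le C\,\mathrm{diam}(E)^{n}\sqrt{\delta_s(E)},$$ where $C=C(n,s)$ depends only on $n$ and $s$ (one may take $C=3\sqrt{5/(2(n+s))}$). Here $|\cdot|$ is Lebesgue measure and $\Delta$ is symmetric difference.
   Context: $H=\{x\in\mathbb R^n:x_n>0\}$, with outer unit normal $\nu_H=-e_n$ on $\partial H$. Assumption (h1): $s\in(0,1)$, $\alpha\in(s,1)$, $n\ge 2$, and $E\subset\mathbb R^n$ is a bounded open connected subset of $H$ such that $M:=\overline{\partial E\cap H}$ is a $C^{2,\alpha}$-hypersurface with boundary, whose manifold boundary is ${\rm bd}(M)=M\cap\partial H$. $\nu_E$ denotes the outer unit normal to $E$ along $M$ (it extends continuously to $M\cap\partial H$). For $q\in M\cap H$ the fractional mean curvature is $$\mathbf H^s_E(q)=\mathrm{p.v.}\int_{\mathbb R^n}\frac{\chi_{E^c}(x)-\chi_E(x)}{|x-q|^{n+s}}\,dx=\lim_{\varepsilon\to0^+}\int_{\mathbb R^n\setminus B_\varepsilon(q)}\frac{\chi_{E^c}(x)-\chi_E(x)}{|x-q|^{n+s}}\,dx,$$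 which is finite and $C^1$ on $M\cap H$. The $s$-deficit of $E$ is $$\delta_s(E)=\mathrm{diam}(E)^{s+1}\sup\Big\{\frac{|\mathbf H^s_E(p)-\mathbf H^s_E(q)|}{|p-q|}:\ p,q\in M\cap H,\ p\neq q,\ p_n=q_n\Big\}.$$ *)

theory Defs
  imports "HOL-Analysis.Analysis"
begin

text \<open>Ambient space R^n is modelled as real^'n, with n = CARD('n).
  The distinguished coordinate x_n is the component at an index k :: 'n.\<close>

definition halfspace :: "'n::finite \<Rightarrow> (real^'n) set" where
  "halfspace k = {x. x $ k > 0}"

definition C2alpha :: "real \<Rightarrow> (real^'n::finite \<Rightarrow> real^'m::finite) \<Rightarrow> (real^'n) set \<Rightarrow> bool" where
  "C2alpha \<alpha> f U \<longleftrightarrow> open U \<and>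
     (\<exists>f' f'' L.
        (\<forall>x\<in>U. (f has_derivative blinfun_apply (f' x)) (at x)
              \<and> (f' has_derivative blinfun_apply (f'' x)) (at x)) \<and>
        (\<forall>x\<in>U. \<forall>y\<in>U. norm (f'' x - f'' y) \<le> L * dist x y powr \<alpha>))"

definition C2alpha_diffeo :: "real \<Rightarrow> (real^'n::finite \<Rightarrow> real^'n) \<Rightarrow> (real^'n) set \<Rightarrow> (real^'n) set \<Rightarrow> bool" where
  "C2alpha_diffeo \<alpha> \<phi> U V \<longleftrightarrow> open U \<and> open V \<and> \<phi> ` U = V \<and> inj_on \<phi> U \<and>
     C2alpha \<alpha> \<phi> U \<and> C2alpha \<alpha> (inv_into U \<phi>) V"

definition C2alpha_hypersurface_with_boundary ::
  "real \<Rightarrow> (real^'n::finite) set \<Rightarrow> (real^'n) set \<Rightarrow> bool" where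
  "C2alpha_hypersurface_with_boundary \<alpha> M B \<longleftrightarrow> B \<subseteq> M \<and>
     (\<forall>p\<in>M. \<exists>U V \<phi> i j. p \<in> U \<and> i \<noteq> j \<and> C2alpha_diffeo \<alpha> \<phi> U V \<and>
        \<phi> ` (M \<inter> U) = V \<inter> {y. y $ i = 0 \<and> y $ j \<ge> 0} \<and>
        \<phi> ` (B \<inter> U) = V \<inter> {y. y $ i = 0 \<and> y $ j = 0})"

definition outer_unit_normal ::
  "'n::finite \<Rightarrow> (real^'n) set \<Rightarrow> (real^'n) set \<Rightarrow> (real^'n \<Rightarrow> real^'n) \<Rightarrow> bool" where
  "outer_unit_normal k E M nu \<longleftrightarrow>
     (\<forall>q\<in>M. norm (nu q) = 1) \<and> continuous_on M nu \<and>
     (\<forall>q\<in>M. ((\<lambda>x. (nu q \<bullet> (x - q)) / norm (x - q)) \<longlongrightarrow> 0) (at q within M)) \<and>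
     (\<forall>q\<in>M \<inter> halfspace k. \<exists>r>0. \<forall>t. 0 < t \<and> t < r \<longrightarrow>
         q + t *\<^sub>R nu q \<notin> E \<and> q - t *\<^sub>R nu q \<in> E)"

definition frac_mean_curv :: "real \<Rightarrow> (real^'n::finite) set \<Rightarrow> real^'n \<Rightarrow> real" where
  "frac_mean_curv s E q =
     Lim (at_right 0)
       (\<lambda>\<epsilon>. LINT x : - ball q \<epsilon> | lborel.
              (indicator (- E) x - indicator E x) / norm (x - q) powr (real CARD('n) + s))"

text \<open>The s-deficit, with values in the extended reals (it may be +infinity).
  The supremum is taken over a set of nonnegative quotients (with 0 added, so that
  the sup of an empty family is 0).\<close>
definition s_deficit :: "real \<Rightarrow> 'n::finite \<Rightarrow> (real^'n) set \<Rightarrow> (real^'n) set \<Rightarrow> ereal" where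
  "s_deficit s k E M =
     ereal (diameter E powr (s + 1)) *
     Sup (insert 0 {ereal (\<bar>frac_mean_curv s E p - frac_mean_curv s E q\<bar> / norm (p - q)) | p q.
            p \<in> M \<inter> halfspace k \<and> q \<in> M \<inter> halfspace k \<and> p \<noteq> q \<and> p $ k = q $ k})"

text \<open>Reflection across the hyperplane {x. x \<bullet> e = c} (e a unit vector).\<close>
definition reflection :: "real^'n::finite \<Rightarrow> real \<Rightarrow> real^'n \<Rightarrow> real^'n" where
  "reflection e c x = x - (2 * (x \<bullet> e - c)) *\<^sub>R e"

definition symdiff :: "'a set \<Rightarrow> 'a set \<Rightarrow> 'a set" where
  "symdiff A B = (A - B) \<union> (B - A)"

end

theory Submission
  imports Defs
begin

text \<open>
  Move a hyperplane orthogonal to \<open>e\<close> to the supremum \<open>lam\<close> of the midpoints of the chords of \<open>E\<close> in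
  direction \<open>e\<close>. Then \<open>E\<close> beyond the plane reflects into \<open>E\<close>, and a sequence of chords with midpoints
  tending to the plane has limit endpoints \<open>q\<close> and \<open>p\<close> that are mirror images of each other. For the
  kernel \<open>|z|\<^sup>-\<^sup>(\<^sup>n\<^sup>+\<^sup>s\<^sup>)\<close>, the difference of the potentials of \<open>E\<close> at \<open>q\<close> and \<open>p\<close> only sees the part \<open>A\<close> of
  \<open>E\<close> whose mirror image leaves \<open>E\<close>, and is at least \<open>|p - q|\<close> times a multiple of the first moment of
  \<open>A\<close> about the plane. It equals half the difference of the fractional mean curvatures, so that the
  deficit controls this moment, and the moment controls \<open>|A|\<^sup>2\<close>.

  If \<open>p = q\<close>, or if \<open>p\<close> and \<open>q\<close> lie on \<open>\<partial>H\<close>, the argument is applied to nearby pairs of points of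
  \<open>M \<inter> H\<close> at equal height. The potentials are then split at a scale \<open>\<rho>\<close>; the outer part passes to the
  limit, and the inner part is \<open>O(\<rho> powr (\<alpha> - s))\<close> relative to the distance of the pair, because
  \<open>E\<close> is a \<open>C\<^sup>2\<^sup>,\<^sup>\<alpha>\<close> subgraph there. On \<open>\<partial>H\<close> the constant contact angle makes the two graphs touch
  to first order (\<open>p \<noteq> q\<close>) or makes the mixed second derivative vanish (\<open>p = q\<close>).
\<close>

section \<open>A convex truncation of the kernel\<close>

text \<open>The potential of \<open>E\<close> for the untruncated kernel is infinite at boundary
  points, and the curvature is only a principal value. A convex truncation makes every integral
  finite, its tangent inequality gives the lower bound with one constant at all truncation scales,
  and the integral of the truncated kernel over the whole space cancels in differences. Only
  difference quotients of the curvature occur, never a derivative. The deficit controls pairs of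
  equal height inside H only. Reflections in horizontal directions keep the height, but on
  \<partial>H a pair has to be lifted, and lifted points are in general not mirror images of each
  other; the splitting of scales compensates for this. That its inner error vanishes with the scale
  is the condition s < \<alpha>. The argument gives a squared volume of at most 8/(n+s) times
  diam(E)^(2n) times the deficit; the square of 3 sqrt(5/(2(n+s))) is 45/(2(n+s)), which is
  larger.\<close>

text \<open>The function \<open>t powr (-b)\<close>, continued below \<open>a\<close> by its tangent at \<open>a\<close>, so that it stays convex and \<open>C\<^sup>1\<close>;
  it is applied to \<open>t = |z|\<^sup>2\<close>.\<close>
definition kap :: "real \<Rightarrow> real \<Rightarrow> real \<Rightarrow> real" where
  "kap b a t = (if a \<le> t then t powr (-b) else a powr (-b) - b * a powr (-b-1) * (t - a))"

definition dkap :: "real \<Rightarrow> real \<Rightarrow> real \<Rightarrow> real" where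
  "dkap b a t = b * max a t powr (-b-1)"

lemma kap_deriv:
  assumes "0 < a"
  shows "(kap b a has_real_derivative - dkap b a t) (at t)"
proof -
  have D1: "((\<lambda>t. t powr (-b)) has_real_derivative - (b * t powr (-b-1))) (at t)" if "0 < t" for t
    using that by (auto intro!: derivative_eq_intros)
  have D2: "((\<lambda>t. a powr (-b) - b * a powr (-b-1) * (t - a)) has_real_derivative - (b * a powr (-b-1))) (at t)" for t
    by (auto intro!: derivative_eq_intros)
  consider "t < a" | "t > a" | "t = a" by linarith
  then show ?thesis
  proof cases
    case 1
    then have "(kap b a has_real_derivative - (b * a powr (-b-1))) (at t)"
      by (intro has_field_derivative_transform_within_open[OF D2, where S="{..<a}"]) (auto simp: kap_def)
    then show ?thesis using 1 by (simp add: dkap_def max_def)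
  next
    case 2
    then have "(kap b a has_real_derivative - (b * t powr (-b-1))) (at t)"
      using assms by (intro has_field_derivative_transform_within_open[OF D1, where S="{a<..}"]) (auto simp: kap_def)
    then show ?thesis using 2 by (simp add: dkap_def max_def)
  next
    case 3
    have "((\<lambda>y. (kap b a y - kap b a a) / (y - a)) \<longlongrightarrow> - dkap b a a) (at a)"
    proof (rule filterlim_split_at)
      have "((\<lambda>y. ((a powr (-b) - b * a powr (-b-1) * (y - a)) - (a powr (-b) - b * a powr (-b-1) * (a - a))) / (y - a)) \<longlongrightarrow> - dkap b a a) (at_left a)"
        using D2[of a] by (simp add: has_field_derivative_iff dkap_def filterlim_at_split)
      then show "((\<lambda>y. (kap b a y - kap b a a) / (y - a)) \<longlongrightarrow> - dkap b a a) (at_left a)"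
        by (rule Lim_transform_eventually)
          (rule eventually_mono[of "\<lambda>y. y < a"], auto simp: eventually_at_filter kap_def)
    next
      have "((\<lambda>y. (y powr (-b) - a powr (-b)) / (y - a)) \<longlongrightarrow> - dkap b a a) (at_right a)"
        using D1[of a] assms by (simp add: has_field_derivative_iff dkap_def filterlim_at_split)
      then show "((\<lambda>y. (kap b a y - kap b a a) / (y - a)) \<longlongrightarrow> - dkap b a a) (at_right a)"
        by (rule Lim_transform_eventually)
          (rule eventually_mono[of "\<lambda>y. a < y"], auto simp: eventually_at_filter kap_def)
    qed
    then show ?thesis using 3 by (simp add: has_field_derivative_iff)
  qed
qed

lemma continuous_on_kap [continuous_intros]:
  assumes "0 < a" "continuous_on S f"
  shows "continuous_on S (\<lambda>x. kap b a (f x))"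
proof -
  have "continuous_on UNIV (kap b a)"
    using kap_deriv[OF assms(1)] by (intro DERIV_continuous_on) auto
  then show ?thesis by (rule continuous_on_compose2[OF _ assms(2)]) auto
qed

lemma continuous_on_dkap [continuous_intros]:
  assumes "0 < a" "continuous_on S f"
  shows "continuous_on S (\<lambda>x. dkap b a (f x))"
  unfolding dkap_def using assms by (intro continuous_intros) auto

lemma dkap_antimono: "0 < b \<Longrightarrow> 0 < a \<Longrightarrow> a \<le> a' \<Longrightarrow> t \<le> t' \<Longrightarrow> dkap b a' t' \<le> dkap b a t"
  unfolding dkap_def by (intro mult_left_mono powr_mono2') auto

lemma dkap_nonneg: "0 < b \<Longrightarrow> 0 \<le> dkap b a t"
  by (simp add: dkap_def)

text \<open>Follows from the monotonicity of \<open>dkap\<close>. With the squared distances of a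
  point to p and to q in place of \<open>y\<close> and \<open>x\<close>, it bounds a difference of
  kernels from below by a multiple of the difference of these squares, which is affine in the point;
  this is how a first moment arises.\<close>

lemma kap_convex:
  assumes "0 < a" "0 < b"
  shows "kap b a x \<ge> kap b a y + dkap b a y * (y - x)"
proof -
  consider "x < y" | "x = y" | "x > y" by linarith
  then show ?thesis
  proof cases
    case 1
    obtain z where z: "x < z" "z < y" "kap b a y - kap b a x = (y - x) * - dkap b a z"
      using MVT2[OF 1, of "kap b a" "\<lambda>t. - dkap b a t"] kap_deriv[OF assms(1)] by auto
    have "dkap b a y \<le> dkap b a z" using assms z by (intro dkap_antimono) auto
    then have "(y - x) * dkap b a y \<le> (y - x) * dkap b a z" using 1 by (intro mult_left_mono) auto
    then show ?thesis using z by (simp add: algebra_simps)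
  next
    case 3
    obtain z where z: "y < z" "z < x" "kap b a x - kap b a y = (x - y) * - dkap b a z"
      using MVT2[OF 3, of "kap b a" "\<lambda>t. - dkap b a t"] kap_deriv[OF assms(1)] by auto
    have "dkap b a z \<le> dkap b a y" using assms z by (intro dkap_antimono) auto
    then have "(x - y) * dkap b a z \<le> (x - y) * dkap b a y" using 3 by (intro mult_left_mono) auto
    then show ?thesis using z by (simp add: algebra_simps)
  qed simp
qed

lemma kap_antimono:
  assumes "0 < a" "0 < b" "x \<le> y"
  shows "kap b a y \<le> kap b a x"
  using kap_convex[OF assms(1,2), of y x] assms mult_nonneg_nonneg[OF dkap_nonneg[OF assms(2), of a y], of "y - x"]
  by linarith

lemma kap_nonneg:
  assumes "0 < a" "0 < b"
  shows "0 \<le> kap b a t"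
proof (cases "a \<le> t")
  case False
  then have "kap b a a \<le> kap b a t" using assms by (intro kap_antimono) auto
  then show ?thesis by (simp add: kap_def) (smt (verit) powr_ge_zero)
qed (simp add: kap_def)

text \<open>The difference \<open>kap b a' t - kap b a t\<close> increases up to \<open>a'\<close>,
  where it vanishes. Consequently the kernel of \<open>a\<close> minus the kernel of
  \<open>a'\<close> is nonnegative and lives below \<open>a'\<close>; differences of this kind split
  a potential by scales.\<close>

lemma kap_mono_scale:
  assumes "0 < a" "0 < b" "a \<le> a'"
  shows "kap b a' t \<le> kap b a t"
proof (cases "a' \<le> t")
  case False
  let ?g = "\<lambda>t. kap b a' t - kap b a t"
  have "?g t \<le> ?g a'"
  proof (rule DERIV_nonneg_imp_nondecreasing[of t a'])
    show "t \<le> a'" using False by simp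
    fix x assume "t \<le> x" "x \<le> a'"
    have "(?g has_real_derivative - dkap b a' x - - dkap b a x) (at x)"
      using assms by (intro DERIV_diff kap_deriv) auto
    moreover have "0 \<le> - dkap b a' x - - dkap b a x" using dkap_antimono[of b a a' x x] assms by auto
    ultimately show "\<exists>y. (?g has_real_derivative y) (at x) \<and> 0 \<le> y" by blast
  qed
  also have "\<dots> = 0" using assms by (simp add: kap_def)
  finally show ?thesis by simp
qed (use assms in \<open>simp add: kap_def\<close>)

text \<open>For \<open>t < a\<close> the truncation at \<open>a\<close> is compared with the
  truncation at \<open>t\<close> itself, which agrees with the power there. Domination by the
  untruncated kernel is what lets the truncation be removed by dominated convergence.\<close>

lemma kap_le_powr:
  assumes "0 < a" "0 < b" "0 < t"
  shows "kap b a t \<le> t powr (-b)"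
proof (cases "a \<le> t")
  case False
  have "kap b a t \<le> kap b t t" using False assms by (intro kap_mono_scale) auto
  then show ?thesis by (simp add: kap_def)
qed (simp add: kap_def)

lemma kap_le_const:
  assumes "0 < a" "0 < b" "0 \<le> t"
  shows "kap b a t \<le> (1 + b) * a powr (-b)"
proof -
  have "kap b a t \<le> kap b a 0" using assms by (intro kap_antimono) auto
  also have "\<dots> = a powr (-b) + b * (a powr (-b-1) * a)" using assms by (simp add: kap_def)
  also have "a powr (-b-1) * a = a powr (-b)" using assms powr_add[of a "-b-1" 1] by simp
  finally show ?thesis by (simp add: algebra_simps)
qed

lemma kap_le_max:
  assumes "0 < a" "0 < b" "0 \<le> t"
  shows "kap b a t \<le> (1 + b) * (max a t) powr (-b)"
proof (cases "a \<le> t")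
  case True
  then have "kap b a t \<le> 1 * t powr (-b)" by (simp add: kap_def)
  also have "\<dots> \<le> (1 + b) * t powr (-b)" using assms by (intro mult_right_mono) auto
  finally show ?thesis using True by (simp add: max_def)
next
  case False
  then show ?thesis using kap_le_const[OF assms] by (simp add: max_def)
qed

text \<open>Here \<open>\<zeta>\<close> plays the role of the squared distance of a line to the origin and \<open>v\<close>
  is the coordinate along that line.\<close>
lemma kap_lipschitz_along_line:
  assumes "0 < a" "a \<le> a'" "0 < b" "0 \<le> \<zeta>"
  shows "\<bar>(kap b a (\<zeta> + u\<^sup>2) - kap b a' (\<zeta> + u\<^sup>2)) - (kap b a (\<zeta> + v\<^sup>2) - kap b a' (\<zeta> + v\<^sup>2))\<bar>
         \<le> 2 * b * max a \<zeta> powr (- b - 1/2) * \<bar>u - v\<bar>"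
proof -
  let ?k = "\<lambda>v. kap b a (\<zeta> + v\<^sup>2) - kap b a' (\<zeta> + v\<^sup>2)"
  let ?k' = "\<lambda>v. 2 * v * (dkap b a' (\<zeta> + v\<^sup>2) - dkap b a (\<zeta> + v\<^sup>2))"
  have D: "(?k has_real_derivative ?k' v) (at v)" for v
  proof -
    have i: "((\<lambda>v. \<zeta> + v\<^sup>2) has_real_derivative 2 * v) (at v)" by (auto intro!: derivative_eq_intros)
    have "(?k has_real_derivative (- dkap b a (\<zeta> + v\<^sup>2) * (2 * v)) - (- dkap b a' (\<zeta> + v\<^sup>2) * (2 * v))) (at v)"
      using assms by (intro DERIV_diff DERIV_chain2[OF kap_deriv i]) auto
    then show ?thesis by (rule DERIV_cong) (simp add: algebra_simps)
  qed
  have bnd: "\<bar>?k' v\<bar> \<le> 2 * b * max a \<zeta> powr (- b - 1/2)" for v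
  proof -
    let ?M = "max a (\<zeta> + v\<^sup>2)"
    have M: "?M > 0" using assms by auto
    have "dkap b a' (\<zeta> + v\<^sup>2) \<le> dkap b a (\<zeta> + v\<^sup>2)" "0 \<le> dkap b a' (\<zeta> + v\<^sup>2)"
      using assms by (auto intro!: dkap_antimono dkap_nonneg)
    then have "\<bar>?k' v\<bar> \<le> 2 * \<bar>v\<bar> * dkap b a (\<zeta> + v\<^sup>2)"
      by (simp add: abs_mult mult_left_mono)
    also have "\<dots> \<le> 2 * ?M powr (1/2) * dkap b a (\<zeta> + v\<^sup>2)"
    proof -
      have "\<bar>v\<bar> = sqrt (v\<^sup>2)" by simp
      also have "\<dots> \<le> sqrt ?M" using assms by (intro real_sqrt_le_mono) auto
      also have "\<dots> = ?M powr (1/2)" using M by (simp add: powr_half_sqrt)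
      finally show ?thesis using dkap_nonneg assms by (intro mult_right_mono mult_left_mono) auto
    qed
    also have "\<dots> = 2 * b * (?M powr (1/2) * ?M powr (-b-1))" by (simp add: dkap_def)
    also have "?M powr (1/2) * ?M powr (-b-1) = ?M powr (-b-1/2)"
      unfolding powr_add[symmetric] by (rule arg_cong[where f="\<lambda>x. ?M powr x"]) simp
    also have "2 * b * ?M powr (-b-1/2) \<le> 2 * b * max a \<zeta> powr (- b - 1/2)"
      using assms by (intro mult_left_mono powr_mono2' max.mono) (auto simp: less_max_iff_disj)
    finally show ?thesis .
  qed
  have "norm (?k u - ?k v) \<le> (2 * b * max a \<zeta> powr (- b - 1/2)) * norm (u - v)"
  proof (rule field_differentiable_bound[of UNIV ?k ?k'])
    show "\<And>z. z \<in> UNIV \<Longrightarrow> (?k has_field_derivative ?k' z) (at z within UNIV)" using D by simp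
  qed (use bnd in auto)
  then show ?thesis by simp
qed

text \<open>Matching the intermediate points of the two increments is what keeps the error
  quadratic in the small quantities.\<close>
lemma paired_increment_bound:
  fixes T t :: "real \<Rightarrow> real"
  assumes T: "\<And>v. (T has_real_derivative t v) (at v)" and even: "\<And>v. t (-v) = t v"
    and K0: "\<And>v. \<bar>t v\<bar> \<le> K0" and K1: "\<And>u v. \<bar>t u - t v\<bar> \<le> K1 * \<bar>u - v\<bar>" "0 \<le> K1"
    and close: "(\<bar>x1 - y1\<bar> \<le> \<delta> \<and> \<bar>x2 - y2\<bar> \<le> \<delta>) \<or> (\<bar>x1 + y1\<bar> \<le> \<delta> \<and> \<bar>x2 + y2\<bar> \<le> \<delta>)"
  shows "\<bar>T x1 - T x2 + (T y1 - T y2)\<bar> \<le> K0 * \<bar>x1 - x2 + (y1 - y2)\<bar> + K1 * \<delta> * \<bar>y1 - y2\<bar>"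
proof -
  define f where "f = (\<lambda>\<theta>. T (x2 + \<theta> * (x1 - x2)) + T (y2 + \<theta> * (y1 - y2)))"
  define f' where "f' = (\<lambda>\<theta>. t (x2 + \<theta> * (x1 - x2)) * (x1 - x2) + t (y2 + \<theta> * (y1 - y2)) * (y1 - y2))"
  have D: "(f has_real_derivative f' \<theta>) (at \<theta>)" for \<theta>
    unfolding f_def f'_def
    by (intro DERIV_add DERIV_chain2[OF T]) (auto intro!: derivative_eq_intros)
  obtain \<theta> where \<theta>: "0 < \<theta>" "\<theta> < 1" "f 1 - f 0 = f' \<theta>"
    using MVT2[of 0 1 f f'] D by auto
  define a where "a = x2 + \<theta> * (x1 - x2)"
  define b where "b = y2 + \<theta> * (y1 - y2)"
  have conv: "\<bar>(1 - \<theta>) * p + \<theta> * q\<bar> \<le> \<delta>" if "\<bar>p\<bar> \<le> \<delta>" "\<bar>q\<bar> \<le> \<delta>" for p q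
  proof -
    have "\<bar>(1 - \<theta>) * p + \<theta> * q\<bar> \<le> (1 - \<theta>) * \<bar>p\<bar> + \<theta> * \<bar>q\<bar>"
      using \<theta> abs_triangle_ineq[of "(1 - \<theta>) * p" "\<theta> * q"] by (simp add: abs_mult)
    also have "\<dots> \<le> (1 - \<theta>) * \<delta> + \<theta> * \<delta>" using \<theta> that by (intro add_mono mult_left_mono) auto
    finally show ?thesis by (simp add: algebra_simps)
  qed
  \<comment> \<open>At the common parameter \<theta> the intermediate points inherit the closeness
    of the end points by convexity. In the second alternative they are close up to a sign, which is
    harmless because \<open>t\<close> is even.\<close>
  have "\<bar>t a - t b\<bar> \<le> K1 * \<delta>"
  proof -
    from close show ?thesis
    proof
      assume "\<bar>x1 - y1\<bar> \<le> \<delta> \<and> \<bar>x2 - y2\<bar> \<le> \<delta>"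
      then have "\<bar>a - b\<bar> \<le> \<delta>" using conv[of "x2 - y2" "x1 - y1"] by (simp add: a_def b_def algebra_simps)
      then show ?thesis using K1 by (meson mult_left_mono order_trans)
    next
      assume "\<bar>x1 + y1\<bar> \<le> \<delta> \<and> \<bar>x2 + y2\<bar> \<le> \<delta>"
      then have "\<bar>a - (-b)\<bar> \<le> \<delta>" using conv[of "x2 + y2" "x1 + y1"] by (simp add: a_def b_def algebra_simps)
      then show ?thesis using K1 even by (metis mult_left_mono order_trans)
    qed
  qed
  then have *: "\<bar>(t b - t a) * (y1 - y2)\<bar> \<le> K1 * \<delta> * \<bar>y1 - y2\<bar>"
    by (simp add: abs_mult mult_right_mono abs_minus_commute)
  have **: "\<bar>t a * (x1 - x2 + (y1 - y2))\<bar> \<le> K0 * \<bar>x1 - x2 + (y1 - y2)\<bar>"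
    using K0 by (simp add: abs_mult mult_right_mono)
  have "T x1 - T x2 + (T y1 - T y2) = f 1 - f 0" by (simp add: f_def)
  also have "\<dots> = t a * (x1 - x2 + (y1 - y2)) + (t b - t a) * (y1 - y2)"
    unfolding \<theta>(3) f'_def a_def[symmetric] b_def[symmetric] by (simp add: algebra_simps)
  finally show ?thesis using * ** by linarith
qed

section \<open>Integrals of powers of the norm over balls and their complements\<close>

lemma nn_integral_ball_powr:
  fixes \<gamma> :: real
  assumes "0 \<le> \<gamma>" "\<gamma> < DIM('a::euclidean_space)"
  shows "\<exists>C\<ge>0. \<forall>r>0. (\<integral>\<^sup>+z. ennreal (norm z powr (-\<gamma>)) * indicator (ball (0::'a) r) z \<partial>lborel)
            \<le> ennreal (C * r powr (DIM('a) - \<gamma>))"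
proof -
  define n where "n = real DIM('a)"
  define \<omega> where "\<omega> = unit_ball_vol n"
  have \<omega>: "0 \<le> \<omega>" by (simp add: \<omega>_def n_def)
  have vol: "emeasure lborel (ball (0::'a) r) \<le> ennreal (\<omega> * r powr n)" if "0 < r" for r
    using that by (subst emeasure_ball) (auto simp: \<omega>_def n_def powr_realpow ennreal_mult'')
  have vol': "emeasure lborel (cball (0::'a) r) \<le> ennreal (\<omega> * r powr n)" if "0 < r" for r
    using that by (subst emeasure_cball) (auto simp: \<omega>_def n_def powr_realpow ennreal_mult'')
  have "(\<integral>\<^sup>+z. ennreal (norm z powr (-\<gamma>)) * indicator (ball (0::'a) r) z \<partial>lborel)
            \<le> ennreal ((\<omega> + \<gamma> * \<omega> / (n - \<gamma>)) * r powr (n - \<gamma>))" if r: "0 < r" for r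
  proof -
    \<comment> \<open>Layer-cake form: on the ball, |z|^(-\<gamma>) is r^(-\<gamma>) plus the
      integral of \<gamma> \<rho>^(-\<gamma>-1) over |z| \<le> \<rho> \<le> r. After exchanging the
      integrals only volumes of balls are needed, and \<gamma> < n makes \<rho>^(n-\<gamma>-1)
      integrable at 0.\<close>
    let ?g = "\<lambda>(z::'a) \<rho>::real. ennreal (\<gamma> * \<rho> powr (-\<gamma>-1)) * (indicator {0<..r} \<rho> * indicator (cball 0 \<rho>) z)"
    have gm: "(\<lambda>(z::'a, \<rho>::real). ?g z \<rho>) \<in> borel_measurable (lborel \<Otimes>\<^sub>M lborel)"
    proof -
      have "(\<lambda>(z::'a, \<rho>::real). ?g z \<rho>) = (\<lambda>x. ennreal (\<gamma> * snd x powr (-\<gamma>-1)) * indicator {x. 0 < snd x \<and> snd x \<le> r \<and> norm (fst x) \<le> snd x} x)"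
        by (auto simp: indicator_def fun_eq_iff)
      also have "\<dots> \<in> borel_measurable (lborel \<Otimes>\<^sub>M lborel)" by measurable
      finally show ?thesis .
    qed
    have pt: "ennreal (norm z powr (-\<gamma>)) * indicator (ball (0::'a) r) z
              \<le> ennreal (r powr (-\<gamma>)) * indicator (ball 0 r) z + (\<integral>\<^sup>+\<rho>. ?g z \<rho> \<partial>lborel)" if "z \<noteq> 0" for z :: 'a
    proof (cases "z \<in> ball 0 r")
      case True
      then have zr: "norm z \<le> r" by auto
      have nz: "norm z > 0" using that by simp
      have "(\<integral>\<^sup>+\<rho>. ?g z \<rho> \<partial>lborel) = (\<integral>\<^sup>+\<rho>. ennreal (\<gamma> * \<rho> powr (-\<gamma>-1)) * indicator {norm z..r} \<rho> \<partial>lborel)"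
      proof (rule nn_integral_cong)
        fix \<rho> :: real
        have "0 < \<rho> \<and> \<rho> \<le> r \<and> norm z \<le> \<rho> \<longleftrightarrow> norm z \<le> \<rho> \<and> \<rho> \<le> r" using nz by linarith
        then show "?g z \<rho> = ennreal (\<gamma> * \<rho> powr (-\<gamma>-1)) * indicator {norm z..r} \<rho>"
          by (auto simp: indicator_def)
      qed
      also have "\<dots> = ennreal (- (r powr (-\<gamma>)) - - (norm z powr (-\<gamma>)))"
      proof (rule nn_integral_FTC_Icc)
        fix x assume x: "x \<in> {norm z..r}"
        then have "x > 0" using nz by (meson atLeastAtMost_iff less_le_trans)
        then show "((\<lambda>\<rho>. - (\<rho> powr (-\<gamma>))) has_real_derivative \<gamma> * x powr (-\<gamma>-1)) (at x)"
          by (auto intro!: derivative_eq_intros)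
      qed (use assms zr in auto)
      finally show ?thesis using True nz zr assms
        by (simp add: ennreal_plus[symmetric] powr_mono2' del: ennreal_plus)
    qed auto
    have "(\<integral>\<^sup>+z. ennreal (norm z powr (-\<gamma>)) * indicator (ball (0::'a) r) z \<partial>lborel)
          \<le> (\<integral>\<^sup>+z. ennreal (r powr (-\<gamma>)) * indicator (ball (0::'a) r) z + (\<integral>\<^sup>+\<rho>. ?g z \<rho> \<partial>lborel) \<partial>lborel)"
    proof (rule nn_integral_mono_AE)
      have "AE z in lborel. z \<noteq> (0::'a)" by (rule AE_lborel_singleton)
      then show "AE z in lborel. ennreal (norm z powr (-\<gamma>)) * indicator (ball (0::'a) r) z
              \<le> ennreal (r powr (-\<gamma>)) * indicator (ball 0 r) z + (\<integral>\<^sup>+\<rho>. ?g z \<rho> \<partial>lborel)"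
        by (rule eventually_mono) (rule pt)
    qed
    also have "\<dots> = ennreal (r powr (-\<gamma>)) * emeasure lborel (ball (0::'a) r) + (\<integral>\<^sup>+z. \<integral>\<^sup>+\<rho>. ?g z \<rho> \<partial>lborel \<partial>lborel)"
    proof -
      have "(\<lambda>z. \<integral>\<^sup>+\<rho>. ?g z \<rho> \<partial>lborel) \<in> borel_measurable lborel"
        using lborel.borel_measurable_nn_integral[OF gm] by simp
      moreover have "(\<lambda>z. ennreal (r powr (-\<gamma>)) * indicator (ball (0::'a) r) z) \<in> borel_measurable lborel"
        by (intro borel_measurable_times_ennreal borel_measurable_const borel_measurable_indicator) simp
      ultimately have "(\<integral>\<^sup>+z. ennreal (r powr (-\<gamma>)) * indicator (ball (0::'a) r) z + (\<integral>\<^sup>+\<rho>. ?g z \<rho> \<partial>lborel) \<partial>lborel)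
         = (\<integral>\<^sup>+z. ennreal (r powr (-\<gamma>)) * indicator (ball (0::'a) r) z \<partial>lborel) + (\<integral>\<^sup>+z. \<integral>\<^sup>+\<rho>. ?g z \<rho> \<partial>lborel \<partial>lborel)"
        by (rule nn_integral_add[rotated])
      also have "(\<integral>\<^sup>+z. ennreal (r powr (-\<gamma>)) * indicator (ball (0::'a) r) z \<partial>lborel)
         = ennreal (r powr (-\<gamma>)) * emeasure lborel (ball (0::'a) r)"
        by (rule nn_integral_cmult_indicator) simp
      finally show ?thesis .
    qed
    also have "(\<integral>\<^sup>+z. \<integral>\<^sup>+\<rho>. ?g z \<rho> \<partial>lborel \<partial>lborel) = (\<integral>\<^sup>+\<rho>. \<integral>\<^sup>+z. ?g z \<rho> \<partial>lborel \<partial>lborel)"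
      by (rule lborel_pair.Fubini'[symmetric]) (rule gm)
    also have "\<dots> \<le> (\<integral>\<^sup>+\<rho>. ennreal (\<gamma> * \<omega> * \<rho> powr (n-\<gamma>-1)) * indicator {0..r} \<rho> \<partial>lborel)"
    proof (rule nn_integral_mono)
      fix \<rho> :: real
      show "(\<integral>\<^sup>+z. ?g z \<rho> \<partial>lborel) \<le> ennreal (\<gamma> * \<omega> * \<rho> powr (n-\<gamma>-1)) * indicator {0..r} \<rho>"
      proof (cases "\<rho> \<in> {0<..r}")
        case True
        then have "(\<integral>\<^sup>+z. ?g z \<rho> \<partial>lborel) = ennreal (\<gamma> * \<rho> powr (-\<gamma>-1)) * emeasure lborel (cball (0::'a) \<rho>)"
          by (simp add: nn_integral_cmult_indicator)
        also have "\<dots> \<le> ennreal (\<gamma> * \<rho> powr (-\<gamma>-1)) * ennreal (\<omega> * \<rho> powr n)"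
          using True by (intro mult_left_mono vol') auto
        also have "\<dots> = ennreal (\<gamma> * \<omega> * (\<rho> powr (-\<gamma>-1) * \<rho> powr n))"
          using assms \<omega> by (simp add: ennreal_mult[symmetric] mult_ac)
        also have "\<rho> powr (-\<gamma>-1) * \<rho> powr n = \<rho> powr (n-\<gamma>-1)"
          by (simp add: powr_add[symmetric] algebra_simps)
        finally show ?thesis using True by simp
      qed auto
    qed
    also have "\<dots> = ennreal (\<gamma> * \<omega> * (r powr (n - \<gamma>) / (n - \<gamma>)))"
    proof -
      have "((\<lambda>\<rho>. \<rho> powr (n-\<gamma>-1)) has_integral r powr (n-\<gamma>-1+1) / (n-\<gamma>-1+1)) {0..r}"
        using assms r by (intro has_integral_powr_from_0) (auto simp: n_def)
      then have "((\<lambda>\<rho>. \<gamma> * \<omega> * \<rho> powr (n-\<gamma>-1)) has_integral \<gamma> * \<omega> * (r powr (n-\<gamma>) / (n-\<gamma>))) {0..r}"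
        by (intro has_integral_mult_right) simp
      then have "((\<lambda>\<rho>. if \<rho> \<in> {0..r} then \<gamma> * \<omega> * \<rho> powr (n-\<gamma>-1) else 0) has_integral \<gamma> * \<omega> * (r powr (n-\<gamma>) / (n-\<gamma>))) UNIV"
        by (simp only: has_integral_restrict_UNIV)
      from nn_integral_has_integral_lborel[OF _ _ this] have
        "(\<integral>\<^sup>+\<rho>. ennreal (if \<rho> \<in> {0..r} then \<gamma> * \<omega> * \<rho> powr (n-\<gamma>-1) else 0) \<partial>lborel) = ennreal (\<gamma> * \<omega> * (r powr (n - \<gamma>) / (n - \<gamma>)))"
        using assms \<omega> by simp
      moreover have "ennreal (\<gamma> * \<omega> * \<rho> powr (n-\<gamma>-1)) * indicator {0..r} \<rho> = ennreal (if \<rho> \<in> {0..r} then \<gamma> * \<omega> * \<rho> powr (n-\<gamma>-1) else 0)" for \<rho>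
        by auto
      ultimately show ?thesis by simp
    qed
    also have "ennreal (r powr (-\<gamma>)) * emeasure lborel (ball (0::'a) r) \<le> ennreal (r powr (-\<gamma>)) * ennreal (\<omega> * r powr n)"
      using r by (intro mult_left_mono vol) auto
    also have "\<dots> = ennreal (\<omega> * (r powr (-\<gamma>) * r powr n))"
      using \<omega> by (simp add: ennreal_mult[symmetric] mult_ac)
    also have "r powr (-\<gamma>) * r powr n = r powr (n - \<gamma>)" by (simp add: powr_add[symmetric])
    finally show ?thesis using assms \<omega> n_def
      by (simp add: ennreal_plus[symmetric] algebra_simps del: ennreal_plus)
  qed
  then show ?thesis using assms \<omega>
    by (intro exI[of _ "\<omega> + \<gamma> * \<omega> / (n - \<gamma>)"]) (auto simp: n_def)
qed

lemma integrable_powr_outside_ball: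
  fixes m r :: real
  assumes "DIM('a::euclidean_space) < m" "0 < r"
  shows "integrable lborel (\<lambda>z::'a. norm z powr (-m) * indicator (- ball 0 r) z)"
proof (rule integrableI_bounded)
  define n where "n = real DIM('a)"
  define \<omega> where "\<omega> = unit_ball_vol n"
  have \<omega>: "0 \<le> \<omega>" by (simp add: \<omega>_def n_def)
  have m: "0 < m" using assms by simp
  have vol': "emeasure lborel (cball (0::'a) r) \<le> ennreal (\<omega> * r powr n)" if "0 < r" for r
    using that by (subst emeasure_cball) (auto simp: \<omega>_def n_def powr_realpow ennreal_mult'')
  \<comment> \<open>Here |z|^(-m) is the integral of m \<rho>^(-m-1) over \<rho> \<ge> |z|; the
    volumes of balls then leave \<rho>^(n-m-1), which is integrable at infinity because n <
    m.\<close>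
  let ?g = "\<lambda>(z::'a) \<rho>::real. ennreal (m * \<rho> powr (-m-1)) * (indicator {r..} \<rho> * indicator (cball 0 \<rho>) z)"
  have pt: "ennreal (norm (norm z powr (-m) * indicator (- ball 0 r) z)) \<le> (\<integral>\<^sup>+\<rho>. ?g z \<rho> \<partial>lborel)" for z :: 'a
  proof (cases "z \<in> ball 0 r")
    case False
    then have zr: "r \<le> norm z" by auto
    have nz: "norm z > 0" using zr assms by linarith
    have "(\<integral>\<^sup>+\<rho>. ?g z \<rho> \<partial>lborel) = (\<integral>\<^sup>+\<rho>. ennreal (m * \<rho> powr (-m-1)) * indicator {norm z..} \<rho> \<partial>lborel)"
      using zr by (intro nn_integral_cong) (auto simp: indicator_def)
    also have "\<dots> = ennreal (0 - - (norm z powr (-m)))"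
    proof (rule nn_integral_FTC_atLeast)
      fix x assume x: "norm z \<le> x"
      then have "x > 0" using nz by linarith
      then show "((\<lambda>\<rho>. - (\<rho> powr (-m))) has_real_derivative m * x powr (-m-1)) (at x)"
        by (auto intro!: derivative_eq_intros)
    next
      have "((\<lambda>\<rho>. \<rho> powr (-m)) \<longlongrightarrow> 0) at_top"
        using m by (intro tendsto_neg_powr filterlim_ident) auto
      then show "((\<lambda>\<rho>. - (\<rho> powr (-m))) \<longlongrightarrow> 0) at_top" using tendsto_minus by fastforce
    qed (use m in auto)
    finally show ?thesis using False by simp
  qed auto
  have "(\<integral>\<^sup>+z. ennreal (norm (norm z powr (-m) * indicator (- ball (0::'a) r) z)) \<partial>lborel)
        \<le> (\<integral>\<^sup>+z. \<integral>\<^sup>+\<rho>. ?g z \<rho> \<partial>lborel \<partial>lborel)"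
    by (rule nn_integral_mono) (rule pt)
  also have "\<dots> = (\<integral>\<^sup>+\<rho>. \<integral>\<^sup>+z. ?g z \<rho> \<partial>lborel \<partial>lborel)"
  proof (rule lborel_pair.Fubini'[symmetric])
    have "(\<lambda>(z::'a, \<rho>::real). ?g z \<rho>) = (\<lambda>x. ennreal (m * snd x powr (-m-1)) * indicator {x. r \<le> snd x \<and> norm (fst x) \<le> snd x} x)"
      by (auto simp: indicator_def fun_eq_iff)
    also have "\<dots> \<in> borel_measurable (lborel \<Otimes>\<^sub>M lborel)" by measurable
    finally show "(\<lambda>(z::'a, \<rho>::real). ?g z \<rho>) \<in> borel_measurable (lborel \<Otimes>\<^sub>M lborel)" .
  qed
  also have "\<dots> \<le> (\<integral>\<^sup>+\<rho>. ennreal (m * \<omega> * \<rho> powr (n-m-1)) * indicator {r..} \<rho> \<partial>lborel)"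
  proof (rule nn_integral_mono)
    fix \<rho> :: real
    show "(\<integral>\<^sup>+z. ?g z \<rho> \<partial>lborel) \<le> ennreal (m * \<omega> * \<rho> powr (n-m-1)) * indicator {r..} \<rho>"
    proof (cases "\<rho> \<in> {r..}")
      case True
      then have "(\<integral>\<^sup>+z. ?g z \<rho> \<partial>lborel) = ennreal (m * \<rho> powr (-m-1)) * emeasure lborel (cball (0::'a) \<rho>)"
        by (simp add: nn_integral_cmult_indicator)
      also have "\<dots> \<le> ennreal (m * \<rho> powr (-m-1)) * ennreal (\<omega> * \<rho> powr n)"
        using True assms by (intro mult_left_mono vol') auto
      also have "\<dots> = ennreal (m * \<omega> * (\<rho> powr (-m-1) * \<rho> powr n))"
        using m \<omega> by (simp add: ennreal_mult[symmetric] mult_ac)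
      also have "\<rho> powr (-m-1) * \<rho> powr n = \<rho> powr (n-m-1)"
        by (simp add: powr_add[symmetric] algebra_simps)
      finally show ?thesis using True by simp
    qed auto
  qed
  also have "\<dots> = ennreal (0 - (m * \<omega> / (n - m)) * r powr (n-m))"
  proof (rule nn_integral_FTC_atLeast)
    fix x assume x: "r \<le> x"
    then have "x > 0" using assms by linarith
    then show "((\<lambda>\<rho>. m * \<omega> / (n-m) * \<rho> powr (n-m)) has_real_derivative m * \<omega> * x powr (n-m-1)) (at x)"
      using assms by (auto intro!: derivative_eq_intros simp: n_def)
  next
    have "((\<lambda>\<rho>. \<rho> powr (n-m)) \<longlongrightarrow> 0) at_top"
      using assms by (intro tendsto_neg_powr filterlim_ident) (auto simp: n_def)
    then show "((\<lambda>\<rho>. m * \<omega> / (n-m) * \<rho> powr (n-m)) \<longlongrightarrow> 0) at_top" using tendsto_mult_right_zero by blast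
  qed (use m \<omega> in auto)
  also have "\<dots> < \<infinity>" by simp
  finally show "(\<integral>\<^sup>+z. ennreal (norm (norm z powr (-m) * indicator (- ball (0::'a) r) z)) \<partial>lborel) < \<infinity>" .
qed simp

section \<open>Integration along parallel lines\<close>

definition perp :: "'a::real_inner \<Rightarrow> 'a \<Rightarrow> 'a" where
  "perp \<eta> z = z - (z \<bullet> \<eta>) *\<^sub>R \<eta>"

lemma perp_add: "perp \<eta> (y + z) = perp \<eta> y + perp \<eta> z"
  by (simp add: perp_def inner_add_left algebra_simps)

lemma perp_scaleR: "perp \<eta> (c *\<^sub>R z) = c *\<^sub>R perp \<eta> z"
  by (simp add: perp_def algebra_simps)

lemma perp_minus: "perp \<eta> (- z) = - perp \<eta> z"
  by (simp add: perp_def)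

lemma perp_diff: "perp \<eta> (y - z) = perp \<eta> y - perp \<eta> z"
  by (simp add: perp_def inner_diff_left algebra_simps)

lemma inner_perp: "norm \<eta> = 1 \<Longrightarrow> perp \<eta> z \<bullet> \<eta> = 0"
  by (simp add: perp_def inner_diff_left norm_eq_1)

lemma perp_self: "norm \<eta> = 1 \<Longrightarrow> perp \<eta> \<eta> = 0"
  by (simp add: perp_def norm_eq_1)

lemma perp_perp: "norm \<eta> = 1 \<Longrightarrow> perp \<eta> (perp \<eta> z) = perp \<eta> z"
  using inner_perp[of \<eta> z] by (simp add: perp_def)

lemma perp_orthogonal: "z \<bullet> \<eta> = 0 \<Longrightarrow> perp \<eta> z = z"
  by (simp add: perp_def)

lemma norm_perp_le: "norm \<eta> = 1 \<Longrightarrow> norm (perp \<eta> z) \<le> norm z"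
proof -
  assume \<eta>: "norm \<eta> = 1"
  have "(norm (perp \<eta> z))\<^sup>2 = (norm z)\<^sup>2 - (z \<bullet> \<eta>)\<^sup>2"
    unfolding power2_norm_eq_inner perp_def using \<eta>
    by (simp add: inner_diff_left inner_diff_right norm_eq_1 inner_commute power2_eq_square)
  then have "(norm (perp \<eta> z))\<^sup>2 \<le> (norm z)\<^sup>2" by simp
  then show ?thesis by (simp add: power2_le_iff_abs_le)
qed

lemma norm_add_orthogonal_sq:
  "norm \<eta> = 1 \<Longrightarrow> z \<bullet> \<eta> = 0 \<Longrightarrow> (norm (z + u *\<^sub>R \<eta>))\<^sup>2 = (norm z)\<^sup>2 + u\<^sup>2"
  unfolding power2_norm_eq_inner
  by (simp add: inner_add_left inner_add_right norm_eq_1 inner_commute power2_eq_square)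

lemma continuous_on_perp [continuous_intros]:
  "continuous_on S f \<Longrightarrow> continuous_on S (\<lambda>x. perp \<eta> (f x))"
  unfolding perp_def by (intro continuous_intros)

lemma borel_measurable_perp [measurable]: "perp (\<eta>::'a::euclidean_space) \<in> borel \<rightarrow>\<^sub>M borel"
  by (intro borel_measurable_continuous_onI continuous_intros)

text \<open>On the line spanned by \<eta> the weight \<open>linewt\<close> degenerates. In dimension
  at least two this line is a null set, which is the source of the dimension hypothesis in the
  results on parallel lines.\<close>

lemma AE_perp_nonzero:
  fixes \<eta> :: "'a::euclidean_space"
  assumes "2 \<le> DIM('a)"
  shows "AE z in lborel. perp \<eta> z \<noteq> 0"
proof -
  have "{z. perp \<eta> z = 0} \<subseteq> span {\<eta>}"
  proof
    fix z assume "z \<in> {z. perp \<eta> z = 0}"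
    then have "z = (z \<bullet> \<eta>) *\<^sub>R \<eta>" by (simp add: perp_def)
    then show "z \<in> span {\<eta>}" by (metis span_base span_scale singletonI)
  qed
  moreover have "negligible (span {\<eta>})"
  proof (rule negligible_lowdim)
    have "dim (span {\<eta>}) \<le> card {\<eta>}" by (metis dim_span dim_le_card' finite.emptyI finite_insert)
    then show "dim (span {\<eta>}) < DIM('a)" using assms by simp
  qed
  ultimately have "negligible {z. perp \<eta> z = 0}" by (rule negligible_subset[rotated])
  moreover have "closed {z. perp \<eta> z = 0}"
    by (intro closed_Collect_eq continuous_intros)
  ultimately have "{z. perp \<eta> z = 0} \<in> null_sets lborel"
    by (simp add: negligible_iff_null_sets null_sets_completion_iff)
  then show ?thesis by (auto intro!: AE_I'[of "{z. perp \<eta> z = 0}"])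
qed

text \<open>A weight whose integral along every line parallel to \<open>\<eta>\<close> (except \<open>\<real>\<eta>\<close> itself) is 1, and on whose
  support \<open>norm z\<close> and \<open>norm (perp \<eta> z)\<close> are comparable. It turns integrals over the
  hyperplane orthogonal to \<open>\<eta>\<close> into integrals over the whole space.\<close>
definition linewt :: "'a::euclidean_space \<Rightarrow> 'a \<Rightarrow> real" where
  "linewt \<eta> z = (if \<bar>z \<bullet> \<eta>\<bar> < norm (perp \<eta> z) then 1 / (2 * norm (perp \<eta> z)) else 0)"

lemma borel_measurable_linewt [measurable]: "linewt \<eta> \<in> borel_measurable borel"
  unfolding linewt_def by measurable

lemma linewt_nonneg: "0 \<le> linewt \<eta> z"
  by (simp add: linewt_def)

lemma has_bochner_integral_linewt_line:
  fixes \<eta> y :: "'a::euclidean_space"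
  assumes "norm \<eta> = 1" "perp \<eta> y \<noteq> 0"
  shows "has_bochner_integral lborel (\<lambda>u. linewt \<eta> (y - u *\<^sub>R \<eta>)) 1"
proof -
  define t where "t = norm (perp \<eta> y)"
  have t: "0 < t" using assms by (simp add: t_def)
  have "linewt \<eta> (y - u *\<^sub>R \<eta>) = indicator {y \<bullet> \<eta> - t <..< y \<bullet> \<eta> + t} u * (1 / (2 * t))" for u
    using assms by (auto simp: linewt_def perp_diff perp_scaleR perp_self inner_diff_left norm_eq_1 t_def indicator_def)
  moreover have "has_bochner_integral lborel (\<lambda>u. indicator {y \<bullet> \<eta> - t <..< y \<bullet> \<eta> + t} u * (1 / (2 * t)))
      (measure lborel {y \<bullet> \<eta> - t <..< y \<bullet> \<eta> + t} * (1 / (2*t)))"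
    using t by (intro has_bochner_integral_mult_left has_bochner_integral_real_indicator) auto
  ultimately show ?thesis using t by (simp cong: has_bochner_integral_cong)
qed

text \<open>The double integral of \<open>linewt \<eta> z * h (z + u *\<^sub>R \<eta>)\<close> is
  computed in two ways. Integrating over u first gives the right-hand side, after a shift of u by
  \<open>z \<bullet> \<eta>\<close>. Substituting y = z + u \<eta> for fixed u and then integrating
  over u first gives the integral of \<open>h\<close>, since the weight has integral 1 along the
  line through y. No coordinates on the hyperplane are chosen.\<close>

lemma fubini_lines:
  fixes \<eta> :: "'a::euclidean_space" and h :: "'a \<Rightarrow> real"
  assumes \<eta>: "norm \<eta> = 1" and dim: "2 \<le> DIM('a)" and h: "integrable lborel h"
  shows "integrable lborel (\<lambda>z. linewt \<eta> z * (LINT u|lborel. h (perp \<eta> z + u *\<^sub>R \<eta>)))"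
    and "(LINT z|lborel. h z) = (LINT z|lborel. linewt \<eta> z * (LINT u|lborel. h (perp \<eta> z + u *\<^sub>R \<eta>)))"
proof -
  have [measurable]: "h \<in> borel_measurable borel" using h by simp
  define f2 where "f2 = (\<lambda>(u, y). linewt \<eta> (y - u *\<^sub>R \<eta>) * h y)"
  define f where "f = (\<lambda>(u, z). linewt \<eta> z * h (z + u *\<^sub>R \<eta>))"
  have [measurable]: "f2 \<in> borel_measurable (lborel \<Otimes>\<^sub>M lborel)" "f \<in> borel_measurable (lborel \<Otimes>\<^sub>M lborel)"
    unfolding f_def f2_def by measurable
  have shift: "distr lborel borel (\<lambda>z. z + u *\<^sub>R \<eta>) = (lborel :: 'a measure)" for u
  proof -
    have "(\<lambda>z. z + u *\<^sub>R \<eta>) = (+) (u *\<^sub>R \<eta>)" by (simp add: fun_eq_iff add.commute)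
    then show ?thesis by (simp only: lborel_distr_plus)
  qed
  have l1: "(\<integral>\<^sup>+u. ennreal (linewt \<eta> (y - u *\<^sub>R \<eta>)) \<partial>lborel) = 1" if "perp \<eta> y \<noteq> 0" for y
    using has_bochner_integral_linewt_line[OF \<eta> that]
    by (simp add: has_bochner_integral_iff nn_integral_eq_integral linewt_nonneg)
  have f2int: "integrable (lborel \<Otimes>\<^sub>M lborel) f2"
  proof (rule integrableI_bounded)
    have "(\<integral>\<^sup>+x. ennreal (norm (f2 x)) \<partial>(lborel \<Otimes>\<^sub>M lborel))
          = (\<integral>\<^sup>+y. \<integral>\<^sup>+u. ennreal (norm (f2 (u, y))) \<partial>lborel \<partial>lborel)"
      by (subst lborel_pair.nn_integral_snd[symmetric]) auto
    also have "\<dots> = (\<integral>\<^sup>+y. ennreal (norm (h y)) * (\<integral>\<^sup>+u. ennreal (linewt \<eta> (y - u *\<^sub>R \<eta>)) \<partial>lborel) \<partial>lborel)"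
      by (subst nn_integral_cmult[symmetric])
         (auto simp: f2_def abs_mult ennreal_mult linewt_nonneg mult.commute)
    also have "\<dots> = (\<integral>\<^sup>+y. ennreal (norm (h y)) \<partial>lborel)"
      using AE_perp_nonzero[OF dim, of \<eta>] by (intro nn_integral_cong_AE) (auto elim!: eventually_mono simp: l1)
    also have "\<dots> < \<infinity>" using h by (simp add: integrable_iff_bounded)
    finally show "(\<integral>\<^sup>+x. ennreal (norm (f2 x)) \<partial>(lborel \<Otimes>\<^sub>M lborel)) < \<infinity>" .
  qed measurable
  have fint: "integrable (lborel \<Otimes>\<^sub>M lborel) f"
  proof (rule integrableI_bounded)
    have "(\<integral>\<^sup>+x. ennreal (norm (f x)) \<partial>(lborel \<Otimes>\<^sub>M lborel))
          = (\<integral>\<^sup>+u. \<integral>\<^sup>+z. ennreal (norm (f (u, z))) \<partial>lborel \<partial>lborel)"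
      by (subst lborel.nn_integral_fst[symmetric]) auto
    also have "\<dots> = (\<integral>\<^sup>+u. \<integral>\<^sup>+z. ennreal (norm (f2 (u, z + u *\<^sub>R \<eta>))) \<partial>lborel \<partial>lborel)"
      by (simp add: f_def f2_def)
    also have "\<dots> = (\<integral>\<^sup>+u. \<integral>\<^sup>+y. ennreal (norm (f2 (u, y))) \<partial>lborel \<partial>lborel)"
    proof (rule nn_integral_cong)
      fix u :: real
      have "(\<integral>\<^sup>+y. ennreal (norm (f2 (u, y))) \<partial>lborel) = (\<integral>\<^sup>+y. ennreal (norm (f2 (u, y))) \<partial>distr lborel borel (\<lambda>z. z + u *\<^sub>R \<eta>))"
        by (simp only: shift)
      also have "\<dots> = (\<integral>\<^sup>+z. ennreal (norm (f2 (u, z + u *\<^sub>R \<eta>))) \<partial>lborel)"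
        by (subst nn_integral_distr) (auto simp: f2_def)
      finally show "(\<integral>\<^sup>+z. ennreal (norm (f2 (u, z + u *\<^sub>R \<eta>))) \<partial>lborel) = (\<integral>\<^sup>+y. ennreal (norm (f2 (u, y))) \<partial>lborel)" ..
    qed
    also have "\<dots> = (\<integral>\<^sup>+x. ennreal (norm (f2 x)) \<partial>(lborel \<Otimes>\<^sub>M lborel))"
      by (subst lborel.nn_integral_fst[symmetric]) auto
    also have "\<dots> < \<infinity>" using f2int by (simp add: integrable_iff_bounded)
    finally show "(\<integral>\<^sup>+x. ennreal (norm (f x)) \<partial>(lborel \<Otimes>\<^sub>M lborel)) < \<infinity>" .
  qed measurable
  have inner: "(LINT u|lborel. f (u, z)) = linewt \<eta> z * (LINT u|lborel. h (perp \<eta> z + u *\<^sub>R \<eta>))" for z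
  proof -
    have "(LINT u|lborel. h (perp \<eta> z + u *\<^sub>R \<eta>)) = (LINT u|lborel. h (perp \<eta> z + (z \<bullet> \<eta> + 1 * u) *\<^sub>R \<eta>))"
      using lborel_integral_real_affine[of 1 "\<lambda>u. h (perp \<eta> z + u *\<^sub>R \<eta>)" "z \<bullet> \<eta>"] by simp
    also have "\<dots> = (LINT u|lborel. h (z + u *\<^sub>R \<eta>))" by (simp add: perp_def algebra_simps)
    finally show ?thesis by (simp add: f_def)
  qed
  show "integrable lborel (\<lambda>z. linewt \<eta> z * (LINT u|lborel. h (perp \<eta> z + u *\<^sub>R \<eta>)))"
    using lborel_pair.integrable_snd[of "\<lambda>u z. f (u,z)"] fint by (simp add: inner)
  have "(LINT z|lborel. linewt \<eta> z * (LINT u|lborel. h (perp \<eta> z + u *\<^sub>R \<eta>))) = (LINT z|lborel. LINT u|lborel. f (u,z))"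
    by (simp add: inner)
  also have "\<dots> = (LINT u|lborel. LINT z|lborel. f (u,z))"
    using lborel_pair.Fubini_integral[of "\<lambda>u z. f (u,z)"] fint by simp
  also have "\<dots> = (LINT u|lborel. LINT y|lborel. f2 (u,y))"
  proof (rule Bochner_Integration.integral_cong[OF refl])
    fix u :: real
    have "(LINT y|lborel. f2 (u, y)) = (LINT y|distr lborel borel (\<lambda>z. z + u *\<^sub>R \<eta>). f2 (u, y))"
      by (simp only: shift)
    also have "\<dots> = (LINT z|lborel. f2 (u, z + u *\<^sub>R \<eta>))"
      by (subst integral_distr) (auto simp: f2_def)
    finally show "(LINT z|lborel. f (u, z)) = (LINT y|lborel. f2 (u, y))" by (simp add: f_def f2_def)
  qed
  also have "\<dots> = (LINT y|lborel. LINT u|lborel. f2 (u,y))"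
    using lborel_pair.Fubini_integral[of "\<lambda>u z. f2 (u,z)"] f2int by simp
  also have "\<dots> = (LINT y|lborel. h y)"
  proof (rule integral_cong_AE)
    have "(\<lambda>y. LINT u|lborel. f2 (u,y)) \<in> borel_measurable lborel"
      using lborel_pair.integrable_snd[of "\<lambda>u z. f2 (u,z)"] f2int by auto
    then show "(\<lambda>y. LINT u|lborel. f2 (u,y)) \<in> borel_measurable lborel" .
    show "AE y in lborel. (LINT u|lborel. f2 (u,y)) = h y"
      using AE_perp_nonzero[OF dim, of \<eta>]
    proof (rule eventually_mono)
      fix y assume "perp \<eta> y \<noteq> 0"
      from has_bochner_integral_linewt_line[OF \<eta> this]
      have "(LINT u|lborel. linewt \<eta> (y - u *\<^sub>R \<eta>)) = 1" by (simp add: has_bochner_integral_iff)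
      then show "(LINT u|lborel. f2 (u,y)) = h y" by (simp add: f2_def)
    qed
  qed measurable
  finally show "(LINT z|lborel. h z) = (LINT z|lborel. linewt \<eta> z * (LINT u|lborel. h (perp \<eta> z + u *\<^sub>R \<eta>)))" ..
qed

text \<open>The same computation without an integrability hypothesis; it serves where integrability
  is the question, and to see that reflections preserve Lebesgue measure.\<close>

lemma nn_integral_lines:
  fixes \<eta> :: "'a::euclidean_space" and h :: "'a \<Rightarrow> ennreal"
  assumes \<eta>: "norm \<eta> = 1" and dim: "2 \<le> DIM('a)" and [measurable]: "h \<in> borel_measurable borel"
  shows "(\<integral>\<^sup>+z. h z \<partial>lborel) = (\<integral>\<^sup>+z. ennreal (linewt \<eta> z) * (\<integral>\<^sup>+u. h (perp \<eta> z + u *\<^sub>R \<eta>) \<partial>lborel) \<partial>lborel)"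
proof -
  have shift: "distr lborel borel (\<lambda>z. z + u *\<^sub>R \<eta>) = (lborel :: 'a measure)" for u
  proof -
    have "(\<lambda>z. z + u *\<^sub>R \<eta>) = (+) (u *\<^sub>R \<eta>)" by (simp add: fun_eq_iff add.commute)
    then show ?thesis by (simp only: lborel_distr_plus)
  qed
  have l1: "(\<integral>\<^sup>+u. ennreal (linewt \<eta> (y - u *\<^sub>R \<eta>)) \<partial>lborel) = 1" if "perp \<eta> y \<noteq> 0" for y
    using has_bochner_integral_linewt_line[OF \<eta> that]
    by (simp add: has_bochner_integral_iff nn_integral_eq_integral linewt_nonneg)
  have inner: "(\<integral>\<^sup>+u. h (perp \<eta> z + u *\<^sub>R \<eta>) \<partial>lborel) = (\<integral>\<^sup>+u. h (z + u *\<^sub>R \<eta>) \<partial>lborel)" for z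
    using nn_integral_real_affine[of "\<lambda>u. h (perp \<eta> z + u *\<^sub>R \<eta>)" 1 "z \<bullet> \<eta>"]
    by (simp add: perp_def algebra_simps)
  have "(\<integral>\<^sup>+z. ennreal (linewt \<eta> z) * (\<integral>\<^sup>+u. h (perp \<eta> z + u *\<^sub>R \<eta>) \<partial>lborel) \<partial>lborel)
      = (\<integral>\<^sup>+z. \<integral>\<^sup>+u. ennreal (linewt \<eta> z) * h (z + u *\<^sub>R \<eta>) \<partial>lborel \<partial>lborel)"
    unfolding inner by (subst nn_integral_cmult[symmetric]) auto
  also have "\<dots> = (\<integral>\<^sup>+u. \<integral>\<^sup>+z. ennreal (linewt \<eta> z) * h (z + u *\<^sub>R \<eta>) \<partial>lborel \<partial>lborel)"
    by (rule lborel_pair.Fubini') measurable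
  also have "\<dots> = (\<integral>\<^sup>+u. \<integral>\<^sup>+y. ennreal (linewt \<eta> (y - u *\<^sub>R \<eta>)) * h y \<partial>lborel \<partial>lborel)"
  proof (rule nn_integral_cong)
    fix u :: real
    have "(\<integral>\<^sup>+y. ennreal (linewt \<eta> (y - u *\<^sub>R \<eta>)) * h y \<partial>lborel)
        = (\<integral>\<^sup>+y. ennreal (linewt \<eta> (y - u *\<^sub>R \<eta>)) * h y \<partial>distr lborel borel (\<lambda>z. z + u *\<^sub>R \<eta>))"
      by (simp only: shift)
    also have "\<dots> = (\<integral>\<^sup>+z. ennreal (linewt \<eta> z) * h (z + u *\<^sub>R \<eta>) \<partial>lborel)"
      by (subst nn_integral_distr) auto
    finally show "(\<integral>\<^sup>+z. ennreal (linewt \<eta> z) * h (z + u *\<^sub>R \<eta>) \<partial>lborel)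
        = (\<integral>\<^sup>+y. ennreal (linewt \<eta> (y - u *\<^sub>R \<eta>)) * h y \<partial>lborel)" ..
  qed
  also have "\<dots> = (\<integral>\<^sup>+y. \<integral>\<^sup>+u. ennreal (linewt \<eta> (y - u *\<^sub>R \<eta>)) * h y \<partial>lborel \<partial>lborel)"
    by (rule lborel_pair.Fubini'[symmetric]) measurable
  also have "\<dots> = (\<integral>\<^sup>+y. h y \<partial>lborel)"
  proof (rule nn_integral_cong_AE)
    show "AE y in lborel. (\<integral>\<^sup>+u. ennreal (linewt \<eta> (y - u *\<^sub>R \<eta>)) * h y \<partial>lborel) = h y"
      using AE_perp_nonzero[OF dim, of \<eta>]
      by (rule eventually_mono) (simp add: nn_integral_multc l1)
  qed
  finally show ?thesis ..
qed

text \<open>This is the integral of |y|^(-\<gamma>) over the (n-1)-dimensional ball of radius r,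
  written over the whole space. On the support of the weight the norms of z and of its projection
  differ by a factor of at most 2, and the factor 1/|perp z| in the weight raises the exponent to
  \<gamma>+1, so that the n-dimensional bound on the ball of radius 2r applies.\<close>

lemma nn_integral_linewt_powr:
  fixes \<gamma> :: real
  assumes dim: "2 \<le> DIM('a::euclidean_space)" and \<gamma>: "-1 \<le> \<gamma>" "\<gamma> + 1 < DIM('a)"
  shows "\<exists>C\<ge>0. \<forall>\<eta>::'a. \<forall>r>0. norm \<eta> = 1 \<longrightarrow>
    (\<integral>\<^sup>+z. ennreal (linewt \<eta> z * (norm (perp \<eta> z) powr (-\<gamma>) * indicator {..<r} (norm (perp \<eta> z)))) \<partial>lborel)
      \<le> ennreal (C * r powr (real DIM('a) - 1 - \<gamma>))"
proof -
  obtain C where C: "C \<ge> 0" "\<And>r. r > 0 \<Longrightarrow> (\<integral>\<^sup>+z. ennreal (norm z powr (-(\<gamma>+1))) * indicator (ball (0::'a) r) z \<partial>lborel)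
            \<le> ennreal (C * r powr (DIM('a) - (\<gamma>+1)))"
    using nn_integral_ball_powr[where 'a='a, of "\<gamma>+1"] \<gamma> by auto
  let ?D = "2 powr (\<gamma>+1) * C * 2 powr (DIM('a) - (\<gamma>+1))"
  have "(\<integral>\<^sup>+z. ennreal (linewt \<eta> z * (norm (perp \<eta> z) powr (-\<gamma>) * indicator {..<r} (norm (perp \<eta> z)))) \<partial>lborel)
      \<le> ennreal (?D * r powr (real DIM('a) - 1 - \<gamma>))" if \<eta>: "norm \<eta> = 1" and r: "r > 0" for \<eta> :: 'a and r
  proof -
    have "linewt \<eta> z * (norm (perp \<eta> z) powr (-\<gamma>) * indicator {..<r} (norm (perp \<eta> z)))
          \<le> 2 powr (\<gamma>+1) * (norm z powr (-(\<gamma>+1)) * indicator (ball 0 (2*r)) z)" for z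
    proof (cases "\<bar>z \<bullet> \<eta>\<bar> < norm (perp \<eta> z) \<and> norm (perp \<eta> z) < r")
      case True
      define t where "t = norm (perp \<eta> z)"
      have t: "0 < t" using True by (auto simp: t_def)
      have "z = perp \<eta> z + (z \<bullet> \<eta>) *\<^sub>R \<eta>" by (simp add: perp_def)
      then have "norm z \<le> norm (perp \<eta> z) + norm ((z \<bullet> \<eta>) *\<^sub>R \<eta>)" by (metis norm_triangle_ineq)
      then have z2: "norm z \<le> 2 * t" using True \<eta> by (simp add: t_def)
      have tz: "t \<le> norm z" using norm_perp_le[OF \<eta>] by (simp add: t_def)
      have "t powr (-(\<gamma>+1)) \<le> (norm z / 2) powr (-(\<gamma>+1))"
        using z2 t tz \<gamma> by (intro powr_mono2') auto
      also have "\<dots> = 2 powr (\<gamma>+1) * norm z powr (-(\<gamma>+1))"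
        using t tz unfolding powr_divide powr_minus by (simp add: divide_simps)
      finally have *: "t powr (-(\<gamma>+1)) \<le> 2 powr (\<gamma>+1) * norm z powr (-(\<gamma>+1))" .
      have "1 / (2*t) * t powr (-\<gamma>) \<le> t powr (-1) * t powr (-\<gamma>)"
        using t by (intro mult_right_mono) (auto simp: powr_minus_divide divide_simps)
      also have "\<dots> = t powr (-(\<gamma>+1))"
        unfolding powr_add[symmetric] by (rule arg_cong[where f="\<lambda>x. t powr x"]) simp
      finally show ?thesis using True * z2 by (simp add: linewt_def t_def indicator_def)
    qed (auto simp: linewt_def)
    then have "(\<integral>\<^sup>+z. ennreal (linewt \<eta> z * (norm (perp \<eta> z) powr (-\<gamma>) * indicator {..<r} (norm (perp \<eta> z)))) \<partial>lborel)
        \<le> (\<integral>\<^sup>+z. ennreal (2 powr (\<gamma>+1)) * (ennreal (norm z powr (-(\<gamma>+1))) * indicator (ball (0::'a) (2*r)) z) \<partial>lborel)"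
      by (intro nn_integral_mono)
         (auto simp: ennreal_mult[symmetric] ennreal_indicator[symmetric] simp del: ennreal_indicator intro!: ennreal_leI)
    also have "\<dots> = ennreal (2 powr (\<gamma>+1)) * (\<integral>\<^sup>+z. ennreal (norm z powr (-(\<gamma>+1))) * indicator (ball (0::'a) (2*r)) z \<partial>lborel)"
      by (intro nn_integral_cmult borel_measurable_times_ennreal borel_measurable_indicator) auto
    also have "\<dots> \<le> ennreal (2 powr (\<gamma>+1)) * ennreal (C * (2*r) powr (DIM('a) - (\<gamma>+1)))"
      using r by (intro mult_left_mono C) auto
    also have "\<dots> = ennreal (?D * r powr (real DIM('a) - 1 - \<gamma>))"
      using r C by (simp add: ennreal_mult[symmetric] powr_mult algebra_simps)
    finally show ?thesis .
  qed
  then show ?thesis using C by (intro exI[of _ ?D]) auto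
qed

text \<open>The bound of the line integrals is integrated against the weight. The order of the
  quantifiers matters: one constant serves all directions, functions and radii.\<close>

lemma integral_bound_by_lines:
  fixes \<gamma> :: real
  assumes dim: "2 \<le> DIM('a::euclidean_space)" and \<gamma>: "-1 \<le> \<gamma>" "\<gamma> + 1 < DIM('a)"
  shows "\<exists>C\<ge>0. \<forall>(\<eta>::'a) h K. \<forall>r>0. norm \<eta> = 1 \<longrightarrow> integrable lborel h \<longrightarrow> 0 \<le> K \<longrightarrow>
     (\<forall>z. z \<bullet> \<eta> = 0 \<longrightarrow> z \<noteq> 0 \<longrightarrow>
        \<bar>LINT u|lborel. h (z + u *\<^sub>R \<eta>) :: real\<bar> \<le> K * (norm z powr (-\<gamma>) * indicator {..<r} (norm z))) \<longrightarrow>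
     \<bar>LINT z|lborel. h z\<bar> \<le> K * C * r powr (real DIM('a) - 1 - \<gamma>)"
proof -
  from nn_integral_linewt_powr[OF assms] obtain C where C0: "C \<ge> 0" and C1: "\<forall>\<eta>::'a. \<forall>r>0. norm \<eta> = 1 \<longrightarrow>
    (\<integral>\<^sup>+z. ennreal (linewt \<eta> z * (norm (perp \<eta> z) powr (-\<gamma>) * indicator {..<r} (norm (perp \<eta> z)))) \<partial>lborel)
      \<le> ennreal (C * r powr (real DIM('a) - 1 - \<gamma>))"
    by (elim exE conjE)
  note C = C0 C1[rule_format]
  show ?thesis
  proof (intro exI[of _ C] conjI C(1) allI impI)
    fix \<eta> :: 'a and h K and r :: real
    assume r: "r > 0" and \<eta>: "norm \<eta> = 1" and h: "integrable lborel h" and K: "0 \<le> K"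
      and b: "\<forall>z. z \<bullet> \<eta> = 0 \<longrightarrow> z \<noteq> 0 \<longrightarrow>
        \<bar>LINT u|lborel. h (z + u *\<^sub>R \<eta>) :: real\<bar> \<le> K * (norm z powr (-\<gamma>) * indicator {..<r} (norm z))"
    let ?g = "\<lambda>z. linewt \<eta> z * (LINT u|lborel. h (perp \<eta> z + u *\<^sub>R \<eta>))"
    let ?b = "\<lambda>z. linewt \<eta> z * (norm (perp \<eta> z) powr (-\<gamma>) * indicator {..<r} (norm (perp \<eta> z)))"
    have "ennreal \<bar>LINT z|lborel. h z\<bar> = ennreal \<bar>LINT z|lborel. ?g z\<bar>"
      using fubini_lines(2)[OF \<eta> dim h] by simp
    also have "\<dots> \<le> (\<integral>\<^sup>+z. ennreal \<bar>?g z\<bar> \<partial>lborel)"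
      using integral_norm_bound_ennreal[OF fubini_lines(1)[OF \<eta> dim h]] by simp
    also have "\<dots> \<le> (\<integral>\<^sup>+z. ennreal K * ennreal (?b z) \<partial>lborel)"
    proof (rule nn_integral_mono)
      fix z :: 'a
      show "ennreal \<bar>?g z\<bar> \<le> ennreal K * ennreal (?b z)"
      proof (cases "perp \<eta> z = 0")
        case True
        then show ?thesis by (simp add: linewt_def)
      next
        case False
        then have "\<bar>LINT u|lborel. h (perp \<eta> z + u *\<^sub>R \<eta>)\<bar> \<le> K * (norm (perp \<eta> z) powr (-\<gamma>) * indicator {..<r} (norm (perp \<eta> z)))"
          using b inner_perp[OF \<eta>] by blast
        then have "\<bar>?g z\<bar> \<le> K * ?b z"
          unfolding abs_mult abs_of_nonneg[OF linewt_nonneg] mult.left_commute[of K]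
          by (intro mult_left_mono linewt_nonneg)
        then show ?thesis using K by (simp add: ennreal_mult[symmetric] linewt_nonneg ennreal_leI)
      qed
    qed
    also have "\<dots> = ennreal K * (\<integral>\<^sup>+z. ennreal (?b z) \<partial>lborel)" by (rule nn_integral_cmult) measurable
    also have "\<dots> \<le> ennreal K * ennreal (C * r powr (real DIM('a) - 1 - \<gamma>))"
      by (intro mult_left_mono C(2) r \<eta>) auto
    also have "\<dots> = ennreal (K * C * r powr (real DIM('a) - 1 - \<gamma>))"
      using K C by (simp add: ennreal_mult[symmetric] mult.assoc)
    finally show "\<bar>LINT z|lborel. h z\<bar> \<le> K * C * r powr (real DIM('a) - 1 - \<gamma>)"
      using K C by (subst (asm) ennreal_le_iff) auto
  qed
qed

section \<open>Paired subgraphs\<close>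

definition hrefl :: "'a::real_inner \<Rightarrow> 'a \<Rightarrow> 'a" where
  "hrefl v z = z - (2 * (z \<bullet> v)) *\<^sub>R v"

lemma hrefl_add: "hrefl v (y + z) = hrefl v y + hrefl v z"
  by (simp add: hrefl_def inner_add_left algebra_simps)

lemma hrefl_scaleR: "hrefl v (c *\<^sub>R z) = c *\<^sub>R hrefl v z"
  by (simp add: hrefl_def algebra_simps)

lemma hrefl_diff: "hrefl v (y - z) = hrefl v y - hrefl v z"
  by (simp add: hrefl_def inner_diff_left algebra_simps)

lemma hrefl_inner: "norm v = 1 \<Longrightarrow> hrefl v y \<bullet> hrefl v z = y \<bullet> z"
  by (simp add: hrefl_def inner_diff_left inner_diff_right norm_eq_1 inner_commute algebra_simps)

lemma norm_hrefl: "norm v = 1 \<Longrightarrow> norm (hrefl v z) = norm z"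
  by (simp add: norm_eq_sqrt_inner hrefl_inner)

lemma hrefl_hrefl: "norm v = 1 \<Longrightarrow> hrefl v (hrefl v z) = z"
  by (simp add: hrefl_def inner_diff_left norm_eq_1 algebra_simps)

lemma continuous_on_hrefl [continuous_intros]:
  "continuous_on S f \<Longrightarrow> continuous_on S (\<lambda>x. hrefl v (f x))"
  unfolding hrefl_def by (intro continuous_intros)

lemma borel_measurable_hrefl [measurable]: "hrefl (v::'a::euclidean_space) \<in> borel \<rightarrow>\<^sub>M borel"
  by (intro borel_measurable_continuous_onI continuous_intros)

text \<open>In the decomposition into lines parallel to \<open>v\<close> the reflection fixes the
  projection and reverses the coordinate on each line, which preserves one-dimensional Lebesgue
  measure.\<close>

lemma distr_lborel_hrefl:
  fixes v :: "'a::euclidean_space"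
  assumes v: "norm v = 1" and dim: "2 \<le> DIM('a)"
  shows "distr lborel borel (hrefl v) = lborel"
proof (rule measure_eqI)
  fix A assume "A \<in> sets (distr lborel borel (hrefl v))"
  then have A[measurable]: "A \<in> sets borel" by simp
  have "emeasure (distr lborel borel (hrefl v)) A = (\<integral>\<^sup>+z. indicator A z \<partial>distr lborel borel (hrefl v))"
    by (subst nn_integral_indicator) auto
  also have "\<dots> = (\<integral>\<^sup>+z. indicator A (hrefl v z) \<partial>lborel)"
    by (subst nn_integral_distr) auto
  also have "\<dots> = (\<integral>\<^sup>+z. ennreal (linewt v z) * (\<integral>\<^sup>+u. indicator A (hrefl v (perp v z + u *\<^sub>R v)) \<partial>lborel) \<partial>lborel)"
    by (rule nn_integral_lines[OF v dim]) measurable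
  also have "\<dots> = (\<integral>\<^sup>+z. ennreal (linewt v z) * (\<integral>\<^sup>+u. indicator A (perp v z + u *\<^sub>R v) \<partial>lborel) \<partial>lborel)"
  proof (rule nn_integral_cong)
    fix z :: 'a
    have "hrefl v (perp v z + u *\<^sub>R v) = perp v z + (0 + (-1) * u) *\<^sub>R v" for u
    proof -
      have "(perp v z + u *\<^sub>R v) \<bullet> v = u" using v inner_perp[OF v, of z] by (simp add: inner_add_left norm_eq_1)
      then have "hrefl v (perp v z + u *\<^sub>R v) = perp v z + (u *\<^sub>R v - (2 * u) *\<^sub>R v)"
        by (simp only: hrefl_def add_diff_eq)
      also have "u *\<^sub>R v - (2 * u) *\<^sub>R v = (u - 2 * u) *\<^sub>R v" by (rule scaleR_left_diff_distrib[symmetric])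
      finally show ?thesis by simp
    qed
    then have "(\<integral>\<^sup>+u. indicator A (hrefl v (perp v z + u *\<^sub>R v)) \<partial>lborel) = (\<integral>\<^sup>+u. indicator A (perp v z + u *\<^sub>R v) \<partial>lborel :: ennreal)"
      using nn_integral_real_affine[of "\<lambda>u. indicator A (perp v z + u *\<^sub>R v)" "-1" 0] by simp
    then show "ennreal (linewt v z) * (\<integral>\<^sup>+u. indicator A (hrefl v (perp v z + u *\<^sub>R v)) \<partial>lborel)
      = ennreal (linewt v z) * (\<integral>\<^sup>+u. indicator A (perp v z + u *\<^sub>R v) \<partial>lborel)" by simp
  qed
  also have "\<dots> = (\<integral>\<^sup>+z. indicator A z \<partial>lborel)"
    by (rule nn_integral_lines[OF v dim, symmetric]) measurable
  finally show "emeasure (distr lborel borel (hrefl v)) A = emeasure lborel A" by simp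
qed simp

lemma distr_lborel_uminus: "distr lborel borel uminus = (lborel :: 'a::euclidean_space measure)"
  using lborel_affine[of "-1" "0::'a"] by (simp add: density_1)

lemma distr_lborel_compose:
  assumes "distr lborel borel f = (lborel :: 'a::euclidean_space measure)" "distr lborel borel g = lborel"
    and [measurable]: "f \<in> borel \<rightarrow>\<^sub>M borel" "g \<in> borel \<rightarrow>\<^sub>M borel"
  shows "distr lborel borel (\<lambda>x. g (f x)) = lborel"
proof -
  have "distr lborel borel (g \<circ> f) = distr (distr lborel borel f) borel g"
    by (rule distr_distr[symmetric]) auto
  then show ?thesis by (simp add: assms o_def)
qed

text \<open>The difference of indicators is the signed indicator of the interval between
  \<open>x1\<close> and \<open>x2\<close>, so no order of the two is required. The formula
  evaluates, on one line, the integral of a kernel over the region between two graphs.\<close>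

lemma has_bochner_integral_between_graphs:
  fixes T t :: "real \<Rightarrow> real"
  assumes T: "\<And>v. (T has_real_derivative t v) (at v)" and t: "continuous_on UNIV t"
  shows "has_bochner_integral lborel (\<lambda>u. (indicator {..<x1} u - indicator {..<x2} u) * t u) (T x1 - T x2)"
proof -
  have *: "has_bochner_integral lborel (\<lambda>u. (indicator {..<y} u - indicator {..<x} u) * t u) (T y - T x)" if "x \<le> y" for x y
  proof -
    have "has_bochner_integral lborel (\<lambda>u. t u * indicator {x..y} u) (T y - T x)"
      using that T t by (intro has_bochner_integral_FTC_Icc_real) (auto simp: continuous_on_eq_continuous_at)
    moreover have "AE u in lborel. t u * indicator {x..y} u = (indicator {..<y} u - indicator {..<x} u) * t u"
      using AE_lborel_singleton[of y] by (rule eventually_mono) (use that in \<open>auto simp: indicator_def\<close>)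
    ultimately show ?thesis
    proof (subst (asm) has_bochner_integral_cong_AE)
      have [measurable]: "t \<in> borel_measurable borel" using t by (rule borel_measurable_continuous_onI)
      show "(\<lambda>u. t u * indicator {x..y} u) \<in> borel_measurable lborel" by measurable
      show "(\<lambda>u. (indicator {..<y} u - indicator {..<x} u) * t u) \<in> borel_measurable lborel" by measurable
    qed auto
  qed
  show ?thesis
  proof (cases "x2 \<le> x1")
    case True
    then show ?thesis by (rule *)
  next
    case False
    then have "has_bochner_integral lborel (\<lambda>u. - ((indicator {..<x2} u - indicator {..<x1} u) * t u)) (- (T x2 - T x1))"
      by (intro has_bochner_integral_minus *) auto
    then show ?thesis by (simp add: algebra_simps)
  qed
qed

text \<open>A fixed choice of the constant of \<open>integral_bound_by_lines\<close>. It depends on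
  the space and on \<gamma> alone, so that error terms built from it are uniform in the pair of
  points and in the scale.\<close>

definition lines_const :: "'a::euclidean_space itself \<Rightarrow> real \<Rightarrow> real" where
  "lines_const _ (\<gamma>::real) = (SOME C. C\<ge>0 \<and> (\<forall>(\<eta>::'a) h K. \<forall>r>0. norm \<eta> = 1 \<longrightarrow> integrable lborel h \<longrightarrow> 0 \<le> K \<longrightarrow>
     (\<forall>z. z \<bullet> \<eta> = 0 \<longrightarrow> z \<noteq> 0 \<longrightarrow>
        \<bar>LINT u|lborel. h (z + u *\<^sub>R \<eta>) :: real\<bar> \<le> K * (norm z powr (-\<gamma>) * indicator {..<r} (norm z))) \<longrightarrow>
     \<bar>LINT z|lborel. h z\<bar> \<le> K * C * r powr (real DIM('a) - 1 - \<gamma>)))"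

lemma lines_const:
  fixes \<gamma> :: real
  assumes "2 \<le> DIM('a::euclidean_space)" "-1 \<le> \<gamma>" "\<gamma> + 1 < DIM('a)"
  shows lines_const_nonneg: "0 \<le> lines_const TYPE('a) \<gamma>"
    and lines_const_bound: "\<And>(\<eta>::'a) h K r. r > 0 \<Longrightarrow> norm \<eta> = 1 \<Longrightarrow> integrable lborel h \<Longrightarrow> 0 \<le> K \<Longrightarrow>
     (\<And>z. z \<bullet> \<eta> = 0 \<Longrightarrow> z \<noteq> 0 \<Longrightarrow>
        \<bar>LINT u|lborel. h (z + u *\<^sub>R \<eta>) :: real\<bar> \<le> K * (norm z powr (-\<gamma>) * indicator {..<r} (norm z))) \<Longrightarrow>
     \<bar>LINT z|lborel. h z\<bar> \<le> K * lines_const TYPE('a) \<gamma> * r powr (real DIM('a) - 1 - \<gamma>)"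
proof -
  note * = someI_ex[OF integral_bound_by_lines[OF assms]]
  show "0 \<le> lines_const TYPE('a) \<gamma>" unfolding lines_const_def using conjunct1[OF *] .
  show "\<bar>LINT z|lborel. h z\<bar> \<le> K * lines_const TYPE('a) \<gamma> * r powr (real DIM('a) - 1 - \<gamma>)"
    if "r > 0" "norm \<eta> = 1" "integrable lborel h" "0 \<le> K"
     "\<And>z. z \<bullet> \<eta> = 0 \<Longrightarrow> z \<noteq> 0 \<Longrightarrow>
        \<bar>LINT u|lborel. h (z + u *\<^sub>R \<eta>) :: real\<bar> \<le> K * (norm z powr (-\<gamma>) * indicator {..<r} (norm z))"
    for \<eta> :: 'a and h K r
    unfolding lines_const_def using conjunct2[OF *, rule_format, OF that] .
qed

lemma integrable_bounded_support:
  fixes f :: "'a::euclidean_space \<Rightarrow> real"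
  assumes [measurable]: "f \<in> borel_measurable borel" and b: "\<And>z. \<bar>f z\<bar> \<le> K" and s: "\<And>z. r \<le> norm z \<Longrightarrow> f z = 0"
  shows "integrable lborel f"
proof (rule Bochner_Integration.integrable_bound)
  show "integrable lborel (\<lambda>z. K * indicator (ball (0::'a) r) z)"
    by (intro integrable_mult_right integrable_real_indicator) (use emeasure_bounded_finite[OF bounded_ball, of "0::'a" r] in \<open>auto simp: infinity_ennreal_def\<close>)
  show "AE z in lborel. norm (f z) \<le> norm (K * indicator (ball 0 r) z)"
  proof (rule AE_I2)
    fix z
    show "norm (f z) \<le> norm (K * indicator (ball 0 r) z)"
      using b[of z] s[of z] by (cases "r \<le> norm z") (auto simp: indicator_def)
  qed
qed simp

text \<open>\<open>S1\<close> and \<open>S2\<close> are subgraphs over the hyperplane orthogonal to \<open>\<eta>\<close>, possibly cut by a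
  half-space. Averaging over the involution \<open>R\<close> before integrating along the lines parallel to
  \<open>\<eta>\<close> cancels the first-order part of \<open>g1 - g2\<close>.\<close>
lemma paired_subgraph_kernel_bound:
  fixes R :: "'a::euclidean_space \<Rightarrow> 'a" and \<gamma> :: real and e g1 g2 :: "'a \<Rightarrow> real" and S1 S2 :: "'a set"
  assumes dim: "2 \<le> DIM('a)" and \<gamma>: "-1 \<le> \<gamma>" "\<gamma> + 1 < DIM('a)"
    and \<eta>: "norm \<eta> = 1" and r: "0 < r" and a: "0 < a" "a \<le> r\<^sup>2" and b: "0 < b" and L: "0 \<le> L" "0 \<le> \<omega>"
    and Rm: "distr lborel borel R = lborel" "R \<in> borel \<rightarrow>\<^sub>M borel"
    and R\<eta>: "\<And>z u. R (z + u *\<^sub>R \<eta>) = R z + u *\<^sub>R \<eta>" and Rperp: "\<And>z. z \<bullet> \<eta> = 0 \<Longrightarrow> R z \<bullet> \<eta> = 0"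
    and Rn: "\<And>z. norm (R z) = norm z"
    and cutR: "\<And>z. Q (R z) = Q z" and cut\<eta>: "\<And>z u. Q (z + u *\<^sub>R \<eta>) = Q z"
    and S[measurable]: "S1 \<in> sets borel" "S2 \<in> sets borel"
    and S1: "\<And>z. norm z < r \<Longrightarrow> z \<in> S1 \<longleftrightarrow> Q z \<and> z \<bullet> \<eta> < g1 (perp \<eta> z)"
    and S2: "\<And>z. norm z < r \<Longrightarrow> z \<in> S2 \<longleftrightarrow> Q z \<and> z \<bullet> \<eta> < g2 (perp \<eta> z)"
    and close: "\<And>z. z \<bullet> \<eta> = 0 \<Longrightarrow> z \<noteq> 0 \<Longrightarrow> norm z < r \<Longrightarrow>
        \<bar>g1 z - g1 (R z)\<bar> \<le> L * e z \<and> \<bar>g2 z - g2 (R z)\<bar> \<le> L * e z \<or>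
        \<bar>g1 z + g1 (R z)\<bar> \<le> L * e z \<and> \<bar>g2 z + g2 (R z)\<bar> \<le> L * e z"
    and F: "\<And>z. z \<bullet> \<eta> = 0 \<Longrightarrow> z \<noteq> 0 \<Longrightarrow> norm z < r \<Longrightarrow> \<bar>g1 z - g2 z\<bar> \<le> L * \<omega> * norm z"
    and FR: "\<And>z. z \<bullet> \<eta> = 0 \<Longrightarrow> z \<noteq> 0 \<Longrightarrow> norm z < r \<Longrightarrow>
        \<bar>(g1 z - g2 z) + (g1 (R z) - g2 (R z))\<bar> \<le> L * \<omega> * e z"
    and e: "\<And>z. z \<bullet> \<eta> = 0 \<Longrightarrow> z \<noteq> 0 \<Longrightarrow> norm z < r \<Longrightarrow>
        0 \<le> e z \<and> e z * max a ((norm z)\<^sup>2) powr (-b) \<le> 2 * norm z powr (-\<gamma>)"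
  shows "\<bar>LINT z|lborel. (indicator S1 z - indicator S2 z) * (kap b a ((norm z)\<^sup>2) - kap b (r\<^sup>2) ((norm z)\<^sup>2))\<bar>
      \<le> \<omega> * ((1 + b) * L + 2 * b * L\<^sup>2) * lines_const TYPE('a) \<gamma> * r powr (real DIM('a) - 1 - \<gamma>)"
proof -
  define c where "c = (1 + b) * L + 2 * b * L\<^sup>2"
  have c: "0 \<le> c" using b L by (simp add: c_def)
  define k where "k = (\<lambda>\<tau>. kap b a \<tau> - kap b (r\<^sup>2) \<tau>)"
  define h where "h = (\<lambda>z. (indicator S1 z - indicator S2 z) * k ((norm z)\<^sup>2) :: real)"
  have r2: "0 < r\<^sup>2" using r by simp
  have kcont: "continuous_on UNIV (\<lambda>v. k (\<zeta> + v\<^sup>2))" for \<zeta>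
    unfolding k_def using a r2 by (intro continuous_intros) auto
  have k0: "0 \<le> k \<tau>" for \<tau> unfolding k_def using kap_mono_scale[OF a(1) b a(2)] by simp
  have kle: "k \<tau> \<le> (1 + b) * (max a \<tau>) powr (-b)" if "0 \<le> \<tau>" for \<tau>
    unfolding k_def using kap_le_max[OF a(1) b that] kap_nonneg[OF r2 b, of \<tau>] by linarith
  have kle': "k \<tau> \<le> (1 + b) * a powr (-b)" if "0 \<le> \<tau>" for \<tau>
    unfolding k_def using kap_le_const[OF a(1) b that] kap_nonneg[OF r2 b, of \<tau>] by linarith
  have kz: "k ((norm z)\<^sup>2) = 0" if "r \<le> norm z" for z :: 'a
  proof -
    have "r\<^sup>2 \<le> (norm z)\<^sup>2" using that r by (intro power_mono) auto
    then show ?thesis using a by (simp add: k_def kap_def)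
  qed
  have [measurable]: "(\<lambda>z::'a. k ((norm z)\<^sup>2)) \<in> borel_measurable borel"
    unfolding k_def using a r2 by (intro borel_measurable_continuous_onI continuous_intros) auto
  have hm[measurable]: "h \<in> borel_measurable borel" unfolding h_def by measurable
  have hb: "\<bar>h z\<bar> \<le> (1 + b) * a powr (-b)" for z
  proof -
    have "\<bar>h z\<bar> \<le> k ((norm z)\<^sup>2)" using k0[of "(norm z)\<^sup>2"] by (auto simp: h_def indicator_def)
    then show ?thesis using kle'[of "(norm z)\<^sup>2"] by simp
  qed
  have hi: "integrable lborel h"
    by (rule integrable_bounded_support[OF hm hb, of r]) (simp add: h_def kz)
  have hR: "(LINT z|lborel. h (R z)) = (LINT z|lborel. h z)"
  proof -
    have "(LINT z|distr lborel borel R. h z) = (LINT z|lborel. h (R z))"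
      using Rm(2) by (intro integral_distr) auto
    then show ?thesis by (simp add: Rm(1))
  qed
  have hRi: "integrable lborel (\<lambda>z. h (R z))"
  proof (rule integrable_bounded_support[of _ "(1 + b) * a powr (-b)" r])
    show "(\<lambda>z. h (R z)) \<in> borel_measurable borel" using Rm(2) by measurable
    show "\<bar>h (R z)\<bar> \<le> (1 + b) * a powr (-b)" for z by (rule hb)
  qed (simp add: h_def kz Rn)
  \<comment> \<open>Where the kernel does not vanish, the two sets meet a line parallel to \<eta> in
    half-lines or, if \<open>Q\<close> fails, not at all. With a primitive \<open>T\<close> of the
    kernel along the line, the integral is the difference of the values of \<open>T\<close> at the
    two graph heights.\<close>
  have line: "has_bochner_integral lborel (\<lambda>u. h (z + u *\<^sub>R \<eta>)) (if Q z then T (g1 z) - T (g2 z) else 0)"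
    if z: "z \<bullet> \<eta> = 0" and T: "\<And>v. (T has_real_derivative k ((norm z)\<^sup>2 + v\<^sup>2)) (at v)" for z T
  proof -
    have p: "perp \<eta> (z + u *\<^sub>R \<eta>) = z" for u
      using z \<eta> by (simp add: perp_add perp_scaleR perp_self perp_orthogonal)
    have n: "(norm (z + u *\<^sub>R \<eta>))\<^sup>2 = (norm z)\<^sup>2 + u\<^sup>2" for u by (rule norm_add_orthogonal_sq[OF \<eta> z])
    have i: "(z + u *\<^sub>R \<eta>) \<bullet> \<eta> = u" for u using z \<eta> by (simp add: inner_add_left norm_eq_1)
    have hu: "h (z + u *\<^sub>R \<eta>) = (if Q z then (indicator {..<g1 z} u - indicator {..<g2 z} u) * k ((norm z)\<^sup>2 + u\<^sup>2) else 0)" for u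
    proof (cases "norm (z + u *\<^sub>R \<eta>) < r")
      case True
      then show ?thesis using S1[OF True] S2[OF True] by (auto simp: h_def n i p cut\<eta> indicator_def)
    next
      case False
      then show ?thesis using kz[of "z + u *\<^sub>R \<eta>"] by (simp add: h_def n)
    qed
    show ?thesis unfolding hu using has_bochner_integral_between_graphs[OF T kcont, of "g1 z" "g2 z"]
      by (auto simp: has_bochner_integral_zero)
  qed
  have key: "\<bar>LINT u|lborel. h (z + u *\<^sub>R \<eta>) + h (R (z + u *\<^sub>R \<eta>))\<bar>
      \<le> (2 * \<omega> * c) * (norm z powr (-\<gamma>) * indicator {..<r} (norm z))"
    if z: "z \<bullet> \<eta> = 0" "z \<noteq> 0" for z
  proof (cases "norm z < r")
    case False
    have "r \<le> norm (z + u *\<^sub>R \<eta>)" for u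
    proof -
      have "(norm z)\<^sup>2 \<le> (norm (z + u *\<^sub>R \<eta>))\<^sup>2" using norm_add_orthogonal_sq[OF \<eta> z(1)] by simp
      then have "norm z \<le> norm (z + u *\<^sub>R \<eta>)" by (rule power2_le_imp_le) simp
      then show ?thesis using False by simp
    qed
    then have "h (z + u *\<^sub>R \<eta>) + h (R (z + u *\<^sub>R \<eta>)) = 0" for u by (simp add: h_def kz Rn)
    then show ?thesis using False by simp
  next
    case True
    let ?t = "\<lambda>v. k ((norm z)\<^sup>2 + v\<^sup>2)"
    obtain T where T: "\<And>v. (T has_real_derivative ?t v) (at v)"
      using einterval_antiderivative[of "-\<infinity>" "\<infinity>" ?t] kcont[of "(norm z)\<^sup>2"]
      by (auto simp: continuous_on_eq_continuous_at has_real_derivative_iff_has_vector_derivative)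
    have l1: "has_bochner_integral lborel (\<lambda>u. h (z + u *\<^sub>R \<eta>)) (if Q z then T (g1 z) - T (g2 z) else 0)"
      by (rule line[OF z(1) T])
    have l2: "has_bochner_integral lborel (\<lambda>u. h (R (z + u *\<^sub>R \<eta>))) (if Q z then T (g1 (R z)) - T (g2 (R z)) else 0)"
      using line[OF Rperp[OF z(1)], of T] T by (simp add: R\<eta> Rn cutR)
    define M where "M = max a ((norm z)\<^sup>2)"
    have M: "0 < M" "norm z \<le> M powr (1/2)"
    proof -
      show "0 < M" using a by (simp add: M_def)
      have "norm z = sqrt ((norm z)\<^sup>2)" by simp
      also have "\<dots> \<le> sqrt M" unfolding M_def by (intro real_sqrt_le_mono) simp
      finally show "norm z \<le> M powr (1/2)" using \<open>0 < M\<close> by (simp add: powr_half_sqrt)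
    qed
    have ez: "0 \<le> e z" "e z * M powr (-b) \<le> 2 * norm z powr (-\<gamma>)" using e[OF z True] by (auto simp: M_def)
    have Rz: "R z \<bullet> \<eta> = 0" "R z \<noteq> 0" "norm (R z) < r"
      using Rperp[OF z(1)] Rn[of z] z True by auto
    \<comment> \<open>The increments of \<open>T\<close> at z and at \<open>R z\<close> are
      estimated together. The first term sees only the part of \<open>g1 - g2\<close> that is even
      under \<open>R\<close>; in the second the increment itself occurs, multiplied by the Lipschitz
      constant of the kernel and by the asymmetry \<open>L * e z\<close>. Both carry the weight
      \<open>e z * M powr (-b)\<close>, which hypothesis \<open>e\<close> controls.\<close>
    have "\<bar>T (g1 z) - T (g2 z) + (T (g1 (R z)) - T (g2 (R z)))\<bar>
        \<le> ((1 + b) * M powr (-b)) * \<bar>g1 z - g2 z + (g1 (R z) - g2 (R z))\<bar>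
          + (2 * b * M powr (- b - 1/2)) * (L * e z) * \<bar>g1 (R z) - g2 (R z)\<bar>"
    proof (rule paired_increment_bound[OF T])
      show "\<bar>?t v\<bar> \<le> (1 + b) * M powr (-b)" for v
      proof -
        have "\<bar>?t v\<bar> \<le> (1 + b) * max a ((norm z)\<^sup>2 + v\<^sup>2) powr (-b)" using k0 kle by simp
        also have "\<dots> \<le> (1 + b) * M powr (-b)"
          unfolding M_def using a b by (intro mult_left_mono powr_mono2' max.mono) (auto simp: less_max_iff_disj)
        finally show ?thesis .
      qed
      show "\<bar>?t u - ?t v\<bar> \<le> 2 * b * M powr (- b - 1/2) * \<bar>u - v\<bar>" for u v
        unfolding k_def M_def using kap_lipschitz_along_line[OF a b, of "(norm z)\<^sup>2" u v] by simp
    qed (use close[OF z True] b in auto)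
    also have "\<dots> \<le> ((1 + b) * M powr (-b)) * (L * \<omega> * e z) + (2 * b * M powr (- b - 1/2)) * (L * e z) * (L * \<omega> * M powr (1/2))"
    proof (intro add_mono mult_left_mono)
      show "\<bar>g1 z - g2 z + (g1 (R z) - g2 (R z))\<bar> \<le> L * \<omega> * e z" by (rule FR[OF z True])
      have "\<bar>g1 (R z) - g2 (R z)\<bar> \<le> L * \<omega> * norm z" using F[OF Rz] by (simp add: Rn)
      also have "\<dots> \<le> L * \<omega> * M powr (1/2)" using M L by (intro mult_left_mono) auto
      finally show "\<bar>g1 (R z) - g2 (R z)\<bar> \<le> L * \<omega> * M powr (1/2)" .
    qed (use b L ez in auto)
    also have "\<dots> = \<omega> * c * (e z * M powr (-b))"
    proof -
      have "M powr (- b - 1/2) * M powr (1/2) = M powr (-b)" unfolding powr_add[symmetric] by simp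
      then have "(2 * b * M powr (- b - 1/2)) * (L * e z) * (L * \<omega> * M powr (1/2)) = 2 * b * L\<^sup>2 * \<omega> * e z * M powr (-b)"
        by (simp add: power2_eq_square mult_ac)
      then show ?thesis by (simp add: c_def algebra_simps)
    qed
    also have "\<dots> \<le> \<omega> * c * (2 * norm z powr (-\<gamma>))"
      using ez(2) c L by (intro mult_left_mono) auto
    finally have main: "\<bar>T (g1 z) - T (g2 z) + (T (g1 (R z)) - T (g2 (R z)))\<bar> \<le> 2 * \<omega> * c * norm z powr (-\<gamma>)"
      by (simp add: mult_ac)
    have nn: "0 \<le> 2 * \<omega> * c * norm z powr (-\<gamma>)" using c L by simp
    have "(LINT u|lborel. h (z + u *\<^sub>R \<eta>) + h (R (z + u *\<^sub>R \<eta>))) =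
        (if Q z then T (g1 z) - T (g2 z) + (T (g1 (R z)) - T (g2 (R z))) else 0)"
      using has_bochner_integral_integral_eq[OF has_bochner_integral_add[OF l1 l2]] by auto
    then show ?thesis using main nn True by simp
  qed
  have "\<bar>LINT z|lborel. h z + h (R z)\<bar>
      \<le> (2 * \<omega> * c) * lines_const TYPE('a) \<gamma> * r powr (real DIM('a) - 1 - \<gamma>)"
    by (rule lines_const_bound[OF dim \<gamma> r \<eta>]) (use hi hRi key c L in auto)
  moreover have "(LINT z|lborel. h z + h (R z)) = 2 * (LINT z|lborel. h z)"
    using hi hRi hR by simp
  ultimately have "\<bar>LINT z|lborel. h z\<bar> \<le> \<omega> * c * lines_const TYPE('a) \<gamma> * r powr (real DIM('a) - 1 - \<gamma>)"
    by (simp add: abs_mult mult_ac)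
  then show ?thesis by (simp add: h_def k_def c_def)
qed

text \<open>This verifies the weight condition of the kernel bound for the error
  \<open>t powr (1+\<alpha>) + h powr \<alpha> * t\<close>. Against the untruncated kernel the
  second term is too large for t < h, which is why the kernel has to be truncated at a scale not
  below h: with M the maximum of sqrt a and t, both h and t are at most M.\<close>

lemma paired_weight_bound:
  fixes t a b \<alpha> h :: real
  assumes "0 < t" "0 \<le> h" "h\<^sup>2 \<le> a" "0 < a" "0 < \<alpha>" "\<alpha> < 2 * b"
  shows "(t powr (1+\<alpha>) + h powr \<alpha> * t) * max a (t\<^sup>2) powr (-b) \<le> 2 * t powr (1+\<alpha>-2*b)"
proof -
  define M where "M = max (sqrt a) t"
  have M: "0 < M" "t \<le> M" "h \<le> M"
    using assms real_le_rsqrt[of h a] by (auto simp: M_def max_def)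
  have M2: "max a (t\<^sup>2) = M\<^sup>2"
  proof (cases "sqrt a \<le> t")
    case True
    then have "a \<le> t\<^sup>2" using assms by (simp add: real_le_lsqrt sqrt_le_D)
    then show ?thesis using True by (simp add: M_def max_def)
  next
    case False
    then have "t \<le> sqrt a" by simp
    then have "t\<^sup>2 \<le> (sqrt a)\<^sup>2" using assms by (intro power_mono) auto
    then have "t\<^sup>2 \<le> a" using assms by simp
    then show ?thesis using False assms by (auto simp: M_def max_def)
  qed
  have e: "max a (t\<^sup>2) powr (-b) = M powr (-(2*b))"
  proof -
    have "M\<^sup>2 = M powr 2" using M by (simp add: powr_numeral)
    then have "M\<^sup>2 powr (-b) = M powr (2 * -b)" by (simp only: powr_powr)
    then show ?thesis by (simp add: M2)
  qed
  have "t powr (1+\<alpha>) * M powr (-(2*b)) \<le> t powr (1+\<alpha>) * t powr (-(2*b))"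
    using M assms by (intro mult_left_mono powr_mono2') auto
  also have "\<dots> = t powr (1+\<alpha>-2*b)" by (simp add: powr_add[symmetric])
  finally have 1: "t powr (1+\<alpha>) * M powr (-(2*b)) \<le> t powr (1+\<alpha>-2*b)" .
  have "h powr \<alpha> * t * M powr (-(2*b)) \<le> M powr \<alpha> * t * M powr (-(2*b))"
    using M assms by (intro mult_right_mono powr_mono2) auto
  also have "\<dots> = t * M powr (\<alpha>-2*b)" by (simp add: powr_add[symmetric] mult_ac)
  also have "\<dots> \<le> t * t powr (\<alpha>-2*b)"
    using M assms by (intro mult_left_mono powr_mono2') auto
  also have "\<dots> = t powr (1+\<alpha>-2*b)" using assms by (simp add: powr_add[symmetric] powr_mult_base add_ac) (simp add: add_diff_eq)
  finally have 2: "h powr \<alpha> * t * M powr (-(2*b)) \<le> t powr (1+\<alpha>-2*b)" .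
  show ?thesis unfolding e using 1 2 by (simp add: distrib_right)
qed

text \<open>The constant of the kernel bound for b = (n+s)/2 and \<gamma> = n+s-1-\<alpha>. With
  these exponents n-1-\<gamma> equals \<alpha>-s, and the condition \<gamma>+1 < n reads s <
  \<alpha>: here the Hoelder exponent has to exceed s.\<close>

definition graph_const :: "'a::euclidean_space itself \<Rightarrow> real \<Rightarrow> real \<Rightarrow> real \<Rightarrow> real" where
  "graph_const _ s \<alpha> L = ((1 + (real DIM('a) + s) / 2) * L + 2 * ((real DIM('a) + s) / 2) * L\<^sup>2) * lines_const TYPE('a) (real DIM('a) + s - 1 - \<alpha>)"

lemma graph_const_nonneg:
  assumes "2 \<le> DIM('a::euclidean_space)" "0 < s" "s < \<alpha>" "\<alpha> < 1" "0 \<le> L"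
  shows "0 \<le> graph_const TYPE('a) s \<alpha> L"
  unfolding graph_const_def using assms by (intro mult_nonneg_nonneg lines_const_nonneg) auto

text \<open>The symmetry fixes \<eta> and is z \<mapsto> -z on the orthogonal hyperplane. Under it
  the recentred graphs are odd up to the error \<open>L * norm z powr (1+\<alpha>)\<close>, so the
  second alternative of the kernel bound applies; \<omega> is the gain from the closeness of the two
  graphs.\<close>

lemma uncut_pair_bound:
  fixes g1 g2 :: "'a::euclidean_space \<Rightarrow> real" and S1 S2 :: "'a set"
  assumes dim: "2 \<le> DIM('a)" and s: "0 < s" "s < \<alpha>" "\<alpha> < 1"
    and \<eta>: "norm \<eta> = 1" and \<epsilon>: "0 < \<epsilon>" "\<epsilon> \<le> r" and L: "0 \<le> L" "0 \<le> \<omega>"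
    and S[measurable]: "S1 \<in> sets borel" "S2 \<in> sets borel"
    and S1: "\<And>z. norm z < r \<Longrightarrow> z \<in> S1 \<longleftrightarrow> z \<bullet> \<eta> < g1 (perp \<eta> z)"
    and S2: "\<And>z. norm z < r \<Longrightarrow> z \<in> S2 \<longleftrightarrow> z \<bullet> \<eta> < g2 (perp \<eta> z)"
    and g1: "\<And>z. z \<bullet> \<eta> = 0 \<Longrightarrow> norm z < r \<Longrightarrow> \<bar>g1 z + g1 (-z)\<bar> \<le> L * norm z powr (1+\<alpha>)"
    and g2: "\<And>z. z \<bullet> \<eta> = 0 \<Longrightarrow> norm z < r \<Longrightarrow> \<bar>g2 z + g2 (-z)\<bar> \<le> L * norm z powr (1+\<alpha>)"
    and F: "\<And>z. z \<bullet> \<eta> = 0 \<Longrightarrow> norm z < r \<Longrightarrow> \<bar>g1 z - g2 z\<bar> \<le> L * \<omega> * norm z"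
    and FR: "\<And>z. z \<bullet> \<eta> = 0 \<Longrightarrow> norm z < r \<Longrightarrow>
        \<bar>(g1 z - g2 z) + (g1 (-z) - g2 (-z))\<bar> \<le> L * \<omega> * norm z powr (1+\<alpha>)"
  shows "\<bar>LINT z|lborel. (indicator S1 z - indicator S2 z) *
       (kap ((real DIM('a) + s) / 2) (\<epsilon>\<^sup>2) ((norm z)\<^sup>2) - kap ((real DIM('a) + s) / 2) (r\<^sup>2) ((norm z)\<^sup>2))\<bar>
      \<le> \<omega> * graph_const TYPE('a) s \<alpha> L * r powr (\<alpha> - s)"
proof -
  let ?b = "(real DIM('a) + s) / 2"
  let ?\<gamma> = "real DIM('a) + s - 1 - \<alpha>"
  let ?R = "\<lambda>z. - hrefl \<eta> z"
  have eq: "1 + \<alpha> - 2 * ?b = - ?\<gamma>" by (simp add: field_simps)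
  have Rp: "?R z = -z" if "z \<bullet> \<eta> = 0" for z using that by (simp add: hrefl_def)
  have "\<bar>LINT z|lborel. (indicator S1 z - indicator S2 z) *
       (kap ?b (\<epsilon>\<^sup>2) ((norm z)\<^sup>2) - kap ?b (r\<^sup>2) ((norm z)\<^sup>2))\<bar>
      \<le> \<omega> * ((1 + ?b) * L + 2 * ?b * L\<^sup>2) * lines_const TYPE('a) ?\<gamma> * r powr (real DIM('a) - 1 - ?\<gamma>)"
  proof (rule paired_subgraph_kernel_bound[where R="?R" and Q="\<lambda>_. True" and e="\<lambda>z. norm z powr (1+\<alpha>)"])
    show "norm (?R z) = norm z" for z by (simp add: norm_hrefl[OF \<eta>])
    show "distr lborel borel ?R = (lborel :: 'a measure)"
      by (rule distr_lborel_compose[OF distr_lborel_hrefl[OF \<eta> dim] distr_lborel_uminus]) auto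
    show "?R (z + u *\<^sub>R \<eta>) = ?R z + u *\<^sub>R \<eta>" for z u
    proof -
      have "hrefl \<eta> \<eta> = - \<eta>" using \<eta> by (simp add: hrefl_def norm_eq_1 scaleR_2)
      then show ?thesis by (simp add: hrefl_add hrefl_scaleR)
    qed
    fix z assume z: "z \<bullet> \<eta> = 0" "z \<noteq> 0" "norm z < r"
    show "\<bar>g1 z - g1 (?R z)\<bar> \<le> L * norm z powr (1+\<alpha>) \<and> \<bar>g2 z - g2 (?R z)\<bar> \<le> L * norm z powr (1+\<alpha>) \<or>
       \<bar>g1 z + g1 (?R z)\<bar> \<le> L * norm z powr (1+\<alpha>) \<and> \<bar>g2 z + g2 (?R z)\<bar> \<le> L * norm z powr (1+\<alpha>)"
      using g1[OF z(1,3)] g2[OF z(1,3)] by (simp add: Rp z)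
    show "\<bar>(g1 z - g2 z) + (g1 (?R z) - g2 (?R z))\<bar> \<le> L * \<omega> * norm z powr (1+\<alpha>)"
      using FR[OF z(1,3)] by (simp add: Rp z)
    \<comment> \<open>The weight bound is used with height parameter 0, and
      \<open>0 powr \<alpha>\<close> is 0.\<close>
    have "(norm z powr (1+\<alpha>) + 0 powr \<alpha> * norm z) * max (\<epsilon>\<^sup>2) ((norm z)\<^sup>2) powr (-?b) \<le> 2 * norm z powr (1+\<alpha>-2*?b)"
      using z s dim \<epsilon> by (intro paired_weight_bound) auto
    then show "0 \<le> norm z powr (1+\<alpha>) \<and> norm z powr (1+\<alpha>) * max (\<epsilon>\<^sup>2) ((norm z)\<^sup>2) powr (-?b) \<le> 2 * norm z powr (-?\<gamma>)"
      by (simp only: eq) simp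
  qed (use assms in \<open>auto simp: norm_hrefl hrefl_def inner_diff_left norm_eq_1\<close>)
  then show ?thesis by (simp add: graph_const_def mult_ac)
qed

text \<open>Below the scale of the distance \<open>h\<close> to the cutting hyperplane the subgraphs are not cut and the
  symmetry is the central one; above that scale a symmetry \<open>R\<close> respecting the cut is used.\<close>
lemma cut_pair_bound:
  fixes g1 g2 :: "'a::euclidean_space \<Rightarrow> real" and S1 S2 :: "'a set" and R :: "'a \<Rightarrow> 'a"
  assumes dim: "2 \<le> DIM('a)" and s: "0 < s" "s < \<alpha>" "\<alpha> < 1"
    and \<eta>: "norm \<eta> = 1" and \<epsilon>: "0 < \<epsilon>" "\<epsilon> \<le> h" "h \<le> r" and L: "0 \<le> L" "0 \<le> \<omega>"
    and \<kappa>: "norm \<kappa> = 1" "\<kappa> \<bullet> \<eta> = 0"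
    and Rm: "distr lborel borel R = lborel" "R \<in> borel \<rightarrow>\<^sub>M borel"
    and R\<eta>: "\<And>z u. R (z + u *\<^sub>R \<eta>) = R z + u *\<^sub>R \<eta>" and Rperp: "\<And>z. z \<bullet> \<eta> = 0 \<Longrightarrow> R z \<bullet> \<eta> = 0"
    and Rn: "\<And>z. norm (R z) = norm z" and R\<kappa>: "\<And>z. R z \<bullet> \<kappa> = z \<bullet> \<kappa>"
    and S[measurable]: "S1 \<in> sets borel" "S2 \<in> sets borel"
    and S1: "\<And>z. norm z < r \<Longrightarrow> z \<in> S1 \<longleftrightarrow> - h < z \<bullet> \<kappa> \<and> z \<bullet> \<eta> < g1 (perp \<eta> z)"
    and S2: "\<And>z. norm z < r \<Longrightarrow> z \<in> S2 \<longleftrightarrow> - h < z \<bullet> \<kappa> \<and> z \<bullet> \<eta> < g2 (perp \<eta> z)"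
    and g1: "\<And>z. z \<bullet> \<eta> = 0 \<Longrightarrow> norm z < r \<Longrightarrow> \<bar>g1 z + g1 (-z)\<bar> \<le> L * norm z powr (1+\<alpha>)"
    and g2: "\<And>z. z \<bullet> \<eta> = 0 \<Longrightarrow> norm z < r \<Longrightarrow> \<bar>g2 z + g2 (-z)\<bar> \<le> L * norm z powr (1+\<alpha>)"
    and F: "\<And>z. z \<bullet> \<eta> = 0 \<Longrightarrow> norm z < r \<Longrightarrow> \<bar>g1 z - g2 z\<bar> \<le> L * \<omega> * norm z"
    and FR: "\<And>z. z \<bullet> \<eta> = 0 \<Longrightarrow> norm z < r \<Longrightarrow>
        \<bar>(g1 z - g2 z) + (g1 (-z) - g2 (-z))\<bar> \<le> L * \<omega> * norm z powr (1+\<alpha>)"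
    and R1: "\<And>z. z \<bullet> \<eta> = 0 \<Longrightarrow> norm z < r \<Longrightarrow> \<bar>g1 z - g1 (R z)\<bar> \<le> L * (norm z powr (1+\<alpha>) + h powr \<alpha> * norm z)"
    and R2: "\<And>z. z \<bullet> \<eta> = 0 \<Longrightarrow> norm z < r \<Longrightarrow> \<bar>g2 z - g2 (R z)\<bar> \<le> L * (norm z powr (1+\<alpha>) + h powr \<alpha> * norm z)"
    and R12: "\<And>z. z \<bullet> \<eta> = 0 \<Longrightarrow> norm z < r \<Longrightarrow>
        \<bar>(g1 z - g2 z) + (g1 (R z) - g2 (R z))\<bar> \<le> L * \<omega> * (norm z powr (1+\<alpha>) + h powr \<alpha> * norm z)"
  shows "\<bar>LINT z|lborel. (indicator S1 z - indicator S2 z) *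
       (kap ((real DIM('a) + s) / 2) (\<epsilon>\<^sup>2) ((norm z)\<^sup>2) - kap ((real DIM('a) + s) / 2) (r\<^sup>2) ((norm z)\<^sup>2))\<bar>
      \<le> 2 * \<omega> * graph_const TYPE('a) s \<alpha> L * r powr (\<alpha> - s)"
proof -
  let ?b = "(real DIM('a) + s) / 2"
  let ?\<gamma> = "real DIM('a) + s - 1 - \<alpha>"
  let ?I = "\<lambda>a a'. LINT z|lborel. (indicator S1 z - indicator S2 z) * (kap ?b a ((norm z)\<^sup>2) - kap ?b a' ((norm z)\<^sup>2))"
  have eq: "1 + \<alpha> - 2 * ?b = - ?\<gamma>" by (simp add: field_simps)
  have b: "0 < ?b" using s by simp
  have h: "0 < h" using \<epsilon> by simp
  have r: "0 < r" using \<epsilon> by simp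
  have pos: "0 < \<epsilon>\<^sup>2" "0 < h\<^sup>2" "0 < r\<^sup>2" using \<epsilon> h r by auto
  have "\<bar>?I (\<epsilon>\<^sup>2) (h\<^sup>2)\<bar> \<le> \<omega> * graph_const TYPE('a) s \<alpha> L * h powr (\<alpha> - s)"
  proof (rule uncut_pair_bound[where ?g1.0=g1 and ?g2.0=g2, OF dim s \<eta> \<epsilon>(1,2) L S])
    fix z :: 'a assume z: "norm z < h"
    have "\<bar>z \<bullet> \<kappa>\<bar> \<le> norm z" using Cauchy_Schwarz_ineq2[of z \<kappa>] \<kappa> by simp
    then have "- h < z \<bullet> \<kappa>" using z by linarith
    then show "z \<in> S1 \<longleftrightarrow> z \<bullet> \<eta> < g1 (perp \<eta> z)" "z \<in> S2 \<longleftrightarrow> z \<bullet> \<eta> < g2 (perp \<eta> z)"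
      using S1[of z] S2[of z] z \<epsilon> by auto
  qed (use g1 g2 F FR \<epsilon> in auto)
  also have "\<dots> \<le> \<omega> * graph_const TYPE('a) s \<alpha> L * r powr (\<alpha> - s)"
    using \<epsilon> s L graph_const_nonneg[OF dim s L(1)] by (intro mult_left_mono powr_mono2) auto
  finally have 1: "\<bar>?I (\<epsilon>\<^sup>2) (h\<^sup>2)\<bar> \<le> \<omega> * graph_const TYPE('a) s \<alpha> L * r powr (\<alpha> - s)" .
  \<comment> \<open>Between the scales h and r the graphs are compared through \<open>R\<close>,
    which respects the cut; the truncation at h absorbs the error term with
    \<open>h powr \<alpha>\<close>.\<close>
  have "\<bar>?I (h\<^sup>2) (r\<^sup>2)\<bar> \<le> \<omega> * ((1 + ?b) * L + 2 * ?b * L\<^sup>2) * lines_const TYPE('a) ?\<gamma> * r powr (real DIM('a) - 1 - ?\<gamma>)"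
  proof (rule paired_subgraph_kernel_bound[where R=R and Q="\<lambda>z. - h < z \<bullet> \<kappa>" and ?g1.0=g1 and ?g2.0=g2
        and e="\<lambda>z. norm z powr (1+\<alpha>) + h powr \<alpha> * norm z"])
    fix z assume z: "z \<bullet> \<eta> = 0" "z \<noteq> 0" "norm z < r"
    have "(norm z powr (1+\<alpha>) + h powr \<alpha> * norm z) * max (h\<^sup>2) ((norm z)\<^sup>2) powr (-?b) \<le> 2 * norm z powr (1+\<alpha>-2*?b)"
      using z s dim h by (intro paired_weight_bound) auto
    then show "0 \<le> norm z powr (1+\<alpha>) + h powr \<alpha> * norm z \<and>
       (norm z powr (1+\<alpha>) + h powr \<alpha> * norm z) * max (h\<^sup>2) ((norm z)\<^sup>2) powr (-?b) \<le> 2 * norm z powr (-?\<gamma>)"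
      by (simp only: eq) simp
  next
    show "- h < (z + u *\<^sub>R \<eta>) \<bullet> \<kappa> \<longleftrightarrow> - h < z \<bullet> \<kappa>" for z u
      using \<kappa> by (simp add: inner_add_left inner_commute[of \<eta>])
    show "h\<^sup>2 \<le> r\<^sup>2" using \<epsilon> h by (intro power_mono) auto
    show "z \<bullet> \<eta> = 0 \<Longrightarrow> z \<noteq> 0 \<Longrightarrow> norm z < r \<Longrightarrow> \<bar>g1 z - g2 z\<bar> \<le> L * \<omega> * norm z" for z by (rule F)
  qed (use dim s \<eta> r pos L Rm R\<eta> Rperp Rn R\<kappa> S S1 S2 R1 R2 R12 b in \<open>auto\<close>)
  also have "\<dots> = \<omega> * graph_const TYPE('a) s \<alpha> L * r powr (\<alpha> - s)"
    by (simp add: graph_const_def mult_ac)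
  finally have 2: "\<bar>?I (h\<^sup>2) (r\<^sup>2)\<bar> \<le> \<omega> * graph_const TYPE('a) s \<alpha> L * r powr (\<alpha> - s)" .
  have int: "integrable lborel (\<lambda>z. (indicator S1 z - indicator S2 z) * (kap ?b (\<rho>\<^sup>2) ((norm z)\<^sup>2) - kap ?b (\<rho>'\<^sup>2) ((norm z)\<^sup>2)) :: real)"
    if \<rho>: "0 < \<rho>" "\<rho> \<le> \<rho>'" for \<rho> \<rho>'
  proof (rule integrable_bounded_support)
    have p: "0 < \<rho>\<^sup>2" "0 < \<rho>'\<^sup>2" "\<rho>\<^sup>2 \<le> \<rho>'\<^sup>2" using \<rho> by (auto intro!: power_mono)
    have [measurable]: "(\<lambda>z::'a. kap ?b (\<rho>\<^sup>2) ((norm z)\<^sup>2)) \<in> borel_measurable borel" "(\<lambda>z::'a. kap ?b (\<rho>'\<^sup>2) ((norm z)\<^sup>2)) \<in> borel_measurable borel"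
      using p by (auto intro!: borel_measurable_continuous_onI continuous_intros)
    show "(\<lambda>z. (indicator S1 z - indicator S2 z) * (kap ?b (\<rho>\<^sup>2) ((norm z)\<^sup>2) - kap ?b (\<rho>'\<^sup>2) ((norm z)\<^sup>2)) :: real) \<in> borel_measurable borel"
      by measurable
    fix z :: 'a
    have "\<bar>kap ?b (\<rho>\<^sup>2) ((norm z)\<^sup>2) - kap ?b (\<rho>'\<^sup>2) ((norm z)\<^sup>2)\<bar> \<le> (1 + ?b) * (\<rho>\<^sup>2) powr (-?b)"
      using kap_mono_scale[OF p(1) b p(3), of "(norm z)\<^sup>2"] kap_nonneg[OF p(2) b, of "(norm z)\<^sup>2"]
        kap_le_const[OF p(1) b, of "(norm z)\<^sup>2"] by simp
    moreover have "\<bar>indicator S1 z - indicator S2 z :: real\<bar> \<le> 1" by (auto simp: indicator_def)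
    ultimately show "\<bar>(indicator S1 z - indicator S2 z) * (kap ?b (\<rho>\<^sup>2) ((norm z)\<^sup>2) - kap ?b (\<rho>'\<^sup>2) ((norm z)\<^sup>2))\<bar> \<le> 1 * ((1 + ?b) * (\<rho>\<^sup>2) powr (-?b))"
      unfolding abs_mult by (intro mult_mono) auto
  next
    fix z :: 'a assume "\<rho>' \<le> norm z"
    then have "\<rho>'\<^sup>2 \<le> (norm z)\<^sup>2" "\<rho>\<^sup>2 \<le> (norm z)\<^sup>2" using \<rho> by (auto intro!: power_mono)
    then show "(indicator S1 z - indicator S2 z) * (kap ?b (\<rho>\<^sup>2) ((norm z)\<^sup>2) - kap ?b (\<rho>'\<^sup>2) ((norm z)\<^sup>2)) = (0::real)"
      by (simp add: kap_def)
  qed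
  have "?I (\<epsilon>\<^sup>2) (r\<^sup>2) = ?I (\<epsilon>\<^sup>2) (h\<^sup>2) + ?I (h\<^sup>2) (r\<^sup>2)"
    unfolding Bochner_Integration.integral_add[OF int[OF \<epsilon>(1,2)] int[OF h \<epsilon>(3)], symmetric]
    by (simp add: algebra_simps)
  then show ?thesis using 1 2 by linarith
qed

section \<open>Truncated potentials and the fractional mean curvature\<close>

lemma power2_powr_half: "0 < t \<Longrightarrow> (t\<^sup>2) powr (-(x/2)) = t powr (-x)" for t x :: real
proof -
  assume "0 < t"
  then have "t\<^sup>2 = t powr 2" by (simp add: powr_numeral)
  then have "(t\<^sup>2) powr (-(x/2)) = t powr (2 * -(x/2))" by (simp only: powr_powr)
  then show ?thesis by simp
qed

lemma integrable_kap:
  fixes s :: real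
  assumes s: "0 < s" and a: "0 < a"
  shows "integrable lborel (\<lambda>z::'a::euclidean_space. kap ((real DIM('a) + s) / 2) a ((norm z)\<^sup>2))"
proof -
  let ?b = "(real DIM('a) + s) / 2"
  define r where "r = sqrt a"
  have r: "0 < r" "r\<^sup>2 = a" using a by (auto simp: r_def)
  have b: "0 < ?b" using s by simp
  have "integrable lborel (\<lambda>z::'a. (1 + ?b) * a powr (-?b) * indicator (ball 0 r) z + norm z powr (-(real DIM('a) + s)) * indicator (- ball 0 r) z)"
    using emeasure_bounded_finite[OF bounded_ball, of "0::'a" r] s r
    by (intro Bochner_Integration.integrable_add integrable_mult_right integrable_real_indicator integrable_powr_outside_ball)
       (auto simp: infinity_ennreal_def)
  then show ?thesis
  proof (rule Bochner_Integration.integrable_bound)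
    show "AE z in lborel. norm (kap ?b a ((norm (z::'a))\<^sup>2)) \<le> norm ((1 + ?b) * a powr (-?b) * indicator (ball 0 r) z + norm z powr (-(real DIM('a) + s)) * indicator (- ball 0 r) z)"
    proof (rule AE_I2)
      fix z :: 'a
      show "norm (kap ?b a ((norm z)\<^sup>2)) \<le> norm ((1 + ?b) * a powr (-?b) * indicator (ball 0 r) z + norm z powr (-(real DIM('a) + s)) * indicator (- ball 0 r) z)"
      proof (cases "norm z < r")
        case True
        then show ?thesis using kap_le_const[OF a b, of "(norm z)\<^sup>2"] kap_nonneg[OF a b, of "(norm z)\<^sup>2"] b by simp
      next
        case False
        then have nz: "0 < norm z" using r by linarith
        have "(norm z)\<^sup>2 powr (-?b) = norm z powr (-(real DIM('a) + s))"
          using nz by (rule power2_powr_half)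
        then show ?thesis using False kap_le_powr[OF a b, of "(norm z)\<^sup>2"] kap_nonneg[OF a b, of "(norm z)\<^sup>2"] nz by simp
      qed
    qed
    show "(\<lambda>z::'a. kap ?b a ((norm z)\<^sup>2)) \<in> borel_measurable lborel"
      using a by (auto intro!: borel_measurable_continuous_onI continuous_intros)
  qed
qed

text \<open>The potential of \<open>E\<close> at \<open>q\<close> for the kernel |z|^(-n-s),
  truncated at the distance sqrt a. Since \<open>kap\<close> is applied to squared distances,
  \<open>a\<close> is a squared length, and a scale \<rho> enters as its square.\<close>

definition kap_mass :: "real \<Rightarrow> real \<Rightarrow> 'a::euclidean_space set \<Rightarrow> 'a \<Rightarrow> real" where
  "kap_mass s a E q = (LINT z|lborel. indicator E (q + z) * kap ((real DIM('a) + s) / 2) a ((norm z)\<^sup>2))"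

lemma borel_translate [measurable]: "E \<in> sets borel \<Longrightarrow> {z. q + z \<in> E} \<in> sets borel" for q :: "'a::euclidean_space"
  using measurable_sets[of "\<lambda>z. q + z" borel borel E] by (simp add: vimage_def)

lemma borel_translate_uminus: "E \<in> sets borel \<Longrightarrow> {z. q - z \<in> E} \<in> sets borel" for q :: "'a::euclidean_space"
  using measurable_sets[of "\<lambda>z. q - z" borel borel E] by (simp add: vimage_def)

lemma integrable_kap_mass:
  fixes q :: "'a::euclidean_space"
  assumes "0 < s" "0 < a" and E: "E \<in> sets borel"
  shows "integrable lborel (\<lambda>z. indicator E (q + z) * kap ((real DIM('a) + s) / 2) a ((norm z)\<^sup>2))"
proof -
  have "integrable lborel (\<lambda>z. indicator {z. q + z \<in> E} z *\<^sub>R kap ((real DIM('a) + s) / 2) a ((norm z)\<^sup>2))"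
    using borel_translate[OF E, of q] by (intro integrable_mult_indicator integrable_kap assms) auto
  moreover have "indicator {z. q + z \<in> E} z = (indicator E (q + z) :: real)" for z by (simp add: indicator_def)
  ultimately show ?thesis by simp
qed

text \<open>Symmetrization turns the principal value into an absolutely convergent integral. Near
  the origin, on a line parallel to \<eta>, the factor vanishes outside the interval between g(z)
  and -g(-z), whose length is at most L|z|^2. This leaves |z|^(2-n-s) on the hyperplane, which is
  integrable at 0 since s < 1.\<close>

lemma symmetrized_kernel_integrable:
  fixes q \<eta> :: "'a::euclidean_space" and g :: "'a \<Rightarrow> real"
  assumes dim: "2 \<le> DIM('a)" and s: "0 < s" "s < 1" and E: "E \<in> sets borel"
    and \<eta>: "norm \<eta> = 1" and r: "0 < r" and L: "0 \<le> L"
    and graph: "\<And>z. norm z < r \<Longrightarrow> q + z \<in> E \<longleftrightarrow> z \<bullet> \<eta> < g (perp \<eta> z)"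
    and g: "\<And>z. z \<bullet> \<eta> = 0 \<Longrightarrow> norm z < r \<Longrightarrow> \<bar>g z + g (-z)\<bar> \<le> L * (norm z)\<^sup>2"
  shows "integrable lborel (\<lambda>z. (1 - indicator E (q + z) - indicator E (q - z)) * norm z powr (-(real DIM('a) + s)))"
proof -
  define m where "m = real DIM('a) + s"
  define \<psi> where "\<psi> = (\<lambda>z. 1 - indicator E (q + z) - indicator E (q - z) :: real)"
  have [measurable]: "\<psi> \<in> borel_measurable borel"
  proof -
    have "\<psi> = (\<lambda>z. 1 - indicator {z. q + z \<in> E} z - indicator {z. q - z \<in> E} z)"
      by (auto simp: \<psi>_def indicator_def)
    then show ?thesis using borel_translate[OF E, of q] borel_translate_uminus[OF E, of q] by simp
  qed
  have \<psi>1: "\<bar>\<psi> z\<bar> \<le> 1" for z by (auto simp: \<psi>_def indicator_def)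
  have "integrable lborel (\<lambda>z. \<psi> z * norm z powr (-m) * indicator (ball 0 r) z)"
  proof (rule integrableI_bounded)
    obtain C where C: "C \<ge> 0" "\<forall>\<eta>::'a. \<forall>r>0. norm \<eta> = 1 \<longrightarrow>
      (\<integral>\<^sup>+z. ennreal (linewt \<eta> z * (norm (perp \<eta> z) powr (-(m-2)) * indicator {..<r} (norm (perp \<eta> z)))) \<partial>lborel)
        \<le> ennreal (C * r powr (real DIM('a) - 1 - (m-2)))"
      using nn_integral_linewt_powr[OF dim, of "m-2"] dim s by (auto simp: m_def)
    let ?h = "\<lambda>z. ennreal (norm (\<psi> z * norm z powr (-m) * indicator (ball 0 r) z))"
    have line: "(\<integral>\<^sup>+u. ?h (z + u *\<^sub>R \<eta>) \<partial>lborel) \<le> ennreal (L * (norm z powr (-(m-2)) * indicator {..<r} (norm z)))"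
      if z: "z \<bullet> \<eta> = 0" "z \<noteq> 0" for z
    proof -
      have n: "(norm (z + u *\<^sub>R \<eta>))\<^sup>2 = (norm z)\<^sup>2 + u\<^sup>2" for u by (rule norm_add_orthogonal_sq[OF \<eta> z(1)])
      have nle: "norm z \<le> norm (z + u *\<^sub>R \<eta>)" for u
      proof (rule power2_le_imp_le)
        show "(norm z)\<^sup>2 \<le> (norm (z + u *\<^sub>R \<eta>))\<^sup>2" unfolding n by simp
      qed simp
      define lo hi where "lo = min (g z) (- g (-z))" and "hi = max (g z) (- g (-z))"
      show ?thesis
      proof (cases "norm z < r")
        case False
        then have "?h (z + u *\<^sub>R \<eta>) = 0" for u using nle[of u] by simp
        then show ?thesis by (simp only: nn_integral_const) simp
      next
        case True
        have pt: "?h (z + u *\<^sub>R \<eta>) \<le> ennreal (norm z powr (-m)) * indicator {lo..hi} u" for u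
        proof (cases "norm (z + u *\<^sub>R \<eta>) < r \<and> \<psi> (z + u *\<^sub>R \<eta>) \<noteq> 0")
          case T: True
          have "perp \<eta> (z + u *\<^sub>R \<eta>) = z" "(z + u *\<^sub>R \<eta>) \<bullet> \<eta> = u"
            using z \<eta> by (auto simp: perp_add perp_scaleR perp_self perp_orthogonal inner_add_left norm_eq_1)
          then have "q + (z + u *\<^sub>R \<eta>) \<in> E \<longleftrightarrow> u < g z" "q - (z + u *\<^sub>R \<eta>) \<in> E \<longleftrightarrow> - u < g (-z)"
            using graph[of "z + u *\<^sub>R \<eta>"] graph[of "- (z + u *\<^sub>R \<eta>)"] T unfolding perp_minus norm_minus_cancel inner_minus_left add_uminus_conv_diff by auto
          then have "u \<in> {lo..hi}"
            using T by (auto simp: \<psi>_def indicator_def lo_def hi_def split: if_splits)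
          moreover have "norm (z + u *\<^sub>R \<eta>) powr (-m) \<le> norm z powr (-m)"
            using nle[of u] z s dim by (intro powr_mono2') (auto simp: m_def)
          then have "norm (\<psi> (z + u *\<^sub>R \<eta>) * norm (z + u *\<^sub>R \<eta>) powr (-m) * indicator (ball 0 r) (z + u *\<^sub>R \<eta>)) \<le> 1 * norm z powr (-m) * 1"
            unfolding norm_mult using \<psi>1 by (intro mult_mono) (auto simp: indicator_def)
          ultimately show ?thesis by (simp add: ennreal_leI)
        qed (auto simp: indicator_def)
        have "(\<integral>\<^sup>+u. ?h (z + u *\<^sub>R \<eta>) \<partial>lborel) \<le> (\<integral>\<^sup>+u. ennreal (norm z powr (-m)) * indicator {lo..hi} u \<partial>lborel)"
          by (intro nn_integral_mono pt)
        also have "\<dots> = ennreal (norm z powr (-m)) * ennreal (hi - lo)"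
          by (subst nn_integral_cmult_indicator) (auto simp: lo_def hi_def)
        also have "\<dots> \<le> ennreal (norm z powr (-m)) * ennreal (L * (norm z)\<^sup>2)"
        proof -
          have "hi - lo = \<bar>g z + g (-z)\<bar>" by (simp add: hi_def lo_def)
          then show ?thesis using g[OF z(1) True] by (intro mult_left_mono ennreal_leI) auto
        qed
        also have "\<dots> = ennreal (L * (norm z powr (-m) * norm z powr 2))"
          using L z by (simp add: ennreal_mult[symmetric] powr_numeral mult_ac)
        also have "norm z powr (-m) * norm z powr 2 = norm z powr (-(m-2))"
          unfolding powr_add[symmetric] by simp
        finally show ?thesis using True by simp
      qed
    qed
    have "(\<integral>\<^sup>+z. ?h z \<partial>lborel) = (\<integral>\<^sup>+z. ennreal (linewt \<eta> z) * (\<integral>\<^sup>+u. ?h (perp \<eta> z + u *\<^sub>R \<eta>) \<partial>lborel) \<partial>lborel)"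
    proof (rule nn_integral_lines[OF \<eta> dim])
      have "(\<lambda>z::'a. indicator (ball 0 r) z :: real) \<in> borel_measurable borel" by (intro borel_measurable_indicator) auto
      then show "?h \<in> borel_measurable borel" by simp
    qed
    also have "\<dots> \<le> (\<integral>\<^sup>+z. ennreal L * ennreal (linewt \<eta> z * (norm (perp \<eta> z) powr (-(m-2)) * indicator {..<r} (norm (perp \<eta> z)))) \<partial>lborel)"
    proof (rule nn_integral_mono)
      fix z :: 'a
      show "ennreal (linewt \<eta> z) * (\<integral>\<^sup>+u. ?h (perp \<eta> z + u *\<^sub>R \<eta>) \<partial>lborel)
        \<le> ennreal L * ennreal (linewt \<eta> z * (norm (perp \<eta> z) powr (-(m-2)) * indicator {..<r} (norm (perp \<eta> z))))"
      proof (cases "perp \<eta> z = 0")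
        case False
        have "ennreal (linewt \<eta> z) * (\<integral>\<^sup>+u. ?h (perp \<eta> z + u *\<^sub>R \<eta>) \<partial>lborel)
           \<le> ennreal (linewt \<eta> z) * ennreal (L * (norm (perp \<eta> z) powr (-(m-2)) * indicator {..<r} (norm (perp \<eta> z))))"
          by (intro mult_left_mono line inner_perp \<eta> False) auto
        also have "\<dots> = ennreal L * ennreal (linewt \<eta> z * (norm (perp \<eta> z) powr (-(m-2)) * indicator {..<r} (norm (perp \<eta> z))))"
          using L by (simp add: ennreal_mult[symmetric] linewt_nonneg mult_ac)
        finally show ?thesis .
      qed (simp add: linewt_def)
    qed
    also have "\<dots> = ennreal L * (\<integral>\<^sup>+z. ennreal (linewt \<eta> z * (norm (perp \<eta> z) powr (-(m-2)) * indicator {..<r} (norm (perp \<eta> z)))) \<partial>lborel)"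
      by (rule nn_integral_cmult) measurable
    also have "\<dots> \<le> ennreal L * ennreal (C * r powr (real DIM('a) - 1 - (m-2)))"
      using C(2) r \<eta> by (intro mult_left_mono) auto
    also have "\<dots> < \<infinity>" by (simp add: ennreal_mult_less_top)
    finally show "(\<integral>\<^sup>+z. ?h z \<partial>lborel) < \<infinity>" .
  next
    have "(\<lambda>z::'a. indicator (ball 0 r) z :: real) \<in> borel_measurable borel" by (intro borel_measurable_indicator) auto
    then show "(\<lambda>z. \<psi> z * norm z powr (-m) * indicator (ball 0 r) z) \<in> borel_measurable lborel" by simp
  qed
  moreover have "integrable lborel (\<lambda>z. \<psi> z * norm z powr (-m) * indicator (- ball 0 r) z)"
  proof (rule Bochner_Integration.integrable_bound)
    show "integrable lborel (\<lambda>z::'a. norm z powr (-m) * indicator (- ball 0 r) z)"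
      using s r by (intro integrable_powr_outside_ball) (auto simp: m_def)
    have "(\<lambda>z::'a. indicator (- ball 0 r) z :: real) \<in> borel_measurable borel" by (intro borel_measurable_indicator) auto
    then show "(\<lambda>z. \<psi> z * norm z powr (-m) * indicator (- ball 0 r) z) \<in> borel_measurable lborel" by simp
    show "AE z in lborel. norm (\<psi> z * norm z powr (-m) * indicator (- ball 0 r) z) \<le> norm (norm z powr (-m) * indicator (- ball 0 r) z)"
    proof (rule AE_I2)
      fix z :: 'a
      have "\<bar>\<psi> z\<bar> * (norm z powr (-m) * indicator (- ball 0 r) z) \<le> 1 * (norm z powr (-m) * indicator (- ball 0 r) z)"
        using \<psi>1 by (intro mult_right_mono) auto
      then show "norm (\<psi> z * norm z powr (-m) * indicator (- ball 0 r) z) \<le> norm (norm z powr (-m) * indicator (- ball 0 r) z)"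
        by (simp add: abs_mult mult.assoc)
    qed
  qed
  ultimately have "integrable lborel (\<lambda>z. \<psi> z * norm z powr (-m) * indicator (ball 0 r) z + \<psi> z * norm z powr (-m) * indicator (- ball 0 r) z)"
    by (rule Bochner_Integration.integrable_add)
  moreover have "\<psi> z * norm z powr (-m) * indicator (ball 0 r) z + \<psi> z * norm z powr (-m) * indicator (- ball 0 r) z = \<psi> z * norm z powr (-m)" for z
    by (auto simp: indicator_def)
  ultimately show ?thesis by (simp add: \<psi>_def m_def)
qed

text \<open>The removed balls in the definition of the curvature and the convex truncation
  approximate the same integrable function \<open>W\<close>, so the two limits agree. For an even
  kernel the substitution z \<mapsto> -z shows that the integral against the symmetrized factor is
  the total mass minus twice the potential of \<open>E\<close>.\<close>

lemma frac_mean_curv_limit: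
  fixes q \<eta> :: "real^'n::finite" and g :: "real^'n \<Rightarrow> real"
  assumes dim: "2 \<le> CARD('n)" and s: "0 < s" "s < 1" and E: "E \<in> sets borel"
    and \<eta>: "norm \<eta> = 1" and r: "0 < r" and L: "0 \<le> L"
    and graph: "\<And>z. norm z < r \<Longrightarrow> q + z \<in> E \<longleftrightarrow> z \<bullet> \<eta> < g (perp \<eta> z)"
    and g: "\<And>z. z \<bullet> \<eta> = 0 \<Longrightarrow> norm z < r \<Longrightarrow> \<bar>g z + g (-z)\<bar> \<le> L * (norm z)\<^sup>2"
    and a: "\<And>j. 0 < a j" "a \<longlonglongrightarrow> 0"
  shows "(\<lambda>j. (LINT z|lborel. kap ((real CARD('n) + s) / 2) (a j) ((norm (z::real^'n))\<^sup>2)) - 2 * kap_mass s (a j) E q)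
           \<longlonglongrightarrow> frac_mean_curv s E q"
proof -
  let ?m = "real CARD('n) + s"
  let ?b = "?m / 2"
  define \<psi> where "\<psi> = (\<lambda>z. 1 - indicator E (q + z) - indicator E (q - z) :: real)"
  define W where "W = (\<lambda>z. \<psi> z * norm z powr (-?m))"
  have Wi: "integrable lborel W"
    unfolding W_def \<psi>_def using symmetrized_kernel_integrable[OF _ s E \<eta> r L graph g] dim by simp
  have b: "0 < ?b" using s by simp
  have um: "{z. q + z \<in> E} \<in> sets borel" "{z. q - z \<in> E} \<in> sets borel"
    using borel_translate[OF E, of q] borel_translate_uminus[OF E, of q] by auto
  have im: "(\<lambda>z. indicator E (q + z) :: real) \<in> borel_measurable borel" "(\<lambda>z. indicator E (q - z) :: real) \<in> borel_measurable borel"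
  proof -
    have "(\<lambda>z. indicator E (q + z) :: real) = indicator {z. q + z \<in> E}" "(\<lambda>z. indicator E (q - z) :: real) = indicator {z. q - z \<in> E}"
      by (auto simp: indicator_def)
    then show "(\<lambda>z. indicator E (q + z) :: real) \<in> borel_measurable borel" "(\<lambda>z. indicator E (q - z) :: real) \<in> borel_measurable borel"
      using um by auto
  qed
  note im[measurable]
  have sym: "(LINT z|lborel. indicator E (q - z) * f z) = (LINT z|lborel. indicator E (q + z) * f z)"
    and symi: "integrable lborel (\<lambda>z. indicator E (q - z) * f z :: real)"
    if f: "integrable lborel f" "\<And>z. f (- z) = f z" for f :: "real^'n \<Rightarrow> real"
  proof -
    have [measurable]: "f \<in> borel_measurable borel" using f by auto
    have "(LINT z|distr lborel borel uminus. indicator E (q - z) * f z) = (LINT z|lborel. indicator E (q - (- z)) * f (- z))"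
      by (rule integral_distr) auto
    then show "(LINT z|lborel. indicator E (q - z) * f z) = (LINT z|lborel. indicator E (q + z) * f z)"
      by (simp add: distr_lborel_uminus f)
    show "integrable lborel (\<lambda>z. indicator E (q - z) * f z :: real)"
      by (rule Bochner_Integration.integrable_bound[OF f(1)]) (measurable, auto simp: indicator_def)
  qed
  have symi': "integrable lborel (\<lambda>z. indicator E (q + z) * f z :: real)"
    if f: "integrable lborel f" for f :: "real^'n \<Rightarrow> real"
  proof -
    have [measurable]: "f \<in> borel_measurable borel" using f by auto
    show ?thesis by (rule Bochner_Integration.integrable_bound[OF f(1)]) (measurable, auto simp: indicator_def)
  qed
  have split: "(LINT z|lborel. \<psi> z * f z) = (LINT z|lborel. f z) - 2 * (LINT z|lborel. indicator E (q + z) * f z)"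
    if f: "integrable lborel f" "\<And>z. f (- z) = f z" for f :: "real^'n \<Rightarrow> real"
  proof -
    have "(LINT z|lborel. \<psi> z * f z) = (LINT z|lborel. f z - indicator E (q + z) * f z - indicator E (q - z) * f z)"
      by (simp add: \<psi>_def algebra_simps)
    also have "\<dots> = (LINT z|lborel. f z) - (LINT z|lborel. indicator E (q + z) * f z) - (LINT z|lborel. indicator E (q - z) * f z)"
      using f symi[OF f] symi'[OF f(1)] by (simp add: Bochner_Integration.integral_diff)
    finally show ?thesis using sym[OF f] by simp
  qed
  let ?I = "\<lambda>\<epsilon>. LINT x : - ball q \<epsilon> | lborel. (indicator (- E) x - indicator E x) / norm (x - q) powr ?m"
  have I: "?I \<epsilon> = (LINT z|lborel. W z * indicator (- ball 0 \<epsilon>) z)" if \<epsilon>: "0 < \<epsilon>" for \<epsilon>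
  proof -
    let ?f = "\<lambda>z::real^'n. norm z powr (-?m) * indicator (- ball 0 \<epsilon>) z"
    have fi: "integrable lborel ?f" using s \<epsilon> by (intro integrable_powr_outside_ball) auto
    have "?I \<epsilon> = (LINT x|lborel. indicator (- ball q \<epsilon>) x * ((indicator (- E) x - indicator E x) / norm (x - q) powr ?m))"
      by (simp add: set_lebesgue_integral_def)
    also have "\<dots> = (LINT x|distr lborel borel ((+) q). indicator (- ball q \<epsilon>) x * ((indicator (- E) x - indicator E x) / norm (x - q) powr ?m))"
      by (simp only: lborel_distr_plus)
    also have "\<dots> = (LINT z|lborel. indicator (- ball q \<epsilon>) (q + z) * ((indicator (- E) (q + z) - indicator E (q + z)) / norm (q + z - q) powr ?m))"
    proof (rule integral_distr)
      have "(\<lambda>x. indicator (- ball q \<epsilon>) x :: real) \<in> borel_measurable borel" "(\<lambda>x. indicator (- E) x :: real) \<in> borel_measurable borel"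
        "(\<lambda>x. indicator E x :: real) \<in> borel_measurable borel" using E by auto
      then show "(\<lambda>x. indicator (- ball q \<epsilon>) x * ((indicator (- E) x - indicator E x) / norm (x - q) powr ?m)) \<in> borel_measurable borel"
        by (intro borel_measurable_times borel_measurable_divide borel_measurable_diff) auto
    qed auto
    also have "\<dots> = (LINT z|lborel. ?f z - 2 * (indicator E (q + z) * ?f z))"
      unfolding powr_minus_divide
      by (intro Bochner_Integration.integral_cong refl) (auto simp: indicator_def dist_norm)
    also have "\<dots> = (LINT z|lborel. ?f z) - 2 * (LINT z|lborel. indicator E (q + z) * ?f z)"
      using fi symi'[OF fi] by (subst Bochner_Integration.integral_diff) auto
    also have "\<dots> = (LINT z|lborel. \<psi> z * ?f z)"
      by (rule split[symmetric]) (use fi in \<open>auto simp: indicator_def\<close>)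
    finally show ?thesis by (simp add: W_def mult.assoc)
  qed
  have lim: "(?I \<longlongrightarrow> (LINT z|lborel. W z)) (at_right 0)"
  proof (rule tendsto_at_right_sequentially[of 0 1])
    fix S :: "nat \<Rightarrow> real" assume S: "\<And>j. 0 < S j" "\<And>j. S j < 1" "decseq S" "S \<longlonglongrightarrow> 0"
    have "(\<lambda>j. LINT z|lborel. W z * indicator (- ball 0 (S j)) z) \<longlonglongrightarrow> (LINT z|lborel. W z)"
    proof (rule integral_dominated_convergence[where w="\<lambda>z. \<bar>W z\<bar>"])
      show "AE z in lborel. (\<lambda>j. W z * indicator (- ball 0 (S j)) z) \<longlonglongrightarrow> W z"
        using AE_lborel_singleton[of 0]
      proof (rule eventually_mono)
        fix z :: "real^'n" assume "z \<noteq> 0"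
        then have "eventually (\<lambda>j. S j < norm z) sequentially" using S(4) by (intro order_tendstoD(2)) auto
        then have "eventually (\<lambda>j. W z * indicator (- ball 0 (S j)) z = W z) sequentially"
          by (rule eventually_mono) (auto simp: indicator_def)
        then show "(\<lambda>j. W z * indicator (- ball 0 (S j)) z) \<longlonglongrightarrow> W z" by (rule tendsto_eventually)
      qed
      show "integrable lborel (\<lambda>z. \<bar>W z\<bar>)" using Wi by simp
      show "W \<in> borel_measurable lborel" using Wi by simp
      show "(\<lambda>z. W z * indicator (- ball 0 (S j)) z) \<in> borel_measurable lborel" for j
      proof -
        have "(\<lambda>x::real^'n. indicator (- ball 0 (S j)) x :: real) \<in> borel_measurable borel" by (intro borel_measurable_indicator) auto
        then show ?thesis using Wi by simp
      qed
    qed (auto simp: indicator_def)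
    then show "(\<lambda>j. ?I (S j)) \<longlonglongrightarrow> (LINT z|lborel. W z)" by (simp add: I S)
  qed simp
  have H: "frac_mean_curv s E q = (LINT z|lborel. W z)"
    unfolding frac_mean_curv_def by (rule tendsto_Lim[OF _ lim]) simp
  have "(\<lambda>j. LINT z|lborel. \<psi> z * kap ?b (a j) ((norm z)\<^sup>2)) \<longlonglongrightarrow> (LINT z|lborel. W z)"
  proof (rule integral_dominated_convergence[where w="\<lambda>z. \<bar>W z\<bar>"])
    have pw: "(norm z)\<^sup>2 powr (-?b) = norm z powr (-?m)" if "z \<noteq> 0" for z :: "real^'n"
      using that by (intro power2_powr_half) simp
    show "AE z in lborel. (\<lambda>j. \<psi> z * kap ?b (a j) ((norm z)\<^sup>2)) \<longlonglongrightarrow> W z"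
      using AE_lborel_singleton[of 0]
    proof (rule eventually_mono)
      fix z :: "real^'n" assume z: "z \<noteq> 0"
      then have "eventually (\<lambda>j. a j < (norm z)\<^sup>2) sequentially" using a(2) by (intro order_tendstoD(2)) auto
      then have "eventually (\<lambda>j. \<psi> z * kap ?b (a j) ((norm z)\<^sup>2) = W z) sequentially"
        by (rule eventually_mono) (simp add: kap_def W_def pw[OF z])
      then show "(\<lambda>j. \<psi> z * kap ?b (a j) ((norm z)\<^sup>2)) \<longlonglongrightarrow> W z" by (rule tendsto_eventually)
    qed
    show "AE z in lborel. norm (\<psi> z * kap ?b (a j) ((norm z)\<^sup>2)) \<le> \<bar>W z\<bar>" for j
      using AE_lborel_singleton[of 0]
    proof (rule eventually_mono)
      fix z :: "real^'n" assume z: "z \<noteq> 0"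
      then have "kap ?b (a j) ((norm z)\<^sup>2) \<le> norm z powr (-?m)"
        using kap_le_powr[OF a(1) b, of "(norm z)\<^sup>2"] pw[OF z] by simp
      then show "norm (\<psi> z * kap ?b (a j) ((norm z)\<^sup>2)) \<le> \<bar>W z\<bar>"
        using kap_nonneg[OF a(1) b] by (simp add: W_def abs_mult mult_left_mono)
    qed
    show "integrable lborel (\<lambda>z. \<bar>W z\<bar>)" using Wi by simp
    show "W \<in> borel_measurable lborel" using Wi by simp
    show "(\<lambda>z. \<psi> z * kap ?b (a j) ((norm z)\<^sup>2)) \<in> borel_measurable lborel" for j
    proof -
      have "(\<lambda>z::real^'n. kap ?b (a j) ((norm z)\<^sup>2)) \<in> borel_measurable borel"
        using a by (auto intro!: borel_measurable_continuous_onI continuous_intros)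
      then show ?thesis unfolding \<psi>_def by simp
    qed
  qed
  moreover have "(LINT z|lborel. \<psi> z * kap ?b (a j) ((norm z)\<^sup>2))
       = (LINT z|lborel. kap ?b (a j) ((norm (z::real^'n))\<^sup>2)) - 2 * kap_mass s (a j) E q" for j
    unfolding kap_mass_def using split[OF integrable_kap[where 'a="real^'n", OF s(1) a(1)]] by simp
  ultimately show ?thesis by (simp add: H)
qed

section \<open>Moving planes\<close>

text \<open>For open \<open>E\<close> and a unit vector \<open>e\<close> the open segment is a
  connected component of the intersection of \<open>E\<close> with a line in direction
  \<open>e\<close>.\<close>

definition chord :: "'a::real_normed_vector set \<Rightarrow> 'a \<Rightarrow> 'a \<Rightarrow> 'a \<Rightarrow> bool" where
  "chord E e q p \<longleftrightarrow> (\<exists>l>0. p = q + l *\<^sub>R e \<and> q \<notin> E \<and> p \<notin> E \<and> (\<forall>t. 0 < t \<and> t < l \<longrightarrow> q + t *\<^sub>R e \<in> E))"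

text \<open>The set of exit times is closed because \<open>E\<close> is open and nonempty because
  \<open>E\<close> is bounded, so its infimum is attained.\<close>

lemma ray_exit:
  fixes E :: "'a::real_normed_vector set"
  assumes E: "open E" "bounded E" and x: "x \<in> E" and e: "norm e = 1"
  obtains t where "0 < t" "x + t *\<^sub>R e \<notin> E" "\<And>u. 0 \<le> u \<Longrightarrow> u < t \<Longrightarrow> x + u *\<^sub>R e \<in> E"
    "\<And>u. 0 \<le> u \<Longrightarrow> x + u *\<^sub>R e \<notin> E \<Longrightarrow> t \<le> u"
proof -
  define S where "S = {u. 0 \<le> u \<and> x + u *\<^sub>R e \<notin> E}"
  have cl: "closed S"
  proof -
    have "S = {0..} \<inter> (\<lambda>u. x + u *\<^sub>R e) -` (- E)" by (auto simp: S_def)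
    moreover have "closed ((\<lambda>u. x + u *\<^sub>R e) -` (- E))"
      using E(1) by (intro closed_vimage continuous_intros) auto
    ultimately show ?thesis by (simp add: closed_Int)
  qed
  obtain B where B: "\<And>y. y \<in> E \<Longrightarrow> norm y \<le> B" using E(2) by (auto simp: bounded_iff)
  have ne: "\<bar>B\<bar> + norm x + 1 \<in> S"
  proof -
    have "norm ((\<bar>B\<bar> + norm x + 1) *\<^sub>R e) \<le> norm (x + (\<bar>B\<bar> + norm x + 1) *\<^sub>R e) + norm x"
      using norm_triangle_ineq4[of "x + (\<bar>B\<bar> + norm x + 1) *\<^sub>R e" x] by simp
    then have "norm (x + (\<bar>B\<bar> + norm x + 1) *\<^sub>R e) > B" using e by simp
    then show ?thesis using B by (force simp: S_def)
  qed
  have bd: "bdd_below S" by (auto simp: S_def bdd_below_def)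
  have IS: "Inf S \<in> S" using closed_contains_Inf[OF _ bd cl] ne by blast
  show ?thesis
  proof (rule that[of "Inf S"])
    show "0 < Inf S" using IS x by (cases "Inf S = 0") (auto simp: S_def)
    show "x + Inf S *\<^sub>R e \<notin> E" using IS by (auto simp: S_def)
    show "x + u *\<^sub>R e \<in> E" if "0 \<le> u" "u < Inf S" for u
      using cInf_lower[OF _ bd, of u] that by (auto simp: S_def)
    show "Inf S \<le> u" if "0 \<le> u" "x + u *\<^sub>R e \<notin> E" for u
      using cInf_lower[OF _ bd, of u] that by (auto simp: S_def)
  qed
qed

text \<open>The last clause records that the backward exit is the first one; it locates the left end
  point of the chord when the critical plane is chosen.\<close>

lemma chord_through:
  fixes E :: "'a::real_normed_vector set"
  assumes E: "open E" "bounded E" and x: "x \<in> E" and e: "norm e = 1"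
  obtains t1 t2 where "0 < t1" "0 < t2" "chord E e (x - t1 *\<^sub>R e) (x + t2 *\<^sub>R e)"
    "\<And>u. 0 \<le> u \<Longrightarrow> x - u *\<^sub>R e \<notin> E \<Longrightarrow> t1 \<le> u"
proof -
  obtain t2 where t2: "0 < t2" "x + t2 *\<^sub>R e \<notin> E" "\<And>u. 0 \<le> u \<Longrightarrow> u < t2 \<Longrightarrow> x + u *\<^sub>R e \<in> E"
    using ray_exit[OF E x e] by metis
  have e': "norm (- e) = 1" using e by simp
  obtain t1 where t1: "0 < t1" "x + t1 *\<^sub>R (- e) \<notin> E" "\<And>u. 0 \<le> u \<Longrightarrow> u < t1 \<Longrightarrow> x + u *\<^sub>R (- e) \<in> E"
    "\<And>u. 0 \<le> u \<Longrightarrow> x + u *\<^sub>R (- e) \<notin> E \<Longrightarrow> t1 \<le> u"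
    using ray_exit[OF E x e'] by metis
  have "chord E e (x - t1 *\<^sub>R e) (x + t2 *\<^sub>R e)"
    unfolding chord_def
  proof (intro exI[of _ "t1 + t2"] conjI allI impI)
    fix t assume t: "0 < t \<and> t < t1 + t2"
    show "x - t1 *\<^sub>R e + t *\<^sub>R e \<in> E"
    proof (cases "t < t1")
      case True
      then have "x + (t1 - t) *\<^sub>R (- e) \<in> E" using t by (intro t1(3)) auto
      then show ?thesis by (simp add: algebra_simps)
    next
      case False
      then have "x + (t - t1) *\<^sub>R e \<in> E" using t by (intro t2(3)) auto
      then show ?thesis by (simp add: algebra_simps)
    qed
  qed (use t1 t2 in \<open>auto simp: algebra_simps\<close>)
  then show ?thesis using that[OF t1(1) t2(1)] t1(4) by simp
qed

lemma chord_frontier: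
  fixes E :: "'a::real_normed_vector set"
  assumes E: "open E" and c: "chord E e q p"
  shows "q \<in> frontier E" "p \<in> frontier E"
proof -
  obtain l where l: "0 < l" "p = q + l *\<^sub>R e" "q \<notin> E" "p \<notin> E" "\<And>t. 0 < t \<Longrightarrow> t < l \<Longrightarrow> q + t *\<^sub>R e \<in> E"
    using c by (auto simp: chord_def)
  have cl: "x \<in> closure E" if "((\<lambda>t. q + t *\<^sub>R e) \<longlongrightarrow> x) F" "eventually (\<lambda>t. q + t *\<^sub>R e \<in> E) F" "F \<noteq> bot" for x and F :: "real filter"
  proof -
    have "eventually (\<lambda>t. q + t *\<^sub>R e \<in> closure E) F"
      using that(2) by (rule eventually_mono) (use closure_subset in auto)
    then show ?thesis by (rule Lim_in_closed_set[OF closed_closure _ that(3,1)])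
  qed
  have 1: "q \<in> closure E"
  proof (rule cl[of _ "at_right 0"])
    have "((\<lambda>t. q + t *\<^sub>R e) \<longlongrightarrow> q + 0 *\<^sub>R e) (at_right 0)" by (intro tendsto_intros)
    then show "((\<lambda>t. q + t *\<^sub>R e) \<longlongrightarrow> q) (at_right 0)" by simp
    show "eventually (\<lambda>t. q + t *\<^sub>R e \<in> E) (at_right 0)"
      using l by (auto simp: eventually_at_right[of 0 1] intro!: exI[of _ l])
  qed simp
  have 2: "p \<in> closure E"
  proof (rule cl[of _ "at_left l"])
    show "((\<lambda>t. q + t *\<^sub>R e) \<longlongrightarrow> p) (at_left l)" unfolding l(2) by (intro tendsto_intros)
    show "eventually (\<lambda>t. q + t *\<^sub>R e \<in> E) (at_left l)"
      using l by (auto simp: eventually_at_left[of 0 l] intro!: exI[of _ 0])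
  qed simp
  show "q \<in> frontier E" "p \<in> frontier E"
    using 1 2 l E by (auto simp: frontier_def interior_open)
qed

text \<open>Used with \<open>w\<close> the vertical axis and \<open>e\<close> horizontal: end points
  of chords lie at equal and positive height, even where \<open>E\<close> reaches \<partial>H.
  Limits of end points may lose the positivity.\<close>

lemma chord_inner:
  assumes c: "chord E e q p" and w: "e \<bullet> w = 0" and E: "\<And>x. x \<in> E \<Longrightarrow> 0 < x \<bullet> w"
  shows "0 < q \<bullet> w" "p \<bullet> w = q \<bullet> w"
proof -
  obtain l where l: "0 < l" "p = q + l *\<^sub>R e" "\<And>t. 0 < t \<Longrightarrow> t < l \<Longrightarrow> q + t *\<^sub>R e \<in> E"
    using c by (auto simp: chord_def)
  have "0 < (q + (l/2) *\<^sub>R e) \<bullet> w" using l by (intro E) auto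
  then show "0 < q \<bullet> w" "p \<bullet> w = q \<bullet> w" using w l by (auto simp: inner_add_left)
qed

text \<open>The plane is placed at the supremum of the chord midpoints. If a point x of
  \<open>E\<close> beyond it had its mirror image outside \<open>E\<close>, the chord through x
  would start no earlier than that mirror image and end strictly after x, so its midpoint would
  exceed the supremum. The supremum need not be attained, hence the sequence of chords; the end
  points converge along a subsequence because the closure of \<open>E\<close> is compact.\<close>

lemma critical_chords:
  fixes E :: "(real^'n::finite) set"
  assumes E: "open E" "bounded E" "E \<noteq> {}" and e: "norm e = 1"
  obtains lam qs ps q p where
    "\<And>x. x \<in> E \<Longrightarrow> lam < x \<bullet> e \<Longrightarrow> reflection e lam x \<in> E"
    "\<And>j::nat. chord E e (qs j) (ps j)" "qs \<longlonglongrightarrow> q" "ps \<longlonglongrightarrow> p" "(q + p) \<bullet> e = 2 * lam" 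
proof -
  define S where "S = {(q + p) \<bullet> e / 2 | q p. chord E e q p}"
  obtain B where B: "\<And>y. y \<in> closure E \<Longrightarrow> norm y \<le> B" using bounded_closure[OF E(2)] by (auto simp: bounded_iff)
  have cl: "q \<in> closure E" "p \<in> closure E" if "chord E e q p" for q p
    using chord_frontier[OF E(1) that] by (auto simp: frontier_def)
  have bd: "bdd_above S"
  proof (rule bdd_aboveI[of _ B])
    fix x assume "x \<in> S"
    then obtain q p where x: "x = (q + p) \<bullet> e / 2" "chord E e q p" by (auto simp: S_def)
    have "norm (q + p) \<le> B + B" using cl[OF x(2)] B norm_triangle_mono by blast
    moreover have "(q + p) \<bullet> e \<le> norm (q + p)" using Cauchy_Schwarz_ineq2[of "q+p" e] e by simp
    ultimately show "x \<le> B" using x by simp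
  qed
  have ne: "S \<noteq> {}"
  proof -
    obtain x where x: "x \<in> E" using E(3) by blast
    obtain q p where "chord E e q p" using chord_through[OF E(1,2) x e] by metis
    then show ?thesis unfolding S_def by blast
  qed
  define lam where "lam = Sup S"
  have good: "reflection e lam x \<in> E" if x: "x \<in> E" "lam < x \<bullet> e" for x
  proof (rule ccontr)
    assume n: "reflection e lam x \<notin> E"
    obtain t1 t2 where t: "0 < t1" "0 < t2" "chord E e (x - t1 *\<^sub>R e) (x + t2 *\<^sub>R e)"
      "\<And>u. 0 \<le> u \<Longrightarrow> x - u *\<^sub>R e \<notin> E \<Longrightarrow> t1 \<le> u" using chord_through[OF E(1,2) x(1) e] by metis
    have "t1 \<le> 2 * (x \<bullet> e - lam)" using n x by (intro t(4)) (auto simp: reflection_def)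
    moreover have "((x - t1 *\<^sub>R e) + (x + t2 *\<^sub>R e)) \<bullet> e / 2 \<le> lam"
    proof -
      have "((x - t1 *\<^sub>R e) + (x + t2 *\<^sub>R e)) \<bullet> e / 2 \<in> S" unfolding S_def using t(3) by blast
      then show ?thesis unfolding lam_def by (rule cSup_upper[OF _ bd])
    qed
    moreover have "((x - t1 *\<^sub>R e) + (x + t2 *\<^sub>R e)) \<bullet> e = 2 * (x \<bullet> e) - t1 + t2"
      using e by (simp only: inner_add_left inner_diff_left inner_scaleR_left) (simp add: norm_eq_1)
    ultimately show False using t(2) by simp
  qed
  have "\<exists>x\<in>S. lam - inverse (real (Suc j)) < x" for j
    unfolding lam_def using ne bd by (subst less_cSup_iff[symmetric]) auto
  then have "\<exists>q p. chord E e q p \<and> lam - inverse (real (Suc j)) < (q + p) \<bullet> e / 2" for j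
    unfolding S_def by blast
  then obtain qs ps where qp: "\<And>j. chord E e (qs j) (ps j)" "\<And>j. lam - inverse (real (Suc j)) < (qs j + ps j) \<bullet> e / 2"
    by metis
  have up: "(qs j + ps j) \<bullet> e / 2 \<le> lam" for j
  proof -
    have "(qs j + ps j) \<bullet> e / 2 \<in> S" unfolding S_def using qp(1) by blast
    then show ?thesis unfolding lam_def by (rule cSup_upper[OF _ bd])
  qed
  have lim: "(\<lambda>j. (qs j + ps j) \<bullet> e / 2) \<longlonglongrightarrow> lam"
  proof (rule tendsto_sandwich[of "\<lambda>j. lam - inverse (real (Suc j))" _ _ "\<lambda>_. lam"])
    show "(\<lambda>j. lam - inverse (real (Suc j))) \<longlonglongrightarrow> lam"
      using tendsto_diff[OF tendsto_const[of lam] LIMSEQ_inverse_real_of_nat] by simp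
  qed (use up qp(2) less_imp_le in \<open>auto intro!: always_eventually\<close>)
  have "compact (closure E \<times> closure E)" using E(2) by (intro compact_Times) (auto simp: compact_closure)
  moreover have "\<forall>j. (qs j, ps j) \<in> closure E \<times> closure E" using cl[OF qp(1)] by auto
  ultimately obtain l r where l: "strict_mono r" "((\<lambda>j. (qs j, ps j)) \<circ> r) \<longlonglongrightarrow> l"
    by (elim seq_compactE[OF compact_imp_seq_compact])
  have q: "(\<lambda>j. qs (r j)) \<longlonglongrightarrow> fst l" and p: "(\<lambda>j. ps (r j)) \<longlonglongrightarrow> snd l"
    using tendsto_fst[OF l(2)] tendsto_snd[OF l(2)] by (auto simp: o_def)
  have "(\<lambda>j. (qs (r j) + ps (r j)) \<bullet> e / 2) \<longlonglongrightarrow> (fst l + snd l) \<bullet> e / 2"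
    by (intro tendsto_intros q p) simp
  moreover have "(\<lambda>j. (qs (r j) + ps (r j)) \<bullet> e / 2) \<longlonglongrightarrow> lam"
    using LIMSEQ_subseq_LIMSEQ[OF lim l(1)] by (simp add: o_def)
  ultimately have "(fst l + snd l) \<bullet> e / 2 = lam" by (rule LIMSEQ_unique)
  then show ?thesis using that[OF good, of "\<lambda>j. qs (r j)" "\<lambda>j. ps (r j)" "fst l" "snd l"] qp(1) q p by simp
qed

section \<open>Affine reflections, cancellation by symmetry and volume estimates\<close>

lemma reflection_eq_hrefl: "reflection e c x = hrefl e x + (2 * c) *\<^sub>R e"
  by (simp add: reflection_def hrefl_def algebra_simps)

lemma reflection_inner: "norm e = 1 \<Longrightarrow> reflection e c x \<bullet> e = 2 * c - x \<bullet> e"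
  by (simp add: reflection_def inner_diff_left norm_eq_1)

lemma reflection_reflection: "norm e = 1 \<Longrightarrow> reflection e c (reflection e c x) = x"
  using reflection_inner[of e c x] by (simp add: reflection_def[of e c "reflection e c x"]) (simp add: reflection_def algebra_simps)

lemma reflection_fixed: "x \<bullet> e = c \<Longrightarrow> reflection e c x = x"
  by (simp add: reflection_def)

lemma norm_reflection_diff: "norm e = 1 \<Longrightarrow> norm (reflection e c x - reflection e c y) = norm (x - y)"
proof -
  assume "norm e = 1"
  have "reflection e c x - reflection e c y = hrefl e (x - y)" by (simp add: reflection_eq_hrefl hrefl_diff)
  then show ?thesis using norm_hrefl[OF \<open>norm e = 1\<close>] by simp
qed

lemma borel_measurable_reflection [measurable]: "reflection e c \<in> borel \<rightarrow>\<^sub>M borel"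
  unfolding reflection_def by measurable

lemma distr_lborel_reflection:
  fixes e :: "real^'n::finite"
  assumes "norm e = 1" "2 \<le> CARD('n)"
  shows "distr lborel borel (reflection e c) = lborel"
proof -
  have "distr lborel borel (\<lambda>x. (2 * c) *\<^sub>R e + hrefl e x) = lborel"
    using assms by (intro distr_lborel_compose[OF distr_lborel_hrefl lborel_distr_plus]) auto
  moreover have "(\<lambda>x. (2 * c) *\<^sub>R e + hrefl e x) = reflection e c"
    by (simp add: fun_eq_iff reflection_eq_hrefl add.commute)
  ultimately show ?thesis by simp
qed

text \<open>Apart from points on the plane, where \<open>\<phi>\<close> vanishes by oddness,
  \<open>E\<close> consists of the part beyond the plane, the mirror image of that part, and the
  points before the plane whose mirror image leaves \<open>E\<close>. The first two contribute
  opposite amounts.\<close>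

lemma odd_integral_moving_plane:
  fixes e :: "real^'n::finite" and \<phi> :: "real^'n \<Rightarrow> real"
  assumes e: "norm e = 1" "2 \<le> CARD('n)" and E: "E \<in> sets borel"
    and good: "\<And>x. x \<in> E \<Longrightarrow> c < x \<bullet> e \<Longrightarrow> reflection e c x \<in> E"
    and \<phi>: "integrable lborel (\<lambda>x. indicator E x * \<phi> x)" and odd: "\<And>x. \<phi> (reflection e c x) = - \<phi> x"
    and [measurable]: "\<phi> \<in> borel_measurable borel"
  shows "(LINT x|lborel. indicator E x * \<phi> x) = (LINT x|lborel. indicator {x\<in>E. x \<bullet> e < c \<and> reflection e c x \<notin> E} x * \<phi> x)"
proof -
  define A where "A = {x\<in>E. x \<bullet> e < c \<and> reflection e c x \<notin> E}"
  define B where "B = {x\<in>E. c < x \<bullet> e}"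
  define B' where "B' = {x\<in>E. x \<bullet> e < c \<and> reflection e c x \<in> E}"
  have RE: "{x. reflection e c x \<in> E} \<in> sets borel"
    using measurable_sets[OF borel_measurable_reflection E] by (simp add: vimage_def)
  have [measurable]: "E \<in> sets borel" by (rule E)
  have hs: "{x. x \<bullet> e < c} \<in> sets borel" "{x. c < x \<bullet> e} \<in> sets borel" by auto
  have Am: "A \<in> sets borel" "B \<in> sets borel" "B' \<in> sets borel"
  proof -
    have "A = E \<inter> {x. x \<bullet> e < c} - {x. reflection e c x \<in> E}" "B = E \<inter> {x. c < x \<bullet> e}"
      "B' = E \<inter> {x. x \<bullet> e < c} \<inter> {x. reflection e c x \<in> E}" by (auto simp: A_def B_def B'_def)
    then show "A \<in> sets borel" "B \<in> sets borel" "B' \<in> sets borel" using RE hs E by auto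
  qed
  have int: "integrable lborel (\<lambda>x. indicator S x * \<phi> x)" if "S \<subseteq> E" "S \<in> sets borel" for S
  proof (rule Bochner_Integration.integrable_bound[OF \<phi>])
    show "(\<lambda>x. indicator S x * \<phi> x) \<in> borel_measurable lborel" using that by simp
  qed (use that in \<open>auto simp: indicator_def\<close>)
  have zero: "\<phi> x = 0" if "x \<bullet> e = c" for x using odd[of x] reflection_fixed[OF that] by simp
  have "(LINT x|lborel. indicator B' x * \<phi> x) = (LINT x|distr lborel borel (reflection e c). indicator B' x * \<phi> x)"
    by (simp only: distr_lborel_reflection[OF e])
  also have "\<dots> = (LINT x|lborel. indicator B' (reflection e c x) * \<phi> (reflection e c x))"
    using Am by (intro integral_distr) auto
  also have "\<dots> = (LINT x|lborel. - (indicator B x * \<phi> x))"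
  proof (intro Bochner_Integration.integral_cong refl)
    fix x
    have "reflection e c x \<in> B' \<longleftrightarrow> x \<in> B"
      using good[of x] by (auto simp: B'_def B_def reflection_inner[OF e(1)] reflection_reflection[OF e(1)])
    then show "indicator B' (reflection e c x) * \<phi> (reflection e c x) = - (indicator B x * \<phi> x)"
      by (simp add: odd indicator_def)
  qed
  finally have B': "(LINT x|lborel. indicator B' x * \<phi> x) = - (LINT x|lborel. indicator B x * \<phi> x)" by simp
  have "(LINT x|lborel. indicator E x * \<phi> x) = (LINT x|lborel. indicator A x * \<phi> x + indicator B x * \<phi> x + indicator B' x * \<phi> x)"
  proof (intro Bochner_Integration.integral_cong refl)
    fix x show "indicator E x * \<phi> x = indicator A x * \<phi> x + indicator B x * \<phi> x + indicator B' x * \<phi> x"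
      using zero[of x] by (cases "x \<bullet> e" c rule: linorder_cases) (auto simp: A_def B_def B'_def indicator_def)
  qed
  also have "\<dots> = (LINT x|lborel. indicator A x * \<phi> x)"
    using int[of A] int[of B] int[of B'] Am B' by (simp add: A_def B_def B'_def)
  finally show ?thesis by (simp add: A_def)
qed

text \<open>A measure-preserving linear isometry that turns the component along \<open>e\<close>
  into a coordinate puts the set into a box with one side \<open>t\<close> and all other sides
  \<open>d\<close>.\<close>

lemma measure_slab_le:
  fixes e :: "real^'n::finite" and S :: "(real^'n) set"
  assumes e: "norm e = 1" "2 \<le> CARD('n)" and S: "S \<in> sets borel" and d: "0 \<le> d" "\<And>x y. x \<in> S \<Longrightarrow> y \<in> S \<Longrightarrow> norm (x - y) \<le> d"
    and t: "0 \<le> t" "\<And>x. x \<in> S \<Longrightarrow> c \<le> x \<bullet> e \<and> x \<bullet> e \<le> c + t"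
  shows "measure lborel S \<le> t * d ^ (CARD('n) - 1)"
proof (cases "S = {}")
  case True
  then show ?thesis using d t by simp
next
  case False
  \<comment> \<open>Any coordinate will do; \<open>T\<close> is the reflection across the hyperplane
    bisecting \<open>e\<close> and the chosen axis, unless the two coincide.\<close>
  define i :: 'n where "i = undefined"
  define T where "T = (if e = axis i 1 then id else hrefl ((1 / norm (e - axis i 1)) *\<^sub>R (e - axis i 1)))"
  have T: "distr lborel borel T = lborel" "T \<in> borel \<rightarrow>\<^sub>M borel" "\<And>x y. T x - T y = T (x - y)" "\<And>x. norm (T x) = norm x"
    "\<And>x. T x $ i = x \<bullet> e"
  proof -
    let ?v = "(1 / norm (e - axis i 1)) *\<^sub>R (e - axis i 1)"
    have v: "norm ?v = 1" if "e \<noteq> axis i 1" using that by simp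
    show "distr lborel borel T = lborel"
      using distr_lborel_hrefl[OF v] e by (auto simp: T_def id_def distr_id2)
    show "T \<in> borel \<rightarrow>\<^sub>M borel" by (auto simp: T_def)
    show "\<And>x y. T x - T y = T (x - y)" by (simp add: T_def hrefl_diff)
    show "\<And>x. norm (T x) = norm x" using v by (simp add: T_def norm_hrefl)
    fix x
    show "T x $ i = x \<bullet> e"
    proof (cases "e = axis i 1")
      case True
      then show ?thesis by (simp add: T_def inner_axis)
    next
      case False
      let ?w = "e - axis i 1"
      have w: "?w \<bullet> ?w = 2 * (1 - e $ i)"
        using e by (simp add: inner_diff_left inner_diff_right inner_axis inner_axis' norm_eq_1)
      have nw: "?w \<bullet> ?w \<noteq> 0" using False by simp
      have "hrefl ?v e = e - (2 * (e \<bullet> ?w) / (?w \<bullet> ?w)) *\<^sub>R ?w"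
        by (simp add: hrefl_def norm_eq_sqrt_inner)
      also have "2 * (e \<bullet> ?w) / (?w \<bullet> ?w) = 1"
        using nw e unfolding w by (simp add: inner_diff_right inner_axis norm_eq_1)
      finally have ve: "hrefl ?v e = axis i 1" by simp
      have "T x $ i = hrefl ?v x \<bullet> axis i 1" using False by (simp add: T_def inner_axis)
      also have "\<dots> = hrefl ?v x \<bullet> hrefl ?v e" by (simp add: ve)
      also have "\<dots> = x \<bullet> e" by (rule hrefl_inner[OF v[OF False]])
      finally show ?thesis .
    qed
  qed
  obtain x0 where x0: "x0 \<in> S" using False by blast
  define lo where "lo = (\<lambda>j. Inf ((\<lambda>x. T x $ j) ` S))"
  have comp: "\<bar>T x $ j - T y $ j\<bar> \<le> d" if "x \<in> S" "y \<in> S" for x y j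
  proof -
    have "\<bar>(T x - T y) $ j\<bar> \<le> norm (T x - T y)" by (rule component_le_norm_cart)
    also have "\<dots> = norm (x - y)" using T(3,4) by metis
    finally show ?thesis using d(2)[OF that] by simp
  qed
  have bd: "bdd_below ((\<lambda>x. T x $ j) ` S)" for j
    using comp[OF _ x0, of _ j] by (intro bdd_belowI2[of _ "T x0 $ j - d"]) (smt (verit))
  have lo: "lo j \<le> T x $ j" "T x $ j \<le> lo j + d" if "x \<in> S" for x j
  proof -
    show "lo j \<le> T x $ j" unfolding lo_def using that by (intro cInf_lower bd) auto
    have "T x $ j - d \<le> T y $ j" if "y \<in> S" for y using comp[OF \<open>x \<in> S\<close> that, of j] by linarith
    then have "T x $ j - d \<le> lo j" unfolding lo_def using x0 by (intro cInf_greatest) auto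
    then show "T x $ j \<le> lo j + d" by simp
  qed
  define l u where "l = (\<chi> j. if j = i then c else lo j)" and "u = (\<chi> j. if j = i then c + t else lo j + d)"
  have sub: "S \<subseteq> T -` cbox l u"
    using lo t T(5) by (auto simp: l_def u_def mem_box_cart)
  have ne: "cbox l u \<noteq> {}" using sub x0 by blast
  have "emeasure lborel S \<le> emeasure lborel (T -` cbox l u)"
    using sub measurable_sets[OF T(2), of "cbox l u"] by (intro emeasure_mono) auto
  also have "\<dots> = emeasure (distr lborel borel T) (cbox l u)"
    using T(2) by (subst emeasure_distr) auto
  also have "\<dots> = emeasure lborel (cbox l u)" by (simp add: T(1))
  finally have "measure lborel S \<le> measure lborel (cbox l u)"
    using emeasure_bounded_finite[OF bounded_cbox, of l u] unfolding measure_def infinity_ennreal_def by (rule enn2real_mono)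
  also have "\<dots> = (\<Prod>j\<in>UNIV. u $ j - l $ j)"
    using content_cbox_cart[OF ne] by simp
  also have "\<dots> = (u $ i - l $ i) * (\<Prod>j\<in>UNIV - {i}. u $ j - l $ j)"
    by (rule prod.remove) auto
  also have "(\<Prod>j\<in>UNIV - {i}. u $ j - l $ j) = (\<Prod>j\<in>UNIV - {i}. d)"
    by (intro prod.cong refl) (auto simp: l_def u_def)
  also have "\<dots> = d ^ (CARD('n) - 1)" by (simp add: card_Diff_singleton)
  finally show ?thesis by (simp add: l_def u_def)
qed


text \<open>The slab of thickness t = |A| / (2 d^(n-1)) next to the plane contains at most half of
  \<open>A\<close>. At least half of \<open>A\<close> therefore has distance at least t from the
  plane and contributes at least t |A| / 2 to the moment.\<close>

lemma moving_plane_moment_bound: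
  fixes e :: "real^'n::finite" and A :: "(real^'n) set"
  assumes e: "norm e = 1" "2 \<le> CARD('n)" and A: "A \<in> sets borel" "bounded A"
    and d: "0 < d" "\<And>x y. x \<in> A \<Longrightarrow> y \<in> A \<Longrightarrow> norm (x - y) \<le> d"
    and c: "\<And>x. x \<in> A \<Longrightarrow> x \<bullet> e < c"
  shows "(measure lborel A)\<^sup>2 \<le> 4 * d ^ (CARD('n) - 1) * (LINT x|lborel. indicator A x * (c - x \<bullet> e))"
proof -
  define D where "D = d ^ (CARD('n) - 1)"
  have D: "0 < D" using d by (simp add: D_def)
  define v where "v = measure lborel A"
  define t where "t = v / (2 * D)"
  have t: "0 \<le> t" using D by (simp add: t_def v_def)
  define A1 where "A1 = A \<inter> {x. c - t < x \<bullet> e}"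
  have A1m: "A1 \<in> sets borel" unfolding A1_def using A by auto
  have A1: "measure lborel A1 \<le> t * D"
    unfolding D_def using d c by (intro measure_slab_le[OF e A1m _ _ t, where c="c - t"]) (force simp: A1_def less_imp_le)+
  have fin: "S \<in> fmeasurable lborel" if "S \<subseteq> A" "S \<in> sets borel" for S
    using that emeasure_bounded_finite[OF bounded_subset[OF A(2) that(1)]] by (auto simp: fmeasurable_def infinity_ennreal_def)
  have A1A: "A1 \<subseteq> A" by (auto simp: A1_def)
  have "measure lborel (A - A1) = v - measure lborel A1"
    unfolding v_def using A1A A A1m fin[of A] by (intro measure_Diff) (auto simp: fmeasurable_def infinity_ennreal_def)
  also have "\<dots> \<ge> v - t * D" using A1 by simp
  also have "v - t * D = v / 2" using D by (simp add: t_def)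
  finally have half: "v / 2 \<le> measure lborel (A - A1)" .
  obtain B where B: "\<And>x. x \<in> A \<Longrightarrow> norm x \<le> B" using A(2) by (auto simp: bounded_iff)
  have int: "integrable lborel (\<lambda>x. indicator A x * (c - x \<bullet> e))"
  proof (rule integrable_bounded_support[of _ "\<bar>c\<bar> + \<bar>B\<bar>" "\<bar>B\<bar> + 1"])
    show "(\<lambda>x. indicator A x * (c - x \<bullet> e)) \<in> borel_measurable borel" using A by simp
    show "\<bar>indicator A x * (c - x \<bullet> e)\<bar> \<le> \<bar>c\<bar> + \<bar>B\<bar>" for x
    proof (cases "x \<in> A")
      case True
      have "\<bar>x \<bullet> e\<bar> \<le> \<bar>B\<bar>" using B[OF True] Cauchy_Schwarz_ineq2[of x e] e by simp
      then show ?thesis by (simp add: indicator_def) linarith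
    qed simp
    show "indicator A x * (c - x \<bullet> e) = 0" if "\<bar>B\<bar> + 1 \<le> norm x" for x
      using B[of x] that by (cases "x \<in> A") auto
  qed
  have "t * measure lborel (A - A1) = (LINT x|lborel. t * indicator (A - A1) x)" by simp
  also have "\<dots> \<le> (LINT x|lborel. indicator A x * (c - x \<bullet> e))"
  proof (rule integral_mono[OF _ int])
    show "integrable lborel (\<lambda>x. t * indicator (A - A1) x)"
      using fin[of "A - A1"] A A1m by (intro integrable_mult_right integrable_real_indicator) (auto simp: fmeasurable_def)
    show "t * indicator (A - A1) x \<le> indicator A x * (c - x \<bullet> e)" for x
      using c[of x] by (auto simp: indicator_def A1_def)
  qed
  finally have "t * (v / 2) \<le> (LINT x|lborel. indicator A x * (c - x \<bullet> e))"
    using mult_left_mono[OF half t] by linarith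
  then have "v\<^sup>2 / (4 * D) \<le> (LINT x|lborel. indicator A x * (c - x \<bullet> e))"
    by (simp add: t_def power2_eq_square)
  then show ?thesis using D by (simp add: v_def D_def field_simps)
qed

text \<open>Every point of the symmetric difference, or else its mirror image, lies in the cap
  \<open>A\<close>, so the volume is at most 2|A|, which the moment bound controls. Hypothesis
  \<open>K\<close> is the bound of the moment that the deficit will supply; the powers of the
  diameter combine as d^(n-1) d^(n+s+2) = d^(2n) d^(s+1).\<close>

lemma symdiff_reflection_bound:
  fixes e :: "real^'n::finite" and E :: "(real^'n) set"
  assumes e: "norm e = 1" "2 \<le> CARD('n)" and E: "open E" "bounded E" "E \<noteq> {}" and s: "0 < s"
    and good: "\<And>x. x \<in> E \<Longrightarrow> c < x \<bullet> e \<Longrightarrow> reflection e c x \<in> E"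
    and K: "2 * (real CARD('n) + s) * diameter E powr (- (real CARD('n) + s) - 2)
       * (LINT x|lborel. indicator {x\<in>E. x \<bullet> e < c \<and> reflection e c x \<notin> E} x * (c - x \<bullet> e)) \<le> K"
  shows "measure lebesgue (symdiff E (reflection e c ` E))
       \<le> 3 * sqrt (5 / (2 * (real CARD('n) + s))) * diameter E ^ CARD('n) * sqrt (diameter E powr (s + 1) * K)"
proof -
  let ?n = "CARD('n)"
  define m where "m = real ?n + s"
  define d where "d = diameter E"
  define A where "A = {x\<in>E. x \<bullet> e < c \<and> reflection e c x \<notin> E}"
  define I where "I = (LINT x|lborel. indicator A x * (c - x \<bullet> e))"
  have m: "0 < m" using s by (simp add: m_def)
  have d: "0 < d"
  proof -
    obtain x where x: "x \<in> E" using E by blast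
    then obtain \<epsilon> where \<epsilon>: "0 < \<epsilon>" "ball x \<epsilon> \<subseteq> E" using E(1) openE by blast
    have "x + (\<epsilon>/2) *\<^sub>R e \<in> E" using \<epsilon> e by (intro subsetD[OF \<epsilon>(2)]) (auto simp: dist_norm)
    then have "dist x (x + (\<epsilon>/2) *\<^sub>R e) \<le> d" unfolding d_def by (intro diameter_bounded_bound E x)
    then show ?thesis using \<epsilon> e by (simp add: dist_norm)
  qed
  have Eb: "E \<in> sets borel" using E by simp
  have "{x. reflection e c x \<in> E} \<in> sets borel"
    using measurable_sets[OF borel_measurable_reflection Eb] by (simp add: vimage_def)
  moreover have "A = E \<inter> {x. x \<bullet> e < c} - {x. reflection e c x \<in> E}" by (auto simp: A_def)
  ultimately have Ab: "A \<in> sets borel" using Eb by simp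
  have AE: "A \<subseteq> E" by (auto simp: A_def)
  have Abd: "bounded A" using bounded_subset[OF E(2) AE] .
  have mom: "(measure lborel A)\<^sup>2 \<le> 4 * d ^ (?n - 1) * I"
    unfolding I_def
  proof (rule moving_plane_moment_bound[OF e Ab Abd d])
    show "norm (x - y) \<le> d" if "x \<in> A" "y \<in> A" for x y
      using diameter_bounded_bound[OF E(2), of x y] that AE by (auto simp: d_def dist_norm)
  qed (auto simp: A_def)
  define A' where "A' = {x. reflection e c x \<in> A}"
  have A'b: "A' \<in> sets borel"
    unfolding A'_def using measurable_sets[OF borel_measurable_reflection Ab] by (simp add: vimage_def)
  have A'm: "measure lborel A' = measure lborel A"
  proof -
    have "emeasure (distr lborel borel (reflection e c)) A = emeasure lborel A'"
      using Ab by (subst emeasure_distr) (auto simp: A'_def vimage_def)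
    then show ?thesis by (simp add: distr_lborel_reflection[OF e] measure_def)
  qed
  have sub: "symdiff E (reflection e c ` E) \<subseteq> A \<union> A'"
  proof
    fix x assume x: "x \<in> symdiff E (reflection e c ` E)"
    have im: "x \<in> reflection e c ` E \<longleftrightarrow> reflection e c x \<in> E"
      using reflection_reflection[OF e(1)] by (metis imageE imageI)
    show "x \<in> A \<union> A'"
    proof (cases "x \<in> E")
      case True
      then have n: "reflection e c x \<notin> E" using x im by (auto simp: symdiff_def)
      then have "x \<bullet> e \<noteq> c" "\<not> c < x \<bullet> e" using True good reflection_fixed by metis+
      then show ?thesis using True n by (auto simp: A_def)
    next
      case False
      then have n: "reflection e c x \<in> E" using x im by (auto simp: symdiff_def)
      have "\<not> c < reflection e c x \<bullet> e" using good[OF n] False by (auto simp: reflection_reflection[OF e(1)])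
      moreover have "reflection e c x \<bullet> e \<noteq> c"
      proof
        assume "reflection e c x \<bullet> e = c"
        then have "x \<bullet> e = c" using reflection_inner[OF e(1), of c x] by simp
        then show False using n False reflection_fixed by metis
      qed
      ultimately show ?thesis using n False by (auto simp: A'_def A_def reflection_reflection[OF e(1)])
    qed
  qed
  have A'bd: "bounded A'"
  proof -
    have "A' \<subseteq> reflection e c ` A" unfolding A'_def using reflection_reflection[OF e(1)] by (metis (mono_tags) image_eqI mem_Collect_eq subsetI)
    moreover have "bounded (reflection e c ` A)"
    proof -
      obtain B where B: "\<And>x. x \<in> A \<Longrightarrow> norm x \<le> B" using Abd by (auto simp: bounded_iff)
      have "norm (reflection e c x) \<le> B + norm ((2 * c) *\<^sub>R e)" if "x \<in> A" for x
        unfolding reflection_eq_hrefl using norm_triangle_ineq[of "hrefl e x" "(2 * c) *\<^sub>R e"] norm_hrefl[OF e(1), of x] B[OF that] by linarith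
      then show ?thesis by (auto simp: bounded_iff)
    qed
    ultimately show ?thesis by (rule bounded_subset[rotated])
  qed
  have fin: "S \<in> fmeasurable lborel" if "bounded S" "S \<in> sets borel" for S :: "(real^'n) set"
    using that emeasure_bounded_finite[OF that(1)] by (auto simp: fmeasurable_def infinity_ennreal_def)
  have sdb: "symdiff E (reflection e c ` E) \<in> sets borel"
  proof -
    have "reflection e c ` E = {x. reflection e c x \<in> E}"
      using reflection_reflection[OF e(1)] by (auto intro: image_eqI[where x="reflection e c _"])
    then show ?thesis unfolding symdiff_def using Eb \<open>{x. reflection e c x \<in> E} \<in> sets borel\<close> by auto
  qed
  have "measure lebesgue (symdiff E (reflection e c ` E)) = measure lborel (symdiff E (reflection e c ` E))"
    using sdb by simp
  also have "\<dots> \<le> measure lborel (A \<union> A')"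
    using sub sdb fin[of "A \<union> A'"] Ab A'b Abd A'bd by (intro measure_mono_fmeasurable) auto
  also have "\<dots> \<le> measure lborel A + measure lborel A'"
    using Ab A'b by (intro measure_Un_le) auto
  finally have main: "measure lebesgue (symdiff E (reflection e c ` E)) \<le> 2 * measure lborel A" using A'm by simp
  have Iub: "I * (2 * m) \<le> K * d powr (m + 2)"
  proof -
    have "d powr (- m - 2) * d powr (m + 2) = 1" using d by (simp add: powr_add[symmetric])
    then have "I * (2 * m) = 2 * m * d powr (- m - 2) * I * d powr (m + 2)" by (simp add: mult_ac)
    also have "\<dots> \<le> K * d powr (m + 2)"
      using K by (intro mult_right_mono) (auto simp: m_def d_def I_def A_def)
    finally show ?thesis .
  qed
  have I0: "0 \<le> I" unfolding I_def by (intro integral_nonneg_AE AE_I2) (auto simp: A_def indicator_def)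
  have K0: "0 \<le> K"
  proof -
    have "0 \<le> 2 * m * d powr (- m - 2) * I" using m I0 by simp
    also have "\<dots> \<le> K" using K by (simp add: m_def d_def I_def A_def)
    finally show ?thesis .
  qed
  have dpow: "d powr (m + 2) = d ^ (?n + 1) * d powr (s + 1)"
  proof -
    have "d ^ (?n + 1) = d powr (real ?n + 1)" using d powr_realpow[of d "?n + 1"] by (simp add: add.commute)
    then have "d ^ (?n + 1) * d powr (s + 1) = d powr ((real ?n + 1) + (s + 1))" by (simp only: powr_add)
    then show ?thesis by (simp add: m_def algebra_simps)
  qed
  have "(2 * measure lborel A)\<^sup>2 \<le> 16 * d ^ (?n - 1) * I" using mom by (simp add: power_mult_distrib mult_ac)
  also have "\<dots> \<le> 16 * d ^ (?n - 1) * (K * d powr (m + 2) / (2 * m))"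
    using Iub m d by (intro mult_left_mono) (auto simp: field_simps)
  also have "\<dots> = 8 / m * (d ^ ?n)\<^sup>2 * (d powr (s + 1) * K)"
  proof -
    have "d ^ (?n - 1) * d ^ (?n + 1) = (d ^ ?n)\<^sup>2"
      unfolding power_add[symmetric] power_mult[symmetric] using e(2) by (intro arg_cong[where f="\<lambda>k. d ^ k"]) simp
    then show ?thesis unfolding dpow by (simp add: field_simps)
  qed
  \<comment> \<open>The computed factor 8/m is enlarged to the square of 3 sqrt(5/(2m)).\<close>
  also have "\<dots> \<le> 45 / (2 * m) * (d ^ ?n)\<^sup>2 * (d powr (s + 1) * K)"
  proof -
    show ?thesis using K0 m by (intro mult_right_mono) (auto simp: field_simps)
  qed
  also have "\<dots> = (3 * sqrt (5 / (2 * m)) * d ^ ?n * sqrt (d powr (s + 1) * K))\<^sup>2"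
  proof -
    show ?thesis using K0 m by (simp add: power_mult_distrib)
  qed
  finally have "2 * measure lborel A \<le> 3 * sqrt (5 / (2 * m)) * d ^ ?n * sqrt (d powr (s + 1) * K)"
  proof (rule power2_le_imp_le)
    show "0 \<le> 3 * sqrt (5 / (2 * m)) * d ^ ?n * sqrt (d powr (s + 1) * K)" using K0 m d by simp
  qed
  then show ?thesis using main by (simp add: m_def d_def)
qed

section \<open>Local graphs\<close>

lemma MVT_unit_interval:
  fixes f :: "real \<Rightarrow> real"
  assumes "\<And>t. 0 \<le> t \<Longrightarrow> t \<le> 1 \<Longrightarrow> (f has_real_derivative f' t) (at t)"
  obtains t where "0 < t" "t < 1" "f 1 - f 0 = f' t"
  using MVT2[of 0 1 f f'] assms by auto

text \<open>A function of class \<open>C\<^sup>2\<^sup>,\<^sup>\<alpha>\<close> on the hyperplane orthogonal to \<open>\<eta>\<close>, extended constantly along \<open>\<eta>\<close>;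
  \<open>B\<close> is its second derivative.\<close>
locale C2alpha_graph =
  fixes \<alpha> r \<Lambda> :: real and \<eta> :: "'a::euclidean_space" and G :: "'a \<Rightarrow> real"
    and G' :: "'a \<Rightarrow> 'a \<Rightarrow> real" and B :: "'a \<Rightarrow> 'a \<Rightarrow> 'a \<Rightarrow> real"
  assumes \<alpha>: "0 < \<alpha>" "\<alpha> \<le> 1" and r: "0 < r" "r \<le> 1" and \<Lambda>: "0 \<le> \<Lambda>" and \<eta>: "norm \<eta> = 1"
    and G_perp: "\<And>y. G (perp \<eta> y) = G y" and G0: "G 0 = 0"
    and deriv: "\<And>y. norm y < r \<Longrightarrow> (G has_derivative G' y) (at y)"
    and taylor: "\<And>y z y0 v. norm y < r \<Longrightarrow> norm (y + z) < r \<Longrightarrow> norm y0 < r \<Longrightarrow>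
       \<bar>G' (y + z) v - G' y v - B y0 z v\<bar> \<le> \<Lambda> * (norm (y - y0) + norm z) powr \<alpha> * norm z * norm v"
    and B_bound: "\<And>y z v. norm y < r \<Longrightarrow> \<bar>B y z v\<bar> \<le> \<Lambda> * norm z * norm v"
    and B_add: "\<And>y z1 z2 v. norm y < r \<Longrightarrow> B y (z1 + z2) v = B y z1 v + B y z2 v"
    and B_scale: "\<And>y z v c. norm y < r \<Longrightarrow> B y (c *\<^sub>R z) v = c * B y z v"
    and B_scale_right: "\<And>y z v c. norm y < r \<Longrightarrow> B y z (c *\<^sub>R v) = c * B y z v"
begin

lemma B_minus: "norm y < r \<Longrightarrow> B y (- z) v = - B y z v"
  using B_scale[of y "-1" z v] by simp

lemma G'_linear: "norm y < r \<Longrightarrow> linear (G' y)"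
  using deriv has_derivative_linear by blast

lemma G_perp_add: "G (perp \<eta> y + z) = G (y + z)"
  using G_perp[of "perp \<eta> y + z"] G_perp[of "y + z"] by (simp add: perp_add perp_perp \<eta>)

lemma line_deriv:
  assumes "norm (y + t *\<^sub>R v) < r"
  shows "((\<lambda>t. G (y + t *\<^sub>R v)) has_real_derivative G' (y + t *\<^sub>R v) v) (at t)"
proof -
  have "((\<lambda>t. y + t *\<^sub>R v) has_derivative (\<lambda>h. h *\<^sub>R v)) (at t)" by (auto intro!: derivative_eq_intros)
  then have "((\<lambda>t. G (y + t *\<^sub>R v)) has_derivative (\<lambda>h. G' (y + t *\<^sub>R v) (h *\<^sub>R v))) (at t)"
    using deriv[OF assms] by (rule has_derivative_compose)
  moreover have "G' (y + t *\<^sub>R v) (h *\<^sub>R v) = G' (y + t *\<^sub>R v) v * h" for h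
    using linear_cmul[OF G'_linear[OF assms]] by simp
  ultimately show ?thesis by (simp add: has_field_derivative_def mult_commute_abs)
qed

text \<open>This is \<open>taylor\<close> with base point y itself. Both points lie in a ball of
  radius at most 1, so |z| \<le> 2 and |z|^\<alpha> \<le> 2; the bound of \<open>B\<close> adds 1,
  whence the constant 3.\<close>

lemma G'_lipschitz:
  assumes "norm y < r" "norm (y + z) < r"
  shows "\<bar>G' (y + z) v - G' y v\<bar> \<le> 3 * \<Lambda> * norm z * norm v"
proof -
  have "norm z \<le> norm (y + z) + norm y" using norm_triangle_ineq4[of "y + z" y] by simp
  then have z: "norm z \<le> 2" using assms r by linarith
  have "norm z powr \<alpha> \<le> 2"
  proof (cases "norm z \<le> 1")
    case True
    then have "norm z powr \<alpha> \<le> 1 powr \<alpha>" using \<alpha> by (intro powr_mono2) auto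
    then show ?thesis by simp
  next
    case False
    then have "norm z powr \<alpha> \<le> norm z powr 1" using \<alpha> by (intro powr_mono) auto
    then show ?thesis using z False by simp
  qed
  then have "\<Lambda> * (norm (y - y) + norm z) powr \<alpha> * norm z * norm v \<le> \<Lambda> * 2 * norm z * norm v"
    using \<Lambda> by (intro mult_right_mono mult_left_mono) auto
  then show ?thesis using taylor[OF assms assms(1), of v] B_bound[OF assms(1), of z v] by (simp add: mult_ac)
qed

text \<open>Both sides of y are followed simultaneously, so that one mean value step leaves the
  difference of \<open>G'\<close> at two points whose distance is 2t|z|. For the recentred graph z
  \<mapsto> G(y+z) - G(y) the estimate says that it is odd up to second order.\<close>

lemma G_second_difference:
  assumes "norm y + norm z < r"
  shows "\<bar>G (y + z) + G (y - z) - 2 * G y\<bar> \<le> 6 * \<Lambda> * (norm z)\<^sup>2"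
proof -
  have in_ball: "norm (y + t *\<^sub>R z) < r" if "\<bar>t\<bar> \<le> 1" for t
  proof -
    have "norm (y + t *\<^sub>R z) \<le> norm y + \<bar>t\<bar> * norm z" using norm_triangle_ineq[of y "t *\<^sub>R z"] by simp
    also have "\<bar>t\<bar> * norm z \<le> norm z" using that mult_right_mono[of "\<bar>t\<bar>" 1 "norm z"] by simp
    finally show ?thesis using assms by linarith
  qed
  define f where "f = (\<lambda>t. G (y + t *\<^sub>R z) + G (y + t *\<^sub>R (- z)))"
  have D: "(f has_real_derivative G' (y + t *\<^sub>R z) z + G' (y + t *\<^sub>R (- z)) (- z)) (at t)" if "0 \<le> t" "t \<le> 1" for t
    unfolding f_def using in_ball[of t] in_ball[of "-t"] that by (intro DERIV_add line_deriv) auto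
  obtain t where t: "0 < t" "t < 1" "f 1 - f 0 = G' (y + t *\<^sub>R z) z + G' (y + t *\<^sub>R (- z)) (- z)"
    using MVT_unit_interval[OF D] by blast
  have eq: "y + t *\<^sub>R (- z) + (2 * t) *\<^sub>R z = y + t *\<^sub>R z"
  proof -
    have "(2 * t) *\<^sub>R z = t *\<^sub>R z + t *\<^sub>R z" by (simp only: mult_2 scaleR_left_distrib)
    then show ?thesis by simp
  qed
  have b: "norm (y + t *\<^sub>R (- z)) < r" "norm (y + t *\<^sub>R (- z) + (2 * t) *\<^sub>R z) < r"
    unfolding eq using in_ball[of t] in_ball[of "-t"] t by auto
  have "\<bar>f 1 - f 0\<bar> = \<bar>G' (y + t *\<^sub>R z) z - G' (y + t *\<^sub>R (- z)) z\<bar>"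
    unfolding t(3) using linear_neg[OF G'_linear[OF b(1)], of z] by simp
  also have "\<dots> \<le> 3 * \<Lambda> * norm ((2 * t) *\<^sub>R z) * norm z"
    using G'_lipschitz[OF b, of z] unfolding eq .
  also have "\<dots> = 6 * \<Lambda> * (norm z)\<^sup>2 * t" using t by (simp add: power2_eq_square)
  also have "\<dots> \<le> 6 * \<Lambda> * (norm z)\<^sup>2 * 1" using t \<Lambda> by (intro mult_left_mono) auto
  finally show ?thesis by (simp add: f_def)
qed

text \<open>The quantity is the difference, at z, of the graphs recentred at y + d and at y. A mean
  value step in direction d extracts the factor |d| and leaves an increment of \<open>G'\<close>
  over z. The estimates concern its size, its even part under z \<mapsto> -z, where the linear terms
  cancel, and its sum over z and w when the second derivative at 0 kills the pair (z + w, d). In the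
  last case the linear part is taken at 0, so that the distance to 0 enters the error.\<close>

lemma G_mixed_difference:
  assumes "norm y + norm d + norm z < r"
  shows "\<bar>(G (y + d + z) - G (y + d)) - (G (y + z) - G y)\<bar> \<le> 3 * \<Lambda> * norm d * norm z"
    and "\<bar>(G (y + d + z) - G (y + d)) - (G (y + z) - G y) + ((G (y + d - z) - G (y + d)) - (G (y - z) - G y))\<bar>
        \<le> 2 * \<Lambda> * norm d * norm z powr (1 + \<alpha>)"
    and "norm w = norm z \<Longrightarrow> \<bar>B 0 (z + w) d\<bar> \<le> 0 \<Longrightarrow>
       \<bar>(G (y + d + z) - G (y + d)) - (G (y + z) - G y) + ((G (y + d + w) - G (y + d)) - (G (y + w) - G y))\<bar>
        \<le> 2 * \<Lambda> * (norm y + norm d + norm z) powr \<alpha> * norm d * norm z"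
proof -
  have in_ball: "norm (y + t *\<^sub>R d + z') < r" "norm (y + t *\<^sub>R d) < r" if "0 \<le> t" "t \<le> 1" "norm z' = norm z" for t z'
  proof -
    have "norm (y + t *\<^sub>R d) \<le> norm y + t * norm d" using norm_triangle_ineq[of y "t *\<^sub>R d"] that by simp
    also have "t * norm d \<le> norm d" using that mult_right_mono[of "t" 1 "norm d"] by simp
    finally have 1: "norm (y + t *\<^sub>R d) \<le> norm y + norm d" by simp
    then show "norm (y + t *\<^sub>R d) < r" using assms norm_ge_zero[of z] by linarith
    show "norm (y + t *\<^sub>R d + z') < r" using 1 norm_triangle_ineq[of "y + t *\<^sub>R d" z'] assms that by linarith
  qed
  have dz: "((\<lambda>t. G (y + t *\<^sub>R d + z')) has_real_derivative G' (y + t *\<^sub>R d + z') d) (at t)"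
    if "0 \<le> t" "t \<le> 1" "norm z' = norm z" for t z'
    using line_deriv[of "y + z'" t d] in_ball(1)[OF that] by (simp add: add_ac)
  have d0: "((\<lambda>t. G (y + t *\<^sub>R d)) has_real_derivative G' (y + t *\<^sub>R d) d) (at t)"
    if "0 \<le> t" "t \<le> 1" for t
    using line_deriv[of y t d] in_ball(2)[OF that refl] by simp
  show "\<bar>(G (y + d + z) - G (y + d)) - (G (y + z) - G y)\<bar> \<le> 3 * \<Lambda> * norm d * norm z"
  proof -
    define f where "f = (\<lambda>t. G (y + t *\<^sub>R d + z) - G (y + t *\<^sub>R d))"
    have D: "(f has_real_derivative G' (y + t *\<^sub>R d + z) d - G' (y + t *\<^sub>R d) d) (at t)" if "0 \<le> t" "t \<le> 1" for t
      unfolding f_def using that by (intro DERIV_diff dz d0) auto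
    obtain t where t: "0 < t" "t < 1" "f 1 - f 0 = G' (y + t *\<^sub>R d + z) d - G' (y + t *\<^sub>R d) d"
      using MVT_unit_interval[OF D] by blast
    have "\<bar>f 1 - f 0\<bar> \<le> 3 * \<Lambda> * norm z * norm d"
      unfolding t(3) using t in_ball[of t z] by (intro G'_lipschitz) auto
    then show ?thesis by (simp add: f_def mult_ac)
  qed
  have two: "\<exists>t>0. t < 1 \<and> (G (y + d + z) - G (y + d)) - (G (y + z) - G y) + ((G (y + d + w) - G (y + d)) - (G (y + w) - G y))
      = (G' (y + t *\<^sub>R d + z) d - G' (y + t *\<^sub>R d) d) + (G' (y + t *\<^sub>R d + w) d - G' (y + t *\<^sub>R d) d)"
    if w: "norm w = norm z" for w
  proof -
    define f where "f = (\<lambda>t. (G (y + t *\<^sub>R d + z) - G (y + t *\<^sub>R d)) + (G (y + t *\<^sub>R d + w) - G (y + t *\<^sub>R d)))"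
    have D: "(f has_real_derivative (G' (y + t *\<^sub>R d + z) d - G' (y + t *\<^sub>R d) d) + (G' (y + t *\<^sub>R d + w) d - G' (y + t *\<^sub>R d) d)) (at t)"
      if "0 \<le> t" "t \<le> 1" for t
      unfolding f_def using that w by (intro DERIV_diff DERIV_add dz d0) auto
    obtain t where t: "0 < t" "t < 1" "f 1 - f 0 = (G' (y + t *\<^sub>R d + z) d - G' (y + t *\<^sub>R d) d) + (G' (y + t *\<^sub>R d + w) d - G' (y + t *\<^sub>R d) d)"
      using MVT_unit_interval[OF D] by blast
    then show ?thesis by (intro exI[of _ t]) (simp add: f_def)
  qed
  show "\<bar>(G (y + d + z) - G (y + d)) - (G (y + z) - G y) + ((G (y + d - z) - G (y + d)) - (G (y - z) - G y))\<bar>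
        \<le> 2 * \<Lambda> * norm d * norm z powr (1 + \<alpha>)"
  proof -
    obtain t where t: "0 < t" "t < 1" and eq: "(G (y + d + z) - G (y + d)) - (G (y + z) - G y) + ((G (y + d + - z) - G (y + d)) - (G (y + - z) - G y))
      = (G' (y + t *\<^sub>R d + z) d - G' (y + t *\<^sub>R d) d) + (G' (y + t *\<^sub>R d + - z) d - G' (y + t *\<^sub>R d) d)"
      using two[of "- z"] by auto
    let ?Y = "y + t *\<^sub>R d"
    have Y: "norm ?Y < r" "norm (?Y + z) < r" "norm (?Y + - z) < r" using in_ball[of t z] in_ball[of t "- z"] t by auto
    have 1: "\<bar>G' (?Y + z) d - G' ?Y d - B ?Y z d\<bar> \<le> \<Lambda> * norm z powr \<alpha> * norm z * norm d"
      using taylor[OF Y(1,2,1), of d] by simp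
    have 2: "\<bar>G' (?Y + - z) d - G' ?Y d - B ?Y (- z) d\<bar> \<le> \<Lambda> * norm z powr \<alpha> * norm z * norm d"
      using taylor[OF Y(1,3,1), of d] by simp
    have pw: "norm z powr (1 + \<alpha>) = norm z powr \<alpha> * norm z" by (cases "z = 0") (simp_all add: powr_add)
    show ?thesis using 1 2 eq unfolding B_minus[OF Y(1)] pw by (simp add: mult_ac)
  qed
  show "\<bar>(G (y + d + z) - G (y + d)) - (G (y + z) - G y) + ((G (y + d + w) - G (y + d)) - (G (y + w) - G y))\<bar>
        \<le> 2 * \<Lambda> * (norm y + norm d + norm z) powr \<alpha> * norm d * norm z"
    if w: "norm w = norm z" "\<bar>B 0 (z + w) d\<bar> \<le> 0"
  proof -
    obtain t where t: "0 < t" "t < 1" and eq: "(G (y + d + z) - G (y + d)) - (G (y + z) - G y) + ((G (y + d + w) - G (y + d)) - (G (y + w) - G y))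
      = (G' (y + t *\<^sub>R d + z) d - G' (y + t *\<^sub>R d) d) + (G' (y + t *\<^sub>R d + w) d - G' (y + t *\<^sub>R d) d)"
      using two[OF w(1)] by auto
    let ?Y = "y + t *\<^sub>R d"
    have Y: "norm ?Y < r" "norm (?Y + z) < r" "norm (?Y + w) < r" using in_ball[of t z] in_ball[of t w] t w by auto
    have r0: "norm (0::'a) < r" using r by simp
    have B0: "B 0 z d + B 0 w d = 0" using B_add[OF r0, of z w d] w(2) by simp
    have Yn: "norm ?Y \<le> norm y + norm d"
    proof -
      have "norm ?Y \<le> norm y + t * norm d" using norm_triangle_ineq[of y "t *\<^sub>R d"] t by simp
      also have "t * norm d \<le> norm d" using t mult_right_mono[of "t" 1 "norm d"] by simp
      finally show ?thesis by simp
    qed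
    have mono: "\<Lambda> * (norm (?Y - 0) + norm z) powr \<alpha> * norm z * norm d \<le> \<Lambda> * (norm y + norm d + norm z) powr \<alpha> * norm z * norm d"
      using \<Lambda> \<alpha> Yn by (intro mult_right_mono mult_left_mono powr_mono2) auto
    have 1: "\<bar>G' (?Y + z) d - G' ?Y d - B 0 z d\<bar> \<le> \<Lambda> * (norm y + norm d + norm z) powr \<alpha> * norm z * norm d"
      using taylor[OF Y(1,2) r0, of d] mono by linarith
    have 2: "\<bar>G' (?Y + w) d - G' ?Y d - B 0 w d\<bar> \<le> \<Lambda> * (norm y + norm d + norm z) powr \<alpha> * norm z * norm d"
      using taylor[OF Y(1,3) r0, of d, unfolded w(1)] mono by linarith
    have "\<bar>(G (y + d + z) - G (y + d)) - (G (y + z) - G y) + ((G (y + d + w) - G (y + d)) - (G (y + w) - G y))\<bar>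
       \<le> 2 * (\<Lambda> * (norm y + norm d + norm z) powr \<alpha> * norm z * norm d)"
      using 1 2 B0 unfolding eq by linarith
    then show ?thesis by (simp add: mult_ac)
  qed
qed

text \<open>The increment G(tb+ta) - G(tb) - G(ta) + G(0) is symmetric in a and b, and it equals t^2
  B(a,b) up to o(t^2).\<close>

lemma B_symmetric:
  shows "B 0 z v = B 0 v z"
proof (rule ccontr)
  assume ne: "B 0 z v \<noteq> B 0 v z"
  define N where "N = norm z + norm v + 1"
  have N: "0 < N" by (simp add: N_def add_nonneg_pos)
  have r0: "norm (0::'a) < r" using r by simp
  have key: "\<bar>(G (t *\<^sub>R b + t *\<^sub>R a) - G (t *\<^sub>R b)) - (G (t *\<^sub>R a) - G 0) - t\<^sup>2 * B 0 a b\<bar> \<le> \<Lambda> * (2 * t * N) powr \<alpha> * t\<^sup>2 * N\<^sup>2"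
    if t: "0 < t" "t * N < r / 2" and ab: "norm a \<le> N" "norm b \<le> N" for t a b
  proof -
    have nb: "norm (u *\<^sub>R (t *\<^sub>R b)) \<le> t * N" if "0 \<le> u" "u \<le> 1" for u
    proof -
      have "norm (u *\<^sub>R (t *\<^sub>R b)) = u * (t * norm b)" using that t by simp
      also have "\<dots> \<le> 1 * (t * N)" using that t ab by (intro mult_mono mult_left_mono) auto
      finally show ?thesis by simp
    qed
    have na: "norm (t *\<^sub>R a) \<le> t * N" using t ab by simp
    define f where "f = (\<lambda>u. G (t *\<^sub>R a + u *\<^sub>R (t *\<^sub>R b)) - G (0 + u *\<^sub>R (t *\<^sub>R b)))"
    have in1: "norm (t *\<^sub>R a + u *\<^sub>R (t *\<^sub>R b)) < r" "norm (0 + u *\<^sub>R (t *\<^sub>R b)) < r" if "0 \<le> u" "u \<le> 1" for u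
      using nb[OF that] na norm_triangle_ineq[of "t *\<^sub>R a" "u *\<^sub>R (t *\<^sub>R b)"] t(2) mult_pos_pos[OF t(1) N] unfolding add_0_left by linarith+
    have D: "(f has_real_derivative G' (t *\<^sub>R a + u *\<^sub>R (t *\<^sub>R b)) (t *\<^sub>R b) - G' (0 + u *\<^sub>R (t *\<^sub>R b)) (t *\<^sub>R b)) (at u)"
      if "0 \<le> u" "u \<le> 1" for u
      unfolding f_def using in1[OF that] by (intro DERIV_diff line_deriv) auto
    obtain u where u: "0 < u" "u < 1" "f 1 - f 0 = G' (t *\<^sub>R a + u *\<^sub>R (t *\<^sub>R b)) (t *\<^sub>R b) - G' (0 + u *\<^sub>R (t *\<^sub>R b)) (t *\<^sub>R b)"
      using MVT_unit_interval[OF D] by blast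
    let ?Y = "u *\<^sub>R (t *\<^sub>R b)"
    have Y: "norm ?Y < r" "norm (?Y + t *\<^sub>R a) < r" using in1[of u] u by (auto simp: add.commute)
    have "\<bar>G' (?Y + t *\<^sub>R a) (t *\<^sub>R b) - G' ?Y (t *\<^sub>R b) - B 0 (t *\<^sub>R a) (t *\<^sub>R b)\<bar>
        \<le> \<Lambda> * (norm (?Y - 0) + norm (t *\<^sub>R a)) powr \<alpha> * norm (t *\<^sub>R a) * norm (t *\<^sub>R b)"
      by (rule taylor[OF Y r0])
    also have "\<dots> \<le> \<Lambda> * (2 * t * N) powr \<alpha> * (t * N) * (t * N)"
    proof (intro mult_mono mult_left_mono powr_mono2)
      show "norm (?Y - 0) + norm (t *\<^sub>R a) \<le> 2 * t * N" using nb[of u] na u by simp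
    qed (use \<Lambda> \<alpha> na t ab N in auto)
    also have "\<dots> = \<Lambda> * (2 * t * N) powr \<alpha> * t\<^sup>2 * N\<^sup>2" by (simp add: power2_eq_square)
    finally have main: "\<bar>G' (?Y + t *\<^sub>R a) (t *\<^sub>R b) - G' ?Y (t *\<^sub>R b) - B 0 (t *\<^sub>R a) (t *\<^sub>R b)\<bar> \<le> \<Lambda> * (2 * t * N) powr \<alpha> * t\<^sup>2 * N\<^sup>2" .
    have Bt: "B 0 (t *\<^sub>R a) (t *\<^sub>R b) = t\<^sup>2 * B 0 a b"
      using B_scale[OF r0] B_scale_right[OF r0] by (simp add: power2_eq_square)
    have "f 1 - f 0 = (G (t *\<^sub>R b + t *\<^sub>R a) - G (t *\<^sub>R b)) - (G (t *\<^sub>R a) - G 0)"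
      by (simp add: f_def add.commute)
    then show ?thesis using main u(3) Bt by (simp add: add.commute)
  qed
  define \<epsilon> where "\<epsilon> = \<bar>B 0 z v - B 0 v z\<bar>"
  have \<epsilon>: "0 < \<epsilon>" using ne by (simp add: \<epsilon>_def)
  have zN: "norm z \<le> N" "norm v \<le> N" by (auto simp: N_def)
  have bound: "\<epsilon> \<le> 2 * \<Lambda> * (2 * t * N) powr \<alpha> * N\<^sup>2" if t: "0 < t" "t * N < r / 2" for t
  proof -
    have "t\<^sup>2 * \<epsilon> = \<bar>t\<^sup>2 * B 0 z v - t\<^sup>2 * B 0 v z\<bar>"
      using t by (simp add: \<epsilon>_def abs_mult flip: right_diff_distrib)
    also have "\<dots> \<le> 2 * (\<Lambda> * (2 * t * N) powr \<alpha> * t\<^sup>2 * N\<^sup>2)"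
      using key[OF t zN] key[OF t zN(2,1)] by (simp add: add.commute)
    finally have "t\<^sup>2 * \<epsilon> \<le> t\<^sup>2 * (2 * \<Lambda> * (2 * t * N) powr \<alpha> * N\<^sup>2)" by (simp add: mult_ac)
    then show ?thesis using t by simp
  qed
  have "((\<lambda>t. 2 * \<Lambda> * (2 * t * N) powr \<alpha> * N\<^sup>2) \<longlongrightarrow> 2 * \<Lambda> * (2 * 0 * N) powr \<alpha> * N\<^sup>2) (at_right 0)"
    using \<alpha> N by (intro tendsto_intros tendsto_powr2) (auto intro!: eventually_at_rightI[of 0 1])
  then have lim: "((\<lambda>t. 2 * \<Lambda> * (2 * t * N) powr \<alpha> * N\<^sup>2) \<longlongrightarrow> 0) (at_right 0)" by simp
  have "eventually (\<lambda>t. \<epsilon> \<le> 2 * \<Lambda> * (2 * t * N) powr \<alpha> * N\<^sup>2) (at_right 0)"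
    using r N by (intro eventually_at_rightI[of 0 "r / (2 * N)"] bound) (auto simp: field_simps)
  then have "\<epsilon> \<le> 0" by (rule tendsto_lowerbound[OF lim]) simp
  then show False using \<epsilon> by simp
qed

end

section \<open>Hoelder bounds and implicit functions with Hoelder continuous second
  derivative\<close>

lemma has_real_derivative_along_line:
  fixes F :: "'a::real_normed_vector \<Rightarrow> real"
  assumes "(F has_derivative F') (at (x + t *\<^sub>R v))"
  shows "((\<lambda>t. F (x + t *\<^sub>R v)) has_real_derivative F' v) (at t)"
proof -
  have "((\<lambda>t. x + t *\<^sub>R v) has_derivative (\<lambda>h. h *\<^sub>R v)) (at t)" by (auto intro!: derivative_eq_intros)
  then have "((\<lambda>t. F (x + t *\<^sub>R v)) has_derivative (\<lambda>h. F' (h *\<^sub>R v))) (at t)"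
    using assms by (rule has_derivative_compose)
  moreover have "F' (h *\<^sub>R v) = F' v * h" for h
    using linear_cmul[OF has_derivative_linear[OF assms], of h v] by simp
  ultimately show ?thesis by (simp add: has_field_derivative_def mult_commute_abs)
qed

text \<open>One number bounds both the values and the Hoelder quotients. In this form the class is
  stable under sums, products and reciprocals of functions bounded away from 0, with explicit
  constants; that transfers the regularity to the second derivative of an implicitly defined
  function.\<close>

definition bounded_hoelder :: "real \<Rightarrow> 'a::real_normed_vector set \<Rightarrow> real \<Rightarrow> ('a \<Rightarrow> real) \<Rightarrow> bool" where
  "bounded_hoelder \<alpha> S K a \<longleftrightarrow> 0 \<le> K \<and> (\<forall>y\<in>S. \<bar>a y\<bar> \<le> K) \<and> (\<forall>y\<in>S. \<forall>z\<in>S. \<bar>a y - a z\<bar> \<le> K * norm (y - z) powr \<alpha>)"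

lemma bounded_hoelder_mult:
  assumes a: "bounded_hoelder \<alpha> S K a" and b: "bounded_hoelder \<alpha> S L b"
  shows "bounded_hoelder \<alpha> S (2 * K * L) (\<lambda>y. a y * b y)"
  unfolding bounded_hoelder_def
proof (intro conjI ballI)
  have K: "0 \<le> K" "0 \<le> L" using a b by (auto simp: bounded_hoelder_def)
  then show "0 \<le> 2 * K * L" by simp
  fix y assume y: "y \<in> S"
  have "\<bar>a y * b y\<bar> \<le> K * L" unfolding abs_mult using a b y K by (intro mult_mono) (auto simp: bounded_hoelder_def)
  also have "\<dots> \<le> 2 * K * L" using K by simp
  finally show "\<bar>a y * b y\<bar> \<le> 2 * K * L" .
  fix z assume z: "z \<in> S"
  have "a y * b y - a z * b z = a y * (b y - b z) + (a y - a z) * b z" by (simp add: algebra_simps)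
  also have "\<bar>\<dots>\<bar> \<le> \<bar>a y\<bar> * \<bar>b y - b z\<bar> + \<bar>a y - a z\<bar> * \<bar>b z\<bar>"
    using abs_triangle_ineq[of "a y * (b y - b z)" "(a y - a z) * b z"] by (simp add: abs_mult)
  also have "\<dots> \<le> K * (L * norm (y - z) powr \<alpha>) + (K * norm (y - z) powr \<alpha>) * L"
    using a b y z K by (intro add_mono mult_mono) (auto simp: bounded_hoelder_def)
  finally show "\<bar>a y * b y - a z * b z\<bar> \<le> 2 * K * L * norm (y - z) powr \<alpha>" by (simp add: mult_ac)
qed

lemma bounded_hoelder_add:
  assumes a: "bounded_hoelder \<alpha> S K a" and b: "bounded_hoelder \<alpha> S L b"
  shows "bounded_hoelder \<alpha> S (K + L) (\<lambda>y. a y + b y)"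
  unfolding bounded_hoelder_def
proof (intro conjI ballI)
  show "0 \<le> K + L" using a b by (auto simp: bounded_hoelder_def)
  fix y assume y: "y \<in> S"
  show "\<bar>a y + b y\<bar> \<le> K + L" using a b y abs_triangle_ineq[of "a y" "b y"] by (force simp: bounded_hoelder_def)
  fix z assume z: "z \<in> S"
  have "\<bar>a y - a z\<bar> \<le> K * norm (y - z) powr \<alpha>" "\<bar>b y - b z\<bar> \<le> L * norm (y - z) powr \<alpha>"
    using a b y z by (auto simp: bounded_hoelder_def)
  then show "\<bar>a y + b y - (a z + b z)\<bar> \<le> (K + L) * norm (y - z) powr \<alpha>"
    unfolding distrib_right by linarith
qed

lemma bounded_hoelder_minus:
  "bounded_hoelder \<alpha> S K a \<Longrightarrow> bounded_hoelder \<alpha> S K (\<lambda>y. - a y)"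
  by (auto simp: bounded_hoelder_def abs_minus_commute)

lemma bounded_hoelder_inverse:
  assumes a: "bounded_hoelder \<alpha> S K a" and c: "0 < c" "\<And>y. y \<in> S \<Longrightarrow> c \<le> a y"
  shows "bounded_hoelder \<alpha> S (1 / c + K / c\<^sup>2) (\<lambda>y. 1 / a y)"
  unfolding bounded_hoelder_def
proof (intro conjI ballI)
  have K: "0 \<le> K" using a by (auto simp: bounded_hoelder_def)
  then show "0 \<le> 1 / c + K / c\<^sup>2" using c by simp
  have b: "\<bar>1 / a y\<bar> \<le> 1 / c" if "y \<in> S" for y
    using c that by (smt (verit, ccfv_SIG) divide_nonneg_nonneg frac_le)
  fix y assume y: "y \<in> S"
  show "\<bar>1 / a y\<bar> \<le> 1 / c + K / c\<^sup>2" using b[OF y] K by (smt (verit) divide_nonneg_nonneg zero_le_power2)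
  fix z assume z: "z \<in> S"
  have nz: "0 < a y" "0 < a z" using c y z by (meson less_le_trans)+
  have "1 / a y - 1 / a z = (a z - a y) * (1 / a y) * (1 / a z)" using nz by (simp add: field_simps)
  then have "\<bar>1 / a y - 1 / a z\<bar> = \<bar>a y - a z\<bar> * \<bar>1 / a y\<bar> * \<bar>1 / a z\<bar>" by (simp add: abs_mult abs_minus_commute)
  also have "\<dots> \<le> (K * norm (y - z) powr \<alpha>) * (1 / c) * (1 / c)"
    using a y z K b[OF y] b[OF z] c by (intro mult_mono) (auto simp: bounded_hoelder_def)
  also have "\<dots> = K / c\<^sup>2 * norm (y - z) powr \<alpha>" by (simp add: power2_eq_square)
  also have "\<dots> \<le> (1 / c + K / c\<^sup>2) * norm (y - z) powr \<alpha>" using c by (intro mult_right_mono) auto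
  finally show "\<bar>1 / a y - 1 / a z\<bar> \<le> (1 / c + K / c\<^sup>2) * norm (y - z) powr \<alpha>" .
qed

lemma le_double_powr:
  fixes t \<alpha> :: real
  assumes "0 \<le> t" "t \<le> 2" "0 < \<alpha>" "\<alpha> \<le> 1"
  shows "t \<le> 2 * t powr \<alpha>"
proof (cases "t \<le> 1")
  case True
  then have "t \<le> t powr \<alpha>" using assms powr_mono'[of \<alpha> 1 t] by simp
  then show ?thesis using assms by simp
next
  case False
  then have "1 \<le> t powr \<alpha>" using assms ge_one_powr_ge_zero by auto
  then show ?thesis using assms by linarith
qed

text \<open>Monotonicity of \<open>f\<close> along \<eta> yields one zero on each line and also the
  sign of \<open>f\<close> on either side of it. The sign is needed beyond the regularity of the
  zero set, in order to recognise a set as a subgraph. The function \<open>G\<close> is defined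
  through the projection of its argument and is therefore constant along \<eta>.\<close>

lemma implicit_graph:
  fixes f :: "'a::euclidean_space \<Rightarrow> real" and f' :: "'a \<Rightarrow> 'a \<Rightarrow> real" and f'' :: "'a \<Rightarrow> 'a \<Rightarrow> 'a \<Rightarrow> real"
  assumes R0: "0 < R0" and \<alpha>: "0 < \<alpha>" "\<alpha> \<le> 1" and K: "0 \<le> K" and \<eta>: "norm \<eta> = 1"
    and D1: "\<And>x. x \<in> ball p0 R0 \<Longrightarrow> (f has_derivative f' x) (at x)"
    and D2: "\<And>x v. x \<in> ball p0 R0 \<Longrightarrow> ((\<lambda>x. f' x v) has_derivative (\<lambda>w. f'' x w v)) (at x)"
    and lin2: "\<And>x w. x \<in> ball p0 R0 \<Longrightarrow> linear (f'' x w)"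
    and H: "\<And>x y w v. x \<in> ball p0 R0 \<Longrightarrow> y \<in> ball p0 R0 \<Longrightarrow> \<bar>f'' x w v - f'' y w v\<bar> \<le> K * norm (x - y) powr \<alpha> * norm w * norm v"
    and bd: "\<And>x w v. x \<in> ball p0 R0 \<Longrightarrow> \<bar>f'' x w v\<bar> \<le> K * norm w * norm v"
    and f0: "f p0 = 0" "0 < f' p0 \<eta>"
  obtains r \<Lambda> G G' B where "C2alpha_graph \<alpha> r \<Lambda> \<eta> G G' B" "r \<le> R0"
    "\<And>z. norm z < r \<Longrightarrow> f (p0 + z) < 0 \<longleftrightarrow> z \<bullet> \<eta> < G z"
    "\<And>z. norm z < r \<Longrightarrow> f (p0 + z) = 0 \<longleftrightarrow> z \<bullet> \<eta> = G z"
    "\<And>v. G' 0 v = - f' p0 (perp \<eta> v) / f' p0 \<eta>"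
proof -
  have lin1: "linear (f' x)" if "x \<in> ball p0 R0" for x using D1[OF that] has_derivative_linear by blast
  have blin2: "bounded_linear (\<lambda>w. f'' x w v)" if "x \<in> ball p0 R0" for x v using D2[OF that] has_derivative_bounded_linear by blast
  have f'lip: "\<bar>f' x v - f' y v\<bar> \<le> K * norm v * norm (x - y)" if "x \<in> ball p0 R0" "y \<in> ball p0 R0" for x y v
  proof -
    have "norm (f' x v - f' y v) \<le> (K * norm v) * norm (x - y)"
    proof (rule differentiable_bound[OF convex_ball[of p0 R0]])
      show "((\<lambda>x. f' x v) has_derivative (\<lambda>w. f'' x w v)) (at x within ball p0 R0)" if "x \<in> ball p0 R0" for x
        using D2[OF that] by (rule has_derivative_at_withinI)
      show "onorm (\<lambda>w. f'' x w v) \<le> K * norm v" if "x \<in> ball p0 R0" for x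
        using bd[OF that, of _ v] by (intro onorm_bound) (auto simp: K mult_ac)
    qed (use that in auto)
    then show ?thesis by simp
  qed
  have p0: "p0 \<in> ball p0 R0" using R0 by simp
  obtain M0 where M0: "0 < M0" "\<And>v. \<bar>f' p0 v\<bar> \<le> M0 * norm v"
    using bounded_linear.pos_bounded[OF has_derivative_bounded_linear[OF D1[OF p0]]] by (auto simp: mult_ac)
  define C1 where "C1 = M0 + K * R0"
  have C1: "0 < C1" using M0 K R0 by (simp add: C1_def add_pos_nonneg)
  have f'bd: "\<bar>f' x v\<bar> \<le> C1 * norm v" if "x \<in> ball p0 R0" for x v
  proof -
    have "\<bar>f' x v - f' p0 v\<bar> \<le> K * norm v * norm (x - p0)" using f'lip[OF that p0] .
    also have "\<dots> \<le> K * norm v * R0" using that K by (intro mult_left_mono) (auto simp: dist_norm norm_minus_commute)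
    finally show ?thesis using M0(2)[of v] by (simp add: C1_def algebra_simps)
  qed
  have flip: "\<bar>f x - f y\<bar> \<le> C1 * norm (x - y)" if "x \<in> ball p0 R0" "y \<in> ball p0 R0" for x y
  proof -
    have "norm (f x - f y) \<le> C1 * norm (x - y)"
    proof (rule differentiable_bound[OF convex_ball[of p0 R0]])
      show "(f has_derivative f' x) (at x within ball p0 R0)" if "x \<in> ball p0 R0" for x
        using D1[OF that] by (rule has_derivative_at_withinI)
      show "onorm (f' x) \<le> C1" if "x \<in> ball p0 R0" for x
        using f'bd[OF that] C1 by (intro onorm_bound) auto
    qed (use that in auto)
    then show ?thesis by simp
  qed
  \<comment> \<open>On the ball of radius \<open>R1\<close> the slope of \<open>f\<close> along
    \<eta> stays above half of its value at \<open>p0\<close>.\<close>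
  define c where "c = f' p0 \<eta> / 2"
  have c: "0 < c" using f0 by (simp add: c_def)
  define R1 where "R1 = min R0 (c / (K + 1))"
  have R1: "0 < R1" "R1 \<le> R0" using R0 c K by (auto simp: R1_def)
  have sub: "ball p0 R1 \<subseteq> ball p0 R0" using R1 by (simp add: subset_ball)
  have lower: "c \<le> f' x \<eta>" if "x \<in> ball p0 R1" for x
  proof -
    have "\<bar>f' x \<eta> - f' p0 \<eta>\<bar> \<le> K * norm \<eta> * norm (x - p0)" using f'lip that sub p0 by blast
    also have "\<dots> \<le> K * (c / (K + 1))"
    proof -
      have "norm (x - p0) \<le> c / (K + 1)" using that by (auto simp: R1_def dist_norm norm_minus_commute)
      from mult_left_mono[OF this K] show ?thesis using \<eta> by simp
    qed
    also have "\<dots> \<le> c" using K c by (simp add: field_simps)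
    finally show ?thesis unfolding c_def by linarith
  qed
  have mono: "f x + c * \<tau> \<le> f (x + \<tau> *\<^sub>R \<eta>)" if "x \<in> ball p0 R1" "x + \<tau> *\<^sub>R \<eta> \<in> ball p0 R1" "0 \<le> \<tau>" for x \<tau>
  proof (cases "\<tau> = 0")
    case False
    have inb: "x + t *\<^sub>R (\<tau> *\<^sub>R \<eta>) \<in> ball p0 R1" if "0 \<le> t" "t \<le> 1" for t
    proof -
      have "x + t *\<^sub>R (\<tau> *\<^sub>R \<eta>) = (1 - t) *\<^sub>R x + t *\<^sub>R (x + \<tau> *\<^sub>R \<eta>)" by (simp add: algebra_simps)
      then show ?thesis using convexD_alt[OF convex_ball \<open>x \<in> ball p0 R1\<close> \<open>x + \<tau> *\<^sub>R \<eta> \<in> ball p0 R1\<close> that] by simp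
    qed
    have "((\<lambda>t. f (x + t *\<^sub>R (\<tau> *\<^sub>R \<eta>))) has_real_derivative f' (x + t *\<^sub>R (\<tau> *\<^sub>R \<eta>)) \<eta> * \<tau>) (at t)" if "0 \<le> t" "t \<le> 1" for t
    proof -
      have xt: "x + t *\<^sub>R (\<tau> *\<^sub>R \<eta>) \<in> ball p0 R0" using inb[OF that] sub by blast
      have "f' (x + t *\<^sub>R (\<tau> *\<^sub>R \<eta>)) (\<tau> *\<^sub>R \<eta>) = f' (x + t *\<^sub>R (\<tau> *\<^sub>R \<eta>)) \<eta> * \<tau>"
        using linear_cmul[OF lin1[OF xt], of \<tau> \<eta>] by (simp only: real_scaleR_def mult.commute)
      then show ?thesis using has_real_derivative_along_line[OF D1[OF xt]] by (simp only:)
    qed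
    then obtain t where t: "0 < t" "t < 1" "f (x + 1 *\<^sub>R (\<tau> *\<^sub>R \<eta>)) - f (x + 0 *\<^sub>R (\<tau> *\<^sub>R \<eta>)) = f' (x + t *\<^sub>R (\<tau> *\<^sub>R \<eta>)) \<eta> * \<tau>"
      using MVT_unit_interval[of "\<lambda>t. f (x + t *\<^sub>R (\<tau> *\<^sub>R \<eta>))" "\<lambda>t. f' (x + t *\<^sub>R (\<tau> *\<^sub>R \<eta>)) \<eta> * \<tau>"] by blast
    have "c * \<tau> \<le> f' (x + t *\<^sub>R (\<tau> *\<^sub>R \<eta>)) \<eta> * \<tau>" using lower[OF inb[of t]] t that by (intro mult_right_mono) auto
    then show ?thesis using t by simp
  qed simp
  define a where "a = R1 / 2"
  \<comment> \<open>Chosen such that |f| < c a at height 0 above all points considered; as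
    \<open>f\<close> grows at least at the rate c along \<eta>, it changes sign between the heights
    -a and a.\<close>
  define \<rho> where "\<rho> = min (min 1 a) (c * a / (2 * C1))"
  have a: "0 < a" using R1 by (simp add: a_def)
  have \<rho>: "0 < \<rho>" "\<rho> \<le> 1" "\<rho> \<le> a" "C1 * \<rho> < c * a"
  proof -
    show "0 < \<rho>" "\<rho> \<le> 1" "\<rho> \<le> a" using a c C1 by (auto simp: \<rho>_def)
    have "C1 * \<rho> \<le> C1 * (c * a / (2 * C1))" using C1 by (intro mult_left_mono) (auto simp: \<rho>_def)
    also have "\<dots> = c * a / 2" using C1 by simp
    also have "\<dots> < c * a" using a c by simp
    finally show "C1 * \<rho> < c * a" .
  qed
  have inR1: "p0 + perp \<eta> y + u *\<^sub>R \<eta> \<in> ball p0 R1" if "norm y < \<rho>" "\<bar>u\<bar> \<le> a" for y u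
  proof -
    have "norm (perp \<eta> y + u *\<^sub>R \<eta>) \<le> norm (perp \<eta> y) + norm (u *\<^sub>R \<eta>)" by (rule norm_triangle_ineq)
    also have "\<dots> < \<rho> + a" using that norm_perp_le[OF \<eta>, of y] \<eta> by simp
    finally have "norm (perp \<eta> y + u *\<^sub>R \<eta>) < R1" using \<rho> by (simp add: a_def)
    moreover have "p0 + perp \<eta> y + u *\<^sub>R \<eta> - p0 = perp \<eta> y + u *\<^sub>R \<eta>" by simp
    ultimately have "dist (p0 + perp \<eta> y + u *\<^sub>R \<eta>) p0 < R1" by (simp only: dist_norm)
    then show ?thesis by (simp add: dist_commute)
  qed
  have strict: "f (p0 + perp \<eta> y + u *\<^sub>R \<eta>) < f (p0 + perp \<eta> y + v *\<^sub>R \<eta>)" if "norm y < \<rho>" "\<bar>u\<bar> \<le> a" "\<bar>v\<bar> \<le> a" "u < v" for y u v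
  proof -
    have eq: "p0 + perp \<eta> y + u *\<^sub>R \<eta> + (v - u) *\<^sub>R \<eta> = p0 + perp \<eta> y + v *\<^sub>R \<eta>" by (simp add: algebra_simps)
    have "f (p0 + perp \<eta> y + u *\<^sub>R \<eta>) + c * (v - u) \<le> f (p0 + perp \<eta> y + v *\<^sub>R \<eta>)"
      using mono[of "p0 + perp \<eta> y + u *\<^sub>R \<eta>" "v - u", unfolded eq, OF inR1[OF that(1,2)] inR1[OF that(1,3)]] that by simp
    moreover have "0 < c * (v - u)" using c that by simp
    ultimately show ?thesis by linarith
  qed
  define G where "G = (\<lambda>y. SOME u. \<bar>u\<bar> < a \<and> f (p0 + perp \<eta> y + u *\<^sub>R \<eta>) = 0)"
  have Gprop: "\<bar>G y\<bar> < a \<and> f (p0 + perp \<eta> y + G y *\<^sub>R \<eta>) = 0" if y: "norm y < \<rho>" for y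
  proof -
    let ?h = "\<lambda>u. f (p0 + perp \<eta> y + u *\<^sub>R \<eta>)"
    have h0: "\<bar>?h 0\<bar> < c * a"
    proof -
      have "\<bar>f (p0 + perp \<eta> y + 0 *\<^sub>R \<eta>) - f p0\<bar> \<le> C1 * norm (p0 + perp \<eta> y + 0 *\<^sub>R \<eta> - p0)"
        using inR1[OF y, of 0] sub p0 a by (intro flip) auto
      also have "\<dots> = C1 * norm (perp \<eta> y)" by simp
      also have "\<dots> \<le> C1 * \<rho>" using y norm_perp_le[OF \<eta>, of y] C1 by (intro mult_left_mono) auto
      finally show ?thesis using f0 \<rho> by simp
    qed
    have ha: "0 < ?h a"
      using mono[of "p0 + perp \<eta> y + 0 *\<^sub>R \<eta>" a] inR1[OF y, of 0] inR1[OF y, of a] h0 a by simp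
    have hma: "?h (- a) < 0"
      using mono[of "p0 + perp \<eta> y + (-a) *\<^sub>R \<eta>" a] inR1[OF y, of 0] inR1[OF y, of "- a"] h0 a by simp
    have "continuous_on {-a..a} ?h"
    proof -
      have "continuous_on (ball p0 R0) f"
        using D1 by (intro continuous_at_imp_continuous_on ballI has_derivative_continuous) auto
      then show ?thesis
        by (rule continuous_on_compose2) (use inR1[OF y] sub in \<open>auto intro!: continuous_intros simp: subset_iff\<close>)
    qed
    then obtain u where u: "-a \<le> u" "u \<le> a" "?h u = 0"
      using IVT'[of ?h "-a" 0 a] ha hma a by auto
    have "u \<noteq> a" "u \<noteq> - a" using u ha hma by auto
    then have "\<exists>u. \<bar>u\<bar> < a \<and> ?h u = 0" using u by (intro exI[of _ u]) auto
    then show ?thesis unfolding G_def by (rule someI_ex)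
  qed
  have G_perp: "G (perp \<eta> y) = G y" for y by (simp add: G_def perp_perp[OF \<eta>])
  define X where "X = (\<lambda>y. p0 + perp \<eta> y + G y *\<^sub>R \<eta>)"
  have X: "X y \<in> ball p0 R1" "X y \<in> ball p0 R0" "f (X y) = 0" if "norm y < \<rho>" for y
    using Gprop[OF that] inR1[OF that, of "G y"] sub by (auto simp: X_def)
  have G0: "G 0 = 0"
  proof (rule ccontr)
    assume "G 0 \<noteq> 0"
    then consider "G 0 < 0" | "0 < G 0" by linarith
    then show False
      using strict[of 0 "G 0" 0] strict[of 0 0 "G 0"] Gprop[of 0] \<rho> a f0 by cases (auto simp: perp_def)
  qed
  define Lp where "Lp = C1 / c"
  have Lp: "0 < Lp" using C1 c by (simp add: Lp_def)
  have Glip: "\<bar>G y - G z\<bar> \<le> Lp * norm (y - z)" if y: "norm y < \<rho>" and z: "norm z < \<rho>" for y z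
  proof -
    have *: "G y - G z \<le> Lp * norm (y - z)" if y: "norm y < \<rho>" and z: "norm z < \<rho>" and le: "G z \<le> G y" for y z
    proof -
      have eq: "p0 + perp \<eta> y + G z *\<^sub>R \<eta> + (G y - G z) *\<^sub>R \<eta> = X y" by (simp add: X_def algebra_simps)
      have Gz: "\<bar>G z\<bar> \<le> a" using Gprop[OF z] by simp
      have "f (p0 + perp \<eta> y + G z *\<^sub>R \<eta>) + c * (G y - G z) \<le> f (X y)"
        using mono[of "p0 + perp \<eta> y + G z *\<^sub>R \<eta>" "G y - G z", unfolded eq, OF inR1[OF y Gz] X(1)[OF y]] le by simp
      then have "c * (G y - G z) \<le> f (X z) - f (p0 + perp \<eta> y + G z *\<^sub>R \<eta>)" using X(3)[OF y] X(3)[OF z] by simp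
      also have "\<dots> \<le> C1 * norm (X z - (p0 + perp \<eta> y + G z *\<^sub>R \<eta>))"
        using flip[OF X(2)[OF z] subsetD[OF sub inR1[OF y Gz]]] by linarith
      also have "X z - (p0 + perp \<eta> y + G z *\<^sub>R \<eta>) = perp \<eta> (z - y)" by (simp add: X_def perp_diff)
      also have "C1 * norm (perp \<eta> (z - y)) \<le> C1 * norm (y - z)"
        using C1 norm_perp_le[OF \<eta>, of "z - y"] by (intro mult_left_mono) (auto simp: norm_minus_commute)
      finally show ?thesis using c by (simp add: Lp_def field_simps)
    qed
    show ?thesis using *[OF y z] *[OF z y] by (cases "G z \<le> G y") (auto simp: norm_minus_commute)
  qed
  define G' where "G' = (\<lambda>y v. - f' (X y) (perp \<eta> v) / f' (X y) \<eta>)"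
  have lperp: "linear (perp \<eta>)" by (intro linearI) (simp_all add: perp_add perp_scaleR)
  have G'lin: "linear (G' y)" if y: "norm y < \<rho>" for y
  proof -
    note l = lin1[OF X(2)[OF y]]
    show ?thesis unfolding G'_def
      by (intro linearI)
         (simp_all add: perp_add perp_scaleR linear_add[OF l] linear_cmul[OF l] add_divide_distrib diff_divide_distrib)
  qed
  have Xlip: "norm (X y - X z) \<le> (1 + Lp) * norm (y - z)" if "norm y < \<rho>" "norm z < \<rho>" for y z
  proof -
    have "X y - X z = perp \<eta> (y - z) + (G y - G z) *\<^sub>R \<eta>" by (simp add: X_def perp_diff algebra_simps)
    then have "norm (X y - X z) \<le> norm (perp \<eta> (y - z)) + \<bar>G y - G z\<bar>"
      using norm_triangle_ineq[of "perp \<eta> (y - z)" "(G y - G z) *\<^sub>R \<eta>"] \<eta> by simp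
    then show ?thesis using norm_perp_le[OF \<eta>, of "y - z"] Glip[OF that] by (simp add: algebra_simps)
  qed
  \<comment> \<open>Since \<open>f\<close> vanishes at \<open>X y\<close> and \<open>X z\<close>,
    its derivative at an intermediate point of the segment kills the secant \<open>k\<close>.
    Replacing that point by \<open>X y\<close> costs at most K|k|^2, and solving for the increment
    of \<open>G\<close> leaves a quadratic remainder.\<close>
  have Gder: "(G has_derivative G' y) (at y)" if y: "norm y < \<rho>" for y
  proof (rule has_derivativeI_sandwich[where e="\<rho> - norm y" and H="\<lambda>z. K * (1 + Lp)\<^sup>2 / c * norm (z - y)"])
    show "0 < \<rho> - norm y" using y by simp
    show "bounded_linear (G' y)" using G'lin[OF y] by (simp add: linear_conv_bounded_linear)
    show "((\<lambda>z. K * (1 + Lp)\<^sup>2 / c * norm (z - y)) \<longlongrightarrow> 0) (at y)"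
      by (rule tendsto_eq_intros refl | simp)+
    fix z assume zy: "z \<noteq> y" "dist z y < \<rho> - norm y"
    have z: "norm z < \<rho>" using zy norm_triangle_ineq2[of z y] by (simp add: dist_norm)
    define k where "k = X z - X y"
    have kn: "norm k \<le> (1 + Lp) * norm (z - y)" unfolding k_def by (rule Xlip[OF z y])
    have inb: "X y + t *\<^sub>R k \<in> ball p0 R0" if "0 \<le> t" "t \<le> 1" for t
    proof -
      have "X y + t *\<^sub>R k = (1 - t) *\<^sub>R X y + t *\<^sub>R X z" by (simp add: k_def algebra_simps)
      then show ?thesis using convexD_alt[OF convex_ball X(2)[OF y] X(2)[OF z] that] by simp
    qed
    have "((\<lambda>t. f (X y + t *\<^sub>R k)) has_real_derivative f' (X y + t *\<^sub>R k) k) (at t)" if "0 \<le> t" "t \<le> 1" for t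
      by (rule has_real_derivative_along_line[OF D1[OF inb[OF that]]])
    then obtain t where t: "0 < t" "t < 1" "f (X y + 1 *\<^sub>R k) - f (X y + 0 *\<^sub>R k) = f' (X y + t *\<^sub>R k) k"
      using MVT_unit_interval[of "\<lambda>t. f (X y + t *\<^sub>R k)" "\<lambda>t. f' (X y + t *\<^sub>R k) k"] by blast
    have "f' (X y + t *\<^sub>R k) k = 0" using t(3) X(3)[OF y] X(3)[OF z] by (simp add: k_def)
    then have "\<bar>f' (X y) k\<bar> \<le> K * norm k * norm (X y - (X y + t *\<^sub>R k))"
      using f'lip[OF X(2)[OF y] inb[of t], of k] t by simp
    also have "\<dots> = K * norm k * (t * norm k)" using t by simp
    also have "\<dots> \<le> K * norm k * norm k"
      using t K mult_right_mono[of t 1 "norm k"] by (intro mult_left_mono) auto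
    also have "\<dots> \<le> K * ((1 + Lp) * norm (z - y)) * ((1 + Lp) * norm (z - y))"
      by (rule mult_mono[OF mult_left_mono[OF kn K] kn]) (use K Lp in auto)
    finally have 1: "\<bar>f' (X y) k\<bar> \<le> K * (1 + Lp)\<^sup>2 * (norm (z - y))\<^sup>2" by (simp add: power2_eq_square mult_ac)
    have ke: "k = perp \<eta> (z - y) + (G z - G y) *\<^sub>R \<eta>" by (simp add: k_def X_def perp_diff algebra_simps)
    have D: "c \<le> f' (X y) \<eta>" using lower[OF X(1)[OF y]] .
    have "f' (X y) k = f' (X y) (perp \<eta> (z - y)) + (G z - G y) * f' (X y) \<eta>"
      unfolding ke using linear_add[OF lin1[OF X(2)[OF y]]] linear_cmul[OF lin1[OF X(2)[OF y]]] by simp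
    also have "\<dots> = (G z - G y - G' y (z - y)) * f' (X y) \<eta>"
      using D c by (simp add: G'_def field_simps)
    finally have "\<bar>G z - G y - G' y (z - y)\<bar> * f' (X y) \<eta> = \<bar>f' (X y) k\<bar>" using D c by (simp add: abs_mult)
    then have "\<bar>G z - G y - G' y (z - y)\<bar> * c \<le> K * (1 + Lp)\<^sup>2 * (norm (z - y))\<^sup>2"
      using 1 mult_left_mono[OF D, of "\<bar>G z - G y - G' y (z - y)\<bar>"] by simp
    then have "\<bar>G z - G y - G' y (z - y)\<bar> \<le> K * (1 + Lp)\<^sup>2 / c * (norm (z - y))\<^sup>2" using c by (simp add: field_simps)
    then show "norm (G z - G y - G' y (z - y)) / norm (z - y) \<le> K * (1 + Lp)\<^sup>2 / c * norm (z - y)"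
      using zy by (simp add: field_simps power2_eq_square)
  qed
  define X' where "X' = (\<lambda>y w. perp \<eta> w + G' y w *\<^sub>R \<eta>)"
  have Xder: "(X has_derivative X' y) (at y)" if y: "norm y < \<rho>" for y
  proof -
    have "(perp \<eta> has_derivative perp \<eta>) (at y)"
      using lperp by (intro bounded_linear_imp_has_derivative) (simp add: linear_conv_bounded_linear)
    then show ?thesis unfolding X_def X'_def using Gder[OF y]
      by (auto intro!: derivative_eq_intros simp: fun_eq_iff)
  qed
  define Nd where "Nd = (\<lambda>w v y. f'' (X y) (X' y w) v)"
  \<comment> \<open>The quotient rule applied to \<open>G'\<close>; \<open>Nd w v y\<close> is the
    derivative of \<open>f' (X y) v\<close> with respect to y in the direction
    \<open>w\<close>.\<close>
  define B where "B = (\<lambda>y w v. - ((Nd w (perp \<eta> v) y * f' (X y) \<eta> - f' (X y) (perp \<eta> v) * Nd w \<eta> y) * (1 / f' (X y) \<eta>) * (1 / f' (X y) \<eta>)))"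
  have fXder: "((\<lambda>y. f' (X y) v) has_derivative (\<lambda>w. Nd w v y)) (at y)" if y: "norm y < \<rho>" for y v
    unfolding Nd_def using has_derivative_compose[OF Xder[OF y] D2[OF X(2)[OF y]]] .
  have G'der: "((\<lambda>y. G' y v) has_derivative (\<lambda>w. B y w v)) (at y)" if y: "norm y < \<rho>" for y v
  proof -
    have D: "f' (X y) \<eta> \<noteq> 0" using lower[OF X(1)[OF y]] c by simp
    have "((\<lambda>y. - (f' (X y) (perp \<eta> v) / f' (X y) \<eta>)) has_derivative
        (\<lambda>w. - ((Nd w (perp \<eta> v) y * f' (X y) \<eta> - f' (X y) (perp \<eta> v) * Nd w \<eta> y) / (f' (X y) \<eta> * f' (X y) \<eta>)))) (at y)"
      by (intro has_derivative_minus has_derivative_divide' fXder y D)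
    then show ?thesis by (simp add: G'_def B_def)
  qed
  let ?S = "ball (0::'a) \<rho>"
  have dist2: "norm (y - z) \<le> 2 * norm (y - z) powr \<alpha>" if "y \<in> ?S" "z \<in> ?S" for y z
    using that \<rho> \<alpha> norm_triangle_ineq4[of y z] by (intro le_double_powr) auto
  define K1 where "K1 = C1 + 2 * K * (1 + Lp)"
  have K1: "0 \<le> K1" using C1 K Lp by (simp add: K1_def)
  have hb1: "bounded_hoelder \<alpha> ?S K1 (\<lambda>y. f' (X y) v)" if v: "norm v \<le> 1" for v
    unfolding bounded_hoelder_def
  proof (intro conjI ballI K1)
    fix y assume y: "y \<in> ?S"
    have "\<bar>f' (X y) v\<bar> \<le> C1 * norm v" using f'bd[OF X(2)] y by simp
    also have "\<dots> \<le> C1 * 1" using v C1 by (intro mult_left_mono) auto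
    finally show "\<bar>f' (X y) v\<bar> \<le> K1" using K Lp by (simp add: K1_def) (smt (verit) mult_nonneg_nonneg)
    fix z assume z: "z \<in> ?S"
    have "\<bar>f' (X y) v - f' (X z) v\<bar> \<le> K * norm v * norm (X y - X z)" using f'lip[OF X(2) X(2)] y z by simp
    also have "\<dots> \<le> K * 1 * ((1 + Lp) * (2 * norm (y - z) powr \<alpha>))"
    proof (intro mult_mono v)
      have "norm (X y - X z) \<le> (1 + Lp) * norm (y - z)" using Xlip y z by simp
      also have "\<dots> \<le> (1 + Lp) * (2 * norm (y - z) powr \<alpha>)" using dist2[OF y z] Lp by (intro mult_left_mono) auto
      finally show "norm (X y - X z) \<le> (1 + Lp) * (2 * norm (y - z) powr \<alpha>)" .
    qed (use K in auto)
    also have "\<dots> \<le> K1 * norm (y - z) powr \<alpha>" unfolding K1_def using C1 by (simp add: algebra_simps)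
    finally show "\<bar>f' (X y) v - f' (X z) v\<bar> \<le> K1 * norm (y - z) powr \<alpha>" .
  qed
  define K2 where "K2 = K * (1 + Lp)"
  have K2: "0 \<le> K2" using K Lp by (simp add: K2_def)
  have hb2: "bounded_hoelder \<alpha> ?S K2 (\<lambda>y. f'' (X y) w v)" if w: "norm w \<le> 1" and v: "norm v \<le> 1" for w v
    unfolding bounded_hoelder_def
  proof (intro conjI ballI K2)
    have wv: "norm w * norm v \<le> 1" using mult_mono[OF w v] by simp
    fix y assume y: "y \<in> ?S"
    have "\<bar>f'' (X y) w v\<bar> \<le> K * (norm w * norm v)" using bd[OF X(2)] y by (simp add: mult.assoc)
    also have "\<dots> \<le> K * (1 + Lp)" using wv K Lp by (intro mult_left_mono) auto
    finally show "\<bar>f'' (X y) w v\<bar> \<le> K2" by (simp add: K2_def)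
    fix z assume z: "z \<in> ?S"
    have "\<bar>f'' (X y) w v - f'' (X z) w v\<bar> \<le> K * norm (X y - X z) powr \<alpha> * (norm w * norm v)"
      using H[OF X(2) X(2)] y z by (simp add: mult.assoc)
    also have "\<dots> \<le> K * ((1 + Lp) * norm (y - z) powr \<alpha>) * 1"
    proof (intro mult_mono mult_left_mono wv K)
      have "norm (X y - X z) powr \<alpha> \<le> ((1 + Lp) * norm (y - z)) powr \<alpha>"
        using Xlip[of y z] y z \<alpha> by (intro powr_mono2) auto
      also have "\<dots> = (1 + Lp) powr \<alpha> * norm (y - z) powr \<alpha>" using Lp by (simp add: powr_mult)
      also have "\<dots> \<le> (1 + Lp) powr 1 * norm (y - z) powr \<alpha>" using Lp \<alpha> by (intro mult_right_mono powr_mono) auto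
      finally show "norm (X y - X z) powr \<alpha> \<le> (1 + Lp) * norm (y - z) powr \<alpha>" using Lp by simp
    qed (use K Lp in auto)
    finally show "\<bar>f'' (X y) w v - f'' (X z) w v\<bar> \<le> K2 * norm (y - z) powr \<alpha>" by (simp add: K2_def mult_ac)
  qed
  define K3 where "K3 = 1 / c + K1 / c\<^sup>2"
  have hb3: "bounded_hoelder \<alpha> ?S K3 (\<lambda>y. 1 / f' (X y) \<eta>)"
    unfolding K3_def using hb1[of \<eta>] \<eta> c lower X(1) by (intro bounded_hoelder_inverse) auto
  define K4 where "K4 = 2 * K1 * K3"
  have hb4: "bounded_hoelder \<alpha> ?S K4 (\<lambda>y. G' y w)" if w: "norm w \<le> 1" for w
  proof -
    have "norm (perp \<eta> w) \<le> 1" using norm_perp_le[OF \<eta>, of w] w by simp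
    from bounded_hoelder_minus[OF bounded_hoelder_mult[OF hb1[OF this] hb3]]
    show ?thesis by (simp add: G'_def K4_def)
  qed
  define K5 where "K5 = K2 + 2 * K4 * K2"
  have hb5: "bounded_hoelder \<alpha> ?S K5 (Nd w v)" if w: "norm w \<le> 1" and v: "norm v \<le> 1" for w v
  proof -
    have pw: "norm (perp \<eta> w) \<le> 1" using norm_perp_le[OF \<eta>, of w] w by simp
    have n1: "norm \<eta> \<le> 1" using \<eta> by simp
    have "bounded_hoelder \<alpha> ?S K5 (\<lambda>y. f'' (X y) (perp \<eta> w) v + G' y w * f'' (X y) \<eta> v)"
      unfolding K5_def by (intro bounded_hoelder_add bounded_hoelder_mult hb2 hb4 pw v w n1)
    moreover have "Nd w v y = f'' (X y) (perp \<eta> w) v + G' y w * f'' (X y) \<eta> v" if "y \<in> ?S" for y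
    proof -
      interpret bounded_linear "\<lambda>w. f'' (X y) w v" using blin2[OF X(2)] that by simp
      show ?thesis by (simp add: Nd_def X'_def add scaleR)
    qed
    ultimately show ?thesis by (simp add: bounded_hoelder_def)
  qed
  \<comment> \<open>The constants follow the rules for sums, products and reciprocals. The bounds
    are obtained for vectors of norm at most 1 and extended to all vectors by homogeneity in
    \<open>Bunit\<close>.\<close>
  define K6 where "K6 = 2 * (2 * (2 * K5 * K1 + 2 * K1 * K5) * K3) * K3"
  have hb6: "bounded_hoelder \<alpha> ?S K6 (\<lambda>y. B y w v)" if w: "norm w \<le> 1" and v: "norm v \<le> 1" for w v
  proof -
    have pv: "norm (perp \<eta> v) \<le> 1" using norm_perp_le[OF \<eta>, of v] v by simp
    have n1: "norm \<eta> \<le> 1" using \<eta> by simp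
    have "bounded_hoelder \<alpha> ?S K6 (\<lambda>y. - ((Nd w (perp \<eta> v) y * f' (X y) \<eta> + - (f' (X y) (perp \<eta> v) * Nd w \<eta> y)) * (1 / f' (X y) \<eta>) * (1 / f' (X y) \<eta>)))"
      unfolding K6_def by (intro bounded_hoelder_minus bounded_hoelder_add bounded_hoelder_mult hb1 hb3 hb5 w pv n1)
    then show ?thesis by (simp add: B_def)
  qed
  have K6: "0 \<le> K6" using hb6[of 0 0] by (simp add: bounded_hoelder_def)
  have Blin: "linear (\<lambda>w. B y w v)" if "norm y < \<rho>" for y v using G'der[OF that] has_derivative_linear by blast
  have Bscale: "B y (t *\<^sub>R w) v = t * B y w v" if "norm y < \<rho>" for y t w v
    using linear_cmul[OF Blin[OF that]] by simp
  have Bscale2: "B y w (t *\<^sub>R v) = t * B y w v" if "norm y < \<rho>" for y t w v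
  proof -
    have "Nd w (perp \<eta> (t *\<^sub>R v)) y = t * Nd w (perp \<eta> v) y"
      using linear_cmul[OF lin2[OF X(2)[OF that]]] by (simp add: Nd_def perp_scaleR)
    moreover have "f' (X y) (perp \<eta> (t *\<^sub>R v)) = t * f' (X y) (perp \<eta> v)"
      using linear_cmul[OF lin1[OF X(2)[OF that]]] by (simp add: perp_scaleR)
    ultimately show ?thesis by (simp add: B_def algebra_simps)
  qed
  have Bunit: "B y w v = norm w * norm v * B y ((1 / norm w) *\<^sub>R w) ((1 / norm v) *\<^sub>R v)" if "norm y < \<rho>" for y w v
  proof (cases "w = 0 \<or> v = 0")
    case True
    then show ?thesis using Bscale[OF that, of 0 w v] Bscale2[OF that, of w 0 v] by auto
  next
    case False
    then show ?thesis by (simp add: Bscale[OF that] Bscale2[OF that])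
  qed
  have un: "norm ((1 / norm w) *\<^sub>R w) \<le> 1" for w :: 'a by (cases "w = 0") auto
  have Bbd: "\<bar>B y w v\<bar> \<le> K6 * norm w * norm v" if y: "norm y < \<rho>" for y w v
  proof -
    have "\<bar>B y ((1 / norm w) *\<^sub>R w) ((1 / norm v) *\<^sub>R v)\<bar> \<le> K6"
      using hb6[OF un un, of w v] y by (simp add: bounded_hoelder_def)
    then have "norm w * norm v * \<bar>B y ((1 / norm w) *\<^sub>R w) ((1 / norm v) *\<^sub>R v)\<bar> \<le> norm w * norm v * K6"
      by (intro mult_left_mono) auto
    then show ?thesis by (subst Bunit[OF y]) (simp add: abs_mult mult_ac)
  qed
  have Bhoel: "\<bar>B y w v - B z w v\<bar> \<le> K6 * norm (y - z) powr \<alpha> * norm w * norm v" if y: "norm y < \<rho>" and z: "norm z < \<rho>" for y z w v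
  proof -
    let ?b = "\<lambda>y. B y ((1 / norm w) *\<^sub>R w) ((1 / norm v) *\<^sub>R v)"
    have "\<bar>?b y - ?b z\<bar> \<le> K6 * norm (y - z) powr \<alpha>"
      using hb6[OF un un, of w v] y z by (simp add: bounded_hoelder_def)
    then have *: "norm w * norm v * \<bar>?b y - ?b z\<bar> \<le> norm w * norm v * (K6 * norm (y - z) powr \<alpha>)"
      by (intro mult_left_mono) auto
    have "B y w v - B z w v = norm w * norm v * (?b y - ?b z)"
      using Bunit[OF y, of w v] Bunit[OF z, of w v] by (simp only: right_diff_distrib)
    then have "\<bar>B y w v - B z w v\<bar> = norm w * norm v * \<bar>?b y - ?b z\<bar>" by (simp add: abs_mult)
    also have "\<dots> \<le> K6 * norm (y - z) powr \<alpha> * norm w * norm v" using * by (simp only: mult_ac)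
    finally show ?thesis .
  qed
  have graph: "C2alpha_graph \<alpha> \<rho> K6 \<eta> G G' B"
  proof
    show "0 < \<alpha>" "\<alpha> \<le> 1" "0 < \<rho>" "\<rho> \<le> 1" "0 \<le> K6" "norm \<eta> = 1" "G 0 = 0" using \<alpha> \<rho> K6 \<eta> G0 by auto
    show "G (perp \<eta> y) = G y" for y by (rule G_perp)
    show "norm y < \<rho> \<Longrightarrow> (G has_derivative G' y) (at y)" for y by (rule Gder)
    show "norm y < \<rho> \<Longrightarrow> \<bar>B y z v\<bar> \<le> K6 * norm z * norm v" for y z v by (rule Bbd)
    show "norm y < \<rho> \<Longrightarrow> B y (z1 + z2) v = B y z1 v + B y z2 v" for y z1 z2 v using linear_add[OF Blin] by simp
    show "norm y < \<rho> \<Longrightarrow> B y (t *\<^sub>R z) v = t * B y z v" for y z v t by (rule Bscale)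
    show "norm y < \<rho> \<Longrightarrow> B y z (t *\<^sub>R v) = t * B y z v" for y z v t by (rule Bscale2)
    fix y z y0 v :: 'a assume y: "norm y < \<rho>" "norm (y + z) < \<rho>" and y0: "norm y0 < \<rho>"
    have inb: "norm (y + t *\<^sub>R z) < \<rho>" if "0 \<le> t" "t \<le> 1" for t
    proof -
      have "y + t *\<^sub>R z = (1 - t) *\<^sub>R y + t *\<^sub>R (y + z)" by (simp add: algebra_simps)
      then have "y + t *\<^sub>R z \<in> ?S" using convexD_alt[OF convex_ball, of y 0 \<rho> "y + z" t] y that by simp
      then show ?thesis by simp
    qed
    have "((\<lambda>t. G' (y + t *\<^sub>R z) v) has_real_derivative B (y + t *\<^sub>R z) z v) (at t)" if "0 \<le> t" "t \<le> 1" for t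
      by (rule has_real_derivative_along_line[OF G'der[OF inb[OF that]]])
    then obtain t where t: "0 < t" "t < 1" "G' (y + 1 *\<^sub>R z) v - G' (y + 0 *\<^sub>R z) v = B (y + t *\<^sub>R z) z v"
      using MVT_unit_interval[of "\<lambda>t. G' (y + t *\<^sub>R z) v" "\<lambda>t. B (y + t *\<^sub>R z) z v"] by blast
    have n: "norm (y + t *\<^sub>R z - y0) \<le> norm (y - y0) + norm z"
    proof -
      have "norm (y + t *\<^sub>R z - y0) \<le> norm (y - y0) + norm (t *\<^sub>R z)"
        using norm_triangle_ineq[of "y - y0" "t *\<^sub>R z"] by (simp add: algebra_simps)
      moreover have "norm (t *\<^sub>R z) \<le> norm z" using t mult_right_mono[of t 1 "norm z"] by simp
      ultimately show ?thesis by linarith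
    qed
    have "\<bar>G' (y + z) v - G' y v - B y0 z v\<bar> = \<bar>B (y + t *\<^sub>R z) z v - B y0 z v\<bar>" using t(3) by simp
    also have "\<dots> \<le> K6 * norm (y + t *\<^sub>R z - y0) powr \<alpha> * norm z * norm v" using inb[of t] t y0 by (intro Bhoel) auto
    also have "\<dots> \<le> K6 * (norm (y - y0) + norm z) powr \<alpha> * norm z * norm v"
      using n K6 \<alpha> by (intro mult_right_mono mult_left_mono powr_mono2) auto
    finally show "\<bar>G' (y + z) v - G' y v - B y0 z v\<bar> \<le> K6 * (norm (y - y0) + norm z) powr \<alpha> * norm z * norm v" .
  qed
  have decomp: "p0 + z = p0 + perp \<eta> z + (z \<bullet> \<eta>) *\<^sub>R \<eta>" for z by (simp add: perp_def)
  have zi: "\<bar>z \<bullet> \<eta>\<bar> \<le> a" if "norm z < \<rho>" for z using Cauchy_Schwarz_ineq2[of z \<eta>] \<eta> that \<rho> by simp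
  show ?thesis
  proof (rule that[OF graph])
    show "\<rho> \<le> R0" using \<rho> a R1 by (simp add: a_def)
    fix z :: 'a assume z: "norm z < \<rho>"
    have fz: "f (p0 + z) = f (p0 + perp \<eta> z + (z \<bullet> \<eta>) *\<^sub>R \<eta>)" by (rule arg_cong[OF decomp])
    have Gz: "\<bar>G z\<bar> \<le> a" "f (p0 + perp \<eta> z + G z *\<^sub>R \<eta>) = 0" using Gprop[OF z] by auto
    show "f (p0 + z) < 0 \<longleftrightarrow> z \<bullet> \<eta> < G z" "f (p0 + z) = 0 \<longleftrightarrow> z \<bullet> \<eta> = G z"
      unfolding fz using strict[OF z zi[OF z] Gz(1)] strict[OF z Gz(1) zi[OF z]] Gz(2)
      by (cases "z \<bullet> \<eta>" "G z" rule: linorder_cases, auto)+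
  next
    show "G' 0 v = - f' p0 (perp \<eta> v) / f' p0 \<eta>" for v
      by (simp add: G'_def X_def G0 perp_def)
  qed
qed

section \<open>Capillary sets\<close>

text \<open>Along \<open>M\<close> the quotient of N \<bullet> (x - q) by |x - q| tends to 0;
  multiplied by the norm of the difference quotient of the curve it tends to N \<bullet> v. The
  curve is one-sided so that points on the boundary of \<open>M\<close> are covered.\<close>

lemma tangent_orthogonal:
  fixes x :: "real \<Rightarrow> 'a::euclidean_space"
  assumes nu: "((\<lambda>x. (N \<bullet> (x - q)) / norm (x - q)) \<longlongrightarrow> 0) (at q within M)"
    and v: "((\<lambda>t. (1 / t) *\<^sub>R (x t - q)) \<longlongrightarrow> v) (at_right 0)"
    and xM: "eventually (\<lambda>t. x t \<in> M) (at_right 0)"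
  shows "N \<bullet> v = 0"
proof (cases "v = 0")
  case False
  have pos: "eventually (\<lambda>t::real. 0 < t) (at_right 0)" by (simp add: eventually_at_filter)
  have "eventually (\<lambda>t. (1 / t) *\<^sub>R (x t - q) \<noteq> 0) (at_right 0)"
    using tendsto_imp_eventually_ne[OF v False] .
  then have ne: "eventually (\<lambda>t. x t \<noteq> q) (at_right 0)" by (rule eventually_mono) auto
  have "((\<lambda>t. t *\<^sub>R ((1 / t) *\<^sub>R (x t - q))) \<longlongrightarrow> 0 *\<^sub>R v) (at_right 0)"
    by (intro tendsto_scaleR v tendsto_ident_at)
  then have "((\<lambda>t. x t - q) \<longlongrightarrow> 0 *\<^sub>R v) (at_right 0)"
    by (rule Lim_transform_eventually) (rule eventually_mono[OF pos], simp)
  then have "((\<lambda>t. x t - q) \<longlongrightarrow> 0) (at_right 0)" by simp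
  then have "(x \<longlongrightarrow> q) (at_right 0)" by (rule LIM_zero_cancel)
  then have "filterlim x (at q within M) (at_right 0)"
    unfolding filterlim_at using eventually_conj[OF xM ne] by blast
  from filterlim_compose[OF nu this]
  have 1: "((\<lambda>t. (N \<bullet> (x t - q)) / norm (x t - q)) \<longlongrightarrow> 0) (at_right 0)" .
  have 2: "((\<lambda>t. norm ((1 / t) *\<^sub>R (x t - q))) \<longlongrightarrow> norm v) (at_right 0)" using v by (rule tendsto_norm)
  have "((\<lambda>t. (N \<bullet> (x t - q)) / norm (x t - q) * norm ((1 / t) *\<^sub>R (x t - q))) \<longlongrightarrow> 0 * norm v) (at_right 0)"
    by (rule tendsto_mult[OF 1 2])
  then have "((\<lambda>t. N \<bullet> ((1 / t) *\<^sub>R (x t - q))) \<longlongrightarrow> 0 * norm v) (at_right 0)"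
    by (rule Lim_transform_eventually) (rule eventually_mono[OF eventually_conj[OF pos ne]], simp)
  then have "((\<lambda>t. N \<bullet> ((1 / t) *\<^sub>R (x t - q))) \<longlongrightarrow> 0) (at_right 0)" by simp
  moreover have "((\<lambda>t. N \<bullet> ((1 / t) *\<^sub>R (x t - q))) \<longlongrightarrow> N \<bullet> v) (at_right 0)" by (intro tendsto_intros v)
  ultimately show ?thesis using tendsto_unique trivial_limit_at_right_real by blast
qed simp

lemma difference_quotient_at_right:
  fixes x :: "real \<Rightarrow> 'a::real_normed_vector"
  assumes "(x has_derivative (\<lambda>h. h *\<^sub>R v)) (at 0)"
  shows "((\<lambda>t. (1 / t) *\<^sub>R (x t - x 0)) \<longlongrightarrow> v) (at_right 0)"
proof -
  have "((\<lambda>t. norm (x t - x 0 - (t - 0) *\<^sub>R v) / norm (t - 0)) \<longlongrightarrow> 0) (at 0)"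
    using assms unfolding has_derivative_iff_norm by blast
  then have "((\<lambda>t. norm (x t - x 0 - (t - 0) *\<^sub>R v) / norm (t - 0)) \<longlongrightarrow> 0) (at_right 0)"
    unfolding filterlim_at_split by blast
  then have "((\<lambda>t. norm ((1 / t) *\<^sub>R (x t - x 0) - v)) \<longlongrightarrow> 0) (at_right 0)"
  proof (rule Lim_transform_eventually)
    have "norm (x t - x 0 - (t - 0) *\<^sub>R v) / norm (t - 0) = norm ((1 / t) *\<^sub>R (x t - x 0) - v)" if "0 < t" for t
    proof -
      have "(1 / t) *\<^sub>R (x t - x 0) - v = (1 / t) *\<^sub>R (x t - x 0 - (t - 0) *\<^sub>R v)"
        using that by (simp add: scaleR_diff_right)
      then show ?thesis using that by simp
    qed
    moreover have "eventually (\<lambda>t::real. 0 < t) (at_right 0)" by (simp add: eventually_at_filter)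
    ultimately show "eventually (\<lambda>t. norm (x t - x 0 - (t - 0) *\<^sub>R v) / norm (t - 0) = norm ((1 / t) *\<^sub>R (x t - x 0) - v)) (at_right 0)"
      by (auto elim!: eventually_mono)
  qed
  then have "((\<lambda>t. (1 / t) *\<^sub>R (x t - x 0) - v) \<longlongrightarrow> 0) (at_right 0)" by (rule tendsto_norm_zero_cancel)
  then show ?thesis by (simp only: LIM_zero_iff)
qed

locale capillary =
  fixes s \<alpha> \<sigma> :: real and k :: "'n::finite" and E M :: "(real^'n) set" and nu :: "real^'n \<Rightarrow> real^'n"
  assumes n2: "CARD('n) \<ge> 2"
    and s01: "0 < s" "s < 1"
    and alpha: "s < \<alpha>" "\<alpha> < 1"
    and E_open: "open E" and E_bdd: "bounded E"
    and E_sub: "E \<subseteq> halfspace k"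
    and M_def: "M = closure (frontier E \<inter> halfspace k)"
    and M_hyp: "C2alpha_hypersurface_with_boundary \<alpha> M (M \<inter> {x. x $ k = 0})"
    and nu: "outer_unit_normal k E M nu"
    and sigma: "-1 < \<sigma>" "\<sigma> < 1"
    and angle: "\<forall>q \<in> M \<inter> {x. x $ k = 0}. nu q \<bullet> (- axis k 1) = \<sigma>"
begin

lemma nu_norm: "q \<in> M \<Longrightarrow> norm (nu q) = 1"
  using nu by (simp add: outer_unit_normal_def)

lemma nu_tangent: "q \<in> M \<Longrightarrow> ((\<lambda>x. (nu q \<bullet> (x - q)) / norm (x - q)) \<longlongrightarrow> 0) (at q within M)"
  using nu by (simp add: outer_unit_normal_def)

lemma nu_continuous: "continuous_on M nu"
  using nu by (simp add: outer_unit_normal_def)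

lemma nu_sides:
  assumes "q \<in> M" "0 < q $ k"
  shows "\<exists>r>0. \<forall>t. 0 < t \<and> t < r \<longrightarrow> q + t *\<^sub>R nu q \<notin> E \<and> q - t *\<^sub>R nu q \<in> E"
proof -
  have "q \<in> M \<inter> halfspace k" using assms by (simp add: halfspace_def)
  then show ?thesis using nu unfolding outer_unit_normal_def by blast
qed

lemma M_closed: "closed M"
  by (simp add: M_def)

lemma frontier_in_M: "x \<in> frontier E \<Longrightarrow> 0 < x $ k \<Longrightarrow> x \<in> M"
  unfolding M_def using closure_subset by (force simp: halfspace_def)

lemma M_height: "q \<in> M \<Longrightarrow> 0 \<le> q $ k"
proof -
  assume "q \<in> M"
  moreover have "M \<subseteq> {x. 0 \<le> x $ k}" unfolding M_def
    by (intro closure_minimal) (auto simp: halfspace_def closed_halfspace_component_ge_cart)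
  ultimately show ?thesis by auto
qed

lemma M_closure: "q \<in> M \<Longrightarrow> q \<in> closure E"
proof -
  assume "q \<in> M"
  moreover have "M \<subseteq> closure E" unfolding M_def
    by (intro closure_minimal) (auto simp: frontier_def)
  ultimately show ?thesis by auto
qed

text \<open>Up to sign, \<open>f\<close> is the component of the chart that vanishes on
  \<open>M\<close>. Half of the vectors in the kernel of its differential at \<open>p0\<close> are
  velocities of one-sided curves in \<open>M\<close>, hence orthogonal to \<open>nu p0\<close>, and
  the other half follows by a change of sign. So the differential is a multiple of the normal, and
  the sign of \<open>f\<close> makes it a positive one. The last clause, by continuity, fixes the
  direction of increase at nearby points of \<open>M\<close>.\<close>

lemma chart_function:
  assumes p0: "p0 \<in> M"
  obtains f :: "real^'n \<Rightarrow> real" and f' f'' R0 K a \<rho> where "0 < R0" "0 \<le> K" "0 < a" "0 < \<rho>"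
    "\<And>x. x \<in> ball p0 R0 \<Longrightarrow> (f has_derivative f' x) (at x)"
    "\<And>x v. x \<in> ball p0 R0 \<Longrightarrow> ((\<lambda>x. f' x v) has_derivative (\<lambda>w. f'' x w v)) (at x)"
    "\<And>x w. x \<in> ball p0 R0 \<Longrightarrow> linear (f'' x w)"
    "\<And>x y w v. x \<in> ball p0 R0 \<Longrightarrow> y \<in> ball p0 R0 \<Longrightarrow> \<bar>f'' x w v - f'' y w v\<bar> \<le> K * norm (x - y) powr \<alpha> * norm w * norm v"
    "\<And>x w v. x \<in> ball p0 R0 \<Longrightarrow> \<bar>f'' x w v\<bar> \<le> K * norm w * norm v"
    "\<And>v. f' p0 v = a * (nu p0 \<bullet> v)"
    "\<And>q. q \<in> M \<Longrightarrow> q \<in> ball p0 R0 \<Longrightarrow> f q = 0"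
    "\<And>q. q \<in> M \<Longrightarrow> q \<in> ball p0 \<rho> \<Longrightarrow> 0 < f' q (nu q)"
proof -
  obtain U V \<phi> i j where U: "p0 \<in> U" "i \<noteq> j" "C2alpha_diffeo \<alpha> \<phi> U V"
    "\<phi> ` (M \<inter> U) = V \<inter> {y. y $ i = 0 \<and> y $ j \<ge> 0}"
    using bspec[OF conjunct2[OF M_hyp[unfolded C2alpha_hypersurface_with_boundary_def]] p0] by (elim exE conjE)
  define \<psi> where "\<psi> = inv_into U \<phi>"
  have V: "open U" "open V" "\<phi> ` U = V" "inj_on \<phi> U" "C2alpha \<alpha> \<phi> U" "C2alpha \<alpha> \<psi> V"
    using U(3) by (auto simp: C2alpha_diffeo_def \<psi>_def)
  obtain \<phi>' \<phi>'' L where \<phi>: "\<And>x. x \<in> U \<Longrightarrow> (\<phi> has_derivative blinfun_apply (\<phi>' x)) (at x)"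
     "\<And>x. x \<in> U \<Longrightarrow> (\<phi>' has_derivative blinfun_apply (\<phi>'' x)) (at x)"
     "\<And>x y. x \<in> U \<Longrightarrow> y \<in> U \<Longrightarrow> norm (\<phi>'' x - \<phi>'' y) \<le> L * dist x y powr \<alpha>"
    using V(5) unfolding C2alpha_def by blast
  obtain \<psi>' where \<psi>: "\<And>y. y \<in> V \<Longrightarrow> (\<psi> has_derivative blinfun_apply (\<psi>' y)) (at y)"
    using V(6) unfolding C2alpha_def by blast
  define y0 where "y0 = \<phi> p0"
  have y0: "y0 \<in> V" "y0 $ i = 0" "0 \<le> y0 $ j" "\<psi> y0 = p0"
    using U p0 V by (auto simp: y0_def \<psi>_def)
  have inv1: "\<psi>' y0 (\<phi>' p0 v) = v" for v
  proof -
    have "((\<lambda>x. \<psi> (\<phi> x)) has_derivative (\<lambda>v. \<psi>' y0 (\<phi>' p0 v))) (at p0)"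
      using has_derivative_compose[OF \<phi>(1)[OF U(1)], of \<psi> "\<psi>' y0"] \<psi>[OF y0(1)] by (simp add: y0_def)
    moreover have "((\<lambda>x. \<psi> (\<phi> x)) has_derivative (\<lambda>v. v)) (at p0)"
      by (rule has_derivative_transform_within_open[OF has_derivative_ident V(1) U(1)]) (use V in \<open>auto simp: \<psi>_def\<close>)
    ultimately show ?thesis using has_derivative_unique by metis
  qed
  have inv2: "\<phi>' p0 (\<psi>' y0 w) = w" for w
  proof -
    have "((\<lambda>y. \<phi> (\<psi> y)) has_derivative (\<lambda>w. \<phi>' p0 (\<psi>' y0 w))) (at y0)"
      using has_derivative_compose[OF \<psi>[OF y0(1)], of \<phi> "\<phi>' p0"] \<phi>(1)[OF U(1)] by (simp add: y0)
    moreover have "((\<lambda>y. \<phi> (\<psi> y)) has_derivative (\<lambda>v. v)) (at y0)"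
      by (rule has_derivative_transform_within_open[OF has_derivative_ident V(2) y0(1)]) (use V in \<open>auto simp: \<psi>_def f_inv_into_f\<close>)
    ultimately show ?thesis using has_derivative_unique by metis
  qed
  have half: "nu p0 \<bullet> v = 0" if v: "\<phi>' p0 v $ i = 0" "0 \<le> \<phi>' p0 v $ j" for v
  proof (rule tangent_orthogonal[OF nu_tangent[OF p0]])
    let ?c = "\<lambda>t. y0 + t *\<^sub>R \<phi>' p0 v"
    have c: "(?c has_derivative (\<lambda>h. h *\<^sub>R \<phi>' p0 v)) (at 0)" by (auto intro!: derivative_eq_intros)
    have "((\<lambda>t. \<psi> (?c t)) has_derivative (\<lambda>h. \<psi>' y0 (h *\<^sub>R \<phi>' p0 v))) (at 0)"
      using has_derivative_compose[OF c, of \<psi> "\<psi>' y0"] \<psi>[OF y0(1)] by simp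
    moreover have "\<psi>' y0 (h *\<^sub>R \<phi>' p0 v) = h *\<^sub>R v" for h using inv1 by (simp add: blinfun.scaleR_right)
    ultimately have "((\<lambda>t. \<psi> (?c t)) has_derivative (\<lambda>h. h *\<^sub>R v)) (at 0)" by simp
    from difference_quotient_at_right[OF this]
    show "((\<lambda>t. (1 / t) *\<^sub>R (\<psi> (?c t) - p0)) \<longlongrightarrow> v) (at_right 0)" by (simp add: y0)
    have "(?c \<longlongrightarrow> y0 + 0 *\<^sub>R \<phi>' p0 v) (at_right 0)" by (intro tendsto_intros)
    then have "eventually (\<lambda>t. ?c t \<in> V) (at_right 0)" using topological_tendstoD[OF _ V(2)] y0(1) by fastforce
    moreover have "eventually (\<lambda>t::real. 0 < t) (at_right 0)" by (simp add: eventually_at_filter)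
    ultimately show "eventually (\<lambda>t. \<psi> (?c t) \<in> M) (at_right 0)"
    proof (rule eventually_elim2)
      fix t :: real assume t: "?c t \<in> V" "0 < t"
      then have "?c t \<in> V \<inter> {y. y $ i = 0 \<and> y $ j \<ge> 0}" using v y0 by auto
      then obtain x where "x \<in> M \<inter> U" "?c t = \<phi> x" using U(4) by blast
      then show "\<psi> (?c t) \<in> M" using V(4) by (simp add: \<psi>_def)
    qed
  qed
  have tang: "nu p0 \<bullet> v = 0" if v: "\<phi>' p0 v $ i = 0" for v
  proof (cases "0 \<le> \<phi>' p0 v $ j")
    case False
    then have "nu p0 \<bullet> (- v) = 0" using v by (intro half) (auto simp: blinfun.minus_right)
    then show ?thesis by simp
  qed (use half v in auto)
  \<comment> \<open>The vector that the differential of the chart sends to the i-th axis; every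
    \<open>h\<close> differs from a multiple of it by a vector to which \<open>tang\<close>
    applies.\<close>
  define h0 where "h0 = \<psi>' y0 (axis i 1)"
  have h0: "\<phi>' p0 h0 $ i = 1" by (simp add: h0_def inv2)
  have nuh: "nu p0 \<bullet> h = (\<phi>' p0 h $ i) * (nu p0 \<bullet> h0)" for h
  proof -
    have "nu p0 \<bullet> (h - (\<phi>' p0 h $ i) *\<^sub>R h0) = 0"
      by (rule tang) (simp add: blinfun.diff_right blinfun.scaleR_right h0)
    then show ?thesis by (simp add: inner_diff_right)
  qed
  define A where "A = \<phi>' p0 (nu p0) $ i"
  have A1: "1 = A * (nu p0 \<bullet> h0)" using nuh[of "nu p0"] nu_norm[OF p0] by (simp add: A_def norm_eq_1)
  then have A0: "A \<noteq> 0" by auto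
  have Ah: "\<phi>' p0 h $ i = A * (nu p0 \<bullet> h)" for h
  proof -
    have "A * (nu p0 \<bullet> h) = (\<phi>' p0 h $ i) * (A * (nu p0 \<bullet> h0))" using nuh[of h] by simp
    then show ?thesis using A1 by simp
  qed
  define c where "c = sgn A"
  have c: "c * A = \<bar>A\<bar>" "\<bar>c\<bar> = 1" using A0 by (auto simp: c_def sgn_if)
  obtain R0 where R0: "0 < R0" "ball p0 R0 \<subseteq> U" using V(1) U(1) openE by blast
  define f where "f = (\<lambda>x. c * \<phi> x $ i)"
  define f' where "f' = (\<lambda>x v. c * \<phi>' x v $ i)"
  define f'' where "f'' = (\<lambda>x w v. c * (\<phi>'' x w) v $ i)"
  define K where "K = \<bar>L\<bar> + norm (\<phi>'' p0) + \<bar>L\<bar> * R0 powr \<alpha>"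
  have K: "0 \<le> K" "\<bar>L\<bar> \<le> K" by (auto simp: K_def)
  have d1: "(f has_derivative f' x) (at x)" if "x \<in> ball p0 R0" for x
  proof -
    have "x \<in> U" using that R0 by auto
    then have "((\<lambda>x. c * (\<phi> x $ i)) has_derivative (\<lambda>v. c * (\<phi>' x v $ i))) (at x)"
      by (intro has_derivative_mult_right bounded_linear.has_derivative[OF bounded_linear_vec_nth] \<phi>)
    then show ?thesis by (simp add: f_def f'_def)
  qed
  have d2: "((\<lambda>x. f' x v) has_derivative (\<lambda>w. f'' x w v)) (at x)" if "x \<in> ball p0 R0" for x v
  proof -
    have "x \<in> U" using that R0 by auto
    have bl: "bounded_linear (\<lambda>T::(real^'n) \<Rightarrow>\<^sub>L (real^'n). blinfun_apply T v $ i)"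
      using bounded_linear_compose[OF bounded_linear_vec_nth blinfun.bounded_linear_left] .
    have "((\<lambda>x. c * (\<phi>' x v $ i)) has_derivative (\<lambda>w. c * (\<phi>'' x w v $ i))) (at x)"
      by (intro has_derivative_mult_right bounded_linear.has_derivative[OF bl] \<phi>(2) \<open>x \<in> U\<close>)
    then show ?thesis by (simp add: f'_def f''_def)
  qed
  have d3: "linear (f'' x w)" for x w
    unfolding f''_def by (intro linearI) (auto simp: blinfun.add_right blinfun.scaleR_right algebra_simps)
  have comp: "\<bar>c * (T w v $ i)\<bar> \<le> norm T * norm w * norm v" for T :: "(real^'n) \<Rightarrow>\<^sub>L ((real^'n) \<Rightarrow>\<^sub>L (real^'n))" and w v
  proof -
    have "\<bar>c * (T w v $ i)\<bar> = \<bar>T w v $ i\<bar>" using c by (simp add: abs_mult)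
    also have "\<dots> \<le> norm (T w v)" by (rule component_le_norm_cart)
    also have "\<dots> \<le> norm (T w) * norm v" by (rule norm_blinfun)
    also have "\<dots> \<le> (norm T * norm w) * norm v" by (intro mult_right_mono norm_blinfun) auto
    finally show ?thesis .
  qed
  have d4: "\<bar>f'' x w v - f'' y w v\<bar> \<le> K * norm (x - y) powr \<alpha> * norm w * norm v" if "x \<in> ball p0 R0" "y \<in> ball p0 R0" for x y w v
  proof -
    have "\<bar>f'' x w v - f'' y w v\<bar> \<le> norm (\<phi>'' x - \<phi>'' y) * norm w * norm v"
      using comp[of "\<phi>'' x - \<phi>'' y" w v] by (simp add: f''_def blinfun.diff_left algebra_simps)
    also have "\<dots> \<le> (K * norm (x - y) powr \<alpha>) * norm w * norm v"
    proof (intro mult_right_mono)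
      have "norm (\<phi>'' x - \<phi>'' y) \<le> L * dist x y powr \<alpha>" using that R0 by (intro \<phi>(3)) auto
      also have "\<dots> \<le> K * dist x y powr \<alpha>" using K by (intro mult_right_mono) auto
      finally show "norm (\<phi>'' x - \<phi>'' y) \<le> K * norm (x - y) powr \<alpha>" by (simp add: dist_norm)
    qed auto
    finally show ?thesis .
  qed
  have d5: "\<bar>f'' x w v\<bar> \<le> K * norm w * norm v" if "x \<in> ball p0 R0" for x w v
  proof -
    have "norm (\<phi>'' x) \<le> norm (\<phi>'' p0) + norm (\<phi>'' x - \<phi>'' p0)" using norm_triangle_sub[of "\<phi>'' x" "\<phi>'' p0"] by simp
    also have "norm (\<phi>'' x - \<phi>'' p0) \<le> L * dist x p0 powr \<alpha>" using that R0 U by (intro \<phi>(3)) auto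
    also have "\<dots> \<le> \<bar>L\<bar> * R0 powr \<alpha>" using that alpha s01 by (intro mult_mono powr_mono2) (auto simp: dist_commute)
    finally have "norm (\<phi>'' x) \<le> K" by (simp add: K_def)
    then have "norm (\<phi>'' x) * norm w * norm v \<le> K * norm w * norm v" by (intro mult_right_mono) auto
    then show ?thesis using comp[of "\<phi>'' x" w v] by (simp add: f''_def)
  qed
  have d6: "f' p0 v = \<bar>A\<bar> * (nu p0 \<bullet> v)" for v
    using c(1) Ah[of v] by (simp add: f'_def mult.assoc[symmetric])
  have d7: "f q = 0" if "q \<in> M" "q \<in> ball p0 R0" for q
  proof -
    have "\<phi> q \<in> \<phi> ` (M \<inter> U)" using that R0 by auto
    then show ?thesis using U(4) by (simp add: f_def)
  qed
  have "\<exists>\<rho>>0. \<forall>q\<in>M. q \<in> ball p0 \<rho> \<longrightarrow> 0 < f' q (nu q)"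
  proof -
    have "continuous (at p0 within M) \<phi>'"
      using has_derivative_continuous[OF \<phi>(2)[OF U(1)]] continuous_at_imp_continuous_at_within by blast
    moreover have "continuous (at p0 within M) nu" using nu_continuous p0 by (simp add: continuous_on_eq_continuous_within)
    ultimately have "((\<lambda>q. c * (\<phi>' q (nu q)) $ i) \<longlongrightarrow> c * (\<phi>' p0 (nu p0)) $ i) (at p0 within M)"
      unfolding continuous_within by (intro tendsto_intros) auto
    moreover have "0 < c * (\<phi>' p0 (nu p0)) $ i" using c A0 by (simp add: A_def)
    ultimately have "eventually (\<lambda>q. 0 < f' q (nu q)) (at p0 within M)"
      unfolding f'_def by (intro order_tendstoD(1)) auto
    then obtain \<rho> where \<rho>: "0 < \<rho>" "\<And>q. q \<in> M \<Longrightarrow> q \<noteq> p0 \<Longrightarrow> dist q p0 < \<rho> \<Longrightarrow> 0 < f' q (nu q)"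
      unfolding eventually_at by blast
    have "0 < f' p0 (nu p0)" using d6 A0 nu_norm[OF p0] by (simp add: norm_eq_1)
    then show ?thesis using \<rho> by (intro exI[of _ \<rho>]) (auto simp: dist_commute)
  qed
  then obtain \<rho> where "0 < \<rho>" "\<And>q. q \<in> M \<Longrightarrow> q \<in> ball p0 \<rho> \<Longrightarrow> 0 < f' q (nu q)" by blast
  then show ?thesis
    using that[of R0 K "\<bar>A\<bar>" \<rho> f f' f''] R0(1) K(1) A0 d1 d2 d3 d4 d5 d6 d7 by simp
qed


text \<open>The hypersurface condition describes the boundary of \<open>E\<close> and not
  \<open>E\<close> itself. Off the graph there are no boundary points of \<open>E\<close> near
  \<open>p0\<close>, so \<open>E\<close> contains or misses each side, provided the sides are
  connected; which of the two occurs is decided at a single boundary point.\<close>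

lemma local_graph:
  assumes p0: "p0 \<in> M" and \<eta>: "norm \<eta> = 1" "0 < nu p0 \<bullet> \<eta>" and hor: "0 < p0 $ k \<or> \<eta> $ k = 0"
  obtains r \<Lambda> G G' B where "C2alpha_graph \<alpha> r \<Lambda> \<eta> G G' B"
    "\<And>z. norm z < r \<Longrightarrow> 0 < (p0 + z) $ k \<Longrightarrow> p0 + z \<in> E \<longleftrightarrow> z \<bullet> \<eta> < G z"
    "\<And>v. G' 0 v = - (nu p0 \<bullet> perp \<eta> v) / (nu p0 \<bullet> \<eta>)"
    "0 < p0 $ k \<Longrightarrow> r \<le> p0 $ k"
proof -
  obtain f :: "real^'n \<Rightarrow> real" and f' f'' R0 K a \<rho> where f: "0 < R0" "0 \<le> K" "0 < a" "0 < \<rho>"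
    "\<And>x. x \<in> ball p0 R0 \<Longrightarrow> (f has_derivative f' x) (at x)"
    "\<And>x v. x \<in> ball p0 R0 \<Longrightarrow> ((\<lambda>x. f' x v) has_derivative (\<lambda>w. f'' x w v)) (at x)"
    "\<And>x w. x \<in> ball p0 R0 \<Longrightarrow> linear (f'' x w)"
    "\<And>x y w v. x \<in> ball p0 R0 \<Longrightarrow> y \<in> ball p0 R0 \<Longrightarrow> \<bar>f'' x w v - f'' y w v\<bar> \<le> K * norm (x - y) powr \<alpha> * norm w * norm v"
    "\<And>x w v. x \<in> ball p0 R0 \<Longrightarrow> \<bar>f'' x w v\<bar> \<le> K * norm w * norm v"
    and f6: "\<And>v. f' p0 v = a * (nu p0 \<bullet> v)"
    and f7: "\<And>q. q \<in> M \<Longrightarrow> q \<in> ball p0 R0 \<Longrightarrow> f q = 0"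
    and f8: "\<And>q. q \<in> M \<Longrightarrow> q \<in> ball p0 \<rho> \<Longrightarrow> 0 < f' q (nu q)"
    by (rule chart_function[OF p0], rule that) assumption+
  have al: "0 < \<alpha>" "\<alpha> \<le> 1" using alpha s01 by auto
  have fp0: "f p0 = 0" using f7[OF p0] f(1) by simp
  have fpe: "0 < f' p0 \<eta>" using f6 f(3) \<eta> by simp
  obtain r0 \<Lambda> G G' B where G: "C2alpha_graph \<alpha> r0 \<Lambda> \<eta> G G' B" "r0 \<le> R0"
    and Gneg: "\<And>z. norm z < r0 \<Longrightarrow> f (p0 + z) < 0 \<longleftrightarrow> z \<bullet> \<eta> < G z"
    and Gzero: "\<And>z. norm z < r0 \<Longrightarrow> f (p0 + z) = 0 \<longleftrightarrow> z \<bullet> \<eta> = G z"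
    and G'0: "\<And>v. G' 0 v = - f' p0 (perp \<eta> v) / f' p0 \<eta>"
    by (rule implicit_graph[OF f(1) al f(2) \<eta>(1) f(5-9) fp0 fpe], assumption+, rule that) assumption+
  interpret C2alpha_graph \<alpha> r0 \<Lambda> \<eta> G G' B by (rule G(1))
  \<comment> \<open>At positive height the ball is kept inside H; at points of \<partial>H the
    direction \<eta> is horizontal, so that shifts along \<eta> keep the height.\<close>
  define R where "R = (if 0 < p0 $ k then min r0 (p0 $ k) else r0)"
  have R: "0 < R" "R \<le> r0" "0 < p0 $ k \<Longrightarrow> R \<le> p0 $ k" using r by (auto simp: R_def)
  define \<delta> where "\<delta> = R / 4"
  have \<delta>: "0 < \<delta>" using R by (simp add: \<delta>_def)
  have "isCont G 0" using deriv[of 0] r by (intro has_derivative_continuous) auto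
  then have "((\<lambda>y. G y) \<longlongrightarrow> 0) (at 0)" by (simp add: isCont_def G0)
  then have "eventually (\<lambda>y. \<bar>G y\<bar> < \<delta> / 2) (at 0)"
    using tendstoD[of G 0 "at 0" "\<delta>/2"] \<delta> by simp
  then obtain \<delta>1 where \<delta>1: "0 < \<delta>1" "\<And>y. y \<noteq> 0 \<Longrightarrow> norm y < \<delta>1 \<Longrightarrow> \<bar>G y\<bar> < \<delta> / 2"
    unfolding eventually_at by auto
  have \<delta>1': "\<bar>G y\<bar> < \<delta> / 2" if "norm y < \<delta>1" for y using \<delta>1(2)[of y] that G0 \<delta> by (cases "y = 0") auto
  define r' where "r' = min \<delta>1 (\<delta> / 2)"
  have r': "0 < r'" "r' \<le> \<delta>1" "r' \<le> \<delta> / 2" "r' \<le> R" using \<delta>1 \<delta> by (auto simp: r'_def \<delta>_def)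
  have Gshift: "G (z + t *\<^sub>R \<eta>) = G z" for z t
    using G_perp[of "z + t *\<^sub>R \<eta>"] G_perp[of z] \<eta> by (simp add: perp_add perp_scaleR perp_self)
  have height: "0 < (p0 + z + t *\<^sub>R \<eta>) $ k" if "0 < (p0 + z) $ k" "norm (z + t *\<^sub>R \<eta>) < R" for z t
  proof (cases "0 < p0 $ k")
    case True
    have "\<bar>(z + t *\<^sub>R \<eta>) $ k\<bar> < R" using component_le_norm_cart[of "z + t *\<^sub>R \<eta>" k] that by linarith
    then show ?thesis using R(3)[OF True] by (simp add: add.assoc)
  next
    case False
    then show ?thesis using hor that by simp
  qed
  text \<open>For \<open>\<tau> = -1\<close> this treats the side of \<open>E\<close>, for \<open>\<tau> = 1\<close> the exterior side: both are connected
    near \<open>p0\<close> and do not meet the boundary of \<open>E\<close>.\<close>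
  have side: "p0 + z1 \<in> E \<longleftrightarrow> p0 + z2 \<in> E"
    if \<tau>: "\<tau> = 1 \<or> \<tau> = -1" and z: "norm z1 < r'" "norm z2 < r'" "0 < (p0 + z1) $ k" "0 < (p0 + z2) $ k"
      "0 < \<tau> * (z1 \<bullet> \<eta> - G z1)" "0 < \<tau> * (z2 \<bullet> \<eta> - G z2)" for \<tau> z1 z2
  proof -
    define good where "good = (\<lambda>z. norm z < R \<and> 0 < (p0 + z) $ k \<and> 0 < \<tau> * (z \<bullet> \<eta> - G z))"
    have nofr: "p0 + z \<notin> frontier E" if "good z" for z
    proof
      assume fr: "p0 + z \<in> frontier E"
      have "p0 + z \<in> M" using frontier_in_M[OF fr] that by (simp add: good_def)
      then have "f (p0 + z) = 0" using f7 that R G(2) by (simp add: good_def dist_norm)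
      then have "z \<bullet> \<eta> = G z" using Gzero[of z] that R by (simp add: good_def)
      then show False using that by (simp add: good_def)
    qed
    define seg where "seg = (\<lambda>z. (\<lambda>t. p0 + z + (\<tau> * t) *\<^sub>R \<eta>) ` {0..\<delta>})"
    define T where "T = {x. x \<in> ball (p0 + (\<tau> * \<delta>) *\<^sub>R \<eta>) r' \<and> 0 < x $ k}"
    have \<tau>1: "\<tau> * \<tau> = 1" "\<bar>\<tau>\<bar> = 1" using \<tau> by auto
    have segc: "connected (seg z)" for z
      unfolding seg_def by (intro connected_continuous_image continuous_intros) auto
    have Tc: "connected T"
    proof -
      have "convex {x::real^'n. 0 < x $ k}" using convex_halfspace_gt[of 0 "axis k (1::real)"] by (simp add: inner_axis' inner_real_def)
      then have "convex (ball (p0 + (\<tau> * \<delta>) *\<^sub>R \<eta>) r' \<inter> {x. 0 < x $ k})" by (intro convex_Int convex_ball)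
      moreover have "T = ball (p0 + (\<tau> * \<delta>) *\<^sub>R \<eta>) r' \<inter> {x. 0 < x $ k}" by (auto simp: T_def)
      ultimately show ?thesis by (simp only: convex_connected)
    qed
    have seggood: "\<exists>w. x = p0 + w \<and> good w" if x: "x \<in> seg z" and z: "norm z < r'" "0 < (p0 + z) $ k" "0 < \<tau> * (z \<bullet> \<eta> - G z)" for x z
    proof -
      obtain t where t: "0 \<le> t" "t \<le> \<delta>" "x = p0 + z + (\<tau> * t) *\<^sub>R \<eta>" using x by (auto simp: seg_def)
      have "norm (z + (\<tau> * t) *\<^sub>R \<eta>) \<le> norm z + \<bar>\<tau> * t\<bar>" using norm_triangle_ineq[of z "(\<tau> * t) *\<^sub>R \<eta>"] \<eta> by simp
      also have "\<dots> \<le> norm z + \<delta>" using t \<tau>1 by (simp add: abs_mult)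
      also have "\<dots> < R" using z(1) r' \<delta> by (simp add: \<delta>_def)
      finally have n: "norm (z + (\<tau> * t) *\<^sub>R \<eta>) < R" .
      have "\<tau> * ((z + (\<tau> * t) *\<^sub>R \<eta>) \<bullet> \<eta> - G (z + (\<tau> * t) *\<^sub>R \<eta>)) = \<tau> * (z \<bullet> \<eta> - G z) + (\<tau> * \<tau>) * t"
        using \<eta> by (simp add: Gshift inner_add_left norm_eq_1 algebra_simps)
      then have "0 < \<tau> * ((z + (\<tau> * t) *\<^sub>R \<eta>) \<bullet> \<eta> - G (z + (\<tau> * t) *\<^sub>R \<eta>))" using z(3) t \<tau>1 by simp
      then have "good (z + (\<tau> * t) *\<^sub>R \<eta>)" using n height[OF z(2) n] by (simp add: good_def add.assoc)
      then show ?thesis using t by (intro exI[of _ "z + (\<tau> * t) *\<^sub>R \<eta>"]) (simp add: add.assoc)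
    qed
    have Tgood: "\<exists>w. x = p0 + w \<and> good w" if x: "x \<in> T" for x
    proof -
      define w where "w = x - p0"
      define w0 where "w0 = w + (- (\<tau> * \<delta>)) *\<^sub>R \<eta>"
      have "w0 = x - (p0 + (\<tau> * \<delta>) *\<^sub>R \<eta>)" by (simp add: w0_def w_def)
      then have w0: "norm w0 < r'" using x by (simp add: T_def dist_norm norm_minus_commute)
      have w: "w = w0 + (\<tau> * \<delta>) *\<^sub>R \<eta>" by (simp add: w0_def)
      have "norm w \<le> norm w0 + \<bar>\<tau> * \<delta>\<bar>" unfolding w using norm_triangle_ineq[of w0 "(\<tau> * \<delta>) *\<^sub>R \<eta>"] \<eta> by simp
      also have "\<dots> < R" using w0 r' \<delta> \<tau>1 by (simp add: abs_mult \<delta>_def)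
      finally have n: "norm w < R" .
      have "\<tau> * (w \<bullet> \<eta> - G w) = \<tau> * (w0 \<bullet> \<eta> - G w0) + (\<tau> * \<tau>) * \<delta>"
        unfolding w using \<eta> by (simp add: Gshift inner_add_left norm_eq_1 algebra_simps)
      moreover have "\<bar>\<tau> * (w0 \<bullet> \<eta> - G w0)\<bar> < \<delta>"
      proof -
        have "\<bar>w0 \<bullet> \<eta>\<bar> \<le> norm w0" using Cauchy_Schwarz_ineq2[of w0 \<eta>] \<eta> by simp
        moreover have "\<bar>G w0\<bar> < \<delta> / 2" using w0 r' by (intro \<delta>1') auto
        ultimately have "\<bar>w0 \<bullet> \<eta> - G w0\<bar> < \<delta>" using w0 r' by linarith
        then show ?thesis using \<tau>1 by (simp add: abs_mult)
      qed
      ultimately have "0 < \<tau> * (w \<bullet> \<eta> - G w)" using \<tau>1 by simp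
      then have "good w" using n x by (simp add: good_def T_def w_def)
      then show ?thesis by (intro exI[of _ w]) (simp add: w_def)
    qed
    have meet: "seg z \<inter> T \<noteq> {}" if z: "norm z < r'" "0 < (p0 + z) $ k" "0 < \<tau> * (z \<bullet> \<eta> - G z)" for z
    proof -
      let ?x = "p0 + z + (\<tau> * \<delta>) *\<^sub>R \<eta>"
      have xs: "?x \<in> seg z" unfolding seg_def using \<delta> by (intro image_eqI[of _ _ \<delta>]) auto
      obtain w where w: "?x = p0 + w" "good w" using seggood[OF xs z] by blast
      have "0 < (p0 + w) $ k" using w(2) by (simp only: good_def)
      then have "0 < ?x $ k" by (simp only: w(1))
      moreover have "dist (p0 + (\<tau> * \<delta>) *\<^sub>R \<eta>) ?x = norm z"
      proof -
        have "?x - (p0 + (\<tau> * \<delta>) *\<^sub>R \<eta>) = z" by simp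
        then show ?thesis by (metis dist_commute dist_norm)
      qed
      ultimately have "?x \<in> T" using z by (simp add: T_def)
      then show ?thesis using xs by blast
    qed
    \<comment> \<open>The segments parallel to \<eta> carry both points by the length \<delta> away
      from the graph into the convex set \<open>T\<close>, so that the union is connected.\<close>
    define C where "C = seg z1 \<union> T \<union> seg z2"
    have Cc: "connected C"
      unfolding C_def using segc Tc meet[OF z(1,3,5)] meet[OF z(2,4,6)]
      by (intro connected_Un) auto
    have Cf: "C \<inter> frontier E = {}"
    proof -
      have "\<exists>w. x = p0 + w \<and> good w" if "x \<in> C" for x
        using that seggood[OF _ z(1,3,5)] seggood[OF _ z(2,4,6)] Tgood unfolding C_def by blast
      then show ?thesis using nofr by blast
    qed
    have zC: "p0 + z1 \<in> C" "p0 + z2 \<in> C"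
      using \<delta> by (auto simp: C_def seg_def intro!: image_eqI[of _ _ 0])
    show ?thesis using connected_Int_frontier[OF Cc, of E] Cf zC by blast
  qed
  \<comment> \<open>The condition on the two sides of the normal is available at positive height
    only, and \<open>p0\<close> may lie on \<partial>H; it is used at a nearby boundary point
    instead.\<close>
  obtain q where q: "q \<in> frontier E" "0 < q $ k" "dist q p0 < min (r' / 2) \<rho>"
  proof -
    have "p0 \<in> closure (frontier E \<inter> halfspace k)" using p0 by (simp add: M_def)
    moreover have "0 < min (r' / 2) \<rho>" using r' f(4) by simp
    ultimately obtain q where "q \<in> frontier E \<inter> halfspace k" "dist q p0 < min (r' / 2) \<rho>"
      using closure_approachable by blast
    then show ?thesis by (intro that) (auto simp: halfspace_def)
  qed
  have qM: "q \<in> M" using frontier_in_M q by simp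
  have qb: "q \<in> ball p0 R0" "q \<in> ball p0 \<rho>" using q r' R G(2) by (auto simp: dist_commute)
  have fq: "f q = 0" "0 < f' q (nu q)" using f7[OF qM qb(1)] f8[OF qM qb(2)] by auto
  have nuq: "norm (nu q) = 1" by (rule nu_norm[OF qM])
  obtain r1 where r1: "0 < r1" "\<And>t. 0 < t \<Longrightarrow> t < r1 \<Longrightarrow> q + t *\<^sub>R nu q \<notin> E \<and> q - t *\<^sub>R nu q \<in> E"
    using nu_sides[OF qM q(2)] by blast
  have D: "((\<lambda>t. f (q + t *\<^sub>R nu q)) has_real_derivative f' q (nu q)) (at 0)"
    using has_real_derivative_along_line[of f "f' q" q 0 "nu q"] f(5)[OF qb(1)] by simp
  obtain d1 where d1: "0 < d1" "\<And>h. 0 < h \<Longrightarrow> h < d1 \<Longrightarrow> f (q + 0 *\<^sub>R nu q) < f (q + (0 + h) *\<^sub>R nu q)"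
    using DERIV_pos_inc_right[OF D fq(2)] by blast
  obtain d2 where d2: "0 < d2" "\<And>h. 0 < h \<Longrightarrow> h < d2 \<Longrightarrow> f (q + (0 - h) *\<^sub>R nu q) < f (q + 0 *\<^sub>R nu q)"
    using DERIV_pos_inc_left[OF D fq(2)] by blast
  define t where "t = min (min (r1 / 2) (r' / 2)) (min (min (d1 / 2) (d2 / 2)) (q $ k / 2))"
  have t: "0 < t" "t < r1" "t \<le> r' / 2" "t < d1" "t < d2" "t < q $ k"
    using r1 d1(1) d2(1) q r' by (auto simp: t_def)
  have nut: "\<bar>nu q $ k\<bar> \<le> 1" using component_le_norm_cart[of "nu q" k] nuq by simp
  have hk: "0 < (q + c *\<^sub>R nu q) $ k" if "\<bar>c\<bar> = t" for c
  proof -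
    have "\<bar>c * nu q $ k\<bar> \<le> t * 1" unfolding abs_mult using that nut t by (intro mult_mono) auto
    then show ?thesis using t by simp
  qed
  define zin where "zin = q - t *\<^sub>R nu q - p0"
  define zout where "zout = q + t *\<^sub>R nu q - p0"
  have nz: "norm zin < r'" "norm zout < r'"
  proof -
    have "norm (q - p0) < r' / 2" using q by (simp add: dist_norm)
    moreover have "zin = (q - p0) - t *\<^sub>R nu q" "zout = (q - p0) + t *\<^sub>R nu q" by (auto simp: zin_def zout_def)
    moreover have "norm (t *\<^sub>R nu q) \<le> r' / 2" using t nuq by simp
    ultimately show "norm zin < r'" "norm zout < r'"
      using norm_triangle_ineq4[of "q - p0" "t *\<^sub>R nu q"] norm_triangle_ineq[of "q - p0" "t *\<^sub>R nu q"] by auto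
  qed
  have pz: "p0 + zin = q - t *\<^sub>R nu q" "p0 + zout = q + t *\<^sub>R nu q" by (auto simp: zin_def zout_def)
  have inE: "p0 + zin \<in> E" "p0 + zout \<notin> E" using r1(2)[OF t(1,2)] by (auto simp: pz)
  have hz: "0 < (p0 + zin) $ k" "0 < (p0 + zout) $ k"
    using hk[of "-t"] hk[of t] t unfolding pz by auto
  have fz: "f (p0 + zin) < 0" "0 < f (p0 + zout)"
    using d1(2)[OF t(1,4)] d2(2)[OF t(1,5)] fq unfolding pz by auto
  have lt: "x < r0" if "x < r'" for x using that r' R by linarith
  have Gz: "zin \<bullet> \<eta> < G zin" "G zout < zout \<bullet> \<eta>"
    using fz Gneg[OF lt[OF nz(1)]] Gneg[OF lt[OF nz(2)]] Gzero[OF lt[OF nz(2)]] by (auto simp: not_less_iff_gr_or_eq)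
  have main: "p0 + z \<in> E \<longleftrightarrow> z \<bullet> \<eta> < G z" if z: "norm z < r'" "0 < (p0 + z) $ k" for z
  proof (cases "z \<bullet> \<eta>" "G z" rule: linorder_cases)
    case less
    have "p0 + zin \<in> E \<longleftrightarrow> p0 + z \<in> E"
      using side[of "-1" zin z] nz z hz Gz less by simp
    then show ?thesis using inE less by simp
  next
    case greater
    have "p0 + zout \<in> E \<longleftrightarrow> p0 + z \<in> E"
      using side[of "1" zout z] nz z hz Gz greater by simp
    then show ?thesis using inE greater by simp
  next
    \<comment> \<open>Points of the graph are limits of points strictly above it, which are outside
      \<open>E\<close>; as \<open>E\<close> is open, they are outside as well.\<close>
    case equal
    have "p0 + z \<notin> E"
    proof
      assume "p0 + z \<in> E"
      then obtain \<epsilon> where \<epsilon>: "0 < \<epsilon>" "ball (p0 + z) \<epsilon> \<subseteq> E" using E_open openE by blast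
      define u where "u = min (\<epsilon> / 2) ((r' - norm z) / 2)"
      have "u \<le> \<epsilon> / 2" "u \<le> (r' - norm z) / 2" unfolding u_def by (rule min.cobounded1, rule min.cobounded2)
      moreover have "0 < u" using \<epsilon> z by (simp add: u_def)
      ultimately have u: "0 < u" "u < \<epsilon>" "norm z + u < r'" using \<epsilon> z(1) by (auto simp: field_simps)
      have n: "norm (z + u *\<^sub>R \<eta>) < r'" using norm_triangle_ineq[of z "u *\<^sub>R \<eta>"] \<eta> u by simp
      have h: "0 < (p0 + (z + u *\<^sub>R \<eta>)) $ k" using height[OF z(2), of u] n r' by (simp add: add.assoc)
      have g: "G (z + u *\<^sub>R \<eta>) < (z + u *\<^sub>R \<eta>) \<bullet> \<eta>"
        using equal u \<eta> by (simp add: Gshift inner_add_left norm_eq_1)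
      have "p0 + (z + u *\<^sub>R \<eta>) \<in> E" using u \<eta> by (intro subsetD[OF \<epsilon>(2)]) (simp add: dist_norm)
      moreover have "p0 + zout \<in> E \<longleftrightarrow> p0 + (z + u *\<^sub>R \<eta>) \<in> E"
        using side[of "1" zout "z + u *\<^sub>R \<eta>"] nz n hz h Gz g by simp
      ultimately show False using inE by simp
    qed
    then show ?thesis using equal by simp
  qed
  have graph: "C2alpha_graph \<alpha> r' \<Lambda> \<eta> G G' B"
  proof -
    have le: "r' \<le> r0" using r' R by linarith
    show ?thesis
      using \<alpha> r \<Lambda> \<eta> G_perp G0 deriv taylor B_bound B_add B_scale B_scale_right r' le
      by unfold_locales auto
  qed
  show ?thesis
  proof (rule that[OF graph main])
    show "G' 0 v = - (nu p0 \<bullet> perp \<eta> v) / (nu p0 \<bullet> \<eta>)" for v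
      using G'0[of v] f6 f(3) by simp
    show "r' \<le> p0 $ k" if "0 < p0 $ k" using R(3)[OF that] r' by linarith
  qed
qed

end

text \<open>Near \<open>p0\<close> the set \<open>E\<close> is a subgraph within H. The alternative
  \<open>heights\<close> guarantees that a motion along \<eta> inside the ball does not leave H:
  either the ball lies in H, or \<eta> is horizontal.\<close>

locale capillary_graph = capillary s \<alpha> \<sigma> k E M nu + C2alpha_graph \<alpha> r \<Lambda> \<eta> G G' B
  for s \<alpha> \<sigma> :: real and k :: "'n::finite" and E M :: "(real^'n) set" and nu :: "real^'n \<Rightarrow> real^'n"
    and r \<Lambda> :: real and \<eta> :: "real^'n" and G :: "real^'n \<Rightarrow> real"
    and G' :: "real^'n \<Rightarrow> real^'n \<Rightarrow> real" and B :: "real^'n \<Rightarrow> real^'n \<Rightarrow> real^'n \<Rightarrow> real" +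
  fixes p0 :: "real^'n"
  assumes p0M: "p0 \<in> M"
    and E_iff: "\<And>z. norm z < r \<Longrightarrow> 0 < (p0 + z) $ k \<Longrightarrow> p0 + z \<in> E \<longleftrightarrow> z \<bullet> \<eta> < G z"
    and nu_\<eta>: "0 < nu p0 \<bullet> \<eta>"
    and G'_zero: "\<And>v. G' 0 v = - (nu p0 \<bullet> perp \<eta> v) / (nu p0 \<bullet> \<eta>)"
    and heights: "(0 < p0 $ k \<and> r \<le> p0 $ k) \<or> (p0 $ k = 0 \<and> \<eta> $ k = 0)"
begin

lemma G_shift: "G (z + t *\<^sub>R \<eta>) = G z"
  using G_perp[of "z + t *\<^sub>R \<eta>"] G_perp[of z] \<eta> by (simp add: perp_add perp_scaleR perp_self)

lemma height_shift:
  assumes "0 < (p0 + z) $ k" "norm (z + t *\<^sub>R \<eta>) < r"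
  shows "0 < (p0 + (z + t *\<^sub>R \<eta>)) $ k"
proof (cases "0 < p0 $ k")
  case True
  have "\<bar>(z + t *\<^sub>R \<eta>) $ k\<bar> < r" using component_le_norm_cart[of "z + t *\<^sub>R \<eta>" k] assms by linarith
  moreover have "r \<le> p0 $ k" using heights True by auto
  moreover have "(p0 + (z + t *\<^sub>R \<eta>)) $ k = p0 $ k + (z + t *\<^sub>R \<eta>) $ k" by simp
  ultimately show ?thesis by linarith
next
  case False
  then show ?thesis using heights assms by simp
qed

lemma continuous_G: "norm y < r \<Longrightarrow> isCont G y"
  using deriv has_derivative_continuous by blast

lemma frontier_graph:
  assumes z: "norm z < r" "0 < (p0 + z) $ k" "z \<bullet> \<eta> = G z"
  shows "p0 + z \<in> frontier E"
proof -
  have "p0 + z \<notin> E" using E_iff[OF z(1,2)] z(3) by simp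
  moreover have "p0 + z \<in> closure E"
  proof (rule Lim_in_closed_set[of _ "\<lambda>t. p0 + (z + (- t) *\<^sub>R \<eta>)" "at_right 0"])
    have l: "((\<lambda>t. z + (- t) *\<^sub>R \<eta>) \<longlongrightarrow> z + (- 0) *\<^sub>R \<eta>) (at_right 0)" by (intro tendsto_intros)
    then have l': "((\<lambda>t. norm (z + (- t) *\<^sub>R \<eta>)) \<longlongrightarrow> norm z) (at_right 0)" using tendsto_norm by fastforce
    show "((\<lambda>t. p0 + (z + (- t) *\<^sub>R \<eta>)) \<longlongrightarrow> p0 + z) (at_right 0)" using tendsto_add[OF tendsto_const l] by simp
    have "eventually (\<lambda>t. norm (z + (- t) *\<^sub>R \<eta>) < r) (at_right 0)" using order_tendstoD(2)[OF l' z(1)] .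
    moreover have "eventually (\<lambda>t::real. 0 < t) (at_right 0)" by (simp add: eventually_at_filter)
    ultimately show "eventually (\<lambda>t. p0 + (z + (- t) *\<^sub>R \<eta>) \<in> closure E) (at_right 0)"
    proof (rule eventually_elim2)
      fix t :: real assume t: "norm (z + (- t) *\<^sub>R \<eta>) < r" "0 < t"
      have "(z + (- t) *\<^sub>R \<eta>) \<bullet> \<eta> < G (z + (- t) *\<^sub>R \<eta>)"
        unfolding G_shift using t(2) z(3) \<eta> by (simp add: inner_diff_left norm_eq_1)
      then have "p0 + (z + (- t) *\<^sub>R \<eta>) \<in> E" using E_iff[OF t(1) height_shift[OF z(2) t(1)]] by simp
      then show "p0 + (z + (- t) *\<^sub>R \<eta>) \<in> closure E" using closure_subset by blast
    qed
  qed auto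
  ultimately show ?thesis using E_open by (simp add: frontier_def interior_open)
qed

text \<open>A point strictly above the graph has a neighbourhood without points of \<open>E\<close>:
  at positive height the subgraph condition fails there, and \<open>E\<close> has no points at other
  heights.\<close>

lemma frontier_graph_converse:
  assumes z: "norm z < r" "0 < (p0 + z) $ k" "p0 + z \<in> frontier E"
  shows "z \<bullet> \<eta> = G z"
proof -
  have nE: "p0 + z \<notin> E" and cl: "p0 + z \<in> closure E" using z(3) E_open by (auto simp: frontier_def interior_open)
  have "\<not> G z < z \<bullet> \<eta>"
  proof
    assume lt: "G z < z \<bullet> \<eta>"
    have "isCont (\<lambda>w. w \<bullet> \<eta> - G w) z" by (intro continuous_intros continuous_G z(1))
    then have "((\<lambda>w. w \<bullet> \<eta> - G w) \<longlongrightarrow> z \<bullet> \<eta> - G z) (nhds z)"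
      using tendsto_at_iff_tendsto_nhds[of "\<lambda>w. w \<bullet> \<eta> - G w" z] by (simp add: isCont_def)
    then have "eventually (\<lambda>w. 0 < w \<bullet> \<eta> - G w) (nhds z)"
      using lt by (intro order_tendstoD(1)) auto
    moreover have "eventually (\<lambda>w. norm w < r) (nhds z)"
      using order_tendstoD(2)[OF tendsto_norm[OF filterlim_ident] z(1)] .
    ultimately have "eventually (\<lambda>w. 0 < w \<bullet> \<eta> - G w \<and> norm w < r) (nhds z)" by (rule eventually_conj)
    then obtain S where S: "open S" "z \<in> S" "\<And>w. w \<in> S \<Longrightarrow> 0 < w \<bullet> \<eta> - G w \<and> norm w < r"
      unfolding eventually_nhds by blast
    have "open ((+) p0 ` S)" using S(1) by (rule open_translation)
    moreover have "p0 + z \<in> (+) p0 ` S" using S(2) by blast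
    moreover have "(+) p0 ` S \<inter> E = {}"
    proof -
      have "p0 + w \<notin> E" if "w \<in> S" for w
      proof
        assume "p0 + w \<in> E"
        then have "0 < (p0 + w) $ k" using E_sub by (auto simp: halfspace_def)
        then show False using E_iff[of w] S(3)[OF that] \<open>p0 + w \<in> E\<close> by auto
      qed
      then show ?thesis by blast
    qed
    ultimately show False using cl open_Int_closure_eq_empty[of "(+) p0 ` S" E] by blast
  qed
  moreover have "\<not> z \<bullet> \<eta> < G z" using E_iff[OF z(1,2)] nE by simp
  ultimately show ?thesis by linarith
qed

lemma E_iff_shift:
  assumes w: "w \<bullet> \<eta> = G w" and n: "norm (w + z) < r" and h: "0 < (p0 + (w + z)) $ k"
  shows "p0 + w + z \<in> E \<longleftrightarrow> z \<bullet> \<eta> < G (w + z) - G w"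
  using E_iff[OF n h] w by (simp add: inner_add_left add.assoc) linarith

end

context capillary
begin

lemma borel_E: "E \<in> sets borel"
  using E_open by simp

text \<open>With \<eta> the normal itself, the graph is taken over the tangent hyperplane, and its
  differential at 0 vanishes.\<close>

lemma interior_graph:
  assumes p0: "p0 \<in> M" "0 < p0 $ k"
  obtains r \<Lambda> G G' B where "capillary_graph s \<alpha> \<sigma> k E M nu r \<Lambda> (nu p0) G G' B p0"
proof -
  have n: "norm (nu p0) = 1" by (rule nu_norm[OF p0(1)])
  then have pos: "0 < nu p0 \<bullet> nu p0" by (simp add: norm_eq_1)
  obtain r \<Lambda> G G' B where g: "C2alpha_graph \<alpha> r \<Lambda> (nu p0) G G' B"
    "\<And>z. norm z < r \<Longrightarrow> 0 < (p0 + z) $ k \<Longrightarrow> p0 + z \<in> E \<longleftrightarrow> z \<bullet> nu p0 < G z"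
    "\<And>v. G' 0 v = - (nu p0 \<bullet> perp (nu p0) v) / (nu p0 \<bullet> nu p0)"
    "0 < p0 $ k \<Longrightarrow> r \<le> p0 $ k"
    by (rule local_graph[OF p0(1) n pos disjI1[OF p0(2)]], rule that) assumption+
  have "capillary_graph s \<alpha> \<sigma> k E M nu r \<Lambda> (nu p0) G G' B p0"
    using g(2-4) p0 pos by (intro capillary_graph.intro[OF capillary_axioms g(1)]) (unfold_locales, auto)
  then show ?thesis by (rule that)
qed

text \<open>The normalised horizontal part of the normal: at points of \<open>\<partial>H\<close> the contact angle makes \<open>E\<close> a subgraph
  in this direction, over a half-space bounded by \<open>\<partial>H\<close>.\<close>
definition hnormal :: "real^'n \<Rightarrow> real^'n" where
  "hnormal q = (1 / sqrt (1 - \<sigma>\<^sup>2)) *\<^sub>R (nu q + \<sigma> *\<^sub>R axis k 1)"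

lemma sigma_sq: "0 < 1 - \<sigma>\<^sup>2"
  using sigma by (simp add: abs_square_less_1)

lemma nu_k: "q \<in> M \<Longrightarrow> q $ k = 0 \<Longrightarrow> nu q $ k = - \<sigma>"
  using angle by (auto simp: inner_axis)

text \<open>The contact angle fixes the vertical component of \<open>nu\<close> at -\<sigma>.
  Pythagoras then gives the length sqrt(1 - \<sigma>^2) of the horizontal component, which is
  positive because |\<sigma>| < 1.\<close>

lemma hnormal:
  assumes q: "q \<in> M" "q $ k = 0"
  shows "norm (hnormal q) = 1" "hnormal q $ k = 0" "nu q = sqrt (1 - \<sigma>\<^sup>2) *\<^sub>R hnormal q - \<sigma> *\<^sub>R axis k 1"
    "nu q \<bullet> hnormal q = sqrt (1 - \<sigma>\<^sup>2)"
proof -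
  have s0: "sqrt (1 - \<sigma>\<^sup>2) > 0" using sigma_sq by simp
  show k0: "hnormal q $ k = 0" using nu_k[OF q] by (simp add: hnormal_def)
  show eq: "nu q = sqrt (1 - \<sigma>\<^sup>2) *\<^sub>R hnormal q - \<sigma> *\<^sub>R axis k 1" using s0 by (simp add: hnormal_def)
  have "1 = nu q \<bullet> nu q" using nu_norm[OF q(1)] by (simp add: norm_eq_1)
  also have "\<dots> = (1 - \<sigma>\<^sup>2) * (hnormal q \<bullet> hnormal q) + \<sigma>\<^sup>2"
  proof -
    define a :: "real^'n" where "a = axis k 1"
    define c where "c = sqrt (1 - \<sigma>\<^sup>2)"
    have xa: "hnormal q \<bullet> a = 0" "a \<bullet> hnormal q = 0" "a \<bullet> a = 1"
      using k0 by (auto simp: a_def inner_axis inner_axis' inner_axis_axis)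
    have cc: "c * c = 1 - \<sigma>\<^sup>2" using sigma_sq by (simp add: c_def)
    have "nu q \<bullet> nu q = (c *\<^sub>R hnormal q - \<sigma> *\<^sub>R a) \<bullet> (c *\<^sub>R hnormal q - \<sigma> *\<^sub>R a)"
      by (simp only: eq[folded a_def c_def])
    also have "\<dots> = (c * c) * (hnormal q \<bullet> hnormal q) + \<sigma> * \<sigma>"
      by (simp add: inner_diff_left inner_diff_right xa)
    finally show ?thesis by (simp add: cc power2_eq_square)
  qed
  finally have "(1 - \<sigma>\<^sup>2) * (hnormal q \<bullet> hnormal q) = 1 - \<sigma>\<^sup>2" by (metis add_diff_cancel_right')
  then have "hnormal q \<bullet> hnormal q = 1" using sigma_sq by simp
  then show n: "norm (hnormal q) = 1" by (simp add: norm_eq_1)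
  show "nu q \<bullet> hnormal q = sqrt (1 - \<sigma>\<^sup>2)"
    using n k0 by (subst eq) (simp add: inner_diff_left inner_axis' norm_eq_1)
qed

text \<open>The differential at \<open>p0\<close> depends on the vertical component of
  \<open>v\<close> alone, with a coefficient common to all points of \<open>M\<close> on
  \<partial>H. Two such graphs over the same direction therefore agree to first order, and a single
  one is symmetric to first order under linear maps that keep \<eta> and the height.\<close>

lemma boundary_graph:
  assumes p0: "p0 \<in> M" "p0 $ k = 0"
  obtains r \<Lambda> G G' B where "capillary_graph s \<alpha> \<sigma> k E M nu r \<Lambda> (hnormal p0) G G' B p0"
    "\<And>v. G' 0 v = \<sigma> / sqrt (1 - \<sigma>\<^sup>2) * v $ k"
proof -
  note h = hnormal[OF p0]
  have s0: "sqrt (1 - \<sigma>\<^sup>2) > 0" using sigma_sq by simp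
  have pos: "0 < nu p0 \<bullet> hnormal p0" using h(4) s0 by simp
  obtain r \<Lambda> G G' B where g: "C2alpha_graph \<alpha> r \<Lambda> (hnormal p0) G G' B"
    "\<And>z. norm z < r \<Longrightarrow> 0 < (p0 + z) $ k \<Longrightarrow> p0 + z \<in> E \<longleftrightarrow> z \<bullet> hnormal p0 < G z"
    "\<And>v. G' 0 v = - (nu p0 \<bullet> perp (hnormal p0) v) / (nu p0 \<bullet> hnormal p0)"
    by (rule local_graph[OF p0(1) h(1) pos disjI2[OF h(2)]], rule that) assumption+
  have "capillary_graph s \<alpha> \<sigma> k E M nu r \<Lambda> (hnormal p0) G G' B p0"
    using g(2-3) p0 pos h by (intro capillary_graph.intro[OF capillary_axioms g(1)]) (unfold_locales, auto)
  moreover have "G' 0 v = \<sigma> / sqrt (1 - \<sigma>\<^sup>2) * v $ k" for v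
  proof -
    have "nu p0 \<bullet> w = sqrt (1 - \<sigma>\<^sup>2) * (hnormal p0 \<bullet> w) - \<sigma> * w $ k" for w
      by (subst h(3)) (simp add: inner_diff_left inner_axis')
    moreover have "hnormal p0 \<bullet> perp (hnormal p0) v = 0" using inner_perp[OF h(1), of v] by (simp add: inner_commute)
    moreover have "perp (hnormal p0) v $ k = v $ k" using h(2) by (simp add: perp_def)
    ultimately have "nu p0 \<bullet> perp (hnormal p0) v = - \<sigma> * v $ k" by simp
    then show ?thesis unfolding g(3) h(4) by simp
  qed
  ultimately show ?thesis by (rule that)
qed

lemma curv_limit:
  assumes q: "q \<in> M" "0 < q $ k" and a: "\<And>j. 0 < a j" "a \<longlonglongrightarrow> 0"
  shows "(\<lambda>j. (LINT z|lborel. kap ((real CARD('n) + s) / 2) (a j) ((norm (z::real^'n))\<^sup>2)) - 2 * kap_mass s (a j) E q)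
           \<longlonglongrightarrow> frac_mean_curv s E q"
proof -
  obtain r \<Lambda> G G' B where "capillary_graph s \<alpha> \<sigma> k E M nu r \<Lambda> (nu q) G G' B q"
    by (rule interior_graph[OF q])
  then interpret g: capillary_graph s \<alpha> \<sigma> k E M nu r \<Lambda> "nu q" G G' B q .
  show ?thesis
  proof (rule frac_mean_curv_limit[where g=G and L="6 * \<Lambda>" and \<eta>="nu q" and r=r])
    fix z :: "real^'n" assume z: "norm z < r"
    have "\<bar>z $ k\<bar> < r" using component_le_norm_cart[of z k] z by linarith
    then have "0 < (q + z) $ k" using g.heights q by auto
    then show "q + z \<in> E \<longleftrightarrow> z \<bullet> nu q < G (perp (nu q) z)" using g.E_iff[OF z] g.G_perp by simp
    show "\<bar>G z + G (- z)\<bar> \<le> 6 * \<Lambda> * (norm z)\<^sup>2" using g.G_second_difference[of 0 z] z g.G0 by simp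
  qed (use n2 s01 borel_E g.\<eta> g.r g.\<Lambda> a in auto)
qed

text \<open>The total mass of the truncated kernel, which diverges as the truncation is removed, is
  the same at both points and cancels. A larger potential means a smaller curvature, hence the
  exchange of p and q.\<close>

lemma curv_difference:
  assumes "p \<in> M" "0 < p $ k" "q \<in> M" "0 < q $ k" and a: "\<And>j. 0 < a j" "a \<longlonglongrightarrow> 0"
  shows "(\<lambda>j. 2 * (kap_mass s (a j) E q - kap_mass s (a j) E p)) \<longlonglongrightarrow> frac_mean_curv s E p - frac_mean_curv s E q"
  using tendsto_diff[OF curv_limit[OF assms(1,2) a] curv_limit[OF assms(3,4) a]] by (simp add: algebra_simps)

end

section \<open>Potentials at nearby boundary points\<close>

text \<open>This is the form to which the bounds for pairs of subgraphs apply: for a \<le> b the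
  difference of the two kernels vanishes at distances above sqrt b, so that only local graphs
  enter.\<close>

lemma kap_mass_difference:
  fixes E1 E2 :: "'a::euclidean_space set"
  assumes "0 < s" "0 < a" "0 < b" "E1 \<in> sets borel" "E2 \<in> sets borel"
  shows "(kap_mass s a E1 p - kap_mass s b E1 p) - (kap_mass s a E2 q - kap_mass s b E2 q)
     = (LINT z|lborel. (indicator {z. p + z \<in> E1} z - indicator {z. q + z \<in> E2} z) *
       (kap ((real DIM('a) + s) / 2) a ((norm z)\<^sup>2) - kap ((real DIM('a) + s) / 2) b ((norm z)\<^sup>2)))"
proof -
  let ?b = "(real DIM('a) + s) / 2"
  have i: "integrable lborel (\<lambda>z. indicator F (x + z) * kap ?b c ((norm z)\<^sup>2))" if "0 < c" "F \<in> sets borel" for x :: 'a and c F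
    by (rule integrable_kap_mass[OF assms(1) that])
  have "(LINT z|lborel. (indicator {z. p + z \<in> E1} z - indicator {z. q + z \<in> E2} z) * (kap ?b a ((norm z)\<^sup>2) - kap ?b b ((norm z)\<^sup>2)))
     = (LINT z|lborel. (indicator E1 (p + z) * kap ?b a ((norm z)\<^sup>2) - indicator E1 (p + z) * kap ?b b ((norm z)\<^sup>2))
         - (indicator E2 (q + z) * kap ?b a ((norm z)\<^sup>2) - indicator E2 (q + z) * kap ?b b ((norm z)\<^sup>2)))"
    by (intro Bochner_Integration.integral_cong refl) (auto simp: indicator_def)
  then show ?thesis using i[OF assms(2,4)] i[OF assms(3,4)] i[OF assms(2,5)] i[OF assms(3,5)] by (simp add: kap_mass_def)
qed

lemma kap_mass_reflection:
  fixes e :: "real^'n::finite"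
  assumes e: "norm e = 1" "2 \<le> CARD('n)" and E: "E \<in> sets borel" and a: "0 < a"
  shows "kap_mass s a {x. reflection e c x \<in> E} (reflection e c p) = kap_mass s a E p"
proof -
  let ?b = "(real DIM(real^'n) + s) / 2"
  have eq: "reflection e c (reflection e c p + z) = p + hrefl e z" for z
  proof -
    have "reflection e c (x + z) = reflection e c x + hrefl e z" for x
      by (simp add: reflection_eq_hrefl hrefl_add)
    then show ?thesis by (simp only: reflection_reflection[OF e(1)])
  qed
  have m: "(\<lambda>z. indicator E (p + z) * kap ?b a ((norm z)\<^sup>2)) \<in> borel_measurable borel"
  proof -
    have k: "(\<lambda>z::real^'n. kap ?b a ((norm z)\<^sup>2)) \<in> borel_measurable borel"
      using a by (auto intro!: borel_measurable_continuous_onI continuous_intros)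
    have "(\<lambda>z. indicator E (p + z) :: real) = indicator {z. p + z \<in> E}" by (auto simp: indicator_def)
    then have "(\<lambda>z. indicator E (p + z) :: real) \<in> borel_measurable borel" using borel_translate[OF E, of p] by simp
    then show ?thesis by (rule borel_measurable_times[OF _ k])
  qed
  have "kap_mass s a E p = (LINT z|distr lborel borel (hrefl e). indicator E (p + z) * kap ?b a ((norm z)\<^sup>2))"
    using distr_lborel_hrefl[OF e(1)] e(2) by (simp add: kap_mass_def)
  also have "\<dots> = (LINT z|lborel. indicator E (p + hrefl e z) * kap ?b a ((norm (hrefl e z))\<^sup>2))"
    by (rule integral_distr) (use m in auto)
  also have "\<dots> = kap_mass s a {x. reflection e c x \<in> E} (reflection e c p)"
    unfolding kap_mass_def by (intro Bochner_Integration.integral_cong refl) (simp add: indicator_def eq norm_hrefl[OF e(1)])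
  finally show ?thesis ..
qed

lemma power2_le_powr:
  fixes t \<alpha> :: real
  assumes "0 \<le> t" "t \<le> 1" "0 < \<alpha>" "\<alpha> \<le> 1"
  shows "t\<^sup>2 \<le> t powr (1 + \<alpha>)"
proof (cases "t = 0")
  case False
  have "t powr 2 \<le> t powr (1 + \<alpha>)" using assms by (intro powr_mono') auto
  then show ?thesis using assms False by (simp add: powr_numeral)
qed simp

lemma powr_add_le:
  fixes x y \<alpha> :: real
  assumes "0 \<le> x" "0 \<le> y" "0 < \<alpha>" "\<alpha> \<le> 1"
  shows "(2 * x + y) powr \<alpha> \<le> 3 * (x powr \<alpha> + y powr \<alpha>)"
proof -
  define m where "m = max x y"
  have "(2 * x + y) powr \<alpha> \<le> (3 * m) powr \<alpha>" using assms by (intro powr_mono2) (auto simp: m_def)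
  also have "\<dots> = 3 powr \<alpha> * m powr \<alpha>" using assms by (simp add: powr_mult m_def)
  also have "\<dots> \<le> 3 powr 1 * m powr \<alpha>" using assms by (intro mult_right_mono powr_mono) auto
  also have "m powr \<alpha> \<le> x powr \<alpha> + y powr \<alpha>" by (auto simp: m_def max_def)
  finally show ?thesis by simp
qed

section \<open>Pairs of points close to one point of M\<close>

context capillary_graph
begin

text \<open>The recentred graphs differ by a mixed difference of \<open>G\<close> with displacement
  l e, so the hypotheses of the uncut bound hold with \<omega> = l; 6 \<Lambda> dominates the
  constants 6, 3 and 2 that occur. The result is linear in the distance of the two points, with a
  factor that tends to 0 with the scale.\<close>

lemma interior_pair_bound:
  assumes p0: "0 < p0 $ k" and e: "norm e = 1" "e \<bullet> \<eta> = 0" and l: "0 < l"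
    and wq: "wq \<bullet> \<eta> = G wq" and wp: "(wq + l *\<^sub>R e) \<bullet> \<eta> = G (wq + l *\<^sub>R e)"
    and \<rho>: "norm wq + l + \<rho> < r" "0 < \<epsilon>" "\<epsilon> \<le> \<rho>"
  shows "\<bar>(kap_mass s (\<epsilon>\<^sup>2) E (p0 + (wq + l *\<^sub>R e)) - kap_mass s (\<rho>\<^sup>2) E (p0 + (wq + l *\<^sub>R e)))
      - (kap_mass s (\<epsilon>\<^sup>2) E (p0 + wq) - kap_mass s (\<rho>\<^sup>2) E (p0 + wq))\<bar>
      \<le> l * graph_const TYPE(real^'n) s \<alpha> (6 * \<Lambda>) * \<rho> powr (\<alpha> - s)"
proof -
  define d where "d = l *\<^sub>R e"
  have d: "norm d = l" using e l by (simp add: d_def)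
  define g1 where "g1 = (\<lambda>z. G (wq + d + z) - G (wq + d))"
  define g2 where "g2 = (\<lambda>z. G (wq + z) - G wq)"
  have pos: "0 < \<epsilon>\<^sup>2" "0 < \<rho>\<^sup>2" using \<rho> by auto
  have nn: "norm wq + norm d + norm z < r" if "norm z < \<rho>" for z using that \<rho> d by simp
  have sm: "norm z \<le> 1" if "norm z < \<rho>" for z :: "real^'n"
    using that \<rho> r l norm_ge_zero[of wq] by linarith
  have hgt: "0 < (p0 + z) $ k" if "norm z < r" for z
    using component_le_norm_cart[of z k] that heights p0 by auto
  have pw: "6 * \<Lambda> * (norm z)\<^sup>2 \<le> 6 * \<Lambda> * norm z powr (1 + \<alpha>)" if "norm z < \<rho>" for z :: "real^'n"
    using \<Lambda> \<alpha> sm[OF that] by (intro mult_left_mono power2_le_powr) auto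
  have per: "g1 (perp \<eta> z) = g1 z" "g2 (perp \<eta> z) = g2 z" for z
    using G_perp_add[of z "wq + d"] G_perp_add[of z wq] by (simp_all add: g1_def g2_def add.commute)
  have "\<bar>LINT z|lborel. (indicator {z. (p0 + (wq + d)) + z \<in> E} z - indicator {z. (p0 + wq) + z \<in> E} z) *
       (kap ((real DIM(real^'n) + s) / 2) (\<epsilon>\<^sup>2) ((norm z)\<^sup>2) - kap ((real DIM(real^'n) + s) / 2) (\<rho>\<^sup>2) ((norm z)\<^sup>2))\<bar>
      \<le> l * graph_const TYPE(real^'n) s \<alpha> (6 * \<Lambda>) * \<rho> powr (\<alpha> - s)"
  proof (rule uncut_pair_bound[where ?g1.0=g1 and ?g2.0=g2 and \<eta>=\<eta>])
    show "{z. (p0 + (wq + d)) + z \<in> E} \<in> sets borel" "{z. (p0 + wq) + z \<in> E} \<in> sets borel"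
      using borel_translate[OF borel_E] by auto
    fix z :: "real^'n" assume z: "norm z < \<rho>"
    have n1: "norm (wq + d + z) < r" "norm (wq + z) < r"
      using nn[OF z] norm_triangle_ineq[of "wq + d" z] norm_triangle_ineq[of wq d] norm_triangle_ineq[of wq z] norm_ge_zero[of d] by linarith+
    show "z \<in> {z. (p0 + (wq + d)) + z \<in> E} \<longleftrightarrow> z \<bullet> \<eta> < g1 (perp \<eta> z)"
      unfolding mem_Collect_eq per unfolding g1_def by (rule E_iff_shift[OF _ n1(1) hgt[OF n1(1)]]) (simp add: wp d_def)
    show "z \<in> {z. (p0 + wq) + z \<in> E} \<longleftrightarrow> z \<bullet> \<eta> < g2 (perp \<eta> z)"
      unfolding mem_Collect_eq per unfolding g2_def by (rule E_iff_shift[OF wq n1(2) hgt[OF n1(2)]])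
    have nd: "norm (wq + d) + norm z < r" "norm wq + norm z < r"
      using nn[OF z] norm_triangle_ineq[of wq d] norm_ge_zero[of d] by linarith+
    show "\<bar>g1 z + g1 (- z)\<bar> \<le> 6 * \<Lambda> * norm z powr (1 + \<alpha>)"
      using G_second_difference[OF nd(1)] pw[OF z] by (simp add: g1_def)
    show "\<bar>g2 z + g2 (- z)\<bar> \<le> 6 * \<Lambda> * norm z powr (1 + \<alpha>)"
      using G_second_difference[OF nd(2)] pw[OF z] by (simp add: g2_def)
    have "\<bar>g1 z - g2 z\<bar> \<le> 3 * \<Lambda> * l * norm z"
      using G_mixed_difference(1)[OF nn[OF z]] d by (simp add: g1_def g2_def)
    also have "\<dots> \<le> 6 * \<Lambda> * l * norm z" using \<Lambda> l by (intro mult_right_mono) auto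
    finally show "\<bar>g1 z - g2 z\<bar> \<le> 6 * \<Lambda> * l * norm z" .
    have "\<bar>(g1 z - g2 z) + (g1 (- z) - g2 (- z))\<bar> \<le> 2 * \<Lambda> * l * norm z powr (1 + \<alpha>)"
      using G_mixed_difference(2)[OF nn[OF z]] d by (simp add: g1_def g2_def)
    also have "\<dots> \<le> 6 * \<Lambda> * l * norm z powr (1 + \<alpha>)" using \<Lambda> l by (intro mult_right_mono) auto
    finally show "\<bar>(g1 z - g2 z) + (g1 (- z) - g2 (- z))\<bar> \<le> 6 * \<Lambda> * l * norm z powr (1 + \<alpha>)" .
  qed (use n2 s01 alpha \<eta> \<rho> \<Lambda> l in auto)
  then show ?thesis
    unfolding kap_mass_difference[OF s01(1) pos borel_E borel_E] d_def .
qed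

text \<open>At a point of \<partial>H the differential of \<open>G\<close> at 0 sees only the
  height, so that the increments over two vectors of equal height cancel to first order. The error
  comes from evaluating the differential away from 0.\<close>

lemma boundary_first_order:
  assumes p0: "p0 $ k = 0" and G'0: "\<And>v. G' 0 v = c0 * v $ k"
    and y: "norm y + norm z < r" "norm w = norm z" "z $ k = w $ k"
  shows "\<bar>(G (y + z) - G y) - (G (y + w) - G y)\<bar> \<le> 12 * \<Lambda> * ((norm z)\<^sup>2 + norm y * norm z)"
proof -
  have in_ball: "norm (y + t *\<^sub>R x) < r" if "0 \<le> t" "t \<le> 1" "norm x = norm z" for t x
  proof -
    have "norm (y + t *\<^sub>R x) \<le> norm y + t * norm x" using norm_triangle_ineq[of y "t *\<^sub>R x"] that by simp
    also have "t * norm x \<le> norm x" using that mult_right_mono[of t 1 "norm x"] by simp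
    finally show ?thesis using y that by linarith
  qed
  define f where "f = (\<lambda>t. G (y + t *\<^sub>R z) - G (y + t *\<^sub>R w))"
  have D: "(f has_real_derivative G' (y + t *\<^sub>R z) z - G' (y + t *\<^sub>R w) w) (at t)" if "0 \<le> t" "t \<le> 1" for t
    unfolding f_def using in_ball[OF that] y by (intro DERIV_diff line_deriv) auto
  obtain t where t: "0 < t" "t < 1" "f 1 - f 0 = G' (y + t *\<^sub>R z) z - G' (y + t *\<^sub>R w) w"
    using MVT_unit_interval[OF D] by blast
  have r0: "norm (0::real^'n) < r" using r by simp
  have b: "\<bar>G' (y + t *\<^sub>R x) x - G' 0 x\<bar> \<le> 3 * \<Lambda> * (norm y + norm z) * norm z" if x: "norm x = norm z" for x
  proof -
    have n: "norm (0 + (y + t *\<^sub>R x)) < r" using in_ball[of t x] t x by simp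
    have "\<bar>G' (0 + (y + t *\<^sub>R x)) x - G' 0 x\<bar> \<le> 3 * \<Lambda> * norm (y + t *\<^sub>R x) * norm x" by (rule G'_lipschitz[OF r0 n])
    also have "\<dots> \<le> 3 * \<Lambda> * (norm y + norm z) * norm z"
    proof -
      have "norm (y + t *\<^sub>R x) \<le> norm y + t * norm x" using norm_triangle_ineq[of y "t *\<^sub>R x"] t by simp
      also have "t * norm x \<le> norm z" using x t mult_right_mono[of t 1 "norm x"] by simp
      finally have "norm (y + t *\<^sub>R x) \<le> norm y + norm z" by simp
      then show ?thesis unfolding x using \<Lambda> by (intro mult_right_mono mult_left_mono) auto
    qed
    finally show ?thesis by simp
  qed
  have "G' 0 z = G' 0 w" using G'0 y(3) by simp
  then have "\<bar>f 1 - f 0\<bar> \<le> 6 * \<Lambda> * (norm y + norm z) * norm z"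
    unfolding t(3) using b[OF refl] b[OF y(2)] by linarith
  also have "\<dots> = 6 * \<Lambda> * ((norm z)\<^sup>2 + norm y * norm z)" by (simp add: power2_eq_square algebra_simps)
  also have "\<dots> \<le> 12 * \<Lambda> * ((norm z)\<^sup>2 + norm y * norm z)" using \<Lambda> by (intro mult_right_mono) auto
  finally show ?thesis by (simp add: f_def)
qed

text \<open>The base points of the pair are at height h and differ by h e. Beyond the distance h the
  central symmetry is incompatible with the cut by \<partial>H; its substitute \<open>R\<close>
  keeps the height and reverses the remaining tangential directions. Under \<open>R\<close> the
  linear part of the mixed difference does not cancel by itself but leaves a multiple of
  \<open>B 0 (axis k 1) e\<close>, and hypothesis \<open>Be\<close> removes it.\<close>

lemma boundary_pair_bound:
  assumes p0: "p0 $ k = 0" and G'0: "\<And>v. G' 0 v = c0 * v $ k"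
    and e: "norm e = 1" "e \<bullet> \<eta> = 0" "e $ k = 0" and Be: "B 0 (axis k 1) e = 0"
    and h: "0 < h" "h \<le> \<rho>" "2 * h + \<rho> < r"
    and y: "y = h *\<^sub>R axis k 1" and wq: "wq = y + G y *\<^sub>R \<eta>"
    and wp: "wp = y + h *\<^sub>R e + G (y + h *\<^sub>R e) *\<^sub>R \<eta>"
    and nw: "norm wq + \<rho> < r" "norm wp + \<rho> < r" and \<epsilon>: "0 < \<epsilon>" "\<epsilon> \<le> h"
  shows "\<bar>(kap_mass s (\<epsilon>\<^sup>2) E (p0 + wp) - kap_mass s (\<rho>\<^sup>2) E (p0 + wp))
      - (kap_mass s (\<epsilon>\<^sup>2) E (p0 + wq) - kap_mass s (\<rho>\<^sup>2) E (p0 + wq))\<bar>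
      \<le> 2 * h * graph_const TYPE(real^'n) s \<alpha> (24 * \<Lambda>) * \<rho> powr (\<alpha> - s)"
proof -
  let ?\<kappa> = "axis k (1::real) :: real^'n"
  define d where "d = h *\<^sub>R e"
  have d: "norm d = h" "d $ k = 0" "d \<bullet> \<eta> = 0" using e h by (auto simp: d_def)
  have \<eta>k: "\<eta> $ k = 0" using heights p0 by auto
  have \<kappa>: "norm ?\<kappa> = 1" "?\<kappa> \<bullet> \<eta> = 0" "?\<kappa> $ k = 1" using \<eta>k by (auto simp: norm_axis_1 inner_axis')
  have yn: "norm y = h" "y $ k = h" "y \<bullet> \<eta> = 0" using h \<kappa> by (auto simp: y)
  define g1 where "g1 = (\<lambda>z. G (y + d + z) - G (y + d))"
  define g2 where "g2 = (\<lambda>z. G (y + z) - G y)"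
  have pos: "0 < \<epsilon>\<^sup>2" "0 < \<rho>\<^sup>2" using \<epsilon> h by auto
  have \<rho>: "0 < \<rho>" using h by simp
  have h1: "h \<le> 1" using h r by linarith
  have sm: "norm z \<le> 1" if "norm z < \<rho>" for z :: "real^'n" using that h r by linarith
  have nn: "norm y + norm d + norm z < r" if "norm z < \<rho>" for z using that h d yn by simp
  have pw: "(norm z)\<^sup>2 \<le> norm z powr (1 + \<alpha>)" if "norm z < \<rho>" for z :: "real^'n"
    using \<alpha> sm[OF that] by (intro power2_le_powr) auto
  have hw: "h \<le> h powr \<alpha>" using powr_mono'[of \<alpha> 1 h] \<alpha> h h1 by simp
  have Gw: "G wq = G y" "G wp = G (y + d)" "wq \<bullet> \<eta> = G y" "wp \<bullet> \<eta> = G (y + d)"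
    "wq $ k = h" "wp $ k = h"
    using yn d e \<eta> \<eta>k by (auto simp: wq wp d_def[symmetric] G_shift inner_add_left norm_eq_1)
  have Gwz: "G (wq + z) = G (y + z)" "G (wp + z) = G (y + d + z)" for z
    using G_shift[of "y + z" "G y"] G_shift[of "y + d + z" "G (y + d)"]
    by (simp_all add: wq wp d_def[symmetric] add_ac)
  have per: "g1 (perp \<eta> z) = g1 z" "g2 (perp \<eta> z) = g2 z" for z
    using G_perp_add[of z "y + d"] G_perp_add[of z y] by (simp_all add: g1_def g2_def add.commute)
  \<comment> \<open>This map fixes \<eta> and the vertical axis and changes the sign on their common
    orthogonal complement.\<close>
  define R where "R = (\<lambda>z. - hrefl \<eta> (hrefl ?\<kappa> z))"
  have hk: "hrefl \<eta> z $ k = z $ k" for z using \<eta>k by (simp add: hrefl_def)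
  have hkk: "hrefl ?\<kappa> z $ k = - (z $ k)" for z by (simp add: hrefl_def inner_axis)
  have Rk: "R z $ k = z $ k" for z unfolding R_def by (simp only: vector_uminus_component hk hkk minus_minus)
  have Rn: "norm (R z) = norm z" for z by (simp add: R_def norm_hrefl \<eta> \<kappa>)
  have R\<eta>1: "hrefl ?\<kappa> \<eta> = \<eta>" using \<kappa> by (simp add: hrefl_def inner_commute)
  have R\<eta>2: "hrefl \<eta> \<eta> = - \<eta>" using \<eta> by (simp add: hrefl_def norm_eq_1 scaleR_2)
  have R\<eta>: "R (z + u *\<^sub>R \<eta>) = R z + u *\<^sub>R \<eta>" for z u
    by (simp add: R_def hrefl_add hrefl_scaleR R\<eta>1 R\<eta>2)
  have Rperp: "R z \<bullet> \<eta> = 0" if "z \<bullet> \<eta> = 0" for z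
  proof -
    have "R z \<bullet> \<eta> = hrefl \<eta> (hrefl ?\<kappa> z) \<bullet> hrefl \<eta> \<eta>" by (simp add: R_def R\<eta>2)
    also have "\<dots> = hrefl ?\<kappa> z \<bullet> hrefl ?\<kappa> \<eta>" by (simp add: hrefl_inner \<eta> R\<eta>1)
    also have "\<dots> = z \<bullet> \<eta>" by (rule hrefl_inner[OF \<kappa>(1)])
    finally show ?thesis using that by simp
  qed
  have Rsum: "z + R z = (2 * (z $ k)) *\<^sub>R ?\<kappa>" if "z \<bullet> \<eta> = 0" for z
  proof -
    have "hrefl ?\<kappa> z \<bullet> \<eta> = 0" using that hrefl_inner[OF \<kappa>(1), of z \<eta>] R\<eta>1 by simp
    then have "hrefl \<eta> (hrefl ?\<kappa> z) = hrefl ?\<kappa> z" by (simp add: hrefl_def)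
    then show ?thesis by (simp add: R_def) (simp add: hrefl_def inner_axis)
  qed
  have r0: "norm (0::real^'n) < r" using r by simp
  have "\<bar>LINT z|lborel. (indicator {z. (p0 + wp) + z \<in> E} z - indicator {z. (p0 + wq) + z \<in> E} z) *
       (kap ((real DIM(real^'n) + s) / 2) (\<epsilon>\<^sup>2) ((norm z)\<^sup>2) - kap ((real DIM(real^'n) + s) / 2) (\<rho>\<^sup>2) ((norm z)\<^sup>2))\<bar>
      \<le> 2 * h * graph_const TYPE(real^'n) s \<alpha> (24 * \<Lambda>) * \<rho> powr (\<alpha> - s)"
  proof (rule cut_pair_bound[where ?g1.0=g1 and ?g2.0=g2 and \<eta>=\<eta> and \<kappa>="?\<kappa>" and h=h and R=R])
    show "{z. (p0 + wp) + z \<in> E} \<in> sets borel" "{z. (p0 + wq) + z \<in> E} \<in> sets borel"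
      using borel_translate[OF borel_E] by auto
    show "distr lborel borel R = lborel"
    proof -
      have dim: "2 \<le> DIM(real^'n)" using n2 by simp
      have "distr lborel borel (\<lambda>z. hrefl \<eta> (hrefl ?\<kappa> z)) = lborel"
        by (rule distr_lborel_compose[OF distr_lborel_hrefl[OF \<kappa>(1) dim] distr_lborel_hrefl[OF \<eta> dim]]) simp_all
      then have "distr lborel borel (\<lambda>z. - hrefl \<eta> (hrefl ?\<kappa> z)) = lborel"
        by (rule distr_lborel_compose[OF _ distr_lborel_uminus])
           (auto intro!: borel_measurable_continuous_onI continuous_intros)
      then show ?thesis by (simp only: R_def)
    qed
    show "R \<in> borel \<rightarrow>\<^sub>M borel" unfolding R_def by (intro borel_measurable_continuous_onI continuous_intros)
    show "R z \<bullet> ?\<kappa> = z \<bullet> ?\<kappa>" for z using Rk by (simp add: inner_axis)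
    fix z :: "real^'n" assume z: "norm z < \<rho>"
    have n1: "norm (wp + z) < r" "norm (wq + z) < r"
      using nw z norm_triangle_ineq[of wp z] norm_triangle_ineq[of wq z] by linarith+
    have hz: "(p0 + (wp + z)) $ k = h + z $ k" "(p0 + (wq + z)) $ k = h + z $ k" using p0 Gw by simp_all
    have out: "p0 + x \<notin> E" if "\<not> 0 < (p0 + x) $ k" for x using E_sub that by (auto simp: halfspace_def)
    show "z \<in> {z. (p0 + wp) + z \<in> E} \<longleftrightarrow> - h < z \<bullet> ?\<kappa> \<and> z \<bullet> \<eta> < g1 (perp \<eta> z)"
    proof (cases "0 < (p0 + (wp + z)) $ k")
      case True
      then have "p0 + wp + z \<in> E \<longleftrightarrow> z \<bullet> \<eta> < G (wp + z) - G wp" using E_iff_shift[of wp z] Gw n1(1) by simp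
      then show ?thesis unfolding mem_Collect_eq per unfolding g1_def using True hz by (simp add: Gw Gwz inner_axis)
    next
      case False
      then show ?thesis using out[OF False] hz by (simp add: inner_axis add.assoc)
    qed
    show "z \<in> {z. (p0 + wq) + z \<in> E} \<longleftrightarrow> - h < z \<bullet> ?\<kappa> \<and> z \<bullet> \<eta> < g2 (perp \<eta> z)"
    proof (cases "0 < (p0 + (wq + z)) $ k")
      case True
      then have "p0 + wq + z \<in> E \<longleftrightarrow> z \<bullet> \<eta> < G (wq + z) - G wq" using E_iff_shift[of wq z] Gw n1(2) by simp
      then show ?thesis unfolding mem_Collect_eq per unfolding g2_def using True hz by (simp add: Gw Gwz inner_axis)
    next
      case False
      then show ?thesis using out[OF False] hz by (simp add: inner_axis add.assoc)
    qed
    have nd: "norm (y + d) + norm z < r" "norm y + norm z < r"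
      using nn[OF z] norm_triangle_ineq[of y d] norm_ge_zero[of d] by linarith+
    have p6: "6 * \<Lambda> * (norm z)\<^sup>2 \<le> 24 * \<Lambda> * norm z powr (1 + \<alpha>)"
      using \<Lambda> pw[OF z] by (intro mult_mono) auto
    show "\<bar>g1 z + g1 (- z)\<bar> \<le> 24 * \<Lambda> * norm z powr (1 + \<alpha>)"
      using G_second_difference[OF nd(1)] p6 by (simp add: g1_def)
    show "\<bar>g2 z + g2 (- z)\<bar> \<le> 24 * \<Lambda> * norm z powr (1 + \<alpha>)"
      using G_second_difference[OF nd(2)] p6 by (simp add: g2_def)
    have "\<bar>g1 z - g2 z\<bar> \<le> 3 * \<Lambda> * h * norm z"
      using G_mixed_difference(1)[OF nn[OF z]] d by (simp add: g1_def g2_def)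
    also have "\<dots> \<le> 24 * \<Lambda> * h * norm z" using \<Lambda> h by (intro mult_right_mono) auto
    finally show "\<bar>g1 z - g2 z\<bar> \<le> 24 * \<Lambda> * h * norm z" .
    have "\<bar>(g1 z - g2 z) + (g1 (- z) - g2 (- z))\<bar> \<le> 2 * \<Lambda> * h * norm z powr (1 + \<alpha>)"
      using G_mixed_difference(2)[OF nn[OF z]] d by (simp add: g1_def g2_def)
    also have "\<dots> \<le> 24 * \<Lambda> * h * norm z powr (1 + \<alpha>)" using \<Lambda> h by (intro mult_right_mono) auto
    finally show "\<bar>(g1 z - g2 z) + (g1 (- z) - g2 (- z))\<bar> \<le> 24 * \<Lambda> * h * norm z powr (1 + \<alpha>)" .
    \<comment> \<open>Errors c|z| with c of the order of h are absorbed in h^\<alpha> |z|, because h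
      \<le> 1.\<close>
    have hb: "12 * \<Lambda> * ((norm z)\<^sup>2 + c * norm z) \<le> 24 * \<Lambda> * (norm z powr (1 + \<alpha>) + h powr \<alpha> * norm z)" if "c \<le> 2 * h" "0 \<le> c" for c
    proof -
      have "c * norm z \<le> 2 * (h powr \<alpha> * norm z)" using that hw mult_right_mono[of c "2 * h powr \<alpha>" "norm z"] by simp
      then have "(norm z)\<^sup>2 + c * norm z \<le> norm z powr (1 + \<alpha>) + 2 * (h powr \<alpha> * norm z)" using pw[OF z] by (rule add_mono[rotated])
      also have "\<dots> \<le> 2 * (norm z powr (1 + \<alpha>) + h powr \<alpha> * norm z)" by simp
      finally have "(norm z)\<^sup>2 + c * norm z \<le> 2 * (norm z powr (1 + \<alpha>) + h powr \<alpha> * norm z)" .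
      then have "12 * \<Lambda> * ((norm z)\<^sup>2 + c * norm z) \<le> 12 * \<Lambda> * (2 * (norm z powr (1 + \<alpha>) + h powr \<alpha> * norm z))"
        using \<Lambda> by (intro mult_left_mono) auto
      also have "\<dots> = 24 * \<Lambda> * (norm z powr (1 + \<alpha>) + h powr \<alpha> * norm z)" by (simp add: algebra_simps)
      finally show ?thesis .
    qed
    show "\<bar>g1 z - g1 (R z)\<bar> \<le> 24 * \<Lambda> * (norm z powr (1 + \<alpha>) + h powr \<alpha> * norm z)"
    proof -
      have "\<bar>g1 z - g1 (R z)\<bar> \<le> 12 * \<Lambda> * ((norm z)\<^sup>2 + norm (y + d) * norm z)"
        unfolding g1_def by (rule boundary_first_order[OF p0 G'0 nd(1) Rn]) (simp add: Rk)
      also have "\<dots> \<le> 24 * \<Lambda> * (norm z powr (1 + \<alpha>) + h powr \<alpha> * norm z)"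
        using norm_triangle_ineq[of y d] yn d by (intro hb) auto
      finally show ?thesis .
    qed
    show "\<bar>g2 z - g2 (R z)\<bar> \<le> 24 * \<Lambda> * (norm z powr (1 + \<alpha>) + h powr \<alpha> * norm z)"
    proof -
      have "\<bar>g2 z - g2 (R z)\<bar> \<le> 12 * \<Lambda> * ((norm z)\<^sup>2 + norm y * norm z)"
        unfolding g2_def by (rule boundary_first_order[OF p0 G'0 nd(2) Rn]) (simp add: Rk)
      also have "\<dots> \<le> 24 * \<Lambda> * (norm z powr (1 + \<alpha>) + h powr \<alpha> * norm z)"
        using yn h by (intro hb) auto
      finally show ?thesis .
    qed
  next
    fix z :: "real^'n" assume z\<eta>: "z \<bullet> \<eta> = 0" and z: "norm z < \<rho>"
    have "B 0 (z + R z) d = (2 * (z $ k)) * (h * B 0 ?\<kappa> e)"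
      unfolding Rsum[OF z\<eta>] d_def using B_scale[OF r0] B_scale_right[OF r0] by simp
    then have B0: "\<bar>B 0 (z + R z) d\<bar> \<le> 0" using Be by simp
    have "\<bar>(g1 z - g2 z) + (g1 (R z) - g2 (R z))\<bar> \<le> 2 * \<Lambda> * (2 * h + norm z) powr \<alpha> * h * norm z"
      using G_mixed_difference(3)[OF nn[OF z] Rn B0] d yn by (simp add: g1_def g2_def)
    also have "\<dots> \<le> 2 * \<Lambda> * (3 * (h powr \<alpha> + norm z powr \<alpha>)) * h * norm z"
      using \<Lambda> \<alpha> h by (intro mult_right_mono mult_left_mono powr_add_le) auto
    also have "\<dots> = 6 * \<Lambda> * h * (norm z powr \<alpha> * norm z + h powr \<alpha> * norm z)" by (simp add: algebra_simps)
    also have "norm z powr \<alpha> * norm z = norm z powr (1 + \<alpha>)" by (cases "z = 0") (simp_all add: powr_add)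
    also have "6 * \<Lambda> * h * (norm z powr (1 + \<alpha>) + h powr \<alpha> * norm z) \<le> 24 * \<Lambda> * h * (norm z powr (1 + \<alpha>) + h powr \<alpha> * norm z)"
      using \<Lambda> h by (intro mult_right_mono) auto
    finally show "\<bar>(g1 z - g2 z) + (g1 (R z) - g2 (R z))\<bar> \<le> 24 * \<Lambda> * h * (norm z powr (1 + \<alpha>) + h powr \<alpha> * norm z)" .
  qed (use n2 s01 alpha \<eta> \<epsilon> h \<Lambda> \<kappa> Rn R\<eta> Rperp in auto)
  then show ?thesis
    unfolding kap_mass_difference[OF s01(1) pos borel_E borel_E] .
qed

text \<open>At positive height the points of the graph are boundary points of \<open>E\<close>. At
  height 0 the graph is approached from above along the vertical axis, and \<open>M\<close> is
  closed.\<close>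

lemma graph_in_M:
  assumes p0: "p0 $ k = 0" and y: "y \<bullet> \<eta> = 0" "0 \<le> y $ k" "norm (y + G y *\<^sub>R \<eta>) < r" "norm y < r"
  shows "p0 + (y + G y *\<^sub>R \<eta>) \<in> M"
proof -
  have \<eta>k: "\<eta> $ k = 0" using heights p0 by auto
  have pos: "p0 + (y + G y *\<^sub>R \<eta>) \<in> M" if y: "y \<bullet> \<eta> = 0" "0 < y $ k" "norm (y + G y *\<^sub>R \<eta>) < r" for y
  proof -
    have h: "0 < (p0 + (y + G y *\<^sub>R \<eta>)) $ k" using p0 \<eta>k y by simp
    have "(y + G y *\<^sub>R \<eta>) \<bullet> \<eta> = G (y + G y *\<^sub>R \<eta>)" unfolding G_shift using y \<eta> by (simp add: inner_add_left norm_eq_1)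
    then show ?thesis using frontier_graph[OF y(3) h] h by (intro frontier_in_M) auto
  qed
  show ?thesis
  proof (cases "0 < y $ k")
    case False
    then have yk: "y $ k = 0" using y by simp
    let ?\<kappa> = "axis k (1::real) :: real^'n"
    let ?y = "\<lambda>t. y + t *\<^sub>R ?\<kappa>"
    show ?thesis
    proof (rule Lim_in_closed_set[OF M_closed, of "\<lambda>t. p0 + (?y t + G (?y t) *\<^sub>R \<eta>)" "at_right 0"])
      have ly: "(?y \<longlongrightarrow> y) (at_right 0)" by (rule tendsto_eq_intros refl | simp)+
      have lG: "((\<lambda>t. G (?y t)) \<longlongrightarrow> G y) (at_right 0)"
        using continuous_G[OF y(4)] ly by (rule isCont_tendsto_compose)
      have lz: "((\<lambda>t. ?y t + G (?y t) *\<^sub>R \<eta>) \<longlongrightarrow> y + G y *\<^sub>R \<eta>) (at_right 0)" by (intro tendsto_intros ly lG)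
      then show "((\<lambda>t. p0 + (?y t + G (?y t) *\<^sub>R \<eta>)) \<longlongrightarrow> p0 + (y + G y *\<^sub>R \<eta>)) (at_right 0)" by (rule tendsto_add[OF tendsto_const])
      have "eventually (\<lambda>t. norm (?y t + G (?y t) *\<^sub>R \<eta>) < r) (at_right 0)"
        using order_tendstoD(2)[OF tendsto_norm[OF lz] y(3)] .
      moreover have "eventually (\<lambda>t::real. 0 < t) (at_right 0)" by (simp add: eventually_at_filter)
      ultimately show "eventually (\<lambda>t. p0 + (?y t + G (?y t) *\<^sub>R \<eta>) \<in> M) (at_right 0)"
      proof (rule eventually_elim2)
        fix t :: real assume t: "norm (?y t + G (?y t) *\<^sub>R \<eta>) < r" "0 < t"
        show "p0 + (?y t + G (?y t) *\<^sub>R \<eta>) \<in> M"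
          by (rule pos[OF _ _ t(1)]) (use y yk \<eta>k t in \<open>auto simp: inner_add_left inner_axis'\<close>)
      qed
    qed auto
  qed (use pos y in auto)
qed

text \<open>Differentiating the contact angle condition along \<open>\<partial>H\<close>.\<close>
lemma mixed_second_derivative_zero:
  assumes p0: "p0 $ k = 0" and \<eta>h: "\<eta> = hnormal p0" and G'0: "\<And>v. G' 0 v = \<sigma> / sqrt (1 - \<sigma>\<^sup>2) * v $ k"
    and v: "v $ k = 0" "v \<bullet> \<eta> = 0"
  shows "B 0 (axis k 1) v = 0"
proof -
  let ?\<kappa> = "axis k (1::real) :: real^'n"
  define N0 where "N0 = sqrt (1 - \<sigma>\<^sup>2)"
  have N0: "0 < N0" "N0 * N0 = 1 - \<sigma>\<^sup>2" using sigma_sq by (auto simp: N0_def)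
  have \<eta>k: "\<eta> $ k = 0" using heights p0 by auto
  have r0: "norm (0::real^'n) < r" using r by simp
  have nu0: "nu p0 \<bullet> \<eta> = N0" unfolding \<eta>h N0_def by (rule hnormal(4)[OF p0M p0])
  define X where "X = (\<lambda>y. p0 + (y + G y *\<^sub>R \<eta>))"
  have Xlim: "((\<lambda>t. X (t *\<^sub>R v)) \<longlongrightarrow> p0) (at_right 0)" and nlim: "((\<lambda>t. norm (t *\<^sub>R v + G (t *\<^sub>R v) *\<^sub>R \<eta>)) \<longlongrightarrow> 0) (at_right 0)"
    and vlim: "((\<lambda>t. norm (t *\<^sub>R v)) \<longlongrightarrow> 0) (at_right 0)"
  proof -
    have lv: "((\<lambda>t. t *\<^sub>R v) \<longlongrightarrow> 0) (at_right 0)" by (rule tendsto_eq_intros refl | simp)+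
    then show "((\<lambda>t. norm (t *\<^sub>R v)) \<longlongrightarrow> 0) (at_right 0)" using tendsto_norm_zero by blast
    have "((\<lambda>t. G (t *\<^sub>R v)) \<longlongrightarrow> G 0) (at_right 0)" using continuous_G[OF r0] lv by (rule isCont_tendsto_compose)
    then have lG: "((\<lambda>t. G (t *\<^sub>R v)) \<longlongrightarrow> 0) (at_right 0)" by (simp add: G0)
    have lz: "((\<lambda>t. t *\<^sub>R v + G (t *\<^sub>R v) *\<^sub>R \<eta>) \<longlongrightarrow> 0) (at_right 0)"
      using tendsto_add[OF lv tendsto_scaleR[OF lG tendsto_const[of \<eta>]]] by simp
    then show "((\<lambda>t. norm (t *\<^sub>R v + G (t *\<^sub>R v) *\<^sub>R \<eta>)) \<longlongrightarrow> 0) (at_right 0)" by (rule tendsto_norm_zero)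
    show "((\<lambda>t. X (t *\<^sub>R v)) \<longlongrightarrow> p0) (at_right 0)" unfolding X_def using tendsto_add[OF tendsto_const[of p0] lz] by simp
  qed
  have ev_small: "eventually (\<lambda>t. norm (t *\<^sub>R v + G (t *\<^sub>R v) *\<^sub>R \<eta>) < r \<and> norm (t *\<^sub>R v) < r \<and> 0 < t) (at_right 0)"
    using order_tendstoD(2)[OF nlim r(1)] order_tendstoD(2)[OF vlim r(1)]
    by (intro eventually_conj) (auto simp: eventually_at_filter)
  have XM: "X (t *\<^sub>R v) \<in> M" "X (t *\<^sub>R v) $ k = 0" if "norm (t *\<^sub>R v + G (t *\<^sub>R v) *\<^sub>R \<eta>) < r \<and> norm (t *\<^sub>R v) < r \<and> 0 < t" for t
    using graph_in_M[OF p0, of "t *\<^sub>R v"] that v p0 \<eta>k by (auto simp: X_def)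
  have tang: "nu (X (t *\<^sub>R v)) \<bullet> (w + G' (t *\<^sub>R v) w *\<^sub>R \<eta>) = 0"
    if t: "norm (t *\<^sub>R v + G (t *\<^sub>R v) *\<^sub>R \<eta>) < r \<and> norm (t *\<^sub>R v) < r \<and> 0 < t" and w: "w \<bullet> \<eta> = 0" for t w
  proof -
    have tv: "norm (t *\<^sub>R v) < r" using conjunct1[OF conjunct2[OF t]] .
    \<comment> \<open>For directions with nonnegative vertical component the one-sided curves in the
      graph stay in \<open>M\<close>; the other directions follow by linearity.\<close>
    have half: "nu (X (t *\<^sub>R v)) \<bullet> (w + G' (t *\<^sub>R v) w *\<^sub>R \<eta>) = 0" if w: "w \<bullet> \<eta> = 0" "0 \<le> w $ k" for w
    proof (rule tangent_orthogonal[OF nu_tangent[OF XM(1)[OF t]]])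
      let ?x = "\<lambda>u. X (t *\<^sub>R v + u *\<^sub>R w)"
      have "((\<lambda>u. t *\<^sub>R v + u *\<^sub>R w) has_derivative (\<lambda>h. h *\<^sub>R w)) (at 0)" by (auto intro!: derivative_eq_intros)
      moreover have "(G has_derivative G' (t *\<^sub>R v)) (at (t *\<^sub>R v + 0 *\<^sub>R w))" using deriv[OF tv] by simp
      ultimately have dG: "((\<lambda>u. G (t *\<^sub>R v + u *\<^sub>R w)) has_derivative (\<lambda>h. G' (t *\<^sub>R v) (h *\<^sub>R w))) (at 0)"
        by (rule has_derivative_compose)
      have lin: "G' (t *\<^sub>R v) (h *\<^sub>R w) = h * G' (t *\<^sub>R v) w" for h using linear_cmul[OF G'_linear[OF tv], of h w] by simp
      have "(?x has_derivative (\<lambda>h. h *\<^sub>R w + (h * G' (t *\<^sub>R v) w) *\<^sub>R \<eta>)) (at 0)"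
        unfolding X_def using dG[unfolded lin] by (auto intro!: derivative_eq_intros)
      then have "(?x has_derivative (\<lambda>h. h *\<^sub>R (w + G' (t *\<^sub>R v) w *\<^sub>R \<eta>))) (at 0)" by (simp add: scaleR_add_right)
      from difference_quotient_at_right[OF this]
      show "((\<lambda>u. (1 / u) *\<^sub>R (?x u - X (t *\<^sub>R v))) \<longlongrightarrow> w + G' (t *\<^sub>R v) w *\<^sub>R \<eta>) (at_right 0)" by simp
      have ly: "((\<lambda>u. t *\<^sub>R v + u *\<^sub>R w) \<longlongrightarrow> t *\<^sub>R v) (at_right 0)" by (rule tendsto_eq_intros refl | simp)+
      have lG: "((\<lambda>u. G (t *\<^sub>R v + u *\<^sub>R w)) \<longlongrightarrow> G (t *\<^sub>R v)) (at_right 0)"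
        using continuous_G[OF tv] ly by (rule isCont_tendsto_compose)
      have lz: "((\<lambda>u. (t *\<^sub>R v + u *\<^sub>R w) + G (t *\<^sub>R v + u *\<^sub>R w) *\<^sub>R \<eta>) \<longlongrightarrow> t *\<^sub>R v + G (t *\<^sub>R v) *\<^sub>R \<eta>) (at_right 0)"
        by (intro tendsto_intros ly lG)
      have t1: "norm (t *\<^sub>R v + G (t *\<^sub>R v) *\<^sub>R \<eta>) < r" using t by simp
      have "eventually (\<lambda>u. norm ((t *\<^sub>R v + u *\<^sub>R w) + G (t *\<^sub>R v + u *\<^sub>R w) *\<^sub>R \<eta>) < r \<and> norm (t *\<^sub>R v + u *\<^sub>R w) < r \<and> 0 < u) (at_right 0)"
        using order_tendstoD(2)[OF tendsto_norm[OF lz] t1] order_tendstoD(2)[OF tendsto_norm[OF ly] tv]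
        by (intro eventually_conj) (auto simp: eventually_at_filter)
      then show "eventually (\<lambda>u. ?x u \<in> M) (at_right 0)"
      proof (rule eventually_mono)
        fix u assume u: "norm ((t *\<^sub>R v + u *\<^sub>R w) + G (t *\<^sub>R v + u *\<^sub>R w) *\<^sub>R \<eta>) < r \<and> norm (t *\<^sub>R v + u *\<^sub>R w) < r \<and> 0 < u"
        show "?x u \<in> M" unfolding X_def
          by (rule graph_in_M[OF p0]) (use u w v in \<open>auto simp: inner_add_left\<close>)
      qed
    qed
    show ?thesis
    proof (cases "0 \<le> w $ k")
      case False
      have "nu (X (t *\<^sub>R v)) \<bullet> (- w + G' (t *\<^sub>R v) (- w) *\<^sub>R \<eta>) = 0" using w False by (intro half) auto
      then show ?thesis using linear_neg[OF G'_linear[OF tv], of w] by (simp add: inner_add_right inner_diff_right)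
    qed (use half w in auto)
  qed
  define C where "C = 18 * \<Lambda>\<^sup>2 * (norm v)\<^sup>2 / (N0 * N0 * N0) + 1"
  have Nlim: "((\<lambda>t. nu (X (t *\<^sub>R v)) \<bullet> \<eta>) \<longlongrightarrow> N0) (at_right 0)"
  proof -
    have "((\<lambda>t. nu (X (t *\<^sub>R v))) \<longlongrightarrow> nu p0) (at_right 0)"
      by (rule continuous_on_tendsto_compose[OF nu_continuous Xlim p0M]) (rule eventually_mono[OF ev_small], rule XM(1))
    then show ?thesis unfolding nu0[symmetric] by (intro tendsto_intros)
  qed
  have key: "eventually (\<lambda>t. \<bar>B 0 v ?\<kappa>\<bar> \<le> C * t + \<Lambda> * (t * norm v) powr \<alpha> * norm v) (at_right 0)"
  proof -
    have "eventually (\<lambda>t. N0 / 2 < nu (X (t *\<^sub>R v)) \<bullet> \<eta>) (at_right 0)" using N0 by (intro order_tendstoD(1)[OF Nlim]) simp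
    with ev_small show ?thesis
    proof (rule eventually_elim2)
      fix t assume t: "norm (t *\<^sub>R v + G (t *\<^sub>R v) *\<^sub>R \<eta>) < r \<and> norm (t *\<^sub>R v) < r \<and> 0 < t"
        and Nt: "N0 / 2 < nu (X (t *\<^sub>R v)) \<bullet> \<eta>"
      define n where "n = nu (X (t *\<^sub>R v))"
      define N where "N = n \<bullet> \<eta>"
      have N: "N0 / 2 < N" "0 < N" using Nt N0 by (auto simp: N_def n_def)
      have tv: "norm (t *\<^sub>R v) < r" using conjunct1[OF conjunct2[OF t]] .
      have nn: "norm n = 1" "n $ k = - \<sigma>" using nu_norm[OF XM(1)[OF t]] nu_k[OF XM(1,2)[OF t]] by (auto simp: n_def)
      have rel: "n \<bullet> w = - G' (t *\<^sub>R v) w * N" if "w \<bullet> \<eta> = 0" for w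
        using tang[OF t that] by (simp add: n_def[symmetric] inner_add_right N_def)
      \<comment> \<open>The vertical component of \<open>n\<close> is -\<sigma> at every point of
        \<open>M\<close> on \<partial>H. Together with the orthogonality of \<open>n\<close> to the
        vertical tangent vector of the graph, this ties the vertical slope of the graph to
        \<open>N\<close>.\<close>
      have gN: "G' (t *\<^sub>R v) ?\<kappa> * N = \<sigma>"
        using rel[of ?\<kappa>] \<eta>k nn by (simp add: inner_axis inner_axis')
      \<comment> \<open>The part of \<open>n\<close> orthogonal to \<eta> and to the vertical axis.
        It is O(t), because \<open>n\<close> is normal to the graph and the horizontal part of the
        differential vanishes at 0. Hence N^2 = 1 - \<sigma>^2 - |\<omega>|^2 changes by O(t^2)
        only, and so does the vertical slope \<sigma>/N. Its first-order coefficient, the second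
        derivative in the directions v and axis k, has to vanish.\<close>
      define \<omega> where "\<omega> = n - N *\<^sub>R \<eta> + \<sigma> *\<^sub>R ?\<kappa>"
      have \<omega>: "\<omega> $ k = 0" "\<omega> \<bullet> \<eta> = 0"
        using nn \<eta>k \<eta> by (auto simp: \<omega>_def inner_add_left inner_diff_left inner_axis' N_def norm_eq_1)
      have n_eq: "n = \<omega> + N *\<^sub>R \<eta> - \<sigma> *\<^sub>R ?\<kappa>" by (simp add: \<omega>_def)
      have "n \<bullet> \<omega> = \<omega> \<bullet> \<omega>" using \<omega> by (subst n_eq) (simp add: inner_add_left inner_diff_left inner_axis' inner_commute[of \<eta>])
      then have "\<omega> \<bullet> \<omega> = - G' (t *\<^sub>R v) \<omega> * N" using rel[OF \<omega>(2)] by simp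
      then have "(norm \<omega>)\<^sup>2 = \<bar>G' (t *\<^sub>R v) \<omega>\<bar> * \<bar>N\<bar>" by (metis abs_minus_cancel abs_mult abs_power2 dot_square_norm power2_norm_eq_inner abs_of_nonneg inner_ge_zero)
      also have "\<dots> \<le> (3 * \<Lambda> * norm (t *\<^sub>R v) * norm \<omega>) * 1"
      proof (intro mult_mono)
        have "\<bar>G' (0 + t *\<^sub>R v) \<omega> - G' 0 \<omega>\<bar> \<le> 3 * \<Lambda> * norm (t *\<^sub>R v) * norm \<omega>" using tv by (intro G'_lipschitz[OF r0]) simp
        then show "\<bar>G' (t *\<^sub>R v) \<omega>\<bar> \<le> 3 * \<Lambda> * norm (t *\<^sub>R v) * norm \<omega>" using G'0[of \<omega>] \<omega>(1) by simp
        show "\<bar>N\<bar> \<le> 1" unfolding N_def using Cauchy_Schwarz_ineq2[of n \<eta>] nn \<eta> by simp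
      qed (use \<Lambda> in auto)
      finally have "norm \<omega> * norm \<omega> \<le> (3 * \<Lambda> * norm (t *\<^sub>R v)) * norm \<omega>" by (simp add: power2_eq_square)
      then have wle: "norm \<omega> \<le> 3 * \<Lambda> * norm (t *\<^sub>R v)"
        using \<Lambda> by (cases "\<omega> = 0") auto
      have "1 = n \<bullet> n" using nn by (simp add: norm_eq_1)
      also have "\<dots> = \<omega> \<bullet> \<omega> + N * N + \<sigma> * \<sigma>"
      proof -
        have f: "\<eta> \<bullet> \<omega> = 0" "\<omega> \<bullet> ?\<kappa> = 0" "?\<kappa> \<bullet> \<omega> = 0" "\<eta> \<bullet> ?\<kappa> = 0" "?\<kappa> \<bullet> \<eta> = 0" "?\<kappa> \<bullet> ?\<kappa> = 1" "\<eta> \<bullet> \<eta> = 1"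
          using \<omega> \<eta> \<eta>k by (simp_all add: inner_commute[of \<eta> \<omega>] inner_axis inner_axis' inner_axis_axis norm_eq_1)
        have "(\<omega> + N *\<^sub>R \<eta> - \<sigma> *\<^sub>R ?\<kappa>) \<bullet> (\<omega> + N *\<^sub>R \<eta> - \<sigma> *\<^sub>R ?\<kappa>) = \<omega> \<bullet> \<omega> + N * N + \<sigma> * \<sigma>"
          by (simp add: inner_add_left inner_diff_left inner_add_right inner_diff_right f \<omega>(2))
        then show ?thesis by (simp only: n_eq[symmetric])
      qed
      finally have NN: "N0 * N0 - N * N = \<omega> \<bullet> \<omega>" using N0(2) by (simp add: power2_eq_square)
      have "(N0 - N) * (N0 + N) = (norm \<omega>)\<^sup>2" using NN by (simp add: algebra_simps power2_norm_eq_inner)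
      moreover have "(norm \<omega>)\<^sup>2 \<le> (3 * \<Lambda> * norm (t *\<^sub>R v))\<^sup>2" using wle by (intro power_mono) auto
      ultimately have up: "(N0 - N) * (N0 + N) \<le> 9 * \<Lambda>\<^sup>2 * (norm v)\<^sup>2 * t\<^sup>2" and lo: "0 \<le> (N0 - N) * (N0 + N)"
        using t by (auto simp: power_mult_distrib mult_ac)
      have NN0: "0 \<le> N0 - N" using lo N N0 by (simp add: zero_le_mult_iff)
      have "(N0 - N) * N0 \<le> (N0 - N) * (N0 + N)" using NN0 N by (intro mult_left_mono) auto
      then have d1: "N0 - N \<le> 9 * \<Lambda>\<^sup>2 * (norm v)\<^sup>2 * t\<^sup>2 / N0" using up N0 by (simp add: field_simps)
      have "G' (t *\<^sub>R v) ?\<kappa> - G' 0 ?\<kappa> = \<sigma> / N - \<sigma> / N0"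
        using gN N G'0[of ?\<kappa>] by (simp add: N0_def field_simps)
      also have "\<dots> = \<sigma> * (N0 - N) / (N * N0)" using N N0 by (simp add: field_simps)
      finally have "\<bar>G' (t *\<^sub>R v) ?\<kappa> - G' 0 ?\<kappa>\<bar> = \<bar>\<sigma>\<bar> * (N0 - N) / (N * N0)" using N N0 NN0 by (simp add: abs_mult)
      also have "\<dots> \<le> 1 * (9 * \<Lambda>\<^sup>2 * (norm v)\<^sup>2 * t\<^sup>2 / N0) / ((N0 / 2) * N0)"
        using sigma N N0(1) NN0 d1 by (intro frac_le mult_mono mult_right_mono) auto
      also have "\<dots> = 18 * \<Lambda>\<^sup>2 * (norm v)\<^sup>2 / (N0 * N0 * N0) * t\<^sup>2" by (simp add: field_simps)
      also have "\<dots> \<le> C * t\<^sup>2" by (intro mult_right_mono) (auto simp: C_def)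
      finally have 1: "\<bar>G' (t *\<^sub>R v) ?\<kappa> - G' 0 ?\<kappa>\<bar> \<le> C * t\<^sup>2" .
      have 2: "\<bar>G' (t *\<^sub>R v) ?\<kappa> - G' 0 ?\<kappa> - t * B 0 v ?\<kappa>\<bar> \<le> \<Lambda> * (t * norm v) powr \<alpha> * (t * norm v)"
        using taylor[of 0 "t *\<^sub>R v" 0 ?\<kappa>] tv r0 t B_scale[OF r0] by (simp add: norm_axis_1)
      have "t * \<bar>B 0 v ?\<kappa>\<bar> = \<bar>t * B 0 v ?\<kappa>\<bar>" using t by (simp add: abs_mult)
      also have "\<dots> \<le> C * t\<^sup>2 + \<Lambda> * (t * norm v) powr \<alpha> * (t * norm v)" using 1 2 by linarith
      also have "\<dots> = t * (C * t + \<Lambda> * (t * norm v) powr \<alpha> * norm v)" by (simp add: power2_eq_square algebra_simps)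
      finally show "\<bar>B 0 v ?\<kappa>\<bar> \<le> C * t + \<Lambda> * (t * norm v) powr \<alpha> * norm v" using t by simp
    qed
  qed
  have "((\<lambda>t. C * t + \<Lambda> * (t * norm v) powr \<alpha> * norm v) \<longlongrightarrow> C * 0 + \<Lambda> * (0 * norm v) powr \<alpha> * norm v) (at_right 0)"
    using \<alpha> by (intro tendsto_intros tendsto_powr2) (auto intro!: eventually_at_rightI[of 0 1])
  then have "((\<lambda>t. C * t + \<Lambda> * (t * norm v) powr \<alpha> * norm v) \<longlongrightarrow> 0) (at_right 0)" by simp
  then have "\<bar>B 0 v ?\<kappa>\<bar> \<le> 0" using key by (rule tendsto_lowerbound) simp
  then show ?thesis using B_symmetric[of v ?\<kappa>] by simp
qed

end

section \<open>Two boundary graphs that touch to first order\<close>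

lemma C2alpha_graph_hrefl:
  fixes \<eta> e :: "'a::euclidean_space"
  assumes g: "C2alpha_graph \<alpha> r \<Lambda> \<eta> G G' B" and e: "norm e = 1"
  shows "C2alpha_graph \<alpha> r \<Lambda> (hrefl e \<eta>) (\<lambda>y. G (hrefl e y)) (\<lambda>y v. G' (hrefl e y) (hrefl e v))
     (\<lambda>y z v. B (hrefl e y) (hrefl e z) (hrefl e v))"
proof -
  interpret C2alpha_graph \<alpha> r \<Lambda> \<eta> G G' B by (rule g)
  have nr: "norm (hrefl e y) = norm y" for y by (rule norm_hrefl[OF e])
  show ?thesis
  proof
    show "0 < \<alpha>" "\<alpha> \<le> 1" "0 < r" "r \<le> 1" "0 \<le> \<Lambda>" by (fact \<alpha> r \<Lambda>)+
    show "norm (hrefl e \<eta>) = 1" using \<eta> by (simp add: nr)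
    show "G (hrefl e 0) = 0" using G0 by (simp add: hrefl_def)
    show "G (hrefl e (perp (hrefl e \<eta>) y)) = G (hrefl e y)" for y
    proof -
      have "y \<bullet> hrefl e \<eta> = hrefl e y \<bullet> \<eta>" using hrefl_inner[OF e, of y "hrefl e \<eta>"] by (simp add: hrefl_hrefl[OF e])
      then have "hrefl e (perp (hrefl e \<eta>) y) = perp \<eta> (hrefl e y)"
        by (simp add: perp_def hrefl_diff hrefl_scaleR hrefl_hrefl[OF e])
      then show ?thesis by (simp add: G_perp)
    qed
    show "((\<lambda>y. G (hrefl e y)) has_derivative (\<lambda>v. G' (hrefl e y) (hrefl e v))) (at y)" if "norm y < r" for y
    proof -
      have "linear (hrefl e)" by (intro linearI) (simp_all add: hrefl_add hrefl_scaleR)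
      then have "(hrefl e has_derivative hrefl e) (at y)"
        by (intro bounded_linear_imp_has_derivative) (simp add: linear_conv_bounded_linear)
      then show ?thesis by (rule has_derivative_compose) (rule deriv, simp add: nr that)
    qed
    show "\<bar>G' (hrefl e (y + z)) (hrefl e v) - G' (hrefl e y) (hrefl e v) - B (hrefl e y0) (hrefl e z) (hrefl e v)\<bar>
       \<le> \<Lambda> * (norm (y - y0) + norm z) powr \<alpha> * norm z * norm v"
      if "norm y < r" "norm (y + z) < r" "norm y0 < r" for y z y0 v
    proof -
      have "norm (hrefl e y) < r" "norm (hrefl e y + hrefl e z) < r" "norm (hrefl e y0) < r"
        using that by (simp_all add: nr flip: hrefl_add)
      from taylor[OF this, of "hrefl e v"] show ?thesis by (simp add: hrefl_add nr flip: hrefl_diff)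
    qed
    show "\<bar>B (hrefl e y) (hrefl e z) (hrefl e v)\<bar> \<le> \<Lambda> * norm z * norm v" if "norm y < r" for y z v
      using B_bound[of "hrefl e y" "hrefl e z" "hrefl e v"] that by (simp add: nr)
  qed (simp_all add: nr hrefl_add hrefl_scaleR B_add B_scale B_scale_right)
qed

text \<open>The points compared here may come from points far apart, so no gain from a small
  distance is needed and \<omega> is 1. Beyond the distance h the symmetry is the identity, which
  trivially respects the cut: since the differentials at 0 agree, the whole difference of the
  recentred graphs, and not only an even part of it, is of second order up to an error of size
  h|z|.\<close>

lemma touching_graphs_bound:
  fixes q0 \<eta> \<kappa> :: "'a::euclidean_space" and E1 E2 :: "'a set"
  assumes dim: "2 \<le> DIM('a)" and s: "0 < s" "s < \<alpha>" "\<alpha> < 1"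
    and g1: "C2alpha_graph \<alpha> r1 \<Lambda>1 \<eta> G1 G1' B1" and g2: "C2alpha_graph \<alpha> r2 \<Lambda>2 \<eta> G2 G2' B2"
    and \<kappa>: "norm \<kappa> = 1" "\<kappa> \<bullet> \<eta> = 0" and eq0: "\<And>v. G1' 0 v = G2' 0 v"
    and E: "E1 \<in> sets borel" "E2 \<in> sets borel"
    and E1: "\<And>z. norm z < r1 \<Longrightarrow> q0 + z \<in> E1 \<longleftrightarrow> 0 < z \<bullet> \<kappa> \<and> z \<bullet> \<eta> < G1 z"
    and E2: "\<And>z. norm z < r2 \<Longrightarrow> q0 + z \<in> E2 \<longleftrightarrow> 0 < z \<bullet> \<kappa> \<and> z \<bullet> \<eta> < G2 z"
    and h: "0 < h" "h \<le> \<rho>" "h + \<rho> < r1" "h + \<rho> < r2"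
    and w1: "w1 = h *\<^sub>R \<kappa> + G1 (h *\<^sub>R \<kappa>) *\<^sub>R \<eta>" and w2: "w2 = h *\<^sub>R \<kappa> + G2 (h *\<^sub>R \<kappa>) *\<^sub>R \<eta>"
    and nw: "norm w1 + \<rho> < r1" "norm w2 + \<rho> < r2" and \<epsilon>: "0 < \<epsilon>" "\<epsilon> \<le> h"
  shows "\<bar>(kap_mass s (\<epsilon>\<^sup>2) E1 (q0 + w1) - kap_mass s (\<rho>\<^sup>2) E1 (q0 + w1))
      - (kap_mass s (\<epsilon>\<^sup>2) E2 (q0 + w2) - kap_mass s (\<rho>\<^sup>2) E2 (q0 + w2))\<bar>
      \<le> 2 * 1 * graph_const TYPE('a) s \<alpha> (6 * (\<Lambda>1 + \<Lambda>2)) * \<rho> powr (\<alpha> - s)"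
proof -
  interpret A: C2alpha_graph \<alpha> r1 \<Lambda>1 \<eta> G1 G1' B1 by (rule g1)
  interpret B: C2alpha_graph \<alpha> r2 \<Lambda>2 \<eta> G2 G2' B2 by (rule g2)
  define y where "y = h *\<^sub>R \<kappa>"
  define L where "L = 6 * (\<Lambda>1 + \<Lambda>2)"
  have L: "0 \<le> L" "6 * \<Lambda>1 \<le> L" "6 * \<Lambda>2 \<le> L" using A.\<Lambda> B.\<Lambda> by (auto simp: L_def)
  have yn: "norm y = h" "y \<bullet> \<kappa> = h" "y \<bullet> \<eta> = 0" using h \<kappa> by (auto simp: y_def norm_eq_1)
  define gg1 where "gg1 = (\<lambda>z. G1 (y + z) - G1 y)"
  define gg2 where "gg2 = (\<lambda>z. G2 (y + z) - G2 y)"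
  have pos: "0 < \<epsilon>\<^sup>2" "0 < \<rho>\<^sup>2" using \<epsilon> h by auto
  have sm: "norm z \<le> 1" "h + norm z \<le> 1" if "norm z < \<rho>" for z :: 'a using that h A.r by linarith+
  have pw: "(norm z)\<^sup>2 \<le> norm z powr (1 + \<alpha>)" if "norm z < \<rho>" for z :: 'a
    using A.\<alpha> sm[OF that] by (intro power2_le_powr) auto
  have h1: "h \<le> 1" using sm(2)[of 0] h by simp
  have hw: "h \<le> h powr \<alpha>" using powr_mono'[of \<alpha> 1 h] A.\<alpha> h h1 by simp
  have shift1: "G1 (z + t *\<^sub>R \<eta>) = G1 z" for z t
    using A.G_perp[of "z + t *\<^sub>R \<eta>"] A.G_perp[of z] A.\<eta> by (simp add: perp_add perp_scaleR perp_self)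
  have shift2: "G2 (z + t *\<^sub>R \<eta>) = G2 z" for z t
    using B.G_perp[of "z + t *\<^sub>R \<eta>"] B.G_perp[of z] A.\<eta> by (simp add: perp_add perp_scaleR perp_self)
  have per: "gg1 (perp \<eta> z) = gg1 z" "gg2 (perp \<eta> z) = gg2 z" for z
    using A.G_perp_add[of z y] B.G_perp_add[of z y] by (simp_all add: gg1_def gg2_def add.commute)
  have F: "\<bar>gg1 z - gg2 z\<bar> \<le> 3 * (\<Lambda>1 + \<Lambda>2) * (h + norm z) * norm z" if z: "norm z < \<rho>" for z
  proof -
    have inb: "norm (y + t *\<^sub>R z) \<le> h + norm z" if "0 \<le> t" "t \<le> 1" for t
    proof -
      have "norm (y + t *\<^sub>R z) \<le> norm y + t * norm z" using norm_triangle_ineq[of y "t *\<^sub>R z"] that by simp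
      also have "t * norm z \<le> norm z" using that mult_right_mono[of t 1 "norm z"] by simp
      finally show ?thesis using yn by simp
    qed
    have inr: "norm (y + t *\<^sub>R z) < r1" "norm (y + t *\<^sub>R z) < r2" if "0 \<le> t" "t \<le> 1" for t
      using inb[OF that] z h by linarith+
    define f where "f = (\<lambda>t. G1 (y + t *\<^sub>R z) - G2 (y + t *\<^sub>R z))"
    have D: "(f has_real_derivative G1' (y + t *\<^sub>R z) z - G2' (y + t *\<^sub>R z) z) (at t)" if "0 \<le> t" "t \<le> 1" for t
      unfolding f_def using inr[OF that] by (intro DERIV_diff A.line_deriv B.line_deriv) auto
    obtain t where t: "0 < t" "t < 1" "f 1 - f 0 = G1' (y + t *\<^sub>R z) z - G2' (y + t *\<^sub>R z) z"
      using MVT_unit_interval[OF D] by blast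
    have n: "norm (0 + (y + t *\<^sub>R z)) < r1" "norm (0 + (y + t *\<^sub>R z)) < r2" using inr[of t] t by auto
    have 1: "\<bar>G1' (y + t *\<^sub>R z) z - G1' 0 z\<bar> \<le> 3 * \<Lambda>1 * norm (y + t *\<^sub>R z) * norm z"
      using A.G'_lipschitz[OF _ n(1), of z] A.r by simp
    have 2: "\<bar>G2' (y + t *\<^sub>R z) z - G2' 0 z\<bar> \<le> 3 * \<Lambda>2 * norm (y + t *\<^sub>R z) * norm z"
      using B.G'_lipschitz[OF _ n(2), of z] B.r by simp
    have "\<bar>f 1 - f 0\<bar> \<le> 3 * \<Lambda>1 * norm (y + t *\<^sub>R z) * norm z + 3 * \<Lambda>2 * norm (y + t *\<^sub>R z) * norm z"
      unfolding t(3) using 1 2 eq0[of z] by linarith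
    also have "\<dots> = 3 * (\<Lambda>1 + \<Lambda>2) * norm (y + t *\<^sub>R z) * norm z" by (simp add: algebra_simps)
    also have "\<dots> \<le> 3 * (\<Lambda>1 + \<Lambda>2) * (h + norm z) * norm z"
      using A.\<Lambda> B.\<Lambda> inb[of t] t by (intro mult_right_mono mult_left_mono) auto
    finally show ?thesis by (simp add: f_def gg1_def gg2_def algebra_simps)
  qed
  have "\<bar>LINT z|lborel. (indicator {z. (q0 + w1) + z \<in> E1} z - indicator {z. (q0 + w2) + z \<in> E2} z) *
       (kap ((real DIM('a) + s) / 2) (\<epsilon>\<^sup>2) ((norm z)\<^sup>2) - kap ((real DIM('a) + s) / 2) (\<rho>\<^sup>2) ((norm z)\<^sup>2))\<bar>
      \<le> 2 * 1 * graph_const TYPE('a) s \<alpha> L * \<rho> powr (\<alpha> - s)"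
  proof (rule cut_pair_bound[where ?g1.0=gg1 and ?g2.0=gg2 and \<eta>=\<eta> and \<kappa>=\<kappa> and h=h and R="\<lambda>z. z"])
    show "{z. (q0 + w1) + z \<in> E1} \<in> sets borel" "{z. (q0 + w2) + z \<in> E2} \<in> sets borel"
      using borel_translate E by auto
    show "distr lborel borel (\<lambda>z::'a. z) = lborel" by (simp add: distr_id2)
    fix z :: 'a assume z: "norm z < \<rho>"
    have n1: "norm (w1 + z) < r1" "norm (w2 + z) < r2"
      using nw z norm_triangle_ineq[of w1 z] norm_triangle_ineq[of w2 z] by linarith+
    have i: "(w1 + z) \<bullet> \<kappa> = h + z \<bullet> \<kappa>" "(w2 + z) \<bullet> \<kappa> = h + z \<bullet> \<kappa>" "(w1 + z) \<bullet> \<eta> = G1 y + z \<bullet> \<eta>" "(w2 + z) \<bullet> \<eta> = G2 y + z \<bullet> \<eta>"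
      using yn \<kappa> A.\<eta> by (simp_all add: w1 w2 y_def[symmetric] inner_add_left norm_eq_1 inner_commute[of \<eta> \<kappa>])
    have Gz: "G1 (w1 + z) = G1 (y + z)" "G2 (w2 + z) = G2 (y + z)"
      using shift1[of "y + z" "G1 y"] shift2[of "y + z" "G2 y"] by (simp_all add: w1 w2 y_def[symmetric] add_ac)
    have "q0 + w1 + z \<in> E1 \<longleftrightarrow> 0 < (w1 + z) \<bullet> \<kappa> \<and> (w1 + z) \<bullet> \<eta> < G1 (w1 + z)" using E1[OF n1(1)] by (simp add: add.assoc)
    then show "z \<in> {z. (q0 + w1) + z \<in> E1} \<longleftrightarrow> - h < z \<bullet> \<kappa> \<and> z \<bullet> \<eta> < gg1 (perp \<eta> z)"
      unfolding mem_Collect_eq per unfolding gg1_def i Gz by auto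
    have "q0 + w2 + z \<in> E2 \<longleftrightarrow> 0 < (w2 + z) \<bullet> \<kappa> \<and> (w2 + z) \<bullet> \<eta> < G2 (w2 + z)" using E2[OF n1(2)] by (simp add: add.assoc)
    then show "z \<in> {z. (q0 + w2) + z \<in> E2} \<longleftrightarrow> - h < z \<bullet> \<kappa> \<and> z \<bullet> \<eta> < gg2 (perp \<eta> z)"
      unfolding mem_Collect_eq per unfolding gg2_def i Gz by auto
    have nd: "norm y + norm z < r1" "norm y + norm z < r2" using yn z h by auto
    have s1: "\<bar>gg1 z + gg1 (- z)\<bar> \<le> 6 * \<Lambda>1 * (norm z)\<^sup>2" using A.G_second_difference[OF nd(1)] by (simp add: gg1_def)
    have s2: "\<bar>gg2 z + gg2 (- z)\<bar> \<le> 6 * \<Lambda>2 * (norm z)\<^sup>2" using B.G_second_difference[OF nd(2)] by (simp add: gg2_def)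
    have p6: "c * (norm z)\<^sup>2 \<le> L * norm z powr (1 + \<alpha>)" if "c \<le> L" for c
    proof -
      have "c * (norm z)\<^sup>2 \<le> L * (norm z)\<^sup>2" using that by (intro mult_right_mono) auto
      also have "\<dots> \<le> L * norm z powr (1 + \<alpha>)" using pw[OF z] L by (intro mult_left_mono) auto
      finally show ?thesis .
    qed
    show "\<bar>gg1 z + gg1 (- z)\<bar> \<le> L * norm z powr (1 + \<alpha>)" using s1 p6[OF L(2)] by linarith
    show "\<bar>gg2 z + gg2 (- z)\<bar> \<le> L * norm z powr (1 + \<alpha>)" using s2 p6[OF L(3)] by linarith
    have "\<bar>(gg1 z - gg2 z) + (gg1 (- z) - gg2 (- z))\<bar> \<le> L * (norm z)\<^sup>2"
      using s1 s2 by (simp add: L_def algebra_simps)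
    then show "\<bar>(gg1 z - gg2 z) + (gg1 (- z) - gg2 (- z))\<bar> \<le> L * 1 * norm z powr (1 + \<alpha>)" using p6[of L] by simp
    have "\<bar>gg1 z - gg2 z\<bar> \<le> 3 * (\<Lambda>1 + \<Lambda>2) * (h + norm z) * norm z" by (rule F[OF z])
    also have "\<dots> \<le> 3 * (\<Lambda>1 + \<Lambda>2) * 1 * norm z" using sm(2)[OF z] A.\<Lambda> B.\<Lambda> by (intro mult_right_mono mult_left_mono) auto
    also have "\<dots> \<le> L * 1 * norm z" unfolding L_def using A.\<Lambda> B.\<Lambda> by (intro mult_right_mono) auto
    finally show "\<bar>gg1 z - gg2 z\<bar> \<le> L * 1 * norm z" .
    have "gg1 z - gg2 z + (gg1 z - gg2 z) = 2 * (gg1 z - gg2 z)" by simp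
    then have "\<bar>gg1 z - gg2 z + (gg1 z - gg2 z)\<bar> = 2 * \<bar>gg1 z - gg2 z\<bar>" by (simp only: abs_mult abs_numeral)
    also have "\<dots> \<le> 2 * (3 * (\<Lambda>1 + \<Lambda>2) * (h + norm z) * norm z)" by (rule mult_left_mono[OF F[OF z]]) simp
    also have "\<dots> = L * ((norm z)\<^sup>2 + h * norm z)" by (simp add: L_def power2_eq_square algebra_simps)
    also have "\<dots> \<le> L * (norm z powr (1 + \<alpha>) + h powr \<alpha> * norm z)"
      using L pw[OF z] hw by (intro mult_left_mono add_mono mult_right_mono) auto
    finally show "\<bar>gg1 z - gg2 z + (gg1 z - gg2 z)\<bar> \<le> L * 1 * (norm z powr (1 + \<alpha>) + h powr \<alpha> * norm z)" by simp
  qed (use dim s A.\<eta> \<epsilon> h \<kappa> L in auto)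
  then show ?thesis
    unfolding kap_mass_difference[OF s(1) pos E] L_def .
qed

lemma kap_mass_alt:
  fixes q :: "'a::euclidean_space"
  assumes E: "E \<in> sets borel" and a: "0 < a"
  shows "kap_mass s a E q = (LINT x|lborel. indicator E x * kap ((real DIM('a) + s) / 2) a ((norm (x - q))\<^sup>2))"
proof -
  let ?f = "\<lambda>x. indicator E x * kap ((real DIM('a) + s) / 2) a ((norm (x - q))\<^sup>2) :: real"
  have "(\<lambda>x. kap ((real DIM('a) + s) / 2) a ((norm (x - q))\<^sup>2)) \<in> borel_measurable borel"
    using a by (auto intro!: borel_measurable_continuous_onI continuous_intros)
  then have m: "?f \<in> borel_measurable borel" using E by simp
  have "(LINT x|lborel. ?f x) = (LINT x|distr lborel borel ((+) q). ?f x)" by (simp only: lborel_distr_plus)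
  also have "\<dots> = (LINT z|lborel. ?f (q + z))" by (rule integral_distr) (use m in auto)
  finally show ?thesis by (simp add: kap_mass_def)
qed

section \<open>Lower bounds from the reflection\<close>

lemma integrable_on_bounded_set:
  fixes f :: "'a::euclidean_space \<Rightarrow> real"
  assumes E: "E \<in> sets borel" "bounded E" and f: "f \<in> borel_measurable borel" and b: "\<And>x. x \<in> E \<Longrightarrow> \<bar>f x\<bar> \<le> K"
  shows "integrable lborel (\<lambda>x. indicator E x * f x)"
proof -
  obtain r where r: "\<And>x. x \<in> E \<Longrightarrow> norm x \<le> r" using E(2) by (auto simp: bounded_iff)
  show ?thesis
  proof (rule integrable_bounded_support[where K="\<bar>K\<bar>" and r="\<bar>r\<bar> + 1"])
    show "(\<lambda>x. indicator E x * f x) \<in> borel_measurable borel" using E f by simp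
    show "\<bar>indicator E x * f x\<bar> \<le> \<bar>K\<bar>" for x using b[of x] by (auto simp: indicator_def)
    show "indicator E x * f x = 0" if "\<bar>r\<bar> + 1 \<le> norm x" for x using r[of x] that by (auto simp: indicator_def)
  qed
qed

lemma borel_measurable_kap_dist:
  fixes q :: "'a::euclidean_space"
  assumes "0 < a"
  shows "(\<lambda>x. kap b a ((norm (x - q))\<^sup>2)) \<in> borel_measurable borel" "(\<lambda>x. dkap b a ((norm (x - q))\<^sup>2)) \<in> borel_measurable borel"
  using assms by (auto intro!: borel_measurable_continuous_onI continuous_intros)

lemma integrable_kap_dist:
  fixes q :: "'a::euclidean_space"
  assumes E: "E \<in> sets borel" "bounded E" and a: "0 < a" "0 < b"
  shows "integrable lborel (\<lambda>x. indicator E x * kap b a ((norm (x - q))\<^sup>2))"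
proof (rule integrable_on_bounded_set[OF E borel_measurable_kap_dist(1)[OF a(1)], where K="(1 + b) * a powr (-b)"])
  show "\<bar>kap b a ((norm (x - q))\<^sup>2)\<bar> \<le> (1 + b) * a powr (-b)" for x
    using kap_nonneg[OF a, of "(norm (x - q))\<^sup>2"] kap_le_const[OF a, of "(norm (x - q))\<^sup>2"] by simp
qed

text \<open>For a fixed truncation the kernel is bounded and continuous. In this way the outer part
  of a potential follows a pair of points to its limit.\<close>

lemma kap_mass_tendsto:
  fixes q :: "'a::euclidean_space"
  assumes E: "E \<in> sets borel" "bounded E" and s: "0 < s" and a: "0 < a" and x: "x \<longlonglongrightarrow> q"
  shows "(\<lambda>j. kap_mass s a E (x j)) \<longlonglongrightarrow> kap_mass s a E q"
proof -
  let ?b = "(real DIM('a) + s) / 2"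
  have b: "0 < ?b" using s by simp
  have m: "(\<lambda>x. indicator E x * kap ?b a ((norm (x - q))\<^sup>2)) \<in> borel_measurable lborel" for q :: 'a
    using borel_measurable_integrable[OF integrable_kap_dist[OF E a b]] .
  have c: "isCont (kap ?b a) t" for t using DERIV_isCont[OF kap_deriv[OF a]] .
  show ?thesis
    unfolding kap_mass_alt[OF E(1) a]
  proof (rule integral_dominated_convergence[where w="\<lambda>x. indicator E x * ((1 + ?b) * a powr (-?b))"])
    show "integrable lborel (\<lambda>x. indicator E x * ((1 + ?b) * a powr (-?b)))"
      by (rule integrable_on_bounded_set[OF E, where K="\<bar>(1 + ?b) * a powr (-?b)\<bar>"]) auto
    show "AE z in lborel. (\<lambda>j. indicator E z * kap ?b a ((norm (z - x j))\<^sup>2)) \<longlonglongrightarrow> indicator E z * kap ?b a ((norm (z - q))\<^sup>2)"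
      by (intro AE_I2 tendsto_mult tendsto_const isCont_tendsto_compose[OF c] tendsto_power tendsto_norm tendsto_diff x)
    show "AE z in lborel. norm (indicator E z * kap ?b a ((norm (z - x j))\<^sup>2)) \<le> indicator E z * ((1 + ?b) * a powr (-?b))" for j
      using kap_nonneg[OF a b] kap_le_const[OF a b] by (intro AE_I2) (auto simp: indicator_def)
  qed (rule m)+
qed

text \<open>The first moment of the cap about the plane, weighted by (n+s) d^(-n-s-2) with d the
  diameter. The weight is twice the value of \<open>dkap\<close> for the exponent (n+s)/2 at d^2,
  that is, twice the least slope of the kernel at distances up to d.\<close>

definition refl_defect :: "real \<Rightarrow> real^'n::finite \<Rightarrow> real \<Rightarrow> (real^'n) set \<Rightarrow> real" where
  "refl_defect s e c E = (real CARD('n) + s) * diameter E powr (- (real CARD('n) + s) - 2)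
     * (LINT x|lborel. indicator {x\<in>E. x \<bullet> e < c \<and> reflection e c x \<notin> E} x * (c - x \<bullet> e))"

lemma borel_reflection_cap:
  assumes E: "E \<in> sets borel"
  shows "{x\<in>E. x \<bullet> e < c \<and> reflection e c x \<notin> E} \<in> sets borel"
proof -
  have RE: "{x. reflection e c x \<in> E} \<in> sets borel"
    using measurable_sets[OF borel_measurable_reflection E] by (simp add: vimage_def)
  have "{x\<in>E. x \<bullet> e < c \<and> reflection e c x \<notin> E} = E \<inter> {x. x \<bullet> e < c} \<inter> (- {x. reflection e c x \<in> E})" by auto
  moreover have "{x. x \<bullet> e < c} \<in> sets borel" by auto
  ultimately show ?thesis using E borel_comp[OF RE] by (simp only: sets.Int)
qed

text \<open>Distances to \<open>p\<close> do not exceed the diameter d, and \<open>dkap\<close> is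
  smallest at d^2. The condition on \<open>a\<close> keeps d^2 outside the truncated range, so that
  the lower bound is the same for all such truncations.\<close>

lemma reflection_cap_integral_lower:
  fixes e :: "real^'n::finite" and E :: "(real^'n) set"
  assumes E: "E \<in> sets borel" "bounded E" and p: "\<And>x. x \<in> E \<Longrightarrow> norm (x - p) \<le> diameter E"
    and d: "0 < diameter E" and s: "0 < s" and a: "0 < a" "a \<le> (diameter E)\<^sup>2"
  shows "refl_defect s e c E \<le> (LINT x|lborel. indicator {x\<in>E. x \<bullet> e < c \<and> reflection e c x \<notin> E} x
           * (dkap ((real CARD('n) + s) / 2) a ((norm (x - p))\<^sup>2) * (2 * (c - x \<bullet> e))))"
proof -
  define A where "A = {x\<in>E. x \<bullet> e < c \<and> reflection e c x \<notin> E}"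
  define m where "m = real CARD('n) + s"
  define D where "D = diameter E"
  have m: "0 < m / 2" using s by (simp add: m_def)
  have A: "A \<in> sets borel" "bounded A" unfolding A_def by (rule borel_reflection_cap[OF E(1)], rule bounded_subset[OF E(2)]) auto
  obtain r where r: "\<And>x. x \<in> A \<Longrightarrow> norm x \<le> r" using A(2) by (auto simp: bounded_iff)
  have bd: "\<bar>c - x \<bullet> e\<bar> \<le> \<bar>c\<bar> + r * norm e" if "x \<in> A" for x
  proof -
    have "\<bar>x \<bullet> e\<bar> \<le> norm x * norm e" by (rule Cauchy_Schwarz_ineq2)
    also have "\<dots> \<le> r * norm e" using r[OF that] by (intro mult_right_mono) auto
    finally show ?thesis by linarith
  qed
  have d0: "dkap (m/2) a t \<le> dkap (m/2) a 0" if "0 \<le> t" for t using dkap_antimono[OF m a(1) order_refl that] .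
  have "D powr (- m - 2) * m = 2 * dkap (m/2) a (D\<^sup>2)"
  proof -
    have e1: "-((m + 2)/2) = - (m/2) - 1" by (simp add: field_simps)
    have "(D\<^sup>2) powr (- (m/2) - 1) = D powr (-(m + 2))"
      using power2_powr_half[of D "m + 2"] d unfolding e1 by (simp add: D_def)
    moreover have "max a (D\<^sup>2) = D\<^sup>2" using a by (simp add: D_def max_def)
    moreover have "- (m + 2) = - m - 2" by simp
    ultimately show ?thesis unfolding dkap_def by simp
  qed
  then have "refl_defect s e c E = 2 * dkap (m/2) a (D\<^sup>2) * (LINT x|lborel. indicator A x * (c - x \<bullet> e))"
    unfolding refl_defect_def m_def[symmetric] A_def[symmetric] D_def[symmetric] by (simp add: mult.commute)
  also have "\<dots> = (LINT x|lborel. 2 * dkap (m/2) a (D\<^sup>2) * (indicator A x * (c - x \<bullet> e)))" by (rule integral_mult_right_zero[symmetric])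
  also have "\<dots> \<le> (LINT x|lborel. indicator A x * (dkap (m/2) a ((norm (x - p))\<^sup>2) * (2 * (c - x \<bullet> e))))"
  proof (rule integral_mono)
    show "integrable lborel (\<lambda>x. 2 * dkap (m/2) a (D\<^sup>2) * (indicator A x * (c - x \<bullet> e)))"
      by (intro integrable_mult_right integrable_on_bounded_set[OF A, where K="\<bar>c\<bar> + r * norm e"] bd) auto
    show "integrable lborel (\<lambda>x. indicator A x * (dkap (m/2) a ((norm (x - p))\<^sup>2) * (2 * (c - x \<bullet> e))))"
    proof (rule integrable_on_bounded_set[OF A, where K="dkap (m/2) a 0 * (2 * (\<bar>c\<bar> + r * norm e))"])
      show "(\<lambda>x. dkap (m/2) a ((norm (x - p))\<^sup>2) * (2 * (c - x \<bullet> e))) \<in> borel_measurable borel"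
        by (intro borel_measurable_times borel_measurable_kap_dist a) auto
      show "\<bar>dkap (m/2) a ((norm (x - p))\<^sup>2) * (2 * (c - x \<bullet> e))\<bar> \<le> dkap (m/2) a 0 * (2 * (\<bar>c\<bar> + r * norm e))" if "x \<in> A" for x
        unfolding abs_mult using bd[OF that] d0[of "(norm (x - p))\<^sup>2"] dkap_nonneg[OF m, of a] by (intro mult_mono) auto
    qed
    fix x :: "real^'n"
    show "2 * dkap (m/2) a (D\<^sup>2) * (indicator A x * (c - x \<bullet> e)) \<le> indicator A x * (dkap (m/2) a ((norm (x - p))\<^sup>2) * (2 * (c - x \<bullet> e)))"
    proof (cases "x \<in> A")
      case True
      then have x: "x \<in> E" "0 < c - x \<bullet> e" by (auto simp: A_def)
      have "(norm (x - p))\<^sup>2 \<le> D\<^sup>2" using p[OF x(1)] by (auto simp: D_def intro!: power_mono)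
      then have "dkap (m/2) a (D\<^sup>2) \<le> dkap (m/2) a ((norm (x - p))\<^sup>2)" by (rule dkap_antimono[OF m a(1) order_refl])
      then have "dkap (m/2) a (D\<^sup>2) * (2 * (c - x \<bullet> e)) \<le> dkap (m/2) a ((norm (x - p))\<^sup>2) * (2 * (c - x \<bullet> e))"
        using x by (intro mult_right_mono) auto
      then show ?thesis using True by (simp add: algebra_simps)
    qed simp
  qed
  finally show ?thesis by (simp add: A_def m_def)
qed

lemma norm_sq_difference:
  fixes p q x :: "'a::real_inner"
  shows "(norm (x - p))\<^sup>2 - (norm (x - q))\<^sup>2 = (p - q) \<bullet> (p + q - 2 *\<^sub>R x)"
  by (simp add: power2_norm_eq_inner inner_simps inner_commute algebra_simps)

lemma diameter_closure_bound:
  fixes E :: "'a::euclidean_space set"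
  assumes "bounded E" "x \<in> E" "p \<in> closure E"
  shows "norm (x - p) \<le> diameter E"
proof -
  have "dist x p \<le> diameter (closure E)"
    using assms closure_subset by (intro diameter_bounded_bound bounded_closure) auto
  then show ?thesis using diameter_closure[OF assms(1)] by (simp add: dist_norm)
qed

locale reflection_cap =
  fixes s :: real and e :: "real^'n::finite" and lam :: real and E :: "(real^'n) set"
  assumes dim: "2 \<le> CARD('n)" and s_pos: "0 < s" and e_unit: "norm e = 1"
    and Eo: "open E" and Eb: "bounded E" and d_pos: "0 < diameter E"
    and good: "\<And>x. x \<in> E \<Longrightarrow> lam < x \<bullet> e \<Longrightarrow> reflection e lam x \<in> E"
begin

lemma E_borel: "E \<in> sets borel"
  using Eo by simp

text \<open>The reflection exchanges \<open>p\<close> and \<open>q\<close>, so the difference of the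
  two kernels is odd and only the cap contributes. There the tangent inequality applies with |x-p|^2
  - |x-q|^2 = 2 l (lam - x \<bullet> e), which is positive on the cap.\<close>

lemma kap_mass_distinct_lower:
  assumes p: "p = q + l *\<^sub>R e" "p \<in> closure E" and l: "0 < l" and c: "(q + p) \<bullet> e = 2 * lam"
    and a: "0 < a" "a \<le> (diameter E)\<^sup>2"
  shows "refl_defect s e lam E * l \<le> kap_mass s a E q - kap_mass s a E p"
proof -
  let ?b = "(real CARD('n) + s) / 2"
  let ?A = "{x\<in>E. x \<bullet> e < lam \<and> reflection e lam x \<notin> E}"
  have b: "0 < ?b" using s_pos by simp
  define \<phi> where "\<phi> = (\<lambda>x. kap ?b a ((norm (x - q))\<^sup>2) - kap ?b a ((norm (x - p))\<^sup>2))"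
  have ee: "e \<bullet> e = 1" using e_unit by (simp add: norm_eq_1)
  have Rq: "reflection e lam q = p"
  proof -
    have "(q + p) \<bullet> e = q \<bullet> e + (q \<bullet> e + l)" unfolding p inner_add_left inner_scaleR_left ee by simp
    then have "2 * (q \<bullet> e) + l = 2 * lam" using c by linarith
    then have "- (2 * (q \<bullet> e - lam)) = l" by (simp add: algebra_simps)
    then show ?thesis unfolding reflection_def p by (metis diff_conv_add_uminus scaleR_minus_left)
  qed
  have Rp: "reflection e lam p = q" using reflection_reflection[OF e_unit, of lam q] Rq by simp
  have i: "integrable lborel (\<lambda>x. indicator E x * kap ?b a ((norm (x - y))\<^sup>2))" for y
    by (rule integrable_kap_dist[OF E_borel Eb a(1) b])
  have i\<phi>: "integrable lborel (\<lambda>x. indicator E x * \<phi> x)"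
    using Bochner_Integration.integrable_diff[OF i[of q] i[of p]] by (simp add: \<phi>_def right_diff_distrib)
  have m\<phi>: "\<phi> \<in> borel_measurable borel" unfolding \<phi>_def by (intro borel_measurable_diff borel_measurable_kap_dist a)
  have odd: "\<phi> (reflection e lam x) = - \<phi> x" for x
    using norm_reflection_diff[OF e_unit, of lam x p] norm_reflection_diff[OF e_unit, of lam x q] by (simp add: \<phi>_def Rq Rp)
  have "kap_mass s a E q - kap_mass s a E p = (LINT x|lborel. indicator E x * \<phi> x)"
    using i[of q] i[of p] by (simp add: kap_mass_alt[OF E_borel a(1)] \<phi>_def right_diff_distrib)
  also have "\<dots> = (LINT x|lborel. indicator ?A x * \<phi> x)"
    by (rule odd_integral_moving_plane[OF e_unit dim E_borel good i\<phi> odd m\<phi>])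
  also have "\<dots> \<ge> (LINT x|lborel. l * (indicator ?A x * (dkap ?b a ((norm (x - p))\<^sup>2) * (2 * (lam - x \<bullet> e)))))"
  proof (rule integral_mono)
    show "integrable lborel (\<lambda>x. indicator ?A x * \<phi> x)"
    proof -
      have "integrable lborel (\<lambda>x. indicator ?A x *\<^sub>R (indicator E x * \<phi> x))"
        using borel_reflection_cap[OF E_borel, of e lam] i\<phi> by (intro integrable_mult_indicator) auto
      moreover have "(\<lambda>x. indicator ?A x *\<^sub>R (indicator E x * \<phi> x)) = (\<lambda>x. indicator ?A x * \<phi> x)" by (auto simp: indicator_def)
      ultimately show ?thesis by simp
    qed
    have A: "?A \<in> sets borel" "bounded ?A" by (rule borel_reflection_cap[OF E_borel], rule bounded_subset[OF Eb]) auto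
    obtain r where r: "\<And>x. x \<in> E \<Longrightarrow> norm x \<le> r" using Eb by (auto simp: bounded_iff)
    show "integrable lborel (\<lambda>x. l * (indicator ?A x * (dkap ?b a ((norm (x - p))\<^sup>2) * (2 * (lam - x \<bullet> e)))))"
    proof (intro integrable_mult_right integrable_on_bounded_set[OF A, where K="dkap ?b a 0 * (2 * (\<bar>lam\<bar> + r))"])
      show "(\<lambda>x. dkap ?b a ((norm (x - p))\<^sup>2) * (2 * (lam - x \<bullet> e))) \<in> borel_measurable borel"
        by (intro borel_measurable_times borel_measurable_kap_dist a) auto
      fix x assume x: "x \<in> ?A"
      have "\<bar>x \<bullet> e\<bar> \<le> r" using Cauchy_Schwarz_ineq2[of x e] e_unit r[of x] x by simp
      then have "\<bar>lam - x \<bullet> e\<bar> \<le> \<bar>lam\<bar> + r" by linarith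
    then have "\<bar>2 * (lam - x \<bullet> e)\<bar> \<le> 2 * (\<bar>lam\<bar> + r)" by (simp only: abs_mult abs_numeral mult_left_mono)
      then show "\<bar>dkap ?b a ((norm (x - p))\<^sup>2) * (2 * (lam - x \<bullet> e))\<bar> \<le> dkap ?b a 0 * (2 * (\<bar>lam\<bar> + r))"
        unfolding abs_mult using dkap_antimono[OF b a(1) order_refl, of 0 "(norm (x - p))\<^sup>2"] dkap_nonneg[OF b, of a]
        by (intro mult_mono) auto
    qed
    fix x
    have "(norm (x - p))\<^sup>2 - (norm (x - q))\<^sup>2 = l * (2 * (lam - x \<bullet> e))"
    proof -
      have "(norm (x - p))\<^sup>2 - (norm (x - q))\<^sup>2 = (p - q) \<bullet> (p + q - 2 *\<^sub>R x)" by (rule norm_sq_difference)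
      also have "\<dots> = l * ((q + p) \<bullet> e - 2 * (x \<bullet> e))" 
      proof -
        have "p - q = l *\<^sub>R e" by (simp add: p)
        moreover have "e \<bullet> (p + q - 2 *\<^sub>R x) = (q + p) \<bullet> e - 2 * (x \<bullet> e)"
          by (simp add: inner_add_left inner_add_right inner_diff_right inner_commute[of e])
        ultimately show ?thesis by simp
      qed
      finally show ?thesis unfolding c by (simp add: algebra_simps)
    qed
    then show "l * (indicator ?A x * (dkap ?b a ((norm (x - p))\<^sup>2) * (2 * (lam - x \<bullet> e)))) \<le> indicator ?A x * \<phi> x"
      using kap_convex[OF a(1) b, of "(norm (x - p))\<^sup>2" "(norm (x - q))\<^sup>2"] by (auto simp: \<phi>_def indicator_def mult_ac)
  qed
  also have "(LINT x|lborel. l * (indicator ?A x * (dkap ?b a ((norm (x - p))\<^sup>2) * (2 * (lam - x \<bullet> e)))))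
      = l * (LINT x|lborel. indicator ?A x * (dkap ?b a ((norm (x - p))\<^sup>2) * (2 * (lam - x \<bullet> e))))" by (rule integral_mult_right_zero)
  also have "\<dots> \<ge> l * refl_defect s e lam E"
    using reflection_cap_integral_lower[OF E_borel Eb diameter_closure_bound[OF Eb _ p(2)] d_pos s_pos a, of e lam] l
    by (intro mult_left_mono) auto
  finally show ?thesis by (simp add: mult.commute)
qed

text \<open>The points of a pair need not be mirror images of each other, so oddness is available
  only in the limit: the tangent inequality bounds the difference quotient from below by the
  integral of \<open>F j\<close>, and \<open>F j\<close> converges to a function that is odd under
  the reflection. The price is an arbitrarily small \<delta>.\<close>

lemma kap_mass_merging_lower:
  assumes p: "ps \<longlonglongrightarrow> p0" "qs \<longlonglongrightarrow> p0" "p0 \<in> closure E" "p0 \<bullet> e = lam"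
    and l: "\<And>j. 0 < l j" "(\<lambda>j. (1 / l j) *\<^sub>R (ps j - qs j)) \<longlonglongrightarrow> e"
    and a: "0 < a" "a \<le> (diameter E)\<^sup>2" and \<delta>: "0 < \<delta>"
  shows "eventually (\<lambda>j. (refl_defect s e lam E - \<delta>) * l j \<le> kap_mass s a E (qs j) - kap_mass s a E (ps j)) sequentially"
proof -
  let ?b = "(real CARD('n) + s) / 2"
  let ?A = "{x\<in>E. x \<bullet> e < lam \<and> reflection e lam x \<notin> E}"
  have b: "0 < ?b" using s_pos by simp
  define u where "u = (\<lambda>j. (1 / l j) *\<^sub>R (ps j - qs j))"
  have u: "u \<longlonglongrightarrow> e" using l(2) by (simp add: u_def)
  define F where "F = (\<lambda>j x. dkap ?b a ((norm (x - ps j))\<^sup>2) * (u j \<bullet> (ps j + qs j - 2 *\<^sub>R x)))"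
  define \<phi> where "\<phi> = (\<lambda>x. dkap ?b a ((norm (x - p0))\<^sup>2) * (2 * (lam - x \<bullet> e)))"
  have ms: "(\<lambda>j. ps j + qs j) \<longlonglongrightarrow> p0 + p0" by (intro tendsto_add p)
  obtain U where U: "\<And>j. norm (u j) \<le> U" using convergent_imp_Bseq[of u] u by (auto simp: convergent_def Bseq_def)
  obtain V where V: "\<And>j. norm (ps j + qs j) \<le> V" using convergent_imp_Bseq[of "\<lambda>j. ps j + qs j"] ms by (auto simp: convergent_def Bseq_def)
  obtain r where r: "\<And>x. x \<in> E \<Longrightarrow> norm x \<le> r" using Eb by (auto simp: bounded_iff)
  define W where "W = dkap ?b a 0 * (U * (V + 2 * r))"
  have d0: "\<bar>dkap ?b a t\<bar> \<le> dkap ?b a 0" if "0 \<le> t" for t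
    using dkap_antimono[OF b a(1) order_refl that] dkap_nonneg[OF b, of a t] by simp
  have FW: "\<bar>F j x\<bar> \<le> W" if "x \<in> E" for j x
  proof -
    have "norm (ps j + qs j - 2 *\<^sub>R x) \<le> norm (ps j + qs j) + norm (2 *\<^sub>R x)" by (rule norm_triangle_ineq4)
    also have "\<dots> \<le> V + 2 * r" using V[of j] r[OF that] by simp
    finally have "norm (u j) * norm (ps j + qs j - 2 *\<^sub>R x) \<le> U * (V + 2 * r)"
      using U[of j] order_trans[OF norm_ge_zero U[of j]] by (intro mult_mono) auto
    then have "\<bar>u j \<bullet> (ps j + qs j - 2 *\<^sub>R x)\<bar> \<le> U * (V + 2 * r)" using Cauchy_Schwarz_ineq2 order_trans by blast
    then show ?thesis unfolding F_def W_def abs_mult using d0[of "(norm (x - ps j))\<^sup>2"] dkap_nonneg[OF b, of a 0]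
      by (intro mult_mono) auto
  qed
  have mF: "F j \<in> borel_measurable borel" for j
    unfolding F_def by (intro borel_measurable_times borel_measurable_kap_dist a) auto
  have iF: "integrable lborel (\<lambda>x. indicator E x * F j x)" for j
    by (rule integrable_on_bounded_set[OF E_borel Eb mF FW])
  have m\<phi>: "\<phi> \<in> borel_measurable borel"
    unfolding \<phi>_def by (intro borel_measurable_times borel_measurable_kap_dist a) auto
  have i\<phi>: "integrable lborel (\<lambda>x. indicator E x * \<phi> x)"
  proof (rule integrable_on_bounded_set[OF E_borel Eb m\<phi>, where K="dkap ?b a 0 * (2 * (\<bar>lam\<bar> + r))"])
    fix x assume x: "x \<in> E"
    have "\<bar>x \<bullet> e\<bar> \<le> r" using Cauchy_Schwarz_ineq2[of x e] e_unit r[of x] x by simp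
    then have "\<bar>lam - x \<bullet> e\<bar> \<le> \<bar>lam\<bar> + r" by linarith
    then have "\<bar>2 * (lam - x \<bullet> e)\<bar> \<le> 2 * (\<bar>lam\<bar> + r)" by (simp only: abs_mult abs_numeral mult_left_mono)
    then show "\<bar>\<phi> x\<bar> \<le> dkap ?b a 0 * (2 * (\<bar>lam\<bar> + r))"
      unfolding \<phi>_def abs_mult using d0[of "(norm (x - p0))\<^sup>2"] dkap_nonneg[OF b, of a 0] by (intro mult_mono) auto
  qed
  have c: "isCont (dkap ?b a) t" for t
    using continuous_on_dkap[OF a(1) continuous_on_id, of UNIV ?b] by (simp add: continuous_on_eq_continuous_at)
  have "(\<lambda>j. LINT x|lborel. indicator E x * F j x) \<longlonglongrightarrow> (LINT x|lborel. indicator E x * \<phi> x)"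
  proof (rule integral_dominated_convergence[where w="\<lambda>x. indicator E x * W"])
    show "integrable lborel (\<lambda>x. indicator E x * W)"
      by (rule integrable_on_bounded_set[OF E_borel Eb, where K="\<bar>W\<bar>"]) auto
    have lim: "(\<lambda>j. F j x) \<longlonglongrightarrow> \<phi> x" for x
    proof -
      have "(\<lambda>j. F j x) \<longlonglongrightarrow> dkap ?b a ((norm (x - p0))\<^sup>2) * (e \<bullet> (p0 + p0 - 2 *\<^sub>R x))"
        unfolding F_def by (intro tendsto_mult isCont_tendsto_compose[OF c] tendsto_power tendsto_norm tendsto_diff tendsto_const tendsto_inner u ms p)
      moreover have "e \<bullet> (p0 + p0 - 2 *\<^sub>R x) = 2 * (lam - x \<bullet> e)" 
      proof -
        have "e \<bullet> (p0 + p0 - 2 *\<^sub>R x) = p0 \<bullet> e + p0 \<bullet> e - 2 * (x \<bullet> e)"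
          by (simp only: inner_add_right inner_diff_right inner_scaleR_right inner_commute[of e])
        then show ?thesis using p(4) by simp
      qed
      ultimately show ?thesis by (simp add: \<phi>_def)
    qed
    show "AE x in lborel. (\<lambda>j. indicator E x * F j x) \<longlonglongrightarrow> indicator E x * \<phi> x"
      by (rule AE_I2, rule tendsto_mult[OF tendsto_const lim])
    show "(\<lambda>x. indicator E x * F j x) \<in> borel_measurable lborel" for j by (rule borel_measurable_integrable[OF iF])
    show "(\<lambda>x. indicator E x * \<phi> x) \<in> borel_measurable lborel" by (rule borel_measurable_integrable[OF i\<phi>])
    show "AE x in lborel. norm (indicator E x * F j x) \<le> indicator E x * W" for j using FW by (intro AE_I2) (auto simp: indicator_def)
  qed
  moreover have "refl_defect s e lam E \<le> (LINT x|lborel. indicator E x * \<phi> x)"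
  proof -
    have "\<phi> (reflection e lam x) = - \<phi> x" for x
    proof -
      have "norm (reflection e lam x - p0) = norm (x - p0)"
        using norm_reflection_diff[OF e_unit, of lam x p0] reflection_fixed[OF p(4)] by simp
      moreover have "2 * (lam - reflection e lam x \<bullet> e) = - (2 * (lam - x \<bullet> e))"
        unfolding reflection_inner[OF e_unit] by simp
      ultimately show ?thesis unfolding \<phi>_def by (simp only: mult_minus_right)
    qed
    from odd_integral_moving_plane[OF e_unit dim E_borel good i\<phi> this m\<phi>]
    show ?thesis unfolding \<phi>_def
      using reflection_cap_integral_lower[OF E_borel Eb diameter_closure_bound[OF Eb _ p(3)] d_pos s_pos a, of e lam] by simp
  qed
  ultimately have "eventually (\<lambda>j. refl_defect s e lam E - \<delta> < (LINT x|lborel. indicator E x * F j x)) sequentially"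
    using \<delta> by (intro order_tendstoD(1)) auto
  then show ?thesis
  proof (rule eventually_mono)
    fix j assume j: "refl_defect s e lam E - \<delta> < (LINT x|lborel. indicator E x * F j x)"
    have "(refl_defect s e lam E - \<delta>) * l j \<le> l j * (LINT x|lborel. indicator E x * F j x)"
      using mult_right_mono[OF less_imp_le[OF j] less_imp_le[OF l(1)[of j]]] by (simp add: mult.commute)
    also have "\<dots> = (LINT x|lborel. l j * (indicator E x * F j x))" by (rule integral_mult_right_zero[symmetric])
    also have "\<dots> \<le> (LINT x|lborel. indicator E x * kap ?b a ((norm (x - qs j))\<^sup>2) - indicator E x * kap ?b a ((norm (x - ps j))\<^sup>2))"
    proof (rule integral_mono)
      show "integrable lborel (\<lambda>x. l j * (indicator E x * F j x))" by (intro integrable_mult_right iF)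
      show "integrable lborel (\<lambda>x. indicator E x * kap ?b a ((norm (x - qs j))\<^sup>2) - indicator E x * kap ?b a ((norm (x - ps j))\<^sup>2))"
        by (intro Bochner_Integration.integrable_diff integrable_kap_dist[OF E_borel Eb a(1) b])
      fix x
      have "l j * F j x = dkap ?b a ((norm (x - ps j))\<^sup>2) * ((norm (x - ps j))\<^sup>2 - (norm (x - qs j))\<^sup>2)"
        unfolding norm_sq_difference F_def u_def using l(1)[of j] by simp
      then show "l j * (indicator E x * F j x) \<le> indicator E x * kap ?b a ((norm (x - qs j))\<^sup>2) - indicator E x * kap ?b a ((norm (x - ps j))\<^sup>2)"
        using kap_convex[OF a(1) b, of "(norm (x - ps j))\<^sup>2" "(norm (x - qs j))\<^sup>2"] by (auto simp: indicator_def)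
    qed
    also have "\<dots> = kap_mass s a E (qs j) - kap_mass s a E (ps j)"
      using integrable_kap_dist[OF E_borel Eb a(1) b] by (simp add: kap_mass_alt[OF E_borel a(1)])
    finally show "(refl_defect s e lam E - \<delta>) * l j \<le> kap_mass s a E (qs j) - kap_mass s a E (ps j)" .
  qed
qed

end

section \<open>The critical plane\<close>

lemma double_difference_le:
  fixes a x y z b :: real
  assumes "2 * y - z \<le> b" "a = 2 * x - z" "x \<le> y"
  shows "a \<le> b"
  using assms by linarith

text \<open>In the applications \<rho> is the scale at which the potentials are split. The term with
  the power is the inner error, and the linear term absorbs the small loss in the limit of the
  difference quotients.\<close>

lemma le_of_vanishing_error:
  fixes D C K \<gamma> R :: real
  assumes "0 < \<gamma>" "0 < R" and le: "\<And>\<rho>. 0 < \<rho> \<Longrightarrow> \<rho> < R \<Longrightarrow> D - \<rho> - C * \<rho> powr \<gamma> \<le> K"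
  shows "D \<le> K"
proof (rule tendsto_upperbound)
  have pos: "eventually (\<lambda>t::real. 0 < t) (at_right 0)" by (simp add: eventually_at_filter)
  have i: "((\<lambda>\<rho>::real. \<rho>) \<longlongrightarrow> 0) (at_right 0)" by (rule tendsto_ident_at)
  have "((\<lambda>\<rho>. \<rho> powr \<gamma>) \<longlongrightarrow> 0) (at_right 0)"
    by (rule tendsto_zero_powrI[OF i tendsto_const _ assms(1)]) (rule eventually_mono[OF pos], simp)
  then have "((\<lambda>\<rho>. D - \<rho> - C * \<rho> powr \<gamma>) \<longlongrightarrow> D - 0 - C * 0) (at_right 0)" by (intro tendsto_diff tendsto_mult tendsto_const i)
  then show "((\<lambda>\<rho>. D - \<rho> - C * \<rho> powr \<gamma>) \<longlongrightarrow> D) (at_right 0)" by simp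
  show "eventually (\<lambda>\<rho>. D - \<rho> - C * \<rho> powr \<gamma> \<le> K) (at_right 0)"
    unfolding eventually_at_right_field using assms by blast
qed simp

lemma (in C2alpha_graph) G_increment:
  assumes "norm y + norm v < r"
  shows "\<bar>G (y + v) - G y - G' 0 v\<bar> \<le> 3 * \<Lambda> * (norm y + norm v) * norm v"
proof -
  have inb: "norm (y + t *\<^sub>R v) \<le> norm y + norm v" if "0 \<le> t" "t \<le> 1" for t
  proof -
    have "norm (y + t *\<^sub>R v) \<le> norm y + t * norm v" using norm_triangle_ineq[of y "t *\<^sub>R v"] that by simp
    also have "t * norm v \<le> norm v" using that mult_right_mono[of t 1 "norm v"] by simp
    finally show ?thesis by simp
  qed
  have D: "((\<lambda>t. G (y + t *\<^sub>R v)) has_real_derivative G' (y + t *\<^sub>R v) v) (at t)" if "0 \<le> t" "t \<le> 1" for t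
    using inb[OF that] assms by (intro line_deriv) auto
  obtain t where t: "0 < t" "t < 1" "G (y + 1 *\<^sub>R v) - G (y + 0 *\<^sub>R v) = G' (y + t *\<^sub>R v) v"
    using MVT_unit_interval[OF D] by blast
  have n: "norm (0 + (y + t *\<^sub>R v)) < r" using inb[of t] t assms by simp
  have "\<bar>G' (0 + (y + t *\<^sub>R v)) v - G' 0 v\<bar> \<le> 3 * \<Lambda> * norm (y + t *\<^sub>R v) * norm v"
    using r by (intro G'_lipschitz[OF _ n]) simp
  also have "\<dots> \<le> 3 * \<Lambda> * (norm y + norm v) * norm v"
    using \<Lambda> inb[of t] t by (intro mult_right_mono mult_left_mono) auto
  finally show ?thesis using t(3) by simp
qed

text \<open>Divided by the length of the secant, the increment of \<open>G\<close> is e \<bullet>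
  \<eta> on the one hand and \<open>G' 0 e\<close> up to a vanishing error on the other. In the
  applications \<open>G' 0 e\<close> is 0, so that \<open>e\<close> lies in the hyperplane
  orthogonal to \<eta>, as the bounds for pairs require.\<close>

lemma (in C2alpha_graph) secants_tangent:
  assumes e: "norm e = 1" and w: "w \<longlonglongrightarrow> 0" and l: "\<And>j::nat. 0 < l j" "l \<longlonglongrightarrow> 0"
    and q: "\<And>j. norm (w j) + l j < r \<Longrightarrow> w j \<bullet> \<eta> = G (w j)"
    and p: "\<And>j. norm (w j) + l j < r \<Longrightarrow> (w j + l j *\<^sub>R e) \<bullet> \<eta> = G (w j + l j *\<^sub>R e)"
  shows "e \<bullet> \<eta> = G' 0 e"
proof -
  have n: "(\<lambda>j. norm (w j) + l j) \<longlonglongrightarrow> 0" using tendsto_add[OF tendsto_norm_zero[OF w] l(2)] by simp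
  have ev: "eventually (\<lambda>j. norm (w j) + l j < r) sequentially" using order_tendstoD(2)[OF n] r by blast
  have "\<bar>e \<bullet> \<eta> - G' 0 e\<bar> \<le> 0"
  proof (rule tendsto_lowerbound)
    have "(\<lambda>j. 3 * \<Lambda> * (norm (w j) + l j)) \<longlonglongrightarrow> 3 * \<Lambda> * 0" by (intro tendsto_mult tendsto_const n)
    then show "(\<lambda>j. 3 * \<Lambda> * (norm (w j) + l j)) \<longlonglongrightarrow> 0" by simp
    show "eventually (\<lambda>j. \<bar>e \<bullet> \<eta> - G' 0 e\<bar> \<le> 3 * \<Lambda> * (norm (w j) + l j)) sequentially"
      using ev
    proof (rule eventually_mono)
      fix j assume j: "norm (w j) + l j < r"
      have nl: "norm (l j *\<^sub>R e) = l j" using e l(1)[of j] by simp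
      have lin: "G' 0 (l j *\<^sub>R e) = l j * G' 0 e"
        using G'_linear[of 0] r by (simp add: linear_scale)
      have "G (w j + l j *\<^sub>R e) - G (w j) = l j * (e \<bullet> \<eta>)"
        using p[OF j] q[OF j] by (simp add: inner_add_left)
      then have "\<bar>l j * (e \<bullet> \<eta>) - l j * G' 0 e\<bar> \<le> 3 * \<Lambda> * (norm (w j) + l j) * l j"
        using G_increment[of "w j" "l j *\<^sub>R e"] j unfolding nl lin by simp
      moreover have "\<bar>l j * (e \<bullet> \<eta>) - l j * G' 0 e\<bar> = \<bar>e \<bullet> \<eta> - G' 0 e\<bar> * l j"
        using l(1)[of j] by (simp add: abs_mult mult.commute flip: right_diff_distrib)
      ultimately show "\<bar>e \<bullet> \<eta> - G' 0 e\<bar> \<le> 3 * \<Lambda> * (norm (w j) + l j)"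
        using l(1)[of j] by simp
    qed
  qed simp
  then show ?thesis by simp
qed

section \<open>From truncated potentials to differences of the curvature\<close>

context capillary
begin

lemma curv_difference_lower:
  assumes p: "p \<in> M" "0 < p $ k" and q: "q \<in> M" "0 < q $ k"
    and H: "\<bar>frac_mean_curv s E p - frac_mean_curv s E q\<bar> \<le> X" and \<epsilon>0: "0 < \<epsilon>0"
    and lower: "\<And>\<epsilon>. 0 < \<epsilon> \<Longrightarrow> \<epsilon> \<le> \<epsilon>0 \<Longrightarrow> Y \<le> 2 * (kap_mass s (\<epsilon>\<^sup>2) E q - kap_mass s (\<epsilon>\<^sup>2) E p)"
  shows "Y \<le> X"
proof -
  define \<epsilon> where "\<epsilon> = (\<lambda>j. \<epsilon>0 * inverse (real (Suc j)))"
  have pos: "0 < \<epsilon> j" "\<epsilon> j \<le> \<epsilon>0" for j using \<epsilon>0 by (auto simp: \<epsilon>_def field_simps)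
  have "(\<lambda>j. (\<epsilon> j)\<^sup>2) \<longlonglongrightarrow> (\<epsilon>0 * 0)\<^sup>2"
    unfolding \<epsilon>_def by (intro tendsto_power tendsto_mult tendsto_const LIMSEQ_inverse_real_of_nat)
  then have lim: "(\<lambda>j. (\<epsilon> j)\<^sup>2) \<longlonglongrightarrow> 0" by simp
  have "Y \<le> frac_mean_curv s E p - frac_mean_curv s E q"
  proof (rule LIMSEQ_le_const[OF curv_difference[OF p q _ lim]])
    show "0 < (\<epsilon> j)\<^sup>2" for j using pos[of j] by simp
    show "\<exists>N. \<forall>j\<ge>N. Y \<le> 2 * (kap_mass s ((\<epsilon> j)\<^sup>2) E q - kap_mass s ((\<epsilon> j)\<^sup>2) E p)" using lower[OF pos] by blast
  qed
  then show ?thesis using H by linarith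
qed

text \<open>The part of the potentials between the scales \<epsilon> and sqrt a is bounded by
  \<open>Z\<close> uniformly in \<epsilon>. What remains is a difference of potentials with the
  fixed truncation \<open>a\<close>, while the curvature appears as \<epsilon> tends to 0.\<close>

lemma curv_difference_lower_cut:
  assumes p: "p \<in> M" "0 < p $ k" and q: "q \<in> M" "0 < q $ k"
    and H: "\<bar>frac_mean_curv s E p - frac_mean_curv s E q\<bar> \<le> X" and \<epsilon>0: "0 < \<epsilon>0"
    and bound: "\<And>\<epsilon>. 0 < \<epsilon> \<Longrightarrow> \<epsilon> \<le> \<epsilon>0 \<Longrightarrow> \<bar>(kap_mass s (\<epsilon>\<^sup>2) E p - kap_mass s a E p) - (kap_mass s (\<epsilon>\<^sup>2) E q - kap_mass s a E q)\<bar> \<le> Z"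
  shows "2 * (kap_mass s a E q - kap_mass s a E p) - 2 * Z \<le> X"
proof (rule curv_difference_lower[OF p q H \<epsilon>0])
  fix \<epsilon> assume "0 < \<epsilon>" "\<epsilon> \<le> \<epsilon>0"
  from bound[OF this] have "kap_mass s a E q - kap_mass s a E p - Z \<le> kap_mass s (\<epsilon>\<^sup>2) E q - kap_mass s (\<epsilon>\<^sup>2) E p" by linarith
  then show "2 * (kap_mass s a E q - kap_mass s a E p) - 2 * Z \<le> 2 * (kap_mass s (\<epsilon>\<^sup>2) E q - kap_mass s (\<epsilon>\<^sup>2) E p)"
    by (simp add: right_diff_distrib)
qed

end

text \<open>The number \<open>K\<close> is a Lipschitz constant of the curvature for pairs of equal
  positive height, to be supplied by the deficit. Since \<open>e\<close> is horizontal, mirror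
  images have equal height.\<close>

locale critical_plane = capillary s \<alpha> \<sigma> k E M nu + reflection_cap s e lam E
  for s \<alpha> \<sigma> :: real and k :: "'n::finite" and E M :: "(real^'n) set" and nu :: "real^'n \<Rightarrow> real^'n"
    and e :: "real^'n" and lam :: real +
  fixes K :: real
  assumes e_k: "e $ k = 0"
    and K: "\<And>p q. p \<in> M \<Longrightarrow> q \<in> M \<Longrightarrow> 0 < q $ k \<Longrightarrow> p $ k = q $ k \<Longrightarrow> p \<noteq> q \<Longrightarrow>
       \<bar>frac_mean_curv s E p - frac_mean_curv s E q\<bar> \<le> K * norm (p - q)"
begin

abbreviation "D \<equiv> refl_defect s e lam E"

lemma e_inner: "e \<bullet> e = 1"
  using e_unit by (simp add: norm_eq_1)

text \<open>The lower bound for the difference of the potentials has the same constant at every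
  truncation scale up to the diameter, so it survives the limit without any splitting.\<close>

lemma defect_interior_distinct:
  assumes q: "q \<in> M" "0 < q $ k" and p: "p \<in> M" "p = q + l *\<^sub>R e" and l: "0 < l" and c: "(q + p) \<bullet> e = 2 * lam"
  shows "2 * D \<le> K"
proof -
  have pk: "p $ k = q $ k" and ne: "p \<noteq> q" and npq: "norm (p - q) = l" using p(2) l e_k e_unit by auto
  have pp: "0 < p $ k" using pk q by simp
  have H: "\<bar>frac_mean_curv s E p - frac_mean_curv s E q\<bar> \<le> K * l" using K[OF p(1) q(1,2) pk ne] npq by simp
  have "2 * (D * l) \<le> K * l"
  proof (rule curv_difference_lower[OF p(1) pp q H d_pos])
    fix \<epsilon> assume "0 < \<epsilon>" "\<epsilon> \<le> diameter E"
    then have "0 < \<epsilon>\<^sup>2" "\<epsilon>\<^sup>2 \<le> (diameter E)\<^sup>2" by (auto intro!: power_mono)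
    from kap_mass_distinct_lower[OF p(2) M_closure[OF p(1)] l c this]
    show "2 * (D * l) \<le> 2 * (kap_mass s (\<epsilon>\<^sup>2) E q - kap_mass s (\<epsilon>\<^sup>2) E p)" by simp
  qed
  then have "(2 * D) * l \<le> K * l" by simp
  then show ?thesis using l by (rule mult_right_le_imp_le)
qed

text \<open>The end points of the chords themselves serve as pairs. As the chords shrink,
  \<open>e\<close> turns out to be tangent to \<open>M\<close> at \<open>p0\<close>, so that the
  displacement lies in the hyperplane of the graph; the inner error is then proportional to the
  length of the chord and can be divided by it.\<close>

lemma defect_interior_merging:
  assumes p0: "p0 \<in> M" "0 < p0 $ k" "p0 \<bullet> e = lam"
    and fr: "\<And>j. qs j \<in> frontier E" "\<And>j. ps j \<in> frontier E" and pos: "\<And>j. 0 < qs j $ k"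
    and l: "\<And>j::nat. 0 < l j" "\<And>j. ps j = qs j + l j *\<^sub>R e" "l \<longlonglongrightarrow> 0" and qs: "qs \<longlonglongrightarrow> p0"
  shows "2 * D \<le> K"
proof -
  obtain r \<Lambda> G G' B where "capillary_graph s \<alpha> \<sigma> k E M nu r \<Lambda> (nu p0) G G' B p0"
    by (rule interior_graph[OF p0(1,2)])
  then interpret g: capillary_graph s \<alpha> \<sigma> k E M nu r \<Lambda> "nu p0" G G' B p0 .
  define w where "w = (\<lambda>j. qs j - p0)"
  have qw: "qs j = p0 + w j" "ps j = p0 + (w j + l j *\<^sub>R e)" for j using l(2) by (simp_all add: w_def)
  have ppos: "0 < ps j $ k" for j using pos[of j] l(2)[of j] e_k by simp
  have w0: "w \<longlonglongrightarrow> 0" using qs unfolding w_def by (rule LIM_zero)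
  have nl: "norm (w j + l j *\<^sub>R e) \<le> norm (w j) + l j" for j
    using norm_triangle_ineq[of "w j" "l j *\<^sub>R e"] l(1)[of j] e_unit by simp
  have gq: "w j \<bullet> nu p0 = G (w j)" if "norm (w j) + l j < r" for j
    using that l(1)[of j] pos[of j] fr(1)[of j] unfolding qw by (intro g.frontier_graph_converse) auto
  have gp: "(w j + l j *\<^sub>R e) \<bullet> nu p0 = G (w j + l j *\<^sub>R e)" if "norm (w j) + l j < r" for j
    using that nl[of j] ppos[of j] fr(2)[of j] unfolding qw by (intro g.frontier_graph_converse) auto
  have "e \<bullet> nu p0 = G' 0 e" by (rule g.secants_tangent[OF e_unit w0 l(1,3) gq gp])
  also have "\<dots> = 0" unfolding g.G'_zero using inner_perp[OF g.\<eta>, of e] by (simp add: inner_commute)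
  finally have tang: "e \<bullet> nu p0 = 0" .
  define C where "C = graph_const TYPE(real^'n) s \<alpha> (6 * \<Lambda>)"
  have n: "(\<lambda>j. norm (w j) + l j) \<longlonglongrightarrow> 0" using tendsto_add[OF tendsto_norm_zero[OF w0] l(3)] by simp
  have ps: "ps \<longlonglongrightarrow> p0"
  proof -
    have "(\<lambda>j. qs j + l j *\<^sub>R e) \<longlonglongrightarrow> p0 + 0 *\<^sub>R e" by (intro tendsto_add tendsto_scaleR qs l(3) tendsto_const)
    moreover have "ps = (\<lambda>j. qs j + l j *\<^sub>R e)" using l(2) by (rule ext)
    ultimately show ?thesis by simp
  qed
  have quot: "(\<lambda>j. (1 / l j) *\<^sub>R (ps j - qs j)) \<longlonglongrightarrow> e"
  proof -
    have "(1 / l j) *\<^sub>R (ps j - qs j) = e" for j using l(1)[of j] l(2)[of j] by simp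
    then show ?thesis by simp
  qed
  show ?thesis
  proof (rule le_of_vanishing_error[where \<gamma>="\<alpha> - s" and R="min (diameter E) (r/2)" and C="2 * C"])
    show "0 < \<alpha> - s" "0 < min (diameter E) (r/2)" using alpha d_pos g.r by auto
    fix \<rho> assume \<rho>: "0 < \<rho>" "\<rho> < min (diameter E) (r/2)"
    have a: "0 < \<rho>\<^sup>2" "\<rho>\<^sup>2 \<le> (diameter E)\<^sup>2" using \<rho> by (auto intro!: power_mono)
    have "eventually (\<lambda>j. norm (w j) + l j < r/2) sequentially" using order_tendstoD(2)[OF n, of "r/2"] g.r by simp
    moreover have "eventually (\<lambda>j. (D - \<rho>/2) * l j \<le> kap_mass s (\<rho>\<^sup>2) E (qs j) - kap_mass s (\<rho>\<^sup>2) E (ps j)) sequentially"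
      using \<rho> by (intro kap_mass_merging_lower[OF ps qs M_closure[OF p0(1)] p0(3) l(1) quot a]) simp
    ultimately have "eventually (\<lambda>j. norm (w j) + l j < r/2 \<and> (D - \<rho>/2) * l j \<le> kap_mass s (\<rho>\<^sup>2) E (qs j) - kap_mass s (\<rho>\<^sup>2) E (ps j)) sequentially"
      by (rule eventually_conj)
    then obtain j where j: "norm (w j) + l j < r/2" "(D - \<rho>/2) * l j \<le> kap_mass s (\<rho>\<^sup>2) E (qs j) - kap_mass s (\<rho>\<^sup>2) E (ps j)"
      using eventually_happens'[OF sequentially_bot] by blast
    have jr: "norm (w j) + l j < r" "norm (w j) + l j + \<rho> < r" using j(1) \<rho> g.r by auto
    have pM: "ps j \<in> M" "qs j \<in> M" using frontier_in_M fr pos ppos by auto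
    have pk: "ps j $ k = qs j $ k" "ps j \<noteq> qs j" "norm (ps j - qs j) = l j" using l(1)[of j] l(2)[of j] e_k e_unit by auto
    have "2 * (kap_mass s (\<rho>\<^sup>2) E (qs j) - kap_mass s (\<rho>\<^sup>2) E (ps j)) - 2 * (l j * C * \<rho> powr (\<alpha> - s)) \<le> K * l j"
    proof (rule curv_difference_lower_cut[OF pM(1) ppos pM(2) pos _ \<rho>(1)])
      show "\<bar>frac_mean_curv s E (ps j) - frac_mean_curv s E (qs j)\<bar> \<le> K * l j" using K[OF pM pos pk(1,2)] pk(3) by simp
      show "\<bar>(kap_mass s (\<epsilon>\<^sup>2) E (ps j) - kap_mass s (\<rho>\<^sup>2) E (ps j)) - (kap_mass s (\<epsilon>\<^sup>2) E (qs j) - kap_mass s (\<rho>\<^sup>2) E (qs j))\<bar>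
         \<le> l j * C * \<rho> powr (\<alpha> - s)" if "0 < \<epsilon>" "\<epsilon> \<le> \<rho>" for \<epsilon>
        unfolding qw C_def by (rule g.interior_pair_bound[OF p0(2) e_unit tang l(1) gq[OF jr(1)] gp[OF jr(1)] jr(2) that])
    qed
    moreover have "(2 * D - \<rho> - 2 * C * \<rho> powr (\<alpha> - s)) * l j = 2 * ((D - \<rho>/2) * l j) - 2 * (l j * C * \<rho> powr (\<alpha> - s))"
      by (simp add: algebra_simps)
    ultimately have "(2 * D - \<rho> - 2 * C * \<rho> powr (\<alpha> - s)) * l j \<le> K * l j" using j(2) by (rule double_difference_le)
    then show "2 * D - \<rho> - 2 * C * \<rho> powr (\<alpha> - s) \<le> K" using l(1)[of j] by (rule mult_right_le_imp_le)
  qed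
qed

text \<open>The chords serve only to show that \<open>e\<close> is tangential, so that the mixed
  second derivative vanishes. Nothing relates their lengths to their heights, whereas the boundary
  estimate wants the two equal; the pairs are therefore built afresh on the graph, at height
  \<open>h j\<close> with base points displaced by \<open>h j\<close> along \<open>e\<close>. Their
  secants have the direction \<open>e\<close> only in the limit.\<close>

lemma defect_boundary_merging:
  assumes p0: "p0 \<in> M" "p0 $ k = 0" "p0 \<bullet> e = lam"
    and fr: "\<And>j. qs j \<in> frontier E" "\<And>j. ps j \<in> frontier E" and pos: "\<And>j. 0 < qs j $ k"
    and l: "\<And>j::nat. 0 < l j" "\<And>j. ps j = qs j + l j *\<^sub>R e" "l \<longlonglongrightarrow> 0" and qs: "qs \<longlonglongrightarrow> p0"
  shows "2 * D \<le> K"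
proof -
  let ?\<kappa> = "axis k (1::real) :: real^'n"
  define \<eta> where "\<eta> = hnormal p0"
  obtain r \<Lambda> G G' B where gg: "capillary_graph s \<alpha> \<sigma> k E M nu r \<Lambda> \<eta> G G' B p0"
    and G'0: "\<And>v. G' 0 v = \<sigma> / sqrt (1 - \<sigma>\<^sup>2) * v $ k"
    by (rule boundary_graph[OF p0(1,2), folded \<eta>_def], rule that) assumption+
  interpret g: capillary_graph s \<alpha> \<sigma> k E M nu r \<Lambda> \<eta> G G' B p0 by (rule gg)
  have \<eta>k: "\<eta> $ k = 0" unfolding \<eta>_def by (rule hnormal(2)[OF p0(1,2)])
  have tang: "e \<bullet> \<eta> = 0"
  proof -
    define w where "w = (\<lambda>j. qs j - p0)"
    have qw: "qs j = p0 + w j" "ps j = p0 + (w j + l j *\<^sub>R e)" for j using l(2) by (simp_all add: w_def)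
    have ppos: "0 < ps j $ k" for j using pos[of j] l(2)[of j] e_k by simp
    have w0: "w \<longlonglongrightarrow> 0" using qs unfolding w_def by (rule LIM_zero)
    have nl: "norm (w j + l j *\<^sub>R e) \<le> norm (w j) + l j" for j
      using norm_triangle_ineq[of "w j" "l j *\<^sub>R e"] l(1)[of j] e_unit by simp
    have gq: "w j \<bullet> \<eta> = G (w j)" if "norm (w j) + l j < r" for j
      using that l(1)[of j] pos[of j] fr(1)[of j] unfolding qw by (intro g.frontier_graph_converse) auto
    have gp: "(w j + l j *\<^sub>R e) \<bullet> \<eta> = G (w j + l j *\<^sub>R e)" if "norm (w j) + l j < r" for j
      using that nl[of j] ppos[of j] fr(2)[of j] unfolding qw by (intro g.frontier_graph_converse) auto
    have "e \<bullet> \<eta> = G' 0 e" by (rule g.secants_tangent[OF e_unit w0 l(1,3) gq gp])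
    then show ?thesis using G'0[of e] e_k by simp
  qed
  have Be: "B 0 ?\<kappa> e = 0" by (rule g.mixed_second_derivative_zero[OF p0(2) \<eta>_def G'0 e_k tang])
  have \<kappa>: "norm ?\<kappa> = 1" "?\<kappa> \<bullet> \<eta> = 0" "?\<kappa> \<bullet> e = 0" "?\<kappa> $ k = 1" using \<eta>k e_k by (auto simp: inner_axis' norm_axis_1)
  have \<eta>e: "\<eta> \<bullet> e = 0" using tang by (simp add: inner_commute)
  define h where "h = (\<lambda>j. inverse (real (Suc j)))"
  have h: "h \<longlonglongrightarrow> 0" "\<And>j. 0 < h j" unfolding h_def by (rule LIMSEQ_inverse_real_of_nat) simp
  define y where "y = (\<lambda>j. h j *\<^sub>R ?\<kappa>)"
  define z where "z = (\<lambda>j. y j + h j *\<^sub>R e)"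
  define wq where "wq = (\<lambda>j. y j + G (y j) *\<^sub>R \<eta>)"
  define wp where "wp = (\<lambda>j. z j + G (z j) *\<^sub>R \<eta>)"
  have y0: "y \<longlonglongrightarrow> 0" unfolding y_def using tendsto_scaleR[OF h(1) tendsto_const[of ?\<kappa>]] by simp
  have z0: "z \<longlonglongrightarrow> 0" unfolding z_def using tendsto_add[OF y0 tendsto_scaleR[OF h(1) tendsto_const[of e]]] by simp
  have graph0: "(\<lambda>j. x j + G (x j) *\<^sub>R \<eta>) \<longlonglongrightarrow> 0" if "x \<longlonglongrightarrow> 0" for x :: "nat \<Rightarrow> real^'n"
  proof -
    have "isCont G 0" using g.continuous_G g.r by simp
    then have "(\<lambda>j. G (x j)) \<longlonglongrightarrow> 0" using isCont_tendsto_compose[OF _ that] g.G0 by metis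
    then have "(\<lambda>j. x j + G (x j) *\<^sub>R \<eta>) \<longlonglongrightarrow> 0 + 0 *\<^sub>R \<eta>" by (intro tendsto_add that tendsto_scaleR tendsto_const)
    then show ?thesis by simp
  qed
  have wq0: "wq \<longlonglongrightarrow> 0" and wp0: "wp \<longlonglongrightarrow> 0" unfolding wq_def wp_def by (rule graph0[OF y0], rule graph0[OF z0])
  define qj where "qj = (\<lambda>j. p0 + wq j)"
  define pj where "pj = (\<lambda>j. p0 + wp j)"
  have lims: "qj \<longlonglongrightarrow> p0" "pj \<longlonglongrightarrow> p0"
    unfolding qj_def pj_def using tendsto_add[OF tendsto_const[of p0] wq0] tendsto_add[OF tendsto_const[of p0] wp0] by simp_all
  have diff: "pj j - qj j = h j *\<^sub>R e + (G (z j) - G (y j)) *\<^sub>R \<eta>" for j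
    by (simp add: pj_def qj_def wp_def wq_def z_def scaleR_diff_left)
  have small: "eventually (\<lambda>j. norm (x j) < \<epsilon>) sequentially" if "x \<longlonglongrightarrow> 0" "0 < \<epsilon>" for x :: "nat \<Rightarrow> 'x::real_normed_vector" and \<epsilon>
    using order_tendstoD(2)[OF tendsto_norm_zero[OF that(1)] that(2)] .
  have hs: "eventually (\<lambda>j. h j < \<epsilon>) sequentially" if "0 < \<epsilon>" for \<epsilon> using order_tendstoD(2)[OF h(1) that] .
  have quot: "(\<lambda>j. (1 / h j) *\<^sub>R (pj j - qj j)) \<longlonglongrightarrow> e"
  proof -
    \<comment> \<open>The increment of \<open>G\<close> between the two base points is quadratic in
      \<open>h j\<close>, because \<open>G' 0\<close> vanishes on the horizontal vector
      \<open>e\<close>.\<close>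
    have "(\<lambda>j. (G (z j) - G (y j)) / h j) \<longlonglongrightarrow> 0"
    proof (rule Lim_null_comparison)
      have "(\<lambda>j. 6 * \<Lambda> * h j) \<longlonglongrightarrow> 6 * \<Lambda> * 0" by (intro tendsto_mult tendsto_const h)
      then show "(\<lambda>j. 6 * \<Lambda> * h j) \<longlonglongrightarrow> 0" by simp
      have "eventually (\<lambda>j. h j < r/2) sequentially" by (rule hs) (use g.r in simp)
      then show "eventually (\<lambda>j. norm ((G (z j) - G (y j)) / h j) \<le> 6 * \<Lambda> * h j) sequentially"
      proof (rule eventually_mono)
        fix j assume j: "h j < r/2"
        have n: "norm (y j) = h j" "norm (h j *\<^sub>R e) = h j" using h(2)[of j] \<kappa> e_unit by (simp_all add: y_def)
        have "G' 0 (h j *\<^sub>R e) = 0" using G'0 e_k by simp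
        then have "\<bar>G (z j) - G (y j)\<bar> \<le> 3 * \<Lambda> * (h j + h j) * h j"
          using g.G_increment[of "y j" "h j *\<^sub>R e"] j unfolding n z_def by simp
        also have "\<dots> = 6 * \<Lambda> * h j * h j" by simp
        finally show "norm ((G (z j) - G (y j)) / h j) \<le> 6 * \<Lambda> * h j"
          using h(2)[of j] by (simp add: divide_le_eq)
      qed
    qed
    then have "(\<lambda>j. e + ((G (z j) - G (y j)) / h j) *\<^sub>R \<eta>) \<longlonglongrightarrow> e + 0 *\<^sub>R \<eta>"
      by (intro tendsto_add tendsto_const tendsto_scaleR)
    moreover have "(1 / h j) *\<^sub>R (pj j - qj j) = e + ((G (z j) - G (y j)) / h j) *\<^sub>R \<eta>" for j
      unfolding diff using h(2)[of j] by (simp add: scaleR_add_right)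
    ultimately show ?thesis by simp
  qed
  define C where "C = graph_const TYPE(real^'n) s \<alpha> (24 * \<Lambda>)"
  show ?thesis
  proof (rule le_of_vanishing_error[where \<gamma>="\<alpha> - s" and R="min (diameter E) (r/2)" and C="4 * C"])
    show "0 < \<alpha> - s" "0 < min (diameter E) (r/2)" using alpha d_pos g.r by auto
    fix \<rho> assume \<rho>: "0 < \<rho>" "\<rho> < min (diameter E) (r/2)"
    have a: "0 < \<rho>\<^sup>2" "\<rho>\<^sup>2 \<le> (diameter E)\<^sup>2" using \<rho> by (auto intro!: power_mono)
    have r2: "0 < r/2" "0 < r/4" using g.r by auto
    show "2 * D - \<rho> - 4 * C * \<rho> powr (\<alpha> - s) \<le> K"
    proof (rule tendsto_lowerbound)
      have "(\<lambda>j. K * norm ((1 / h j) *\<^sub>R (pj j - qj j))) \<longlonglongrightarrow> K * norm e"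
        by (intro tendsto_mult tendsto_const tendsto_norm quot)
      then show "(\<lambda>j. K * norm ((1 / h j) *\<^sub>R (pj j - qj j))) \<longlonglongrightarrow> K" using e_unit by simp
      have "eventually (\<lambda>j. (D - \<rho>/2) * h j \<le> kap_mass s (\<rho>\<^sup>2) E (qj j) - kap_mass s (\<rho>\<^sup>2) E (pj j)) sequentially"
        using \<rho> by (intro kap_mass_merging_lower[OF lims(2,1) M_closure[OF p0(1)] p0(3) h(2) quot a]) simp
      then show "eventually (\<lambda>j. 2 * D - \<rho> - 4 * C * \<rho> powr (\<alpha> - s) \<le> K * norm ((1 / h j) *\<^sub>R (pj j - qj j))) sequentially"
        using hs[OF \<rho>(1)] hs[OF r2(2)] small[OF wq0 r2(1)] small[OF wp0 r2(1)] small[OF z0 r2(1)]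
      proof eventually_elim
        case (elim j)
        have y: "y j \<bullet> \<eta> = 0" "y j $ k = h j" "norm (y j) = h j" using \<kappa> h(2)[of j] by (simp_all add: y_def)
        have z: "z j \<bullet> \<eta> = 0" "z j $ k = h j" using y tang e_k by (simp_all add: z_def inner_add_left)
        have qM: "qj j \<in> M" unfolding qj_def wq_def
          using elim h(2)[of j] y \<rho> g.r by (intro g.graph_in_M[OF p0(2)]) (auto simp: wq_def)
        have pM: "pj j \<in> M" unfolding pj_def wp_def
          using elim h(2)[of j] z \<rho> g.r by (intro g.graph_in_M[OF p0(2)]) (auto simp: wp_def)
        have qk: "qj j $ k = h j" "pj j $ k = h j" using y z \<eta>k p0 by (simp_all add: qj_def pj_def wq_def wp_def)
        have hp: "0 < qj j $ k" "0 < pj j $ k" "pj j $ k = qj j $ k" using qk h(2)[of j] by simp_all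
        have "(pj j - qj j) \<bullet> e = h j" unfolding diff using \<eta>e e_inner by (simp add: inner_add_left)
        then have ne: "pj j \<noteq> qj j" using h(2)[of j] by auto
        have "2 * (kap_mass s (\<rho>\<^sup>2) E (qj j) - kap_mass s (\<rho>\<^sup>2) E (pj j)) - 2 * (2 * h j * C * \<rho> powr (\<alpha> - s)) \<le> K * norm (pj j - qj j)"
        proof (rule curv_difference_lower_cut[OF pM hp(2) qM hp(1) K[OF pM qM hp(1,3) ne] h(2)])
          fix \<epsilon> assume \<epsilon>: "0 < \<epsilon>" "\<epsilon> \<le> h j"
          have b: "h j \<le> \<rho>" "2 * h j + \<rho> < r" "norm (wq j) + \<rho> < r" "norm (wp j) + \<rho> < r" using elim \<rho> by auto
          have wpj: "wp j = y j + h j *\<^sub>R e + G (y j + h j *\<^sub>R e) *\<^sub>R \<eta>" by (simp add: wp_def z_def)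
          have yj: "y j = h j *\<^sub>R axis k 1" by (simp add: y_def)
          have wqj: "wq j = y j + G (y j) *\<^sub>R \<eta>" by (simp add: wq_def)
          show "\<bar>(kap_mass s (\<epsilon>\<^sup>2) E (pj j) - kap_mass s (\<rho>\<^sup>2) E (pj j)) - (kap_mass s (\<epsilon>\<^sup>2) E (qj j) - kap_mass s (\<rho>\<^sup>2) E (qj j))\<bar>
             \<le> 2 * h j * C * \<rho> powr (\<alpha> - s)"
            unfolding qj_def pj_def C_def
            by (rule g.boundary_pair_bound[OF p0(2) G'0 e_unit tang e_k Be h(2) b(1,2) yj wqj wpj b(3,4) \<epsilon>])
        qed
        moreover have "(2 * D - \<rho> - 4 * C * \<rho> powr (\<alpha> - s)) * h j = 2 * ((D - \<rho>/2) * h j) - 2 * (2 * h j * C * \<rho> powr (\<alpha> - s))"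
          by (simp add: algebra_simps)
        ultimately have "(2 * D - \<rho> - 4 * C * \<rho> powr (\<alpha> - s)) * h j \<le> K * norm (pj j - qj j)" using elim(1) by (rule double_difference_le)
        moreover have "K * norm ((1 / h j) *\<^sub>R (pj j - qj j)) = K * norm (pj j - qj j) / h j" using h(2)[of j] by simp
        ultimately show ?case using h(2)[of j] by (simp add: le_divide_eq)
      qed
    qed simp
  qed
qed

text \<open>The reflected set \<open>E1\<close> is contained in \<open>E\<close> near
  \<open>q\<close>, and both are cut subgraphs with the same vertical slope at \<open>q\<close>. The
  inclusion forces the same horizontal direction, so that the two graphs touch to first order. The
  pairs used are the points at height \<open>h j\<close> on the graphs at \<open>p\<close> and at
  \<open>q\<close>; they become mirror images only in the limit, which is taken at a fixed scale
  before the scale tends to 0.\<close>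

lemma defect_boundary_distinct:
  assumes q: "q \<in> M" "q $ k = 0" and p: "p \<in> M" "p = q + l *\<^sub>R e" and l: "0 < l" and c: "(q + p) \<bullet> e = 2 * lam"
  shows "2 * D \<le> K"
proof -
  let ?\<kappa> = "axis k (1::real) :: real^'n"
  let ?R = "reflection e lam"
  define c0 where "c0 = \<sigma> / sqrt (1 - \<sigma>\<^sup>2)"
  have pk: "p $ k = 0" using p(2) q(2) e_k by simp
  define \<eta>p where "\<eta>p = hnormal p"
  define \<eta>q where "\<eta>q = hnormal q"
  obtain rp \<Lambda>p Gp Gp' Bp where ggp: "capillary_graph s \<alpha> \<sigma> k E M nu rp \<Lambda>p \<eta>p Gp Gp' Bp p"
    and Gp0: "\<And>v. Gp' 0 v = c0 * v $ k"
    by (rule boundary_graph[OF p(1) pk, folded \<eta>p_def c0_def], rule that) assumption+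
  obtain rq \<Lambda>q Gq Gq' Bq where ggq: "capillary_graph s \<alpha> \<sigma> k E M nu rq \<Lambda>q \<eta>q Gq Gq' Bq q"
    and Gq0: "\<And>v. Gq' 0 v = c0 * v $ k"
    by (rule boundary_graph[OF q, folded \<eta>q_def c0_def], rule that) assumption+
  interpret gp: capillary_graph s \<alpha> \<sigma> k E M nu rp \<Lambda>p \<eta>p Gp Gp' Bp p by (rule ggp)
  interpret gq: capillary_graph s \<alpha> \<sigma> k E M nu rq \<Lambda>q \<eta>q Gq Gq' Bq q by (rule ggq)
  have \<eta>k: "\<eta>p $ k = 0" "\<eta>q $ k = 0" unfolding \<eta>p_def \<eta>q_def by (rule hnormal(2)[OF p(1) pk], rule hnormal(2)[OF q])
  define \<eta>1 where "\<eta>1 = hrefl e \<eta>p"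
  define G1 where "G1 = (\<lambda>z. Gp (hrefl e z))"
  have hk: "hrefl e z $ k = z $ k" for z by (simp add: hrefl_def e_k)
  have nh: "norm (hrefl e z) = norm z" for z by (rule norm_hrefl[OF e_unit])
  have ih: "hrefl e z \<bullet> \<eta>p = z \<bullet> \<eta>1" for z
    using hrefl_inner[OF e_unit, of z "\<eta>1"] by (simp add: \<eta>1_def hrefl_hrefl[OF e_unit])
  have \<eta>1: "norm \<eta>1 = 1" "\<eta>1 $ k = 0" using gp.\<eta> \<eta>k by (simp_all add: \<eta>1_def nh hk)
  have \<kappa>: "norm ?\<kappa> = 1" "?\<kappa> \<bullet> \<eta>q = 0" "?\<kappa> \<bullet> \<eta>1 = 0" "?\<kappa> \<bullet> \<eta>p = 0" "?\<kappa> \<bullet> e = 0" "?\<kappa> $ k = 1"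
    using \<eta>k \<eta>1 e_k by (auto simp: inner_axis' norm_axis_1)
  have qe: "q \<bullet> e = lam - l/2"
  proof -
    have "(q + p) \<bullet> e = q \<bullet> e + (q \<bullet> e + l)" unfolding p(2) inner_add_left inner_scaleR_left e_inner by simp
    then show ?thesis using c by simp
  qed
  have Rq: "?R q = p" unfolding reflection_def qe p(2) by simp
  have Rp: "?R p = q" using reflection_reflection[OF e_unit, of lam q] Rq by simp
  have Radd: "?R (x + z) = ?R x + hrefl e z" for x z by (simp add: reflection_eq_hrefl hrefl_add)
  have Rqz: "?R (q + z) = p + hrefl e z" and Rpz: "?R (p + z) = q + hrefl e z" for z by (simp_all add: Radd Rq Rp)
  define E1 where "E1 = {x. ?R x \<in> E}"
  have Epos: "0 < x $ k" if "x \<in> E" for x using E_sub that by (auto simp: halfspace_def)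
  have E1iff: "q + z \<in> E1 \<longleftrightarrow> 0 < z \<bullet> ?\<kappa> \<and> z \<bullet> \<eta>1 < G1 z" if "norm z < rp" for z
    using gp.E_iff[of "hrefl e z"] Epos[of "p + hrefl e z"] that pk
    by (auto simp: E1_def Rqz nh hk ih G1_def inner_axis)
  have E2iff: "q + z \<in> E \<longleftrightarrow> 0 < z \<bullet> ?\<kappa> \<and> z \<bullet> \<eta>q < Gq z" if "norm z < rq" for z
    using gq.E_iff[of z] Epos[of "q + z"] that q by (auto simp: inner_axis)
  have sub: "z \<bullet> \<eta>q < Gq z" if z: "norm z < rp" "norm z < rq" "norm z < l/2" "0 < z $ k" "z \<bullet> \<eta>1 < G1 z" for z
  proof -
    have "q + z \<in> E1" using E1iff[OF z(1)] z by (simp add: inner_axis)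
    then have x: "?R (q + z) \<in> E" by (simp add: E1_def)
    \<comment> \<open>Within the distance l/2 of \<open>q\<close> a point is still before the plane,
      so that its mirror image lies beyond it and the critical property applies.\<close>
    have "\<bar>z \<bullet> e\<bar> < l/2" using Cauchy_Schwarz_ineq2[of z e] e_unit z(3) by simp
    then have "lam < ?R (q + z) \<bullet> e" unfolding reflection_inner[OF e_unit] inner_add_left qe by (simp add: abs_less_iff)
    from good[OF x this] have "q + z \<in> E" by (simp add: reflection_reflection[OF e_unit])
    then show ?thesis using E2iff[OF z(2)] by simp
  qed
  have \<eta>eq: "\<eta>1 = \<eta>q"
  proof (rule ccontr)
    assume ne: "\<eta>1 \<noteq> \<eta>q"
    define v where "v = \<eta>q - \<eta>1"
    define b where "b = 1 - \<eta>q \<bullet> \<eta>1"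
    have nn: "\<eta>q \<bullet> \<eta>q = 1" "\<eta>1 \<bullet> \<eta>1 = 1" using gq.\<eta> \<eta>1 by (simp_all add: norm_eq_1)
    have "0 < v \<bullet> v" using ne by (simp add: v_def)
    also have "v \<bullet> v = b + b" using nn by (simp add: v_def b_def inner_diff_left inner_diff_right inner_commute[of \<eta>1 \<eta>q])
    finally have b: "0 < b" by simp
    define \<delta> where "\<delta> = b / (2 * (\<bar>c0\<bar> + 1))"
    have \<delta>: "0 < \<delta>" using b by (simp add: \<delta>_def)
    have c0\<delta>: "\<bar>c0\<bar> * \<delta> < b"
    proof -
      have "\<bar>c0\<bar> * \<delta> \<le> (\<bar>c0\<bar> + 1) * \<delta>" using \<delta> by simp
      also have "\<dots> = b / 2" by (simp add: \<delta>_def field_simps)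
      finally show ?thesis using b by simp
    qed
    \<comment> \<open>A direction that separates the two subgraphs: its component is b along \<eta>q
      and -b along \<eta>1. The vertical component \<delta> moves the point into H, and |c0|
      \<delta> < b keeps the common slope from hiding the sign. A short step along \<open>u\<close>
      thus stays in the reflected set but leaves \<open>E\<close>.\<close>
    define u where "u = v + \<delta> *\<^sub>R ?\<kappa>"
    have u: "u \<bullet> \<eta>q = b" "u \<bullet> \<eta>1 = - b" "u $ k = \<delta>"
      using nn \<kappa> \<eta>k \<eta>1 by (simp_all add: u_def v_def b_def inner_add_left inner_diff_left inner_commute[of \<eta>1 \<eta>q])
    define N where "N = norm u * norm u"
    have lim: "((\<lambda>t. t * X) \<longlongrightarrow> 0) (at_right 0)" for X :: real
      using tendsto_mult[OF tendsto_ident_at[of 0 "{0<..}"] tendsto_const[of X]] by simp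
    have ev: "eventually (\<lambda>t. t * X < Y) (at_right 0)" if "0 < Y" for X Y :: real
      using order_tendstoD(2)[OF lim that] .
    have b2: "0 < b - \<bar>c0\<bar> * \<delta>" using c0\<delta> by simp
    have tpos: "eventually (\<lambda>t::real. 0 < t) (at_right 0)" by (simp add: eventually_at_filter)
    have "eventually (\<lambda>t. 0 < t \<and> t * norm u < rp \<and> t * norm u < rq \<and> t * norm u < l/2 \<and>
        t * (3 * \<Lambda>p * N) < b - \<bar>c0\<bar> * \<delta> \<and> t * (3 * \<Lambda>q * N) < b - \<bar>c0\<bar> * \<delta>) (at_right 0)"
      using gp.r gq.r l by (intro eventually_conj tpos ev b2) auto
    then obtain t where t: "0 < t" "t * norm u < rp" "t * norm u < rq" "t * norm u < l/2"
        "t * (3 * \<Lambda>p * N) < b - \<bar>c0\<bar> * \<delta>" "t * (3 * \<Lambda>q * N) < b - \<bar>c0\<bar> * \<delta>"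
      using eventually_happens'[OF trivial_limit_at_right_real] by blast
    have nt: "norm (t *\<^sub>R u) = t * norm u" using t(1) by simp
    have c0t: "\<bar>c0 * (t * \<delta>)\<bar> = t * (\<bar>c0\<bar> * \<delta>)" using t(1) \<delta> by (simp add: abs_mult)
    have i1: "\<bar>G1 (t *\<^sub>R u) - c0 * (t * \<delta>)\<bar> \<le> t * (t * (3 * \<Lambda>p * N))"
      using gp.G_increment[of 0 "hrefl e (t *\<^sub>R u)"] t gp.G0 unfolding Gp0 hk nh nt
      by (simp add: G1_def u N_def mult_ac)
    have i2: "\<bar>Gq (t *\<^sub>R u) - c0 * (t * \<delta>)\<bar> \<le> t * (t * (3 * \<Lambda>q * N))"
      using gq.G_increment[of 0 "t *\<^sub>R u"] t gq.G0 unfolding Gq0 nt by (simp add: u N_def mult_ac)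
    have m1: "t * (t * (3 * \<Lambda>p * N)) < t * b - t * (\<bar>c0\<bar> * \<delta>)"
      using mult_strict_left_mono[OF t(5,1)] by (simp add: right_diff_distrib)
    have m2: "t * (t * (3 * \<Lambda>q * N)) < t * b - t * (\<bar>c0\<bar> * \<delta>)"
      using mult_strict_left_mono[OF t(6,1)] by (simp add: right_diff_distrib)
    have "- (t * b) < G1 (t *\<^sub>R u)" using i1 m1 c0t by linarith
    then have "t *\<^sub>R u \<bullet> \<eta>q < Gq (t *\<^sub>R u)" using t \<delta> by (intro sub) (simp_all add: nt u)
    then have "t * b < Gq (t *\<^sub>R u)" by (simp add: u)
    then show False using i2 m2 c0t by linarith
  qed
  have g1: "C2alpha_graph \<alpha> rp \<Lambda>p \<eta>q G1 (\<lambda>y v. Gp' (hrefl e y) (hrefl e v)) (\<lambda>y z v. Bp (hrefl e y) (hrefl e z) (hrefl e v))"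
    using C2alpha_graph_hrefl[OF gp.C2alpha_graph_axioms e_unit] unfolding \<eta>1_def[symmetric] \<eta>eq G1_def .
  have eq0: "Gp' (hrefl e 0) (hrefl e v) = Gq' 0 v" for v
    using Gp0 Gq0 hk by (simp add: hrefl_def[of e 0])
  have E1b: "E1 \<in> sets borel"
    using measurable_sets[OF borel_measurable_reflection E_borel, of e lam] by (simp add: vimage_def E1_def)
  define h where "h = (\<lambda>j. inverse (real (Suc j)))"
  have h: "h \<longlonglongrightarrow> 0" "\<And>j. 0 < h j" unfolding h_def by (rule LIMSEQ_inverse_real_of_nat) simp
  have hs: "eventually (\<lambda>j. h j < \<epsilon>) sequentially" if "0 < \<epsilon>" for \<epsilon> using order_tendstoD(2)[OF h(1) that] .
  define y where "y = (\<lambda>j. h j *\<^sub>R ?\<kappa>)"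
  have y0: "y \<longlonglongrightarrow> 0" unfolding y_def using tendsto_scaleR[OF h(1) tendsto_const[of ?\<kappa>]] by simp
  have yh: "hrefl e (y j) = y j" "y j $ k = h j" "norm (y j) = h j" "y j \<bullet> \<eta>p = 0" "y j \<bullet> \<eta>q = 0" for j
    using \<kappa> h(2)[of j] by (simp_all add: y_def hrefl_def)
  define wp where "wp = (\<lambda>j. y j + Gp (y j) *\<^sub>R \<eta>p)"
  define wq where "wq = (\<lambda>j. y j + Gq (y j) *\<^sub>R \<eta>q)"
  define w1 where "w1 = (\<lambda>j. y j + G1 (y j) *\<^sub>R \<eta>q)"
  have w1p: "hrefl e (wp j) = w1 j" for j
    using \<eta>eq by (simp add: wp_def w1_def hrefl_add hrefl_scaleR yh G1_def \<eta>1_def)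
  have nw1: "norm (w1 j) = norm (wp j)" for j using w1p nh by metis
  have wp0: "wp \<longlonglongrightarrow> 0"
  proof -
    have "isCont Gp 0" using gp.continuous_G gp.r by simp
    then have "(\<lambda>j. Gp (y j)) \<longlonglongrightarrow> 0" using isCont_tendsto_compose[OF _ y0] gp.G0 by metis
    from tendsto_add[OF y0 tendsto_scaleR[OF this tendsto_const[of \<eta>p]]] show ?thesis by (simp add: wp_def)
  qed
  have wq0: "wq \<longlonglongrightarrow> 0"
  proof -
    have "isCont Gq 0" using gq.continuous_G gq.r by simp
    then have "(\<lambda>j. Gq (y j)) \<longlonglongrightarrow> 0" using isCont_tendsto_compose[OF _ y0] gq.G0 by metis
    from tendsto_add[OF y0 tendsto_scaleR[OF this tendsto_const[of \<eta>q]]] show ?thesis by (simp add: wq_def)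
  qed
  define pj where "pj = (\<lambda>j. p + wp j)"
  define qj where "qj = (\<lambda>j. q + wq j)"
  have lims: "qj \<longlonglongrightarrow> q" "pj \<longlonglongrightarrow> p"
    unfolding qj_def pj_def using tendsto_add[OF tendsto_const[of q] wq0] tendsto_add[OF tendsto_const[of p] wp0] by simp_all
  have small: "eventually (\<lambda>j. norm (x j) < \<epsilon>) sequentially" if "x \<longlonglongrightarrow> 0" "0 < \<epsilon>" for x :: "nat \<Rightarrow> real^'n" and \<epsilon>
    using order_tendstoD(2)[OF tendsto_norm_zero[OF that(1)] that(2)] .
  have npq: "norm (p - q) = l" using p(2) l e_unit by simp
  have ne: "eventually (\<lambda>j. pj j \<noteq> qj j) sequentially"
  proof -
    have "(\<lambda>j. pj j - qj j) \<longlonglongrightarrow> p - q" by (intro tendsto_diff lims)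
    moreover have "p - q \<noteq> 0" using npq l by auto
    ultimately have "eventually (\<lambda>j. pj j - qj j \<noteq> 0) sequentially" by (rule tendsto_imp_eventually_ne)
    then show ?thesis by (rule eventually_mono) simp
  qed
  \<comment> \<open>Both potentials are brought to the neighbourhood of \<open>q\<close>: the
    potential of \<open>E\<close> at \<open>pj j\<close> is that of the reflected set at the
    reflected point.\<close>
  have mirror: "kap_mass s a E1 (q + w1 j) = kap_mass s a E (pj j)" if "0 < a" for a j
    using kap_mass_reflection[OF e_unit dim E_borel that, of s lam "pj j"] by (simp add: E1_def pj_def Rpz w1p)
  define C where "C = graph_const TYPE(real^'n) s \<alpha> (6 * (\<Lambda>p + \<Lambda>q))"
  define r where "r = min rp rq"
  have r: "0 < r" "r \<le> rp" "r \<le> rq" using gp.r gq.r by (auto simp: r_def)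
  have "2 * (D * l) \<le> K * l"
  proof (rule le_of_vanishing_error[where \<gamma>="\<alpha> - s" and R="min (diameter E) (r/2)" and C="4 * C"])
    show "0 < \<alpha> - s" "0 < min (diameter E) (r/2)" using alpha d_pos r by auto
    fix \<rho> assume \<rho>: "0 < \<rho>" "\<rho> < min (diameter E) (r/2)"
    have a: "0 < \<rho>\<^sup>2" "\<rho>\<^sup>2 \<le> (diameter E)\<^sup>2" using \<rho> by (auto intro!: power_mono)
    have r2: "0 < r/2" using r by auto
    define Z where "Z = 2 * 1 * C * \<rho> powr (\<alpha> - s)"
    have "2 * (kap_mass s (\<rho>\<^sup>2) E q - kap_mass s (\<rho>\<^sup>2) E p) - 2 * Z \<le> K * norm (p - q)"
    proof (rule tendsto_le[OF sequentially_bot])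
      show "(\<lambda>j. K * norm (pj j - qj j)) \<longlonglongrightarrow> K * norm (p - q)"
        by (intro tendsto_mult tendsto_const tendsto_norm tendsto_diff lims)
      show "(\<lambda>j. 2 * (kap_mass s (\<rho>\<^sup>2) E (qj j) - kap_mass s (\<rho>\<^sup>2) E (pj j)) - 2 * Z)
          \<longlonglongrightarrow> 2 * (kap_mass s (\<rho>\<^sup>2) E q - kap_mass s (\<rho>\<^sup>2) E p) - 2 * Z"
        by (intro tendsto_diff tendsto_mult tendsto_const kap_mass_tendsto[OF E_borel Eb s_pos a(1)] lims)
      show "eventually (\<lambda>j. 2 * (kap_mass s (\<rho>\<^sup>2) E (qj j) - kap_mass s (\<rho>\<^sup>2) E (pj j)) - 2 * Z \<le> K * norm (pj j - qj j)) sequentially"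
        using hs[OF \<rho>(1)] hs[OF r2] small[OF wq0 r2] small[OF wp0 r2] ne
      proof eventually_elim
        case (elim j)
        have qM: "qj j \<in> M" unfolding qj_def wq_def
          using elim h(2)[of j] yh[of j] r by (intro gq.graph_in_M[OF q(2)]) (auto simp: wq_def)
        have pM: "pj j \<in> M" unfolding pj_def wp_def
          using elim h(2)[of j] yh[of j] r by (intro gp.graph_in_M[OF pk]) (auto simp: wp_def)
        have qk: "qj j $ k = h j" "pj j $ k = h j" using yh(2)[of j] \<eta>k pk q by (simp_all add: qj_def pj_def wq_def wp_def)
        have hp: "0 < qj j $ k" "0 < pj j $ k" "pj j $ k = qj j $ k" using qk h(2)[of j] by simp_all
        show ?case
        proof (rule curv_difference_lower_cut[OF pM hp(2) qM hp(1) K[OF pM qM hp(1,3) elim(5)] h(2)])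
          fix \<epsilon> assume \<epsilon>: "0 < \<epsilon>" "\<epsilon> \<le> h j"
          have b: "h j \<le> \<rho>" "h j + \<rho> < rp" "h j + \<rho> < rq" "norm (w1 j) + \<rho> < rp" "norm (wq j) + \<rho> < rq"
            using elim \<rho> r by (auto simp: nw1)
          have ws: "w1 j = h j *\<^sub>R ?\<kappa> + G1 (h j *\<^sub>R ?\<kappa>) *\<^sub>R \<eta>q" "wq j = h j *\<^sub>R ?\<kappa> + Gq (h j *\<^sub>R ?\<kappa>) *\<^sub>R \<eta>q"
            by (simp_all add: w1_def wq_def y_def)
          have dim': "2 \<le> DIM(real^'n)" using dim by simp
          have e2: "0 < \<epsilon>\<^sup>2" using \<epsilon> by simp
          show "\<bar>(kap_mass s (\<epsilon>\<^sup>2) E (pj j) - kap_mass s (\<rho>\<^sup>2) E (pj j)) - (kap_mass s (\<epsilon>\<^sup>2) E (qj j) - kap_mass s (\<rho>\<^sup>2) E (qj j))\<bar> \<le> Z"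
            using touching_graphs_bound[OF dim' s01(1) alpha g1 gq.C2alpha_graph_axioms \<kappa>(1,2) eq0 E1b E_borel
                E1iff[unfolded \<eta>eq] E2iff h(2) b(1-3) ws b(4,5) \<epsilon>]
            unfolding mirror[OF e2] mirror[OF a(1)] Z_def C_def qj_def .
        qed
      qed
    qed
    moreover have "2 * (D * l) \<le> 2 * (kap_mass s (\<rho>\<^sup>2) E q - kap_mass s (\<rho>\<^sup>2) E p)"
      using kap_mass_distinct_lower[OF p(2) M_closure[OF p(1)] l c a] by simp
    moreover have "2 * Z = 4 * C * \<rho> powr (\<alpha> - s)" by (simp add: Z_def)
    ultimately show "2 * (D * l) - \<rho> - 4 * C * \<rho> powr (\<alpha> - s) \<le> K * l" unfolding npq using \<rho>(1) by linarith
  qed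
  then have "(2 * D) * l \<le> K * l" by simp
  then show ?thesis using l by (rule mult_right_le_imp_le)
qed

text \<open>The limits of the end points either differ or coincide, and lie either in H or on
  \<partial>H. The end points themselves are always at positive height, so they belong to
  \<open>M\<close>, and so do their limits.\<close>

lemma defect_le:
  assumes ch: "\<And>j::nat. chord E e (qs j) (ps j)" and q: "qs \<longlonglongrightarrow> q" and p: "ps \<longlonglongrightarrow> p" and c: "(q + p) \<bullet> e = 2 * lam"
  shows "2 * D \<le> K"
proof -
  have w: "e \<bullet> axis k 1 = 0" "\<And>x. x \<in> E \<Longrightarrow> 0 < x \<bullet> axis k 1" using e_k E_sub by (auto simp: inner_axis halfspace_def)
  have hgt: "0 < qs j $ k" "ps j $ k = qs j $ k" for j using chord_inner[OF ch w, of j] by (auto simp: inner_axis)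
  have fr: "qs j \<in> frontier E" "ps j \<in> frontier E" for j using chord_frontier[OF Eo ch] by blast+
  have M: "qs j \<in> M" "ps j \<in> M" for j using frontier_in_M fr hgt by auto
  have qM: "q \<in> M" and pM: "p \<in> M"
    using closed_sequentially[OF M_closed M(1) q] closed_sequentially[OF M_closed M(2) p] by auto
  define l where "l = (\<lambda>j. (ps j - qs j) \<bullet> e)"
  have l: "0 < l j" "ps j = qs j + l j *\<^sub>R e" for j
    using ch[of j] e_inner by (auto simp: chord_def l_def)
  define l0 where "l0 = (p - q) \<bullet> e"
  have llim: "l \<longlonglongrightarrow> l0" unfolding l_def l0_def by (intro tendsto_inner tendsto_diff p q tendsto_const)
  have "(\<lambda>j. qs j + l j *\<^sub>R e) \<longlonglongrightarrow> q + l0 *\<^sub>R e" by (intro tendsto_add q tendsto_scaleR llim tendsto_const)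
  then have "ps \<longlonglongrightarrow> q + l0 *\<^sub>R e" using l(2) by presburger
  then have pq: "p = q + l0 *\<^sub>R e" using LIMSEQ_unique[OF p] by blast
  have l0: "0 \<le> l0" using LIMSEQ_le_const[OF llim] l(1) less_imp_le by blast
  show ?thesis
  proof (cases "l0 = 0")
    case True
    then have "p = q" using pq by simp
    then have qe: "q \<bullet> e = lam" using c by (simp only: inner_add_left)
    have l0': "l \<longlonglongrightarrow> 0" using llim True by simp
    show ?thesis
    proof (cases "0 < q $ k")
      case True
      show ?thesis by (rule defect_interior_merging[OF qM True qe fr hgt(1) l l0' q])
    next
      case False
      then have "q $ k = 0" using M_height[OF qM] by simp
      then show ?thesis by (rule defect_boundary_merging[OF qM _ qe fr hgt(1) l l0' q])
    qed
  next
    case False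
    then have l0p: "0 < l0" using l0 by simp
    show ?thesis
    proof (cases "0 < q $ k")
      case True
      show ?thesis by (rule defect_interior_distinct[OF qM True pM pq l0p c])
    next
      case False
      then have "q $ k = 0" using M_height[OF qM] by simp
      then show ?thesis by (rule defect_boundary_distinct[OF qM _ pM pq l0p c])
    qed
  qed
qed

end

section \<open>From the deficit to the estimate of the volume\<close>

lemma s_deficit_finite:
  fixes s :: real and E M :: "(real^'n::finite) set"
  assumes d: "0 < diameter E" and fin: "s_deficit s k E M < \<infinity>"
  obtains K where "real_of_ereal (s_deficit s k E M) = diameter E powr (s + 1) * K"
    "\<And>p q. p \<in> M \<Longrightarrow> q \<in> M \<Longrightarrow> 0 < q $ k \<Longrightarrow> p $ k = q $ k \<Longrightarrow> p \<noteq> q \<Longrightarrow>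
       \<bar>frac_mean_curv s E p - frac_mean_curv s E q\<bar> \<le> K * norm (p - q)"
proof -
  define S where "S = insert 0 {ereal (\<bar>frac_mean_curv s E p - frac_mean_curv s E q\<bar> / norm (p - q)) | p q.
            p \<in> M \<inter> halfspace k \<and> q \<in> M \<inter> halfspace k \<and> p \<noteq> q \<and> p $ k = q $ k}"
  have c: "0 < diameter E powr (s + 1)" using d by simp
  have sd: "s_deficit s k E M = ereal (diameter E powr (s + 1)) * Sup S" by (simp add: s_deficit_def S_def)
  \<comment> \<open>The element 0 keeps the supremum from being minus infinity, so that finiteness
    of the deficit yields a real number \<open>K\<close>.\<close>
  have S0: "0 \<le> Sup S" by (rule Sup_upper) (simp add: S_def)
  have "Sup S \<noteq> \<infinity>" using fin c unfolding sd by auto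
  then obtain K where K: "Sup S = ereal K" using S0 by (cases "Sup S") auto
  show ?thesis
  proof (rule that)
    show "real_of_ereal (s_deficit s k E M) = diameter E powr (s + 1) * K" unfolding sd K by simp
    fix p q assume pq: "p \<in> M" "q \<in> M" "0 < q $ k" "p $ k = q $ k" "p \<noteq> q"
    have "ereal (\<bar>frac_mean_curv s E p - frac_mean_curv s E q\<bar> / norm (p - q)) \<in> S"
      unfolding S_def using pq by (intro insertI2 CollectI exI[of _ p] exI[of _ q]) (auto simp: halfspace_def)
    then have "ereal (\<bar>frac_mean_curv s E p - frac_mean_curv s E q\<bar> / norm (p - q)) \<le> ereal K"
      unfolding K[symmetric] by (rule Sup_upper)
    then show "\<bar>frac_mean_curv s E p - frac_mean_curv s E q\<bar> \<le> K * norm (p - q)" using pq by (simp add: divide_le_eq)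
  qed
qed

lemma diameter_open_pos:
  fixes E :: "'a::euclidean_space set"
  assumes "open E" "bounded E" "E \<noteq> {}"
  shows "0 < diameter E"
proof -
  obtain x where "x \<in> E" using assms by auto
  then obtain r where r: "0 < r" "cball x r \<subseteq> E" using assms open_contains_cball by blast
  have "0 < diameter (cball x r)" using r by simp
  also have "\<dots> \<le> diameter E" by (rule diameter_subset[OF r(2) assms(2)])
  finally show ?thesis .
qed

theorem theorem1p1:
  fixes s \<alpha> \<sigma> :: real
    and k :: "'n::finite"
    and E M :: "(real^'n) set"
    and nu :: "real^'n \<Rightarrow> real^'n"
  assumes n2: "CARD('n) \<ge> 2"
    and s01: "0 < s" "s < 1"
    and alpha: "s < \<alpha>" "\<alpha> < 1"
    and E_open: "open E" and E_bdd: "bounded E" and E_conn: "connected E"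
    and E_sub: "E \<subseteq> halfspace k"
    and M_def: "M = closure (frontier E \<inter> halfspace k)"
    and M_hyp: "C2alpha_hypersurface_with_boundary \<alpha> M (M \<inter> {x. x $ k = 0})"
    and nu: "outer_unit_normal k E M nu"
    and sigma: "-1 < \<sigma>" "\<sigma> < 1"
    and angle: "\<forall>q \<in> M \<inter> {x. x $ k = 0}. nu q \<bullet> (- axis k 1) = \<sigma>"
  shows "\<forall>e. norm e = 1 \<and> e $ k = 0 \<longrightarrow>
           s_deficit s k E M < \<infinity> \<longrightarrow> (\<exists>c.
              measure lebesgue (symdiff E (reflection e c ` E))
                \<le> 3 * sqrt (5 / (2 * (real CARD('n) + s)))
                    * diameter E ^ CARD('n) * sqrt (real_of_ereal (s_deficit s k E M)))"
proof (intro allI impI)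
  fix e :: "real^'n" assume e: "norm e = 1 \<and> e $ k = 0" and fin: "s_deficit s k E M < \<infinity>"
  show "\<exists>c. measure lebesgue (symdiff E (reflection e c ` E))
                \<le> 3 * sqrt (5 / (2 * (real CARD('n) + s)))
                    * diameter E ^ CARD('n) * sqrt (real_of_ereal (s_deficit s k E M))"
  proof (cases "E = {}")
    \<comment> \<open>For empty \<open>E\<close> both sides are 0 for every plane.\<close>
    case True
    then show ?thesis by (simp add: symdiff_def s_deficit_def)
  next
    case False
    have d: "0 < diameter E" by (rule diameter_open_pos[OF E_open E_bdd False])
    obtain K where Kb: "real_of_ereal (s_deficit s k E M) = diameter E powr (s + 1) * K"
      "\<And>p q. p \<in> M \<Longrightarrow> q \<in> M \<Longrightarrow> 0 < q $ k \<Longrightarrow> p $ k = q $ k \<Longrightarrow> p \<noteq> q \<Longrightarrow>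
         \<bar>frac_mean_curv s E p - frac_mean_curv s E q\<bar> \<le> K * norm (p - q)"
      by (rule s_deficit_finite[OF d fin], rule that) assumption+
    have en: "norm e = 1" "e $ k = 0" using e by auto
    obtain lam qs ps q p where good: "\<And>x. x \<in> E \<Longrightarrow> lam < x \<bullet> e \<Longrightarrow> reflection e lam x \<in> E"
      and ch: "\<And>j::nat. chord E e (qs j) (ps j)" and lim: "qs \<longlonglongrightarrow> q" "ps \<longlonglongrightarrow> p" "(q + p) \<bullet> e = 2 * lam"
      by (rule critical_chords[OF E_open E_bdd False en(1)], rule that) assumption+
    interpret critical_plane s \<alpha> \<sigma> k E M nu e lam K
      by unfold_locales (use n2 s01 alpha E_open E_bdd E_sub M_def M_hyp nu sigma angle en d good Kb(2) in auto)
    have "2 * refl_defect s e lam E \<le> K" by (rule defect_le[OF ch lim])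
    then have le: "2 * (real CARD('n) + s) * diameter E powr (- (real CARD('n) + s) - 2)
       * (LINT x|lborel. indicator {x\<in>E. x \<bullet> e < lam \<and> reflection e lam x \<notin> E} x * (lam - x \<bullet> e)) \<le> K"
      unfolding refl_defect_def by (simp only: mult.assoc)
    show ?thesis
      unfolding Kb(1)
    proof (rule exI, rule symdiff_reflection_bound[OF en(1) n2 E_open E_bdd False s01(1) _ le])
      show "reflection e lam x \<in> E" if "x \<in> E" "lam < x \<bullet> e" for x using good[OF that] .
    qed
  qed
qed

end
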